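(* Let $\mathfrak{M}$ be either the free Brownian motion $S$ or the compensated free Poisson process $\hat N$. Let $n,m\ge1$ be natural numbers and let $\{f_k:k\ge1\}\subset L^2(\mathbb{R}_+^n)$ and $\{g_k:k\ge1\}\subset L^2(\mathbb{R}_+^m)$ be sequences of symmetric functions such that $\big(I_n^{\mathfrak{M}}(f_k),I_m^{\mathfrak{M}}(g_k)\big)\to(F,G)$ jointly in law as $k\to\infty$, where $F,G$ are random variables in $L^2(\mathscr{A},\varphi)$. Then: (i) If $\mathfrak{M}=S$, then $F$ and $G$ are free if and only if $f_k\stackrel{p}{\frown}g_k\to0$ in $L^2(\mathbb{R}_+^{n+m-2p})$ as $k\to\infty$ for all $p=1,\dots,n\wedge m$. (ii) If $\mathfrak{M}=\hat N$, then $F$ and $G$ are free if and only if $f_k\stackrel{p}{\frown}g_k\to0$ in $L^2(\mathbb{R}_+^{n+m-2p})$ and $f_k\star_p^{p-1}g_k\to0$ in $L^2(\mathbb{R}_+^{n+m-2p+1})$ as $k\to\infty$ for all $p=1,\dots,n\wedge m$.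
   Context: $\mathbb{R}_+=[0,\infty)$ with Lebesgue measure; $L^2(\mathbb{R}_+^n)$ is the space of complex-valued square-integrable functions. A function $f\in L^2(\mathbb{R}_+^n)$ is called symmetric if it is real-valued and $f(t_1,\dots,t_n)=f(t_{\sigma(1)},\dots,t_{\sigma(n)})$ for a.e. $(t_1,\dots,t_n)$ and every permutation $\sigma$. Its adjoint is $f^*(t_1,\dots,t_n)=\overline{f(t_n,\dots,t_1)}$. $(\mathscr{A},\varphi)$ is a tracial $W^*$-probability space: $\mathscr{A}$ is a von Neumann algebra and $\varphi:\mathscr{A}\to\mathbb{C}$ is a unital, weakly continuous, positive, faithful, tracial linear functional. $L^2(\mathscr{A},\varphi)$ is the completion of $\mathscr{A}$ for $\|X\|_2=\sqrt{\varphi(XX^* )}$. Random variables are self-adjoint elements. Freeness: $X_1,\dots,X_d$ are free if $\varphi\big([P_1(X_{i_1})-\varphi(P_1(X_{i_1}))]\cdots[P_r(X_{i_r})-\varphi(P_r(X_{i_r}))]\big)=0$ whenever $r\ge1$, $P_1,\dots,P_r$ are polynomials and $i_1,\dots,i_r\in\{1,\dots,d\}$ have no two adjacent indices equal. Joint convergence in law $(X_k^1,\dots,X_k^d)\to(X_\infty^1,\dots,X_\infty^d)$ means $\varphi_k(X_k^{i_1}\cdots X_k^{i_r})\to\varphi_\infty(X_\infty^{i_1}\cdots X_\infty^{i_r})$ for all $r\ge1$ and all $i_1,\dots,i_r\in\{1,\dots,d\}$ (the spaces $(\mathscr{A}_k,\varphi_k)$ may differ). Free Brownian motion $S=\{S_t\}_{t\ge0}$: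 self-adjoint elements of $\mathscr{A}$, adapted to an increasing filtration $(\mathscr{A}_t)_{t\ge 0}$ of von Neumann subalgebras, with $S_0=0$ and such that for $0\le u<t$ the increment $S_t-S_u$ is free from $\mathscr{A}_u$ and has the centered semicircular law of variance $t-u$, with density $(2\pi(t-u))^{-1}\sqrt{4(t-u)-x^2}$ on $[-2\sqrt{t-u},2\sqrt{t-u}]$. Free Poisson process $N=\{N_t\}_{t\ge0}$: positive elements of $\mathscr{A}$ adapted to such a filtration, with $N_0=0$ and $N_t-N_u$ free from $\mathscr{A}_u$ with the free Poisson law of rate $\lambda=t-u$, i.e. $(1-\lambda)\delta_0+\tilde\nu$ if $\lambda\le1$ (with the understanding that $\tilde\nu$ carries mass $\lambda$) and $\tilde\nu$ if $\lambda>1$, where $\tilde\nu(dx)=(2\pi x)^{-1}\sqrt{4\lambda-(x-1-\lambda)^2}\,dx$ on $[(1-\sqrt\lambda)^2,(1+\sqrt\lambda)^2]$. $\hat N_t=N_t-t\mathbf{1}$ is the compensated process. Multiple integrals: for $\mathfrak{M}\in\{S,\hat N\}$, $I_n^{\mathfrak{M}}$ is the linear map $L^2(\mathbb{R}_+^n)\to L^2(\mathscr{A},\varphi)$ determined by $I_n^{\mathfrak{M}}(\mathbf{1}_{[a_1,b_1]\times\cdots\times[a_n,b_n]})=(\mathfrak{M}_{b_1}-\mathfrak{M}_{a_1})\cdots(\mathfrak{M}_{b_n}-\mathfrak{M}_{a_n})$ for pairwise disjoint intervals and extended by linearity and the isometry $\varphi(I_n^{\mathfrak{M}}(f)I_n^{\mathfrak{M}}(g)^*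 )=\langle f,g\rangle_{L^2(\mathbb{R}_+^n)}$; $I_0^{\mathfrak M}(c)=c\mathbf 1$. Integrals of different orders are orthogonal, and $I_n^{\mathfrak{M}}(f)^*=I_n^{\mathfrak{M}}(f^* )$. Contractions, for $f\in L^2(\mathbb{R}_+^n)$, $g\in L^2(\mathbb{R}_+^m)$: for $0\le p\le n\wedge m$, $(f\stackrel{p}{\frown}g)(t_1,\dots,t_{n+m-2p})=\int_{\mathbb{R}_+^p}f(t_1,\dots,t_{n-p},s_1,\dots,s_p)\,g(s_p,\dots,s_1,t_{n-p+1},\dots,t_{n+m-2p})\,ds_1\cdots ds_p$; and for $1\le p\le n\wedge m$, $(f\star_p^{p-1}g)(t_1,\dots,t_{n+m-2p+1})=\int_{\mathbb{R}_+^{p-1}}f(t_1,\dots,t_{n-p+1},s_{p-1},\dots,s_1)\,g(s_1,\dots,s_{p-1},t_{n-p+1},\dots,t_{n+m-2p+1})\,ds_1\cdots ds_{p-1}$. Standing convention: the multiple integrals span a unital $*$-algebra, with products (hence moments) computed by $I_n^S(f)I_m^S(g)=\sum_{p=0}^{n\wedge m}I_{n+m-2p}^S(f\stackrel{p}{\frown}g)$ in the Wigner case and $I_n^{\hat N}(f)I_m^{\hat N}(g)=\sum_{p=0}^{n\wedge m}I_{n+m-2p}^{\hat N}(f\stackrel{p}{\frown}g)+\sum_{p=1}^{n\wedge m}I_{n+m-2p+1}^{\hat N}(f\star_p^{p-1}g)$ in the free Poisson case.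
   Formalization: In (ii) the f_k, g_k lie in a class of square-integrable kernels closed under linear combinations, adjoints and both contractions, and the product formula is assumed only there, since star contractions of general L² kernels (e.g. f² for n=m=p=1) need not be in L². *)

theory Defs
  imports "HOL-Analysis.Analysis" "HOL-Computational_Algebra.Polynomial"
    "HOL-Combinatorics.Permutations"
begin

section \<open>Complex Hilbert spaces and von Neumann algebras\<close>

text \<open>The inner product is linear in its first argument.\<close>

class complex_hilbert_space = banach +
  fixes scaleC :: "complex \<Rightarrow> 'a \<Rightarrow> 'a"  (infixr "*\<^sub>C" 75)
    and cinner :: "'a \<Rightarrow> 'a \<Rightarrow> complex"
  assumes scaleC_add_right: "c *\<^sub>C (x + y) = c *\<^sub>C x + c *\<^sub>C y"
    and scaleC_add_left: "(c + d) *\<^sub>C x = c *\<^sub>C x + d *\<^sub>C x"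
    and scaleC_scaleC: "c *\<^sub>C (d *\<^sub>C x) = (c * d) *\<^sub>C x"
    and scaleC_of_real: "complex_of_real r *\<^sub>C x = r *\<^sub>R x"
    and cinner_commute: "cinner x y = cnj (cinner y x)"
    and cinner_add_left: "cinner (x + y) z = cinner x z + cinner y z"
    and cinner_scaleC_left: "cinner (c *\<^sub>C x) y = c * cinner x y"
    and cinner_self: "cinner x x = complex_of_real ((norm x)\<^sup>2)"

type_synonym 'h op = "'h \<Rightarrow> 'h"

definition bounded_op :: "'h::complex_hilbert_space op \<Rightarrow> bool" where
  "bounded_op X \<longleftrightarrow> bounded_linear X \<and> (\<forall>c x. X (c *\<^sub>C x) = c *\<^sub>C X x)"

definition adj :: "'h::complex_hilbert_space op \<Rightarrow> 'h op" where
  "adj X = (THE Y. bounded_op Y \<and> (\<forall>x y. cinner (X x) y = cinner x (Y y)))"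

definition positive_op :: "'h::complex_hilbert_space op \<Rightarrow> bool" where
  "positive_op X \<longleftrightarrow> bounded_op X \<and> (\<forall>x. cinner (X x) x \<in> \<real>\<^sub>\<ge>\<^sub>0)"

definition commutant :: "'h::complex_hilbert_space op set \<Rightarrow> 'h op set" where
  "commutant B = {Y. bounded_op Y \<and> (\<forall>X\<in>B. X \<circ> Y = Y \<circ> X)}"

definition von_neumann_algebra :: "'h::complex_hilbert_space op set \<Rightarrow> bool" where
  "von_neumann_algebra B \<longleftrightarrow>
     (\<forall>X\<in>B. bounded_op X \<and> adj X \<in> B) \<and> commutant (commutant B) = B"

definition square_summable :: "(nat \<Rightarrow> 'h::real_normed_vector) \<Rightarrow> bool" where
  "square_summable \<xi> \<longleftrightarrow> summable (\<lambda>i. (norm (\<xi> i))\<^sup>2)"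

text \<open>The ultraweak (weak-*) topology on \<open>B\<close>, i.e. the initial topology of all functionals
  \<open>X \<mapsto> \<Sum>i. \<langle>X \<xi>\<^sub>i, \<eta>\<^sub>i\<rangle>\<close> with square-summable \<open>\<xi>\<close>, \<open>\<eta>\<close>.\<close>

definition ultraweak_topology :: "'h::complex_hilbert_space op set \<Rightarrow> 'h op topology" where
  "ultraweak_topology B = pullback_topology B
     (\<lambda>X (\<xi>, \<eta>). if square_summable \<xi> \<and> square_summable \<eta>
                 then (\<Sum>i::nat. cinner (X (\<xi> i)) (\<eta> i)) else 0)
     (euclidean :: ((nat \<Rightarrow> 'h) \<times> (nat \<Rightarrow> 'h) \<Rightarrow> complex) topology)"


section \<open>Tracial W*-probability spaces and their L2-completion\<close>

locale tracial_W_star_space =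
  fixes A :: "'h::complex_hilbert_space op set"
    and \<phi> :: "'h op \<Rightarrow> complex"
  assumes vN: "von_neumann_algebra A"
    and phi_add: "\<lbrakk>X \<in> A; Y \<in> A\<rbrakk> \<Longrightarrow> \<phi> (\<lambda>x. X x + Y x) = \<phi> X + \<phi> Y"
    and phi_scale: "X \<in> A \<Longrightarrow> \<phi> (\<lambda>x. c *\<^sub>C X x) = c * \<phi> X"
    and phi_unital: "\<phi> id = 1"
    and phi_weakly_continuous: "continuous_map (ultraweak_topology A) euclidean \<phi>"
    and phi_positive: "X \<in> A \<Longrightarrow> \<phi> (adj X \<circ> X) \<in> \<real>\<^sub>\<ge>\<^sub>0"
    and phi_faithful: "\<lbrakk>X \<in> A; \<phi> (adj X \<circ> X) = 0\<rbrakk> \<Longrightarrow> X = (\<lambda>_. 0)"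
    and phi_trace: "\<lbrakk>X \<in> A; Y \<in> A\<rbrakk> \<Longrightarrow> \<phi> (X \<circ> Y) = \<phi> (Y \<circ> X)"

text \<open>A completion of \<open>A\<close> for the norm \<open>\<phi>(X X\<^sup>*)\<^sup>1\<^sup>/\<^sup>2\<close>: the Hilbert space \<open>'l\<close> together with the
  embedding \<open>\<iota>\<close>.\<close>

locale nc_L2_completion = tracial_W_star_space A \<phi>
  for A :: "'h::complex_hilbert_space op set" and \<phi> :: "'h op \<Rightarrow> complex" +
  fixes \<iota> :: "'h op \<Rightarrow> 'l::complex_hilbert_space"
  assumes iota_add: "\<lbrakk>X \<in> A; Y \<in> A\<rbrakk> \<Longrightarrow> \<iota> (\<lambda>x. X x + Y x) = \<iota> X + \<iota> Y"
    and iota_scale: "X \<in> A \<Longrightarrow> \<iota> (\<lambda>x. c *\<^sub>C X x) = c *\<^sub>C \<iota> X"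
    and iota_cinner: "\<lbrakk>X \<in> A; Y \<in> A\<rbrakk> \<Longrightarrow> cinner (\<iota> X) (\<iota> Y) = \<phi> (X \<circ> adj Y)"
    and iota_dense: "closure (\<iota> ` A) = UNIV"

text \<open>Elements of \<open>L\<^sup>2(A, \<phi>)\<close> may be unbounded, so adjoint and product are the extensions of those of
  \<open>A\<close> by approximation. The product of two elements of \<open>L\<^sup>2(A, \<phi>)\<close> is in general only in
  \<open>L\<^sup>1(A, \<phi>)\<close>, which embeds in the functionals on \<open>A\<close>; \<open>nc_times A \<phi> \<iota> \<xi> \<eta> \<zeta>\<close> says that it
  lies in \<open>L\<^sup>2(A, \<phi>)\<close> and equals \<open>\<zeta>\<close>. As \<open>|\<phi>(X Y W\<^sup>*)| \<le> \<parallel>X\<parallel>\<^sub>2 \<parallel>Y\<parallel>\<^sub>2 \<parallel>W\<parallel>\<close>, the choice of the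
  approximating sequences does not matter.\<close>

definition nc_adjoint ::
  "'h::complex_hilbert_space op set \<Rightarrow> ('h op \<Rightarrow> 'l::complex_hilbert_space) \<Rightarrow> 'l \<Rightarrow> 'l \<Rightarrow> bool" where
  "nc_adjoint A \<iota> \<xi> \<eta> \<longleftrightarrow>
     (\<exists>X. (\<forall>j::nat. X j \<in> A) \<and> (\<lambda>j. \<iota> (X j)) \<longlonglongrightarrow> \<xi> \<and> (\<lambda>j. \<iota> (adj (X j))) \<longlonglongrightarrow> \<eta>)"

abbreviation nc_selfadjoint ::
  "'h::complex_hilbert_space op set \<Rightarrow> ('h op \<Rightarrow> 'l::complex_hilbert_space) \<Rightarrow> 'l \<Rightarrow> bool" where
  "nc_selfadjoint A \<iota> \<xi> \<equiv> nc_adjoint A \<iota> \<xi> \<xi>"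

definition nc_times ::
  "'h::complex_hilbert_space op set \<Rightarrow> ('h op \<Rightarrow> complex) \<Rightarrow> ('h op \<Rightarrow> 'l::complex_hilbert_space) \<Rightarrow>
   'l \<Rightarrow> 'l \<Rightarrow> 'l \<Rightarrow> bool" where
  "nc_times A \<phi> \<iota> \<xi> \<eta> \<zeta> \<longleftrightarrow>
     (\<exists>X Y. (\<forall>j::nat. X j \<in> A \<and> Y j \<in> A) \<and>
        (\<lambda>j. \<iota> (X j)) \<longlonglongrightarrow> \<xi> \<and> (\<lambda>j. \<iota> (Y j)) \<longlonglongrightarrow> \<eta> \<and>
        (\<forall>W\<in>A. (\<lambda>j. \<phi> (X j \<circ> Y j \<circ> adj W)) \<longlonglongrightarrow> cinner \<zeta> (\<iota> W)))"

inductive nc_word ::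
  "'h::complex_hilbert_space op set \<Rightarrow> ('h op \<Rightarrow> complex) \<Rightarrow> ('h op \<Rightarrow> 'l::complex_hilbert_space) \<Rightarrow>
   'l list \<Rightarrow> 'l \<Rightarrow> bool"
  for A \<phi> \<iota> where
  Nil: "nc_word A \<phi> \<iota> [] (\<iota> id)"
| Cons: "\<lbrakk>nc_word A \<phi> \<iota> \<xi>s \<eta>; nc_times A \<phi> \<iota> \<xi> \<eta> \<zeta>\<rbrakk> \<Longrightarrow> nc_word A \<phi> \<iota> (\<xi> # \<xi>s) \<zeta>"

definition nc_trace :: "('h op \<Rightarrow> 'l::complex_hilbert_space) \<Rightarrow> 'l \<Rightarrow> complex" where
  "nc_trace \<iota> \<xi> = cinner \<xi> (\<iota> id)"

text \<open>The product of the list \<open>\<xi>s\<close> exists in \<open>L\<^sup>2(A, \<phi>)\<close> and has trace \<open>c\<close>.\<close>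

definition nc_moment ::
  "'h::complex_hilbert_space op set \<Rightarrow> ('h op \<Rightarrow> complex) \<Rightarrow> ('h op \<Rightarrow> 'l::complex_hilbert_space) \<Rightarrow>
   'l list \<Rightarrow> complex \<Rightarrow> bool" where
  "nc_moment A \<phi> \<iota> \<xi>s c \<longleftrightarrow> (\<exists>\<zeta>. nc_word A \<phi> \<iota> \<xi>s \<zeta> \<and> nc_trace \<iota> \<zeta> = c)"

definition joint_law_convergence ::
  "'h::complex_hilbert_space op set \<Rightarrow> ('h op \<Rightarrow> complex) \<Rightarrow> ('h op \<Rightarrow> 'l::complex_hilbert_space) \<Rightarrow>
   (nat \<Rightarrow> 'l list) \<Rightarrow> 'l list \<Rightarrow> bool" where
  "joint_law_convergence A \<phi> \<iota> X Xinf \<longleftrightarrow>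
     (\<forall>k. length (X k) = length Xinf) \<and>
     (\<forall>is. is \<noteq> [] \<and> set is \<subseteq> {..<length Xinf} \<longrightarrow>
       (\<exists>c cinf. (\<forall>k. nc_moment A \<phi> \<iota> (map ((!) (X k)) is) (c k)) \<and>
                 nc_moment A \<phi> \<iota> (map ((!) Xinf) is) cinf \<and> c \<longlonglongrightarrow> cinf))"

definition nc_poly ::
  "'h::complex_hilbert_space op set \<Rightarrow> ('h op \<Rightarrow> complex) \<Rightarrow> ('h op \<Rightarrow> 'l::complex_hilbert_space) \<Rightarrow>
   complex poly \<Rightarrow> 'l \<Rightarrow> 'l" where
  "nc_poly A \<phi> \<iota> P \<xi> =
     (\<Sum>j\<le>degree P. coeff P j *\<^sub>C (THE \<zeta>. nc_word A \<phi> \<iota> (replicate j \<xi>) \<zeta>))"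

definition nc_center :: "('h op \<Rightarrow> 'l::complex_hilbert_space) \<Rightarrow> 'l \<Rightarrow> 'l" where
  "nc_center \<iota> \<xi> = \<xi> - nc_trace \<iota> \<xi> *\<^sub>C \<iota> id"

definition nc_free ::
  "'h::complex_hilbert_space op set \<Rightarrow> ('h op \<Rightarrow> complex) \<Rightarrow> ('h op \<Rightarrow> 'l::complex_hilbert_space) \<Rightarrow>
   'l list \<Rightarrow> bool" where
  "nc_free A \<phi> \<iota> X \<longleftrightarrow>
     (\<forall>w :: (nat \<times> complex poly) list.
        w \<noteq> [] \<and> (\<forall>(i, P)\<in>set w. i < length X) \<and> distinct_adj (map fst w) \<longrightarrow>
        nc_moment A \<phi> \<iota> (map (\<lambda>(i, P). nc_center \<iota> (nc_poly A \<phi> \<iota> P (X ! i))) w) 0)"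


section \<open>Free Brownian motion and the free Poisson process\<close>

definition op_poly :: "complex poly \<Rightarrow> 'h::complex_hilbert_space op \<Rightarrow> 'h op" where
  "op_poly P X = (\<lambda>x. \<Sum>j\<le>degree P. coeff P j *\<^sub>C (X ^^ j) x)"

text \<open>Freeness of \<open>X\<close> from a subalgebra \<open>B\<close>: alternating products of centered elements of \<open>B\<close>
  (label \<open>True\<close>) and centered polynomials in \<open>X\<close> (label \<open>False\<close>) are centered.\<close>

definition free_from ::
  "('h::complex_hilbert_space op \<Rightarrow> complex) \<Rightarrow> 'h op \<Rightarrow> 'h op set \<Rightarrow> bool" where
  "free_from \<phi> X B \<longleftrightarrow>
     (\<forall>w :: (bool \<times> 'h op) list.
        w \<noteq> [] \<and> distinct_adj (map fst w) \<and>
        (\<forall>(b, Y)\<in>set w. Y \<in> (if b then B else range (\<lambda>P. op_poly P X)) \<and> \<phi> Y = 0) \<longrightarrow>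
        \<phi> (foldr (\<circ>) (map snd w) id) = 0)"

text \<open>The laws below are compactly supported, hence determined by their moments.\<close>

definition has_law :: "('h op \<Rightarrow> complex) \<Rightarrow> 'h op \<Rightarrow> real measure \<Rightarrow> bool" where
  "has_law \<phi> X \<mu> \<longleftrightarrow> (\<forall>j. \<phi> (X ^^ j) = complex_of_real (\<integral>x. x ^ j \<partial>\<mu>))"

definition semicircular_law :: "real \<Rightarrow> real measure" where
  "semicircular_law v = density lborel (\<lambda>x. ennreal
     (indicator {- 2 * sqrt v .. 2 * sqrt v} x * (sqrt (4 * v - x\<^sup>2) / (2 * pi * v))))"

definition free_poisson_ac :: "real \<Rightarrow> real measure" where
  "free_poisson_ac r = density lborel (\<lambda>x. ennreal
     (indicator {(1 - sqrt r)\<^sup>2 .. (1 + sqrt r)\<^sup>2} x * (sqrt (4 * r - (x - 1 - r)\<^sup>2) / (2 * pi * x))))"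

definition free_poisson_law :: "real \<Rightarrow> real measure" where
  "free_poisson_law r = measure_of UNIV (sets borel)
     (\<lambda>B. (if r \<le> 1 then ennreal (1 - r) * indicator B 0 else 0) + emeasure (free_poisson_ac r) B)"

definition vN_filtration ::
  "'h::complex_hilbert_space op set \<Rightarrow> (real \<Rightarrow> 'h op set) \<Rightarrow> bool" where
  "vN_filtration A \<A> \<longleftrightarrow>
     (\<forall>t\<ge>0. von_neumann_algebra (\<A> t) \<and> \<A> t \<subseteq> A) \<and> (\<forall>s t. 0 \<le> s \<and> s \<le> t \<longrightarrow> \<A> s \<subseteq> \<A> t)"

definition free_brownian_motion ::
  "'h::complex_hilbert_space op set \<Rightarrow> ('h op \<Rightarrow> complex) \<Rightarrow> (real \<Rightarrow> 'h op) \<Rightarrow> bool" where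
  "free_brownian_motion A \<phi> S \<longleftrightarrow>
     (\<exists>\<A>. vN_filtration A \<A> \<and>
        (\<forall>t\<ge>0. S t \<in> \<A> t \<and> adj (S t) = S t) \<and> S 0 = (\<lambda>_. 0) \<and>
        (\<forall>u t. 0 \<le> u \<and> u < t \<longrightarrow>
           free_from \<phi> (\<lambda>x. S t x - S u x) (\<A> u) \<and>
           has_law \<phi> (\<lambda>x. S t x - S u x) (semicircular_law (t - u))))"

definition free_poisson_process ::
  "'h::complex_hilbert_space op set \<Rightarrow> ('h op \<Rightarrow> complex) \<Rightarrow> (real \<Rightarrow> 'h op) \<Rightarrow> bool" where
  "free_poisson_process A \<phi> N \<longleftrightarrow>
     (\<exists>\<A>. vN_filtration A \<A> \<and>
        (\<forall>t\<ge>0. N t \<in> \<A> t \<and> positive_op (N t)) \<and> N 0 = (\<lambda>_. 0) \<and>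
        (\<forall>u t. 0 \<le> u \<and> u < t \<longrightarrow>
           free_from \<phi> (\<lambda>x. N t x - N u x) (\<A> u) \<and>
           has_law \<phi> (\<lambda>x. N t x - N u x) (free_poisson_law (t - u))))"

definition compensated_free_poisson ::
  "'h::complex_hilbert_space op set \<Rightarrow> ('h op \<Rightarrow> complex) \<Rightarrow> (real \<Rightarrow> 'h op) \<Rightarrow> bool" where
  "compensated_free_poisson A \<phi> M \<longleftrightarrow>
     (\<exists>N. free_poisson_process A \<phi> N \<and> (\<forall>t\<ge>0. M t = (\<lambda>x. N t x - t *\<^sub>R x)))"


section \<open>Kernels and contractions\<close>

text \<open>Points of \<open>\<real>\<^sub>+\<^sup>n\<close> are functions on \<open>{..<n}\<close>, so the coordinates are numbered from 0.\<close>

type_synonym kernel = "(nat \<Rightarrow> real) \<Rightarrow> complex"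

definition Rp :: "nat \<Rightarrow> (nat \<Rightarrow> real) measure" where
  "Rp n = Pi\<^sub>M {..<n} (\<lambda>_. restrict_space lborel {0..})"

definition L2_kernels :: "nat \<Rightarrow> kernel set" where
  "L2_kernels n = {f \<in> borel_measurable (Rp n). integrable (Rp n) (\<lambda>t. (cmod (f t))\<^sup>2)}"

definition L2_null_sequence :: "nat \<Rightarrow> (nat \<Rightarrow> kernel) \<Rightarrow> bool" where
  "L2_null_sequence n h \<longleftrightarrow> (\<forall>k. h k \<in> L2_kernels n) \<and>
     (\<lambda>k. sqrt (\<integral>t. (cmod (h k t))\<^sup>2 \<partial>Rp n)) \<longlonglongrightarrow> 0"

definition symmetric_kernel :: "nat \<Rightarrow> kernel \<Rightarrow> bool" where
  "symmetric_kernel n f \<longleftrightarrow> (AE t in Rp n. f t \<in> \<real>) \<and>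
     (\<forall>\<sigma>. \<sigma> permutes {..<n} \<longrightarrow> (AE t in Rp n. f t = f (\<lambda>i\<in>{..<n}. t (\<sigma> i))))"

definition kernel_adjoint :: "nat \<Rightarrow> kernel \<Rightarrow> kernel" where
  "kernel_adjoint n f = (\<lambda>t. cnj (f (\<lambda>i\<in>{..<n}. t (n - 1 - i))))"

definition contraction :: "nat \<Rightarrow> nat \<Rightarrow> nat \<Rightarrow> kernel \<Rightarrow> kernel \<Rightarrow> kernel" where
  "contraction n m p f g = (\<lambda>t. \<integral>s.
     f (\<lambda>i\<in>{..<n}. if i < n - p then t i else s (i - (n - p))) *
     g (\<lambda>i\<in>{..<m}. if i < p then s (p - 1 - i) else t (n - p + (i - p))) \<partial>Rp p)"

text \<open>Here \<open>1 \<le> p\<close>, and the variable \<open>t (n - p)\<close> is shared: it is the last free argument of \<open>f\<close>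
  and the first free argument of \<open>g\<close>.\<close>

definition star_contraction :: "nat \<Rightarrow> nat \<Rightarrow> nat \<Rightarrow> kernel \<Rightarrow> kernel \<Rightarrow> kernel" where
  "star_contraction n m p f g = (\<lambda>t. \<integral>s.
     f (\<lambda>i\<in>{..<n}. if i \<le> n - p then t i else s (n - 1 - i)) *
     g (\<lambda>i\<in>{..<m}. if i < p - 1 then s i else t (n - p + (i - (p - 1)))) \<partial>Rp (p - 1))"


section \<open>Multiple integrals\<close>

text \<open>\<open>I n\<close> is the \<open>n\<close>-fold integral with respect to \<open>M\<close>.\<close>

definition multiple_integrals ::
  "'h::complex_hilbert_space op set \<Rightarrow> ('h op \<Rightarrow> 'l::complex_hilbert_space) \<Rightarrow>
   (real \<Rightarrow> 'h op) \<Rightarrow> (nat \<Rightarrow> kernel \<Rightarrow> 'l) \<Rightarrow> bool" where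
  "multiple_integrals A \<iota> M I \<longleftrightarrow>
     (\<forall>n. \<forall>f\<in>L2_kernels n. \<forall>g\<in>L2_kernels n. \<forall>c d.
        I n (\<lambda>t. c * f t + d * g t) = c *\<^sub>C I n f + d *\<^sub>C I n g) \<and>
     (\<forall>n a b. (\<forall>i<n. 0 \<le> a i \<and> a i \<le> b i) \<and> disjoint_family_on (\<lambda>i. {a i..b i}) {..<n} \<longrightarrow>
        I n (indicator (PiE {..<n} (\<lambda>i. {a i..b i}))) =
          \<iota> (foldr (\<circ>) (map (\<lambda>i x. M (b i) x - M (a i) x) [0..<n]) id)) \<and>
     (\<forall>c. I 0 (\<lambda>_. c) = c *\<^sub>C \<iota> id) \<and>
     (\<forall>n. \<forall>f\<in>L2_kernels n. \<forall>g\<in>L2_kernels n.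
        cinner (I n f) (I n g) = (\<integral>t. f t * cnj (g t) \<partial>Rp n)) \<and>
     (\<forall>n m. n \<noteq> m \<longrightarrow> (\<forall>f\<in>L2_kernels n. \<forall>g\<in>L2_kernels m. cinner (I n f) (I m g) = 0)) \<and>
     (\<forall>n. \<forall>f\<in>L2_kernels n. nc_adjoint A \<iota> (I n f) (I n (kernel_adjoint n f)))"

definition wigner_product_formula ::
  "'h::complex_hilbert_space op set \<Rightarrow> ('h op \<Rightarrow> complex) \<Rightarrow> ('h op \<Rightarrow> 'l::complex_hilbert_space) \<Rightarrow>
   (nat \<Rightarrow> kernel \<Rightarrow> 'l) \<Rightarrow> bool" where
  "wigner_product_formula A \<phi> \<iota> I \<longleftrightarrow>
     (\<forall>n m. \<forall>f\<in>L2_kernels n. \<forall>g\<in>L2_kernels m.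
        nc_times A \<phi> \<iota> (I n f) (I m g)
          (\<Sum>p\<le>min n m. I (n + m - 2 * p) (contraction n m p f g)))"

text \<open>The star contraction of two square-integrable kernels need not be square-integrable
  (for \<open>n = m = p = 1\<close> it is the pointwise product), so in the free Poisson case the multiple
  integrals span an algebra only over a class \<open>D\<close> of kernels that is stable under contractions,
  such as the bounded kernels with bounded support.\<close>

definition poisson_integral_algebra ::
  "'h::complex_hilbert_space op set \<Rightarrow> ('h op \<Rightarrow> complex) \<Rightarrow> ('h op \<Rightarrow> 'l::complex_hilbert_space) \<Rightarrow>
   (nat \<Rightarrow> kernel \<Rightarrow> 'l) \<Rightarrow> (nat \<Rightarrow> kernel set) \<Rightarrow> bool" where
  "poisson_integral_algebra A \<phi> \<iota> I D \<longleftrightarrow>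
     (\<forall>n. D n \<subseteq> L2_kernels n) \<and>
     (\<forall>c. (\<lambda>_. c) \<in> D 0) \<and>
     (\<forall>n. \<forall>f\<in>D n. \<forall>g\<in>D n. \<forall>c d. (\<lambda>t. c * f t + d * g t) \<in> D n) \<and>
     (\<forall>n. \<forall>f\<in>D n. kernel_adjoint n f \<in> D n) \<and>
     (\<forall>n m. \<forall>f\<in>D n. \<forall>g\<in>D m.
        (\<forall>p\<in>{0..min n m}. contraction n m p f g \<in> D (n + m - 2 * p)) \<and>
        (\<forall>p\<in>{1..min n m}. star_contraction n m p f g \<in> D (n + m - 2 * p + 1)) \<and>
        nc_times A \<phi> \<iota> (I n f) (I m g)
          ((\<Sum>p\<le>min n m. I (n + m - 2 * p) (contraction n m p f g)) +
           (\<Sum>p=1..min n m. I (n + m - 2 * p + 1) (star_contraction n m p f g))))"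

end

theory Submission
  imports Defs
begin

text \<open>Write \<open>F\<^sub>k\<close>, \<open>G\<^sub>k\<close> for the multiple integrals of \<open>f\<^sub>k\<close>, \<open>g\<^sub>k\<close>.

If the limits are free, then \<open>\<tau>(F F G G) = \<tau>(F F) \<tau>(G G)\<close>. But \<open>\<tau>(F\<^sub>k G\<^sub>k G\<^sub>k F\<^sub>k) = \<parallel>F\<^sub>k G\<^sub>k\<parallel>\<^sup>2\<close> is, by the product formula,
  the sum of the squared norms of all (star) contractions, and the one of order zero is \<open>\<parallel>f\<^sub>k\<parallel>\<^sup>2 \<parallel>g\<^sub>k\<parallel>\<^sup>2\<close>. So all others
  tend to zero (\<open>free_null\<close>).

Conversely, let the contractions tend to zero. In a polynomial of \<open>G\<^sub>k\<close> every chaos kernel \<open>u\<close> is glued from copies of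
  \<open>g\<^sub>k\<close>, and by Fubini's theorem gluing \<open>f\<^sub>k\<close> to an interval of arguments of \<open>u\<close> again gives a null sequence
  (\<open>NF_gcon\<close>). So in the product of \<open>F\<^sub>k\<close> with the integral of \<open>u \<otimes> z\<close>, where \<open>f\<^sub>k\<close> cannot be contracted with \<open>z\<close>,
  only contractions inside \<open>u\<close> survive (\<open>tensor_times\<close>): polynomials of \<open>F\<^sub>k\<close> and \<open>G\<^sub>k\<close> act on alternating
  products like creation operators, and the centered ones only produce terms of positive order, which have trace zero.
  The moments converge, hence alternating centered products in the limit have trace zero (\<open>free_limit\<close>).

Two difficulties are of a technical nature. The limits may be unbounded, so that products are only partially defined; they
  are associative whenever they exist (\<open>nc_times_assoc\<close>), by truncation with resolvents. And in the Poisson case star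
  contractions are not bounded in the \<open>L\<^sup>2\<close> norm. There one works with sequences of kernels all of whose weighted marginal
  densities are bounded in every \<open>L\<^sup>p\<close>, a class stable under gluing (\<open>Tame_glue\<close>); that \<open>f\<^sub>k\<close> and \<open>g\<^sub>k\<close> are
  of this kind follows from the boundedness of all their moments, because the marginal density of a kernel is the component
  of order one of the square of its integral (\<open>marginal_sum_square\<close>).\<close>

section \<open>Complex Hilbert spaces\<close>

lemma cinner_scaleC_right: "cinner x (c *\<^sub>C y) = cnj c * cinner (x::'a::complex_hilbert_space) y"
 by (metis cinner_commute cinner_scaleC_left complex_cnj_mult)

lemma cinner_add_right: "cinner x (y + z) = cinner x y + cinner (x::'a::complex_hilbert_space) z"
 by (metis cinner_commute cinner_add_left complex_cnj_add)

lemma cinner_zero_left [simp]: "cinner 0 (y::'a::complex_hilbert_space) = 0"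
 using cinner_add_left[of 0 0 y] by simp

lemma cinner_zero_right [simp]: "cinner (y::'a::complex_hilbert_space) 0 = 0"
 using cinner_add_right[of y 0 0] by simp

lemma cinner_minus_left: "cinner (- x) (y::'a::complex_hilbert_space) = - cinner x y"
 using cinner_add_left[of x "-x" y] by (simp add: eq_neg_iff_add_eq_0 add.commute)

lemma cinner_minus_right: "cinner (x::'a::complex_hilbert_space) (- y) = - cinner x y"
 using cinner_add_right[of x y "-y"] by (simp add: eq_neg_iff_add_eq_0 add.commute)

lemma cinner_diff_left: "cinner (x - y) (z::'a::complex_hilbert_space) = cinner x z - cinner y z"
 using cinner_add_left[of x "-y" z] by (simp add: cinner_minus_left)

lemma cinner_diff_right: "cinner (z::'a::complex_hilbert_space) (x - y) = cinner z x - cinner z y"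
 using cinner_add_right[of z x "-y"] by (simp add: cinner_minus_right)

lemma cinner_scaleR_left: "cinner (r *\<^sub>R x) (y::'a::complex_hilbert_space) = r *\<^sub>R cinner x y"
 by (metis scaleC_of_real cinner_scaleC_left scaleR_conv_of_real)

lemma cinner_scaleR_right: "cinner x (r *\<^sub>R (y::'a::complex_hilbert_space)) = r *\<^sub>R cinner x y"
 by (metis scaleC_of_real cinner_scaleC_right scaleR_conv_of_real complex_cnj_complex_of_real)

lemma scaleC_one [simp]: "1 *\<^sub>C (x::'a::complex_hilbert_space) = x"
 using scaleC_of_real[of 1 x] by simp

lemma scaleC_zero_left [simp]: "0 *\<^sub>C (x::'a::complex_hilbert_space) = 0"
 using scaleC_of_real[of 0 x] by simp

lemma scaleC_zero_right [simp]: "c *\<^sub>C (0::'a::complex_hilbert_space) = 0"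
 using scaleC_add_right[of c 0 "0::'a"] by simp

lemma scaleC_minus1: "(-1) *\<^sub>C (x::'a::complex_hilbert_space) = - x"
 using scaleC_of_real[of "-1" x] by simp

lemma scaleC_minus_right: "c *\<^sub>C (- x) = - (c *\<^sub>C (x::'a::complex_hilbert_space))"
 using scaleC_add_right[of c x "-x"] by (simp add: eq_neg_iff_add_eq_0 add.commute)

lemma scaleC_diff_right: "c *\<^sub>C (x - y) = c *\<^sub>C x - c *\<^sub>C (y::'a::complex_hilbert_space)"
 using scaleC_add_right[of c x "-y"] by (simp add: scaleC_minus_right)

lemma scaleC_diff_left: "(c - d) *\<^sub>C x = c *\<^sub>C x - d *\<^sub>C (x::'a::complex_hilbert_space)"
 using scaleC_add_left[of "c - d" d x] by simp

lemma scaleC_sum_right: "c *\<^sub>C (\<Sum>i\<in>S. h i) = (\<Sum>i\<in>S. c *\<^sub>C (h i::'a::complex_hilbert_space))"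
 by (induction S rule: infinite_finite_induct) (auto simp: scaleC_add_right)

lemma cinner_sum_left: "cinner (\<Sum>i\<in>S. h i) (y::'a::complex_hilbert_space) = (\<Sum>i\<in>S. cinner (h i) y)"
 by (induction S rule: infinite_finite_induct) (auto simp: cinner_add_left)

lemma cinner_sum_right: "cinner (y::'a::complex_hilbert_space) (\<Sum>i\<in>S. h i) = (\<Sum>i\<in>S. cinner y (h i))"
 by (induction S rule: infinite_finite_induct) (auto simp: cinner_add_right)

lemma norm_sq_eq_cinner: "(norm (x::'a::complex_hilbert_space))\<^sup>2 = Re (cinner x x)"
 by (simp add: cinner_self)

lemma norm_scaleC: "norm (c *\<^sub>C (x::'a::complex_hilbert_space)) = cmod c * norm x"
proof -
 have "complex_of_real ((norm (c *\<^sub>C x))\<^sup>2) = complex_of_real ((cmod c * norm x)\<^sup>2)"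
  by (simp add: cinner_self[symmetric] cinner_scaleC_left cinner_scaleC_right power_mult_distrib
    complex_norm_square del: of_real_power)
 then have "(norm (c *\<^sub>C x))\<^sup>2 = (cmod c * norm x)\<^sup>2" using of_real_eq_iff by blast
 then show ?thesis by (simp add: power2_eq_iff_nonneg)
qed

lemma norm_add_sq: "(norm (x + y))\<^sup>2 = (norm x)\<^sup>2 + 2 * Re (cinner x y) + (norm (y::'a::complex_hilbert_space))\<^sup>2"
proof -
 have "Re (cinner y x) = Re (cinner x y)" by (subst cinner_commute) simp
 then show ?thesis by (simp add: norm_sq_eq_cinner cinner_add_left cinner_add_right)
qed

lemma cinner_Cauchy_Schwarz: "cmod (cinner x y) \<le> norm x * norm (y::'a::complex_hilbert_space)"
proof (cases "y = 0")
 case False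
 define c where "c = cinner x y / complex_of_real ((norm y)\<^sup>2)"
 have ny: "(norm y)\<^sup>2 > 0" using False by simp
 have "0 \<le> (norm (x + (- c) *\<^sub>C y))\<^sup>2" by simp
 also have "\<dots> = (norm x)\<^sup>2 + 2 * Re (- cnj c * cinner x y) + (cmod c)\<^sup>2 * (norm y)\<^sup>2"
  by (simp add: norm_add_sq norm_scaleC cinner_scaleC_right power_mult_distrib)
 also have "- cnj c * cinner x y = - complex_of_real ((cmod (cinner x y))\<^sup>2 / (norm y)\<^sup>2)"
  by (simp add: c_def complex_norm_square mult.commute del: of_real_power)
 also have "(cmod c)\<^sup>2 * (norm y)\<^sup>2 = (cmod (cinner x y))\<^sup>2 / (norm y)\<^sup>2"
  using False by (simp add: c_def norm_divide norm_mult power2_eq_square)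
 finally have "(cmod (cinner x y))\<^sup>2 / (norm y)\<^sup>2 \<le> (norm x)\<^sup>2"
  by (simp add: del: of_real_divide of_real_power)
 then have "(cmod (cinner x y))\<^sup>2 \<le> (norm x * norm y)\<^sup>2"
  using ny by (simp add: divide_le_eq power_mult_distrib)
 then show ?thesis by (simp add: power2_le_iff_abs_le)
qed simp

lemma bounded_bilinear_cinner: "bounded_bilinear (cinner :: 'a::complex_hilbert_space => 'a => complex)"
 by unfold_locales
  (auto simp: cinner_add_left cinner_add_right cinner_scaleR_left cinner_scaleR_right
   intro!: exI[of _ 1] cinner_Cauchy_Schwarz)

lemma bounded_bilinear_scaleC: "bounded_bilinear (scaleC :: complex => 'a::complex_hilbert_space => 'a)"
proof unfold_locales
 fix r :: real and a :: complex and b :: 'a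
 show "(r *\<^sub>R a) *\<^sub>C b = r *\<^sub>R (a *\<^sub>C b)"
  by (simp add: scaleR_conv_of_real scaleC_scaleC[symmetric] scaleC_of_real)
 show "a *\<^sub>C (r *\<^sub>R b) = r *\<^sub>R (a *\<^sub>C b)"
  by (metis scaleC_of_real scaleC_scaleC mult.commute)
qed (auto simp: scaleC_add_left scaleC_add_right norm_scaleC intro!: exI[of _ 1])

lemmas tendsto_cinner = bounded_bilinear.tendsto[OF bounded_bilinear_cinner]
lemmas tendsto_scaleC = bounded_bilinear.tendsto[OF bounded_bilinear_scaleC]

lemma cinner_ext: "(!!z. cinner z x = cinner z y) ==> x = (y::'a::complex_hilbert_space)"
proof -
 assume "!!z. cinner z x = cinner z y"
 then have "cinner (x - y) (x - y) = 0" by (simp add: cinner_diff_right)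
 then show ?thesis by (simp add: cinner_self)
qed

text \<open>The representing vector minimises \<open>\<parallel>x\<parallel>\<^sup>2 - 2 Re \<ell>(x)\<close>: by the parallelogram law every
 minimising sequence is Cauchy.\<close>

lemma Riesz_representation:
 fixes l :: "'a::complex_hilbert_space => complex"
 assumes add: "!!x y. l (x + y) = l x + l y" and scale: "!!c x. l (c *\<^sub>C x) = c * l x"
  and bdd: "!!x. cmod (l x) \<le> K * norm x"
 shows "\<exists>y. \<forall>x. l x = cinner x y"
proof -
 define Q where "Q x = (norm x)\<^sup>2 - 2 * Re (l x)" for x
 have scR: "l (r *\<^sub>R x) = r *\<^sub>R l x" for r x
  by (metis scale scaleC_of_real scaleR_conv_of_real)
 have bl: "bounded_linear l"
  by (rule bounded_linear_intro[of l K]) (use add scR bdd in \<open>auto simp: mult.commute\<close>)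
 have lower: "Q x \<ge> - K\<^sup>2" for x
 proof -
  have "Re (l x) \<le> K * norm x" using bdd[of x] complex_Re_le_cmod[of "l x"] by linarith
  moreover have "(norm x - K)\<^sup>2 \<ge> 0" by simp
  ultimately show ?thesis by (simp add: Q_def power2_eq_square algebra_simps)
 qed
 define d where "d = (INF x. Q x)"
 have bb: "bdd_below (range Q)" using lower by (intro bdd_belowI[of _ "- K\<^sup>2"]) auto
 have dle: "d \<le> Q x" for x unfolding d_def by (rule cINF_lower[OF bb]) simp
 have "\<exists>x. Q x < d + 1 / real (Suc k)" for k
 proof -
  have "Inf (range Q) < d + 1 / real (Suc k)" by (simp add: d_def)
  then show ?thesis using cInf_lessD[of "range Q"] by auto
 qed
 then obtain X where X: "!!k. Q (X k) < d + 1 / real (Suc k)" by metis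
 have par: "(norm (x - y))\<^sup>2 = 2 * Q x + 2 * Q y - 4 * Q ((1/2) *\<^sub>R (x + y))" for x y
  using norm_add_sq[of x y] norm_add_sq[of x "-y"]
  by (simp add: Q_def scR add cinner_minus_right power_mult_distrib power_divide) argo
 have close: "(norm (X i - X j))\<^sup>2 \<le> 2 / real (Suc i) + 2 / real (Suc j)" for i j
  using par[of "X i" "X j"] X[of i] X[of j] dle[of "(1/2) *\<^sub>R (X i + X j)"] by simp
 have "Cauchy X"
 proof (rule metric_CauchyI)
  fix e :: real assume "e > 0"
  then have "4 / e\<^sup>2 > 0" by simp
  then obtain N where N: "real (Suc N) > 4 / e\<^sup>2" by (metis reals_Archimedean2 less_trans lessI of_nat_less_iff)
  have "norm (X i - X j) < e" if "i \<ge> N" "j \<ge> N" for i j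
  proof -
   have "2 / real (Suc i) \<le> 2 / real (Suc N)" "2 / real (Suc j) \<le> 2 / real (Suc N)"
    using that by (auto intro!: divide_left_mono)
   then have "(norm (X i - X j))\<^sup>2 \<le> 4 / real (Suc N)" using close[of i j] by simp
   also have "\<dots> < e\<^sup>2" using N \<open>e > 0\<close> by (simp add: field_simps)
   finally show ?thesis using \<open>e > 0\<close> power_less_imp_less_base by fastforce
  qed
  then show "\<exists>M. \<forall>m\<ge>M. \<forall>n\<ge>M. dist (X m) (X n) < e" by (auto simp: dist_norm)
 qed
 then obtain y where y: "X \<longlonglongrightarrow> y" using Cauchy_convergent convergent_def by blast
 have "(%k. Q (X k)) \<longlonglongrightarrow> Q y"
  unfolding Q_def by (intro tendsto_intros y bounded_linear.tendsto[OF bl])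
 moreover have "(%k. d + 1 / real (Suc k)) \<longlonglongrightarrow> d + 0"
  by (intro tendsto_intros LIMSEQ_Suc[OF lim_const_over_n])
 ultimately have "Q y \<le> d" using X by (intro LIMSEQ_le[of _ "Q y" _ d]) (auto intro: less_imp_le)
 then have min: "Q y \<le> Q x" for x using dle[of x] by linarith
 have re: "Re (cinner z y) = Re (l z)" for z
 proof (rule ccontr)
  define a where "a = Re (cinner y z) - Re (l z)"
  have cc: "Re (cinner z y) = Re (cinner y z)" by (subst cinner_commute) simp
  assume "Re (cinner z y) \<noteq> Re (l z)"
  then have "a \<noteq> 0" by (simp add: a_def cc)
  have q: "0 \<le> 2 * t * a + t\<^sup>2 * (norm z)\<^sup>2" for t
   using min[of "y + t *\<^sub>R z"]
   by (simp add: Q_def norm_add_sq add scR cinner_scaleR_right a_def algebra_simps power_mult_distrib)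
  define t where "t = - a / ((norm z)\<^sup>2 + 1)"
  have p: "(norm z)\<^sup>2 + 1 > 0" by (meson add_nonneg_pos zero_le_power2 zero_less_one)
  have "0 \<le> 2 * t * a + t\<^sup>2 * ((norm z)\<^sup>2 + 1)" using q[of t] by (simp add: algebra_simps)
  also have "\<dots> = - a\<^sup>2 / ((norm z)\<^sup>2 + 1)"  proof -
   have "2 * (- a / s) * a + (- a / s)\<^sup>2 * s = - a\<^sup>2 / s" if "s > 0" for s :: real
    using that by (simp add: power2_eq_square field_simps)
   from this[OF p] show ?thesis by (simp add: t_def)
  qed
  also have "\<dots> < 0" using p \<open>a \<noteq> 0\<close> by (simp add: divide_neg_pos)
  finally show False by simp
 qed
 have "l x = cinner x y" for x
 proof (rule complex_eqI)
  show "Re (l x) = Re (cinner x y)" using re by simp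
  show "Im (l x) = Im (cinner x y)" using re[of "\<i> *\<^sub>C x"] by (simp add: scale cinner_scaleC_left)
 qed
 then show ?thesis by blast
qed

section \<open>Bounded operators and adjoints\<close>

lemma bounded_op_add: "bounded_op X ==> X (x + y) = X x + X y"
 and bounded_op_scaleC: "bounded_op X ==> X (c *\<^sub>C x) = c *\<^sub>C X x"
 and bounded_op_diff: "bounded_op X ==> X (x - y) = X x - X y"
 and bounded_op_zero: "bounded_op X ==> X 0 = 0"
 by (auto simp: bounded_op_def linear_simps)

lemma bounded_op_bound: "bounded_op X ==> \<exists>K\<ge>0. \<forall>x. norm (X x) \<le> K * norm x"
 unfolding bounded_op_def using bounded_linear.nonneg_bounded[of X] by (metis mult.commute)

lemma bounded_opI:
 assumes "!!x y. X (x + y) = X x + X y" "!!c x. X (c *\<^sub>C x) = c *\<^sub>C X x" "!!x. norm (X x) \<le> K * norm x"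
 shows "bounded_op X"
 unfolding bounded_op_def
proof
 show "bounded_linear X"
  by (rule bounded_linear_intro[of X K]) (use assms in \<open>auto simp: mult.commute scaleC_of_real[symmetric]\<close>)
qed (use assms in auto)

lemma bounded_op_id: "bounded_op id"
 by (rule bounded_opI[of _ 1]) auto

lemma bounded_op_comp: assumes "bounded_op X" "bounded_op Y" shows "bounded_op (X \<circ> Y)"
 using assms by (auto simp: bounded_op_def o_def intro: bounded_linear_compose)

lemma bounded_op_plus: assumes "bounded_op X" "bounded_op Y" shows "bounded_op (%x. X x + Y x)"
 using assms by (auto simp: bounded_op_def scaleC_add_right intro: bounded_linear_add)

lemma bounded_op_scale: assumes "bounded_op X" shows "bounded_op (%x. c *\<^sub>C X x)"
proof -
 obtain K where "K \<ge> 0" "\<forall>x. norm (X x) \<le> K * norm x" using bounded_op_bound[OF assms] by blast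
 then show ?thesis using assms
  by (intro bounded_opI[of _ "cmod c * K"])
   (auto simp: bounded_op_add bounded_op_scaleC scaleC_add_right scaleC_scaleC norm_scaleC mult.commute[of c]
    mult.assoc intro!: mult_left_mono)
qed

lemma adj_ex: assumes "bounded_op X" shows "\<exists>Y. bounded_op Y \<and> (\<forall>x y. cinner (X x) y = cinner x (Y y))"
proof -
 obtain K where K: "K \<ge> 0" "!!x. norm (X x) \<le> K * norm x" using bounded_op_bound[OF assms] by blast
 have "\<exists>z. \<forall>x. cinner (X x) y = cinner x z" for y
 proof (rule Riesz_representation)
  show "cmod (cinner (X x) y) \<le> (K * norm y) * norm x" for x
   using cinner_Cauchy_Schwarz[of "X x" y] mult_right_mono[OF K(2)[of x], of "norm y"] by (simp add: mult_ac)
 qed (auto simp: bounded_op_add[OF assms] bounded_op_scaleC[OF assms] cinner_add_left cinner_scaleC_left)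
 then obtain Y where Y: "!!x y. cinner (X x) y = cinner x (Y y)" by metis
 have "norm (Y y) \<le> K * norm y" for y
 proof (cases "Y y = 0")
  case False
  have "norm (Y y) * norm (Y y) = cmod (cinner (Y y) (Y y))"
   by (simp add: cinner_self power2_eq_square norm_mult)
  also have "\<dots> = cmod (cinner (X (Y y)) y)" by (simp add: Y)
  also have "\<dots> \<le> (K * norm (Y y)) * norm y"
   using cinner_Cauchy_Schwarz[of "X (Y y)" y] mult_right_mono[OF K(2)[of "Y y"], of "norm y"] by simp
  finally show ?thesis using False by (simp add: mult_ac)
 qed (use K in simp)
 moreover have "Y (x + y) = Y x + Y y" for x y
  by (rule cinner_ext) (simp add: Y[symmetric] cinner_add_right)
 moreover have "Y (c *\<^sub>C x) = c *\<^sub>C Y x" for c x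
  by (rule cinner_ext) (simp add: Y[symmetric] cinner_scaleC_right)
 ultimately have "bounded_op Y" by (intro bounded_opI)
 then show ?thesis using Y by blast
qed

lemma adj_unique:
 assumes "!!x y. cinner (X x) y = cinner x (Y y)" "bounded_op X" "bounded_op Y"
 shows "adj X = Y"
 unfolding adj_def
proof (rule the_equality)
 fix Z assume "bounded_op Z \<and> (\<forall>x y. cinner (X x) y = cinner x (Z y))"
 then show "Z = Y" using assms(1) by (intro ext cinner_ext) metis
qed (use assms in auto)

lemma adj_props:
 assumes "bounded_op X"
 shows bounded_op_adj: "bounded_op (adj X)" and cinner_adj: "cinner (X x) y = cinner x (adj X y)"
proof -
 obtain Y where "bounded_op Y" "!!x y. cinner (X x) y = cinner x (Y y)" using adj_ex[OF assms] by blast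
 moreover from this have "adj X = Y" using assms by (intro adj_unique)
 ultimately show "bounded_op (adj X)" "cinner (X x) y = cinner x (adj X y)" by auto
qed

lemma cinner_adj': "bounded_op X ==> cinner (adj X x) y = cinner x (X y)"
 by (metis cinner_adj cinner_commute)

lemma adj_adj: "bounded_op X ==> adj (adj X) = X"
 by (intro adj_unique) (auto simp: cinner_adj' bounded_op_adj)

lemma adj_comp: "bounded_op X ==> bounded_op Y ==> adj (X \<circ> Y) = adj Y \<circ> adj X"
 by (intro adj_unique) (auto simp: cinner_adj bounded_op_adj bounded_op_comp)

lemma adj_plus: "bounded_op X ==> bounded_op Y ==> adj (%x. X x + Y x) = (%x. adj X x + adj Y x)"
 by (intro adj_unique) (auto simp: cinner_adj bounded_op_adj bounded_op_plus cinner_add_left cinner_add_right)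

lemma adj_scale: "bounded_op X ==> adj (%x. c *\<^sub>C X x) = (%x. cnj c *\<^sub>C adj X x)"
 by (intro adj_unique) (auto simp: cinner_adj bounded_op_adj bounded_op_scale cinner_scaleC_left cinner_scaleC_right)

lemma adj_id: "adj id = id"
 by (intro adj_unique) (auto simp: bounded_op_id)

definition op_bound :: "'h::complex_hilbert_space op => real => bool" where
 "op_bound X K \<longleftrightarrow> K \<ge> 0 \<and> (\<forall>x. norm (X x) \<le> K * norm x)"

lemma op_bound_adj: assumes "bounded_op X" "op_bound X K" shows "op_bound (adj X) K"
 unfolding op_bound_def
proof (intro conjI allI)
 show "K \<ge> 0" using assms by (simp add: op_bound_def)
 fix y
 show "norm (adj X y) \<le> K * norm y"
 proof (cases "adj X y = 0")
  case False
  have "norm (adj X y) * norm (adj X y) = cmod (cinner (adj X y) (adj X y))"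
   by (simp add: cinner_self power2_eq_square norm_mult)
  also have "\<dots> = cmod (cinner (X (adj X y)) y)" by (simp add: cinner_adj[OF assms(1)])
  also have "\<dots> \<le> norm (X (adj X y)) * norm y" by (rule cinner_Cauchy_Schwarz)
  also have "\<dots> \<le> (K * norm (adj X y)) * norm y"
   using assms(2) by (intro mult_right_mono) (auto simp: op_bound_def)
  finally show ?thesis using False by (simp add: mult_ac)
 qed (use \<open>K \<ge> 0\<close> in simp)
qed

lemma op_bound_comp: "op_bound X K ==> op_bound Y L ==> op_bound (X \<circ> Y) (K * L)"
 unfolding op_bound_def by (auto simp: mult.assoc) (meson order_trans mult_left_mono)

lemma op_bound_power: "op_bound X K ==> op_bound (X ^^ j) (K ^ j)"
proof (induction j)
 case 0 then show ?case by (simp add: op_bound_def)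
next
 case (Suc j) then show ?case using op_bound_comp[of X K "X ^^ j" "K ^ j"] by (simp add: o_def)
qed

section \<open>The trace norm\<close>

lemma power_dominated_le:
 fixes a b M :: real
 assumes "a \<ge> 0" "b \<ge> 0" and le: "!!n. a ^ (2 ^ n) \<le> M * b ^ (2 ^ n)"
 shows "a \<le> b"
proof (rule ccontr)
 assume "\<not> a \<le> b"
 then have ab: "a > b" by simp
 show False
 proof (cases "b = 0")
  case True
  then show False using le[of 0] ab assms by simp
 next
  case False
  then have b: "b > 0" using assms by simp
  then have r: "a / b > 1" using ab by simp
  have "(a / b) ^ (2 ^ n) \<le> M" for n
   using le[of n] b by (simp add: power_divide divide_le_eq)
  moreover obtain N where "M < (a / b) ^ N" using real_arch_pow[OF r] by blast
  moreover have "(a / b) ^ N \<le> (a / b) ^ (2 ^ N)"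
   using r by (intro power_increasing) (auto intro: less_imp_le)
  ultimately show False by (meson less_le_trans not_less)
 qed
qed

context nc_L2_completion
begin

lemma A_bounded: "X \<in> A ==> bounded_op X"
 and A_adj [intro]: "X \<in> A ==> adj X \<in> A"
 and A_bicommutant: "commutant (commutant A) = A"
 using vN by (auto simp: von_neumann_algebra_def)

lemma A_iff: "X \<in> A \<longleftrightarrow> bounded_op X \<and> (\<forall>Y\<in>commutant A. Y \<circ> X = X \<circ> Y)"
proof -
 have "X \<in> A \<longleftrightarrow> X \<in> commutant (commutant A)" by (simp only: A_bicommutant)
 also have "\<dots> \<longleftrightarrow> bounded_op X \<and> (\<forall>Y\<in>commutant A. Y \<circ> X = X \<circ> Y)"
  unfolding commutant_def[of "commutant A"] by simp
 finally show ?thesis .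
qed

lemma commutant_bounded: "Y \<in> commutant A ==> bounded_op Y"
 by (simp add: commutant_def)

lemma A_id [intro]: "id \<in> A"
 by (simp add: A_iff bounded_op_id)

lemma A_comp [intro]: "X \<in> A ==> Y \<in> A ==> X \<circ> Y \<in> A"
proof -
 assume XY: "X \<in> A" "Y \<in> A"
 show ?thesis unfolding A_iff
 proof (intro conjI ballI)
  fix Z assume Z: "Z \<in> commutant A"
  then have "Z \<circ> X = X \<circ> Z" "Z \<circ> Y = Y \<circ> Z" using XY unfolding A_iff by blast+
  then show "Z \<circ> (X \<circ> Y) = (X \<circ> Y) \<circ> Z" by (metis comp_assoc)
 qed (use XY A_bounded in \<open>intro bounded_op_comp\<close>)
qed

lemma A_plus [intro]: "X \<in> A ==> Y \<in> A ==> (%x. X x + Y x) \<in> A"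
proof -
 assume XY: "X \<in> A" "Y \<in> A"
 show ?thesis unfolding A_iff
 proof (intro conjI ballI)
  fix Z assume Z: "Z \<in> commutant A"
  then have "Z (X x) = X (Z x)" "Z (Y x) = Y (Z x)" for x
   using XY unfolding A_iff by (metis comp_apply)+
  then show "Z \<circ> (%x. X x + Y x) = (%x. X x + Y x) \<circ> Z"
   by (simp add: fun_eq_iff bounded_op_add[OF commutant_bounded[OF Z]])
 qed (use XY A_bounded in \<open>intro bounded_op_plus\<close>)
qed

lemma A_scale [intro]: "X \<in> A ==> (%x. c *\<^sub>C X x) \<in> A"
proof -
 assume X: "X \<in> A"
 show ?thesis unfolding A_iff
 proof (intro conjI ballI)
  fix Z assume Z: "Z \<in> commutant A"
  then have "Z (X x) = X (Z x)" for x
   using X unfolding A_iff by (metis comp_apply)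
  then show "Z \<circ> (%x. c *\<^sub>C X x) = (%x. c *\<^sub>C X x) \<circ> Z"
   by (simp add: fun_eq_iff bounded_op_scaleC[OF commutant_bounded[OF Z]])
 qed (use X A_bounded in \<open>intro bounded_op_scale\<close>)
qed

lemma A_zero [intro]: "(%_. 0) \<in> A"
 using A_scale[OF A_id, of 0] by simp

lemma A_minus [intro]: "X \<in> A ==> (%x. - X x) \<in> A"
 using A_scale[of X "-1"] by (simp add: scaleC_minus1)

lemma A_diff [intro]: "X \<in> A ==> Y \<in> A ==> (%x. X x - Y x) \<in> A"
 using A_plus[OF _ A_minus, of X Y] by simp

lemma A_power [intro]: "X \<in> A ==> X ^^ j \<in> A"
 by (induction j) auto

lemma A_inverse:
 assumes "X \<in> A" "bounded_op Y" "X \<circ> Y = id" "Y \<circ> X = id"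
 shows "Y \<in> A"
 unfolding A_iff
proof (intro conjI ballI)
 fix Z assume Z: "Z \<in> commutant A"
 then have XZ: "Z \<circ> X = X \<circ> Z" using assms(1) unfolding A_iff by blast
 have "Z \<circ> Y = (Y \<circ> X) \<circ> (Z \<circ> Y)" by (simp add: assms)
 also have "\<dots> = Y \<circ> (Z \<circ> X) \<circ> Y" by (simp add: XZ comp_assoc)
 also have "\<dots> = Y \<circ> Z" by (simp add: assms comp_assoc)
 finally show "Z \<circ> Y = Y \<circ> Z" .
qed fact

lemma A_op_bound: "X \<in> A ==> \<exists>K. op_bound X K"
 using bounded_op_bound[OF A_bounded] unfolding op_bound_def by blast

lemma iota_minus: "X \<in> A ==> \<iota> (%x. - X x) = - \<iota> X"
 using iota_scale[of X "-1"] by (simp add: scaleC_minus1)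

lemma iota_diff: "X \<in> A ==> Y \<in> A ==> \<iota> (%x. X x - Y x) = \<iota> X - \<iota> Y"
 using iota_add[OF _ A_minus, of X Y] by (simp add: iota_minus)

lemma phi_iota: "X \<in> A ==> \<phi> X = cinner (\<iota> X) (\<iota> id)"
 using iota_cinner[of X id] by (simp add: adj_id A_id)

lemma norm_iota_sq: "X \<in> A ==> complex_of_real ((norm (\<iota> X))\<^sup>2) = \<phi> (X \<circ> adj X)"
 using iota_cinner[of X X] by (simp add: cinner_self)

lemma norm_iota_adj: assumes "X \<in> A" shows "norm (\<iota> (adj X)) = norm (\<iota> X)"
proof -
 have "complex_of_real ((norm (\<iota> (adj X)))\<^sup>2) = complex_of_real ((norm (\<iota> X))\<^sup>2)"
  using assms by (simp only: norm_iota_sq A_adj adj_adj A_bounded phi_trace)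
 then have "(norm (\<iota> (adj X)))\<^sup>2 = (norm (\<iota> X))\<^sup>2" using of_real_eq_iff by blast
 then show ?thesis by (simp add: power2_eq_iff_nonneg)
qed

text \<open>Ultraweak continuity at zero bounds \<open>\<phi>\<close> by finitely many functionals, each dominated by the operator norm.\<close>

lemma phi_norm_bounded: "\<exists>K\<ge>0. \<forall>X\<in>A. \<forall>C. op_bound X C --> cmod (\<phi> X) \<le> K * C"
proof (rule ccontr)
 assume neg: "\<not> ?thesis"
 have "\<exists>X C. X \<in> A \<and> op_bound X C \<and> cmod (\<phi> X) > real (Suc n) * C" for n
  using neg by (meson not_less of_nat_0_le_iff)
 then obtain X C where X: "!!n. X n \<in> A" "!!n. op_bound (X n) (C n)"
  and big: "!!n. cmod (\<phi> (X n)) > real (Suc n) * C n" by metis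
 have C0: "C n \<ge> 0" for n using X(2)[of n] by (simp add: op_bound_def)
 have pos: "cmod (\<phi> (X n)) > 0" for n
  using big[of n] C0[of n] by (meson le_less_trans mult_nonneg_nonneg of_nat_0_le_iff)
 define Y where "Y n = (%x. (1 / \<phi> (X n)) *\<^sub>C X n x)" for n
 have YA: "Y n \<in> A" for n using X by (auto simp: Y_def)
 have phiY: "\<phi> (Y n) = 1" for n using pos[of n] X by (simp add: Y_def phi_scale)
 have Yb: "norm (Y n x) \<le> 1 / real (Suc n) * norm x" for n x
 proof -
  have "norm (Y n x) = norm (X n x) / cmod (\<phi> (X n))" by (simp add: Y_def norm_scaleC norm_divide)
  also have "\<dots> \<le> C n * norm x / cmod (\<phi> (X n))"
   using X(2)[of n] pos[of n] by (intro divide_right_mono) (auto simp: op_bound_def)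
  also have "\<dots> = C n / cmod (\<phi> (X n)) * norm x" by simp
  also have "\<dots> \<le> 1 / real (Suc n) * norm x"
   using big[of n] pos[of n] by (intro mult_right_mono) (auto simp: field_simps)
  finally show ?thesis .
 qed
 let ?F = "%X (\<xi>::nat => 'h, \<eta>::nat => 'h). if square_summable \<xi> \<and> square_summable \<eta>
        then (\<Sum>i::nat. cinner (X (\<xi> i)) (\<eta> i)) else (0::complex)"
 have coord: "(%n. ?F (Y n) p) \<longlonglongrightarrow> ?F (%_. 0) p" for p
 proof (cases p)
  case (Pair \<xi> \<eta>)
  show ?thesis
  proof (cases "square_summable \<xi> \<and> square_summable \<eta>")
   case True
   define s where "s i = (norm (\<xi> i))\<^sup>2 + (norm (\<eta> i))\<^sup>2" for i
   have s: "summable s" using True unfolding s_def square_summable_def by (intro summable_add) auto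
   have term_le: "cmod (cinner (Y n (\<xi> i)) (\<eta> i)) \<le> 1 / real (Suc n) * s i" for n i
   proof -
    have "cmod (cinner (Y n (\<xi> i)) (\<eta> i)) \<le> (1 / real (Suc n) * norm (\<xi> i)) * norm (\<eta> i)"
     using cinner_Cauchy_Schwarz[of "Y n (\<xi> i)" "\<eta> i"] mult_right_mono[OF Yb[of n "\<xi> i"], of "norm (\<eta> i)"]
     by simp
    also have "\<dots> = 1 / real (Suc n) * (norm (\<xi> i) * norm (\<eta> i))" by simp
    also have "\<dots> \<le> 1 / real (Suc n) * s i"
    proof (rule mult_left_mono)
     have "2 * norm (\<xi> i) * norm (\<eta> i) \<le> s i"
      using sum_squares_bound[of "norm (\<xi> i)" "norm (\<eta> i)"] by (simp add: s_def)
     moreover have "0 \<le> norm (\<xi> i) * norm (\<eta> i)" by simp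
     ultimately show "norm (\<xi> i) * norm (\<eta> i) \<le> s i" by linarith
    qed simp
    finally show ?thesis .
   qed
   have bnd: "cmod (\<Sum>i. cinner (Y n (\<xi> i)) (\<eta> i)) \<le> 1 / real (Suc n) * suminf s" for n
   proof -
    have "summable (%i. 1 / real (Suc n) * s i)" by (rule summable_mult[OF s])
    then have "cmod (\<Sum>i. cinner (Y n (\<xi> i)) (\<eta> i)) \<le> (\<Sum>i. 1 / real (Suc n) * s i)"
     by (rule norm_suminf_le[OF term_le])
    also have "\<dots> = 1 / real (Suc n) * suminf s" by (rule suminf_mult[OF s])
    finally show ?thesis .
   qed
   have "(%n. 1 / real (Suc n) * suminf s) \<longlonglongrightarrow> 0 * suminf s"
    by (intro tendsto_intros LIMSEQ_Suc[OF lim_const_over_n])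
   then have lim0: "(%n. 1 / real (Suc n) * suminf s) \<longlonglongrightarrow> 0" by simp
   have "(%n. \<Sum>i. cinner (Y n (\<xi> i)) (\<eta> i)) \<longlonglongrightarrow> 0"
    by (rule Lim_null_comparison[OF always_eventually[OF allI[OF bnd]] lim0])
   then show ?thesis using True Pair by simp
  next
   case False then show ?thesis by (auto simp: Pair)
  qed
 qed
 have limF: "limitin euclidean (%n. ?F (Y n)) (?F (%_. 0)) sequentially"
  unfolding euclidean_product_topology[symmetric] limitin_componentwise
  using coord by (auto simp: limitin_canonical_iff)
 have "limitin (ultraweak_topology A) Y (%_. 0) sequentially"
  unfolding limitin_def
 proof (intro conjI allI impI)
  show "(%_. 0) \<in> topspace (ultraweak_topology A)"
   by (simp add: ultraweak_topology_def topspace_pullback_topology A_zero)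
  fix U assume "openin (ultraweak_topology A) U \<and> (%_. 0) \<in> U"
  then obtain V where V: "openin euclidean V" "U = ?F -` V \<inter> A" "?F (%_. 0) \<in> V"
   unfolding ultraweak_topology_def openin_pullback_topology by blast
  then have "\<forall>\<^sub>F n in sequentially. ?F (Y n) \<in> V"
   using limF unfolding limitin_def by blast
  then show "\<forall>\<^sub>F n in sequentially. Y n \<in> U" using V(2) YA by (auto elim: eventually_mono)
 qed
 from continuous_map_limit[OF phi_weakly_continuous this]
 have "(%n. \<phi> (Y n)) \<longlonglongrightarrow> \<phi> (%_. 0)" by (simp add: o_def)
 moreover have "\<phi> (%_. 0) = 0" using phi_scale[OF A_id, of 0] by simp
 ultimately have "(%n. 1::complex) \<longlonglongrightarrow> 0" by (simp add: phiY)
 then show False using LIMSEQ_unique[OF tendsto_const] by fastforce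
qed

text \<open>With \<open>S = W W\<^sup>*\<close> the numbers \<open>u\<^sub>k = \<parallel>X S\<^sup>k\<parallel>\<^sub>2\<close> satisfy \<open>u\<^sub>k\<^sup>2 \<le> u\<^sub>2\<^sub>k u\<^sub>0\<close> by the Cauchy-Schwarz
 inequality, and they grow at most like \<open>\<parallel>S\<parallel>\<^sup>k\<close> as the trace is norm bounded; so \<open>u\<^sub>1 \<le> \<parallel>S\<parallel> u\<^sub>0\<close>.\<close>

lemma norm_iota_comp_right:
 assumes X: "X \<in> A" and W: "W \<in> A" "op_bound W C"
 shows "norm (\<iota> (X \<circ> W)) \<le> C * norm (\<iota> X)"
proof -
 define S where "S = W \<circ> adj W"
 have C0: "C \<ge> 0" using W by (simp add: op_bound_def)
 have SA: "S \<in> A" using W by (auto simp: S_def)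
 have Sb: "op_bound S (C\<^sup>2)"
  using op_bound_comp[OF W(2) op_bound_adj[OF A_bounded[OF W(1)] W(2)]] by (simp add: S_def power2_eq_square)
 have adjS: "adj S = S" using W by (simp add: S_def adj_comp A_bounded bounded_op_adj adj_adj)
 have adjSk: "adj (S ^^ k) = S ^^ k" for k
 proof (induction k)
  case (Suc k)
  have "adj (S ^^ Suc k) = adj (S ^^ k) \<circ> adj S"
   using adj_comp[OF A_bounded[OF SA] A_bounded[OF A_power[OF SA]]] by simp
  then have "adj (S ^^ Suc k) = S ^^ k \<circ> S" by (simp only: Suc adjS)
  then show ?case by (simp only: funpow_Suc_right)
 qed (use adj_id in \<open>simp add: id_def\<close>)
 define u where "u k = norm (\<iota> (X \<circ> S ^^ k))" for k
 have XS: "X \<circ> S ^^ k \<in> A" for k using X SA by auto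
 have adjXS: "adj (X \<circ> S ^^ k) = S ^^ k \<circ> adj X" for k
  using adj_comp[OF A_bounded[OF X] A_bounded[OF A_power[OF SA]]] by (simp add: adjSk)
 have eq: "complex_of_real ((u k)\<^sup>2) = \<phi> ((X \<circ> S ^^ (2 * k)) \<circ> adj X)" for k
 proof -
  have "(X \<circ> S ^^ k) \<circ> (S ^^ k \<circ> adj X) = (X \<circ> S ^^ (2 * k)) \<circ> adj X"
   by (simp add: comp_assoc mult_2 funpow_add)
  then show ?thesis using norm_iota_sq[OF XS[of k]] by (simp add: u_def adjXS)
 qed
 have step: "(u k)\<^sup>2 \<le> u (2 * k) * u 0" for k
 proof -
  have "complex_of_real ((u k)\<^sup>2) = cinner (\<iota> (X \<circ> S ^^ (2 * k))) (\<iota> X)"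
   using eq[of k] iota_cinner[OF XS X] by simp
  then have "cmod (complex_of_real ((u k)\<^sup>2)) \<le> norm (\<iota> (X \<circ> S ^^ (2 * k))) * norm (\<iota> X)"
   using cinner_Cauchy_Schwarz by metis
  then show ?thesis by (simp add: u_def norm_power)
 qed
 obtain K where K: "K \<ge> 0" "!!X C. X \<in> A ==> op_bound X C ==> cmod (\<phi> X) \<le> K * C"
  using phi_norm_bounded by blast
 obtain L where L: "op_bound X L" using A_op_bound[OF X] by blast
 have grow: "(u k)\<^sup>2 \<le> (K * L * L) * ((C\<^sup>2) ^ k)\<^sup>2" for k
 proof -
  have "op_bound ((X \<circ> S ^^ (2 * k)) \<circ> adj X) (L * (C\<^sup>2) ^ (2 * k) * L)"
   by (intro op_bound_comp L op_bound_power Sb op_bound_adj A_bounded X)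
  moreover have "(X \<circ> S ^^ (2 * k)) \<circ> adj X \<in> A" using X XS by blast
  ultimately have "cmod (complex_of_real ((u k)\<^sup>2)) \<le> K * (L * (C\<^sup>2) ^ (2 * k) * L)" using K(2) eq[of k] by simp
  then have "(u k)\<^sup>2 \<le> K * (L * (C\<^sup>2) ^ (2 * k) * L)" by (simp only: norm_of_real abs_power2)
  then show ?thesis by (simp add: power_mult mult_ac power2_eq_square power_add mult_2)
 qed
 have u1: "u 1 \<le> C\<^sup>2 * u 0"
 proof (cases "u 0 = 0")
  case True then show ?thesis using step[of 1] by simp
 next
  case False
  then have u0: "u 0 > 0" by (simp add: u_def)
  have unn: "u k \<ge> 0" for k by (simp add: u_def)
  have iter: "(u 1 / u 0) ^ (2 ^ n) \<le> u (2 ^ n) / u 0" for n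
  proof (induction n)
   case (Suc n)
   have "(u 1 / u 0) ^ (2 ^ Suc n) = ((u 1 / u 0) ^ (2 ^ n))\<^sup>2" by (simp add: power_mult[symmetric] mult.commute)
   also have "\<dots> \<le> (u (2 ^ n) / u 0)\<^sup>2" using Suc unn by (intro power_mono) auto
   also have "\<dots> \<le> u (2 * 2 ^ n) / u 0"
    using step[of "2 ^ n"] u0 by (simp add: power_divide power2_eq_square divide_le_eq)
   finally show ?case by simp
  qed simp
  have "u 1 / u 0 \<le> C\<^sup>2"
  proof (rule power_dominated_le)
   fix n :: nat
   have "u (2 ^ n) \<le> sqrt ((K * L * L) * ((C\<^sup>2) ^ (2 ^ n))\<^sup>2)" by (rule real_le_rsqrt[OF grow])
   also have "\<dots> = sqrt (K * L * L) * (C\<^sup>2) ^ (2 ^ n)" by (simp add: real_sqrt_mult del: power_mult_distrib)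
   finally have "u (2 ^ n) / u 0 \<le> sqrt (K * L * L) / u 0 * (C\<^sup>2) ^ (2 ^ n)"
    using u0 by (simp add: divide_right_mono)
   then show "(u 1 / u 0) ^ (2 ^ n) \<le> sqrt (K * L * L) / u 0 * (C\<^sup>2) ^ (2 ^ n)" using iter[of n] by linarith
  qed (use u0 unn in auto)
  then show ?thesis using u0 by (simp add: divide_le_eq)
 qed
 have XW: "X \<circ> W \<in> A" using X W by auto
 have "complex_of_real ((norm (\<iota> (X \<circ> W)))\<^sup>2) = \<phi> ((X \<circ> S) \<circ> adj X)"
  using norm_iota_sq[OF XW] by (simp add: adj_comp A_bounded X W S_def comp_assoc)
 also have "\<dots> = cinner (\<iota> (X \<circ> S)) (\<iota> X)"
  using iota_cinner[OF A_comp[OF X SA] X] by simp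
 finally have "cmod (complex_of_real ((norm (\<iota> (X \<circ> W)))\<^sup>2)) \<le> norm (\<iota> (X \<circ> S)) * norm (\<iota> X)"
  using cinner_Cauchy_Schwarz by metis
 then have "(norm (\<iota> (X \<circ> W)))\<^sup>2 \<le> u 1 * u 0" by (simp add: u_def norm_power)
 also have "\<dots> \<le> (C\<^sup>2 * u 0) * u 0" using u1 by (intro mult_right_mono) (auto simp: u_def)
 also have "\<dots> = (C * norm (\<iota> X))\<^sup>2" by (simp add: u_def power2_eq_square)
 finally show ?thesis by (rule power2_le_imp_le) (simp add: C0)
qed

lemma norm_iota_comp_left:
 assumes X: "X \<in> A" and W: "W \<in> A" "op_bound W C"
 shows "norm (\<iota> (W \<circ> X)) \<le> C * norm (\<iota> X)"
proof -
 have "norm (\<iota> (W \<circ> X)) = norm (\<iota> (adj X \<circ> adj W))"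
  using norm_iota_adj[OF A_comp[OF W(1) X]] by (simp add: adj_comp A_bounded X W)
 also have "\<dots> \<le> C * norm (\<iota> (adj X))"
  using X W by (intro norm_iota_comp_right op_bound_adj A_bounded) auto
 finally show ?thesis by (simp add: norm_iota_adj X)
qed

section \<open>Adjoint and left multiplication on the L2-completion\<close>

abbreviation approx :: "(nat => 'h op) => 'l => bool" where
 "approx X \<xi> \<equiv> (\<forall>j. X j \<in> A) \<and> (%j. \<iota> (X j)) \<longlonglongrightarrow> \<xi>"

lemma approx_ex: "\<exists>X. approx X \<xi>"
proof -
 have "\<xi> \<in> closure (\<iota> ` A)" using iota_dense by simp
 then have "\<exists>s. (\<forall>j. s j \<in> \<iota> ` A) \<and> s \<longlonglongrightarrow> \<xi>" by (simp only: closure_sequential)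
 then obtain s where s: "\<forall>j. s j \<in> \<iota> ` A" "s \<longlonglongrightarrow> \<xi>" by (elim exE conjE)
 define X where "X j = (SOME Y. Y \<in> A \<and> \<iota> Y = s j)" for j
 have X: "X j \<in> A \<and> \<iota> (X j) = s j" for j
 proof -
  have "s j \<in> \<iota> ` A" using s(1) by blast
  then have "\<exists>Y. Y \<in> A \<and> \<iota> Y = s j" by fastforce
  then show ?thesis unfolding X_def by (rule someI_ex)
 qed
 then have "(%j. \<iota> (X j)) = s" by (intro ext) simp
 then show ?thesis using X s(2) by (intro exI[of _ X]) simp
qed

lemma approx_const: "X \<in> A ==> approx (%_. X) (\<iota> X)"
 by simp

lemma L2_extension:
 fixes \<psi> :: "'h op => 'l"
 assumes diff: "!!X Y. X \<in> A ==> Y \<in> A ==> \<psi> (%x. X x - Y x) = \<psi> X - \<psi> Y"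
  and bdd: "!!X. X \<in> A ==> norm (\<psi> X) \<le> C * norm (\<iota> X)"
 shows "\<exists>\<Psi>. \<forall>X \<xi>. approx X \<xi> --> (%j. \<psi> (X j)) \<longlonglongrightarrow> \<Psi> \<xi>"
proof -
 define s where "s \<xi> = (SOME X. approx X \<xi>)" for \<xi>
 have s: "approx (s \<xi>) \<xi>" for \<xi>
  unfolding s_def by (rule someI_ex[OF approx_ex])
 have C': "norm (\<psi> X) \<le> (max C 1) * norm (\<iota> X)" if "X \<in> A" for X
  using bdd[OF that] by (meson max.cobounded1 mult_right_mono norm_ge_zero order_trans)
 have conv: "convergent (%j. \<psi> (s \<xi> j))" for \<xi>
 proof (rule Cauchy_convergent, rule metric_CauchyI)
  fix e :: real assume "e > 0"
  then have "e / max C 1 > 0" by (simp add: less_max_iff_disj)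
  moreover have "Cauchy (%j. \<iota> (s \<xi> j))" using s LIMSEQ_imp_Cauchy by blast
  ultimately obtain N where N: "!!i j. i \<ge> N ==> j \<ge> N ==> dist (\<iota> (s \<xi> i)) (\<iota> (s \<xi> j)) < e / max C 1"
   by (meson metric_CauchyD)
  have "dist (\<psi> (s \<xi> i)) (\<psi> (s \<xi> j)) < e" if "i \<ge> N" "j \<ge> N" for i j
  proof -
   have "norm (\<psi> (s \<xi> i) - \<psi> (s \<xi> j)) \<le> max C 1 * norm (\<iota> (s \<xi> i) - \<iota> (s \<xi> j))"
    using C'[OF A_diff, of "s \<xi> i" "s \<xi> j"] s[of \<xi>] by (simp add: diff iota_diff)
   also have "\<dots> < e" using N[OF that] by (simp add: dist_norm field_simps less_max_iff_disj)
   finally show ?thesis by (simp add: dist_norm)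
  qed
  then show "\<exists>M. \<forall>m\<ge>M. \<forall>n\<ge>M. dist (\<psi> (s \<xi> m)) (\<psi> (s \<xi> n)) < e" by blast
 qed
 define \<Psi> where "\<Psi> \<xi> = lim (%j. \<psi> (s \<xi> j))" for \<xi>
 have \<Psi>: "(%j. \<psi> (s \<xi> j)) \<longlonglongrightarrow> \<Psi> \<xi>" for \<xi>
  using conv[of \<xi>] unfolding \<Psi>_def by (simp add: convergent_LIMSEQ_iff)
 have "(%j. \<psi> (X j)) \<longlonglongrightarrow> \<Psi> \<xi>" if X: "approx X \<xi>" for X \<xi>
 proof -
  have z: "(%j. \<psi> (X j) - \<psi> (s \<xi> j)) \<longlonglongrightarrow> 0"
  proof (rule Lim_null_comparison)
   show "\<forall>\<^sub>F j in sequentially. norm (\<psi> (X j) - \<psi> (s \<xi> j)) \<le> C * norm (\<iota> (X j) - \<iota> (s \<xi> j))"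
    using bdd[OF A_diff, of "X _" "s \<xi> _"] s[of \<xi>] X by (auto simp: diff iota_diff)
   have "(%j. C * norm (\<iota> (X j) - \<iota> (s \<xi> j))) \<longlonglongrightarrow> C * norm (\<xi> - \<xi>)"
    using s[of \<xi>] X by (intro tendsto_intros) auto
   then show "(%j. C * norm (\<iota> (X j) - \<iota> (s \<xi> j))) \<longlonglongrightarrow> 0" by simp
  qed
  show ?thesis using tendsto_add[OF z \<Psi>[of \<xi>]] by simp
 qed
 then show ?thesis by blast
qed

definition J :: "'l => 'l" where
 "J = (SOME \<Psi>. \<forall>X \<xi>. approx X \<xi> --> (%j. \<iota> (adj (X j))) \<longlonglongrightarrow> \<Psi> \<xi>)"

definition lmul :: "'h op => 'l => 'l" where
 "lmul W = (SOME \<Psi>. \<forall>X \<xi>. approx X \<xi> --> (%j. \<iota> (W \<circ> X j)) \<longlonglongrightarrow> \<Psi> \<xi>)"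

lemma adj_diff: "X \<in> A ==> Y \<in> A ==> adj (%x. X x - Y x) = (%x. adj X x - adj Y x)"
 using adj_plus[OF A_bounded A_bounded[OF A_minus], of X Y] adj_scale[OF A_bounded, of Y "-1"]
 by (simp add: scaleC_minus1)

lemma J_approx: "approx X \<xi> ==> (%j. \<iota> (adj (X j))) \<longlonglongrightarrow> J \<xi>"
proof -
 have "\<exists>\<Psi>. \<forall>X \<xi>. approx X \<xi> --> (%j. \<iota> (adj (X j))) \<longlonglongrightarrow> \<Psi> \<xi>"
  by (rule L2_extension[where C = 1]) (auto simp: adj_diff iota_diff A_adj norm_iota_adj)
 from someI_ex[OF this] show "approx X \<xi> ==> (%j. \<iota> (adj (X j))) \<longlonglongrightarrow> J \<xi>" unfolding J_def by blast
qed

lemma lmul_approx: "W \<in> A ==> approx X \<xi> ==> (%j. \<iota> (W \<circ> X j)) \<longlonglongrightarrow> lmul W \<xi>"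
proof -
 assume W: "W \<in> A"
 obtain K where K: "op_bound W K" using A_op_bound[OF W] by blast
 have "\<exists>\<Psi>. \<forall>X \<xi>. approx X \<xi> --> (%j. \<iota> (W \<circ> X j)) \<longlonglongrightarrow> \<Psi> \<xi>"
 proof (rule L2_extension)
  fix X Y assume XY: "X \<in> A" "Y \<in> A"
  have "W \<circ> (%x. X x - Y x) = (%x. (W \<circ> X) x - (W \<circ> Y) x)"
   by (auto simp: bounded_op_diff[OF A_bounded[OF W]])
  then show "\<iota> (W \<circ> (%x. X x - Y x)) = \<iota> (W \<circ> X) - \<iota> (W \<circ> Y)"
   using iota_diff[OF A_comp[OF W XY(1)] A_comp[OF W XY(2)]] by simp
 qed (rule norm_iota_comp_left[OF _ W K])
 from someI_ex[OF this] show "approx X \<xi> ==> (%j. \<iota> (W \<circ> X j)) \<longlonglongrightarrow> lmul W \<xi>" unfolding lmul_def by blast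
qed

lemma J_iota:
 assumes "X \<in> A" shows "J (\<iota> X) = \<iota> (adj X)"
 using LIMSEQ_unique[OF J_approx[of "%_. X" "\<iota> X", OF approx_const[OF assms]] tendsto_const] .

lemma lmul_iota:
 assumes "W \<in> A" "X \<in> A" shows "lmul W (\<iota> X) = \<iota> (W \<circ> X)"
 using LIMSEQ_unique[OF lmul_approx[of W "%_. X" "\<iota> X", OF assms(1) approx_const[OF assms(2)]] tendsto_const] .

lemma approx_add:
 assumes "approx X \<xi>" "approx Y \<eta>" shows "approx (%j x. X j x + Y j x) (\<xi> + \<eta>)"
proof (intro conjI allI)
 have XY: "X j \<in> A" "Y j \<in> A" for j using assms by auto
 show "(%x. X j x + Y j x) \<in> A" for j by (rule A_plus[OF XY])
 have eq: "(%j. \<iota> (%x. X j x + Y j x)) = (%j. \<iota> (X j) + \<iota> (Y j))"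
  by (intro ext iota_add XY)
 show "(%j. \<iota> (%x. X j x + Y j x)) \<longlonglongrightarrow> \<xi> + \<eta>"
  unfolding eq by (intro tendsto_add conjunct2[OF assms(1)] conjunct2[OF assms(2)])
qed

lemma approx_scale:
 assumes "approx X \<xi>" shows "approx (%j x. c *\<^sub>C X j x) (c *\<^sub>C \<xi>)"
proof (intro conjI allI)
 have X: "X j \<in> A" for j using assms by auto
 show "(%x. c *\<^sub>C X j x) \<in> A" for j by (rule A_scale[OF X])
 have eq: "(%j. \<iota> (%x. c *\<^sub>C X j x)) = (%j. c *\<^sub>C \<iota> (X j))"
  by (intro ext iota_scale X)
 show "(%j. \<iota> (%x. c *\<^sub>C X j x)) \<longlonglongrightarrow> c *\<^sub>C \<xi>"
  unfolding eq by (rule tendsto_scaleC[OF tendsto_const conjunct2[OF assms]])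
qed

lemma approx_adj: assumes "approx X \<xi>" shows "approx (%j. adj (X j)) (J \<xi>)"
 using conjunct1[OF assms] by (intro conjI allI A_adj J_approx[OF assms]) blast

lemma approx_lmul: assumes "W \<in> A" "approx X \<xi>" shows "approx (%j. W \<circ> X j) (lmul W \<xi>)"
 using conjunct1[OF assms(2)] by (intro conjI allI A_comp lmul_approx[OF assms] assms(1)) blast

lemma approx_eqI:
 assumes "approx X \<xi>" "approx Y \<eta>" "!!j. X j = Y j"
 shows "\<xi> = \<eta>"
proof -
 have "X = Y" using assms(3) by blast
 then show ?thesis using assms(1,2) LIMSEQ_unique[of "%j. \<iota> (X j)" \<xi> \<eta>] by simp
qed

lemma J_add: "J (\<xi> + \<eta>) = J \<xi> + J \<eta>"
proof -
 obtain X Y where X: "approx X \<xi>" and Y: "approx Y \<eta>" using approx_ex[of \<xi>] approx_ex[of \<eta>] by blast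
 show ?thesis
  by (rule approx_eqI[OF approx_adj[OF approx_add[OF X Y]] approx_add[OF approx_adj[OF X] approx_adj[OF Y]]])
   (use X Y in \<open>simp add: adj_plus A_bounded\<close>)
qed

lemma J_scale: "J (c *\<^sub>C \<xi>) = cnj c *\<^sub>C J \<xi>"
proof -
 obtain X where X: "approx X \<xi>" using approx_ex by blast
 show ?thesis
  by (rule approx_eqI[OF approx_adj[OF approx_scale[OF X]] approx_scale[OF approx_adj[OF X]]])
   (use X in \<open>simp add: adj_scale A_bounded\<close>)
qed

lemma J_J [simp]: "J (J \<xi>) = \<xi>"
proof -
 obtain X where X: "approx X \<xi>" using approx_ex by blast
 show ?thesis
  by (rule approx_eqI[OF approx_adj[OF approx_adj[OF X]] X]) (use X in \<open>simp add: adj_adj A_bounded\<close>)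
qed

lemma cinner_J: "cinner (J \<xi>) (J \<eta>) = cinner \<eta> \<xi>"
proof -
 obtain X Y where X: "approx X \<xi>" and Y: "approx Y \<eta>" using approx_ex[of \<xi>] approx_ex[of \<eta>] by blast
 have "cinner (\<iota> (adj (X j))) (\<iota> (adj (Y j))) = cinner (\<iota> (Y j)) (\<iota> (X j))" for j
 proof -
  have XY: "X j \<in> A" "Y j \<in> A" using X Y by auto
  show ?thesis
   using phi_trace[OF A_adj[OF XY(1)] XY(2)] iota_cinner[OF A_adj[OF XY(1)] A_adj[OF XY(2)]]
    iota_cinner[OF XY(2) XY(1)] adj_adj[OF A_bounded[OF XY(2)]] by simp
 qed
 then have "(%j. cinner (\<iota> (Y j)) (\<iota> (X j))) \<longlonglongrightarrow> cinner (J \<xi>) (J \<eta>)"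
  using tendsto_cinner[OF J_approx[OF X] J_approx[OF Y]] by simp
 moreover have "(%j. cinner (\<iota> (Y j)) (\<iota> (X j))) \<longlonglongrightarrow> cinner \<eta> \<xi>"
  using X Y by (intro tendsto_cinner) auto
 ultimately show ?thesis using LIMSEQ_unique by blast
qed

lemma cinner_J_swap: "cinner \<xi> (J \<eta>) = cinner \<eta> (J \<xi>)"
 using cinner_J[of "J \<xi>" \<eta>] by simp

lemma J_id [simp]: "J (\<iota> id) = \<iota> id"
 by (simp add: J_iota A_id adj_id)

lemma lmul_add: "W \<in> A ==> lmul W (\<xi> + \<eta>) = lmul W \<xi> + lmul W \<eta>"
proof -
 assume W: "W \<in> A"
 obtain X Y where X: "approx X \<xi>" and Y: "approx Y \<eta>" using approx_ex[of \<xi>] approx_ex[of \<eta>] by blast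
 have "W \<circ> (%x. X j x + Y j x) = (%x. (W \<circ> X j) x + (W \<circ> Y j) x)" for j
  by (auto simp: bounded_op_add[OF A_bounded[OF W]])
 then show ?thesis
  by (rule approx_eqI[OF approx_lmul[OF W approx_add[OF X Y]] approx_add[OF approx_lmul[OF W X] approx_lmul[OF W Y]]])
qed

lemma lmul_scale: "W \<in> A ==> lmul W (c *\<^sub>C \<xi>) = c *\<^sub>C lmul W \<xi>"
proof -
 assume W: "W \<in> A"
 obtain X where X: "approx X \<xi>" using approx_ex by blast
 have "W \<circ> (%x. c *\<^sub>C X j x) = (%x. c *\<^sub>C (W \<circ> X j) x)" for j
  by (auto simp: bounded_op_scaleC[OF A_bounded[OF W]])
 then show ?thesis
  by (rule approx_eqI[OF approx_lmul[OF W approx_scale[OF X]] approx_scale[OF approx_lmul[OF W X]]])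
qed

lemma lmul_diff: "W \<in> A ==> lmul W (\<xi> - \<eta>) = lmul W \<xi> - lmul W \<eta>"
 using lmul_add[of W "\<xi> - \<eta>" \<eta>] by simp

lemma lmul_comp: "W \<in> A ==> V \<in> A ==> lmul (W \<circ> V) \<xi> = lmul W (lmul V \<xi>)"
proof -
 assume W: "W \<in> A" and V: "V \<in> A"
 obtain X where X: "approx X \<xi>" using approx_ex by blast
 show ?thesis
  by (rule approx_eqI[OF approx_lmul[OF A_comp[OF W V] X] approx_lmul[OF W approx_lmul[OF V X]]])
   (simp add: comp_assoc)
qed

lemma lmul_minus_op: "W \<in> A ==> V \<in> A ==> lmul (%x. W x - V x) \<xi> = lmul W \<xi> - lmul V \<xi>"
proof -
 assume W: "W \<in> A" and V: "V \<in> A"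
 obtain X where X: "approx X \<xi>" using approx_ex by blast
 have "(%x. W x - V x) \<circ> X j = (%x. (W \<circ> X j) x - (V \<circ> X j) x)" for j by auto
 then have "\<iota> ((%x. W x - V x) \<circ> X j) = \<iota> (W \<circ> X j) - \<iota> (V \<circ> X j)" for j
  using iota_diff[OF A_comp[OF W] A_comp[OF V]] X by simp
 then have "(%j. \<iota> (W \<circ> X j) - \<iota> (V \<circ> X j)) \<longlonglongrightarrow> lmul (%x. W x - V x) \<xi>"
  using lmul_approx[OF A_diff[OF W V] X] by simp
 from LIMSEQ_unique[OF this tendsto_diff[OF lmul_approx[OF W X] lmul_approx[OF V X]]]
 show ?thesis .
qed

lemma lmul_id [simp]: "lmul id \<xi> = \<xi>"
proof -
 obtain X where X: "approx X \<xi>" using approx_ex by blast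
 show ?thesis by (rule approx_eqI[OF approx_lmul[OF A_id X] X]) simp
qed

lemma norm_lmul: "W \<in> A ==> op_bound W C ==> norm (lmul W \<xi>) \<le> C * norm \<xi>"
proof -
 assume W: "W \<in> A" "op_bound W C"
 obtain X where X: "approx X \<xi>" using approx_ex by blast
 have "(%j. norm (\<iota> (W \<circ> X j))) \<longlonglongrightarrow> norm (lmul W \<xi>)"
  by (rule tendsto_norm[OF lmul_approx[OF W(1) X]])
 moreover have "(%j. C * norm (\<iota> (X j))) \<longlonglongrightarrow> C * norm \<xi>"
  using X by (intro tendsto_intros) auto
 ultimately show ?thesis
 proof (rule LIMSEQ_le)
  show "\<exists>N. \<forall>j\<ge>N. norm (\<iota> (W \<circ> X j)) \<le> C * norm (\<iota> (X j))"
   using norm_iota_comp_left[OF _ W] X by blast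
 qed
qed

lemma cinner_lmul: "W \<in> A ==> cinner (lmul W \<xi>) \<eta> = cinner \<xi> (lmul (adj W) \<eta>)"
proof -
 assume W: "W \<in> A"
 obtain X Y where X: "approx X \<xi>" and Y: "approx Y \<eta>" using approx_ex[of \<xi>] approx_ex[of \<eta>] by blast
 have "cinner (\<iota> (W \<circ> X j)) (\<iota> (Y j)) = cinner (\<iota> (X j)) (\<iota> (adj W \<circ> Y j))" for j
 proof -
  have XY: "X j \<in> A" "Y j \<in> A" using X Y by auto
  have "\<phi> (W \<circ> (X j \<circ> adj (Y j))) = \<phi> ((X j \<circ> adj (Y j)) \<circ> W)"
   using W XY by (intro phi_trace A_comp A_adj)
  moreover have "adj (adj W \<circ> Y j) = adj (Y j) \<circ> W"
   using adj_comp[OF A_bounded[OF A_adj[OF W]] A_bounded[OF XY(2)]] adj_adj[OF A_bounded[OF W]] by simp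
  ultimately show ?thesis
   using iota_cinner[OF A_comp[OF W XY(1)] XY(2)] iota_cinner[OF XY(1) A_comp[OF A_adj[OF W] XY(2)]]
   by (simp only: comp_assoc)
 qed
 then have "(%j. cinner (\<iota> (W \<circ> X j)) (\<iota> (Y j))) \<longlonglongrightarrow> cinner \<xi> (lmul (adj W) \<eta>)"
  using tendsto_cinner[of "%j. \<iota> (X j)" \<xi>, OF _ lmul_approx[OF A_adj[OF W] Y]] X by simp
 moreover have "(%j. cinner (\<iota> (W \<circ> X j)) (\<iota> (Y j))) \<longlonglongrightarrow> cinner (lmul W \<xi>) \<eta>"
  using tendsto_cinner[OF lmul_approx[OF W X], of "%j. \<iota> (Y j)" \<eta>] Y by simp
 ultimately show ?thesis using LIMSEQ_unique by blast
qed

lemma cinner_iota_ext: assumes "!!W. W \<in> A ==> cinner \<xi> (\<iota> W) = cinner \<eta> (\<iota> W)" shows "\<xi> = \<eta>"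
proof -
 have "cinner (\<xi> - \<eta>) \<zeta> = 0" for \<zeta>
 proof -
  obtain X where X: "approx X \<zeta>" using approx_ex by blast
  then have "(%j. cinner (\<xi> - \<eta>) (\<iota> (X j))) \<longlonglongrightarrow> cinner (\<xi> - \<eta>) \<zeta>" by (intro tendsto_cinner) auto
  moreover have "cinner (\<xi> - \<eta>) (\<iota> (X j)) = 0" for j using X assms by (simp add: cinner_diff_left)
  ultimately show ?thesis by (simp add: LIMSEQ_const_iff)
 qed
 from this[of "\<xi> - \<eta>"] show ?thesis by (simp add: cinner_self)
qed

lemma nc_adjoint_iff: "nc_adjoint A \<iota> \<xi> \<eta> \<longleftrightarrow> \<eta> = J \<xi>"
proof
 assume "nc_adjoint A \<iota> \<xi> \<eta>"
 then show "\<eta> = J \<xi>" unfolding nc_adjoint_def using J_approx LIMSEQ_unique by blast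
next
 assume "\<eta> = J \<xi>"
 moreover obtain X where "approx X \<xi>" using approx_ex by blast
 ultimately show "nc_adjoint A \<iota> \<xi> \<eta>" unfolding nc_adjoint_def using J_approx by blast
qed

lemma product_functional:
 assumes X: "approx X \<xi>" and Y: "approx Y \<eta>" and W: "W \<in> A"
 shows "(%j. \<phi> (X j \<circ> Y j \<circ> adj W)) \<longlonglongrightarrow> cinner \<xi> (lmul W (J \<eta>))"
proof -
 have "\<phi> (X j \<circ> Y j \<circ> adj W) = cinner (\<iota> (X j)) (\<iota> (W \<circ> adj (Y j)))" for j
 proof -
  have XY: "X j \<in> A" "Y j \<in> A" using X Y by auto
  have "adj (W \<circ> adj (Y j)) = Y j \<circ> adj W"
   using adj_comp[OF A_bounded[OF W] A_bounded[OF A_adj[OF XY(2)]]] adj_adj[OF A_bounded[OF XY(2)]] by simp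
  then show ?thesis
   using iota_cinner[OF XY(1) A_comp[OF W A_adj[OF XY(2)]]] by (simp only: comp_assoc)
 qed
 then show ?thesis
  using X tendsto_cinner[of "%j. \<iota> (X j)" \<xi>, OF _ lmul_approx[OF W approx_adj[OF Y]]] by simp
qed

text \<open>The relation \<open>\<xi> \<eta> = \<zeta>\<close> as a weak identity between vectors, free of approximating sequences.\<close>

lemma nc_times_iff:
 "nc_times A \<phi> \<iota> \<xi> \<eta> \<zeta> \<longleftrightarrow> (\<forall>W\<in>A. cinner \<zeta> (\<iota> W) = cinner \<xi> (lmul W (J \<eta>)))"
proof
 assume "nc_times A \<phi> \<iota> \<xi> \<eta> \<zeta>"
 then obtain X Y where XY: "\<forall>j. X j \<in> A \<and> Y j \<in> A" "(%j. \<iota> (X j)) \<longlonglongrightarrow> \<xi>" "(%j. \<iota> (Y j)) \<longlonglongrightarrow> \<eta>"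
  and lim: "\<forall>W\<in>A. (%j. \<phi> (X j \<circ> Y j \<circ> adj W)) \<longlonglongrightarrow> cinner \<zeta> (\<iota> W)"
  unfolding nc_times_def by (elim exE conjE)
 have "approx X \<xi>" "approx Y \<eta>" using XY by simp_all
 then show "\<forall>W\<in>A. cinner \<zeta> (\<iota> W) = cinner \<xi> (lmul W (J \<eta>))"
  by (intro ballI) (rule LIMSEQ_unique[OF lim[rule_format] product_functional])
next
 assume *: "\<forall>W\<in>A. cinner \<zeta> (\<iota> W) = cinner \<xi> (lmul W (J \<eta>))"
 obtain X where X: "approx X \<xi>" using approx_ex by blast
 obtain Y where Y: "approx Y \<eta>" using approx_ex by blast
 have "\<forall>W\<in>A. (%j. \<phi> (X j \<circ> Y j \<circ> adj W)) \<longlonglongrightarrow> cinner \<zeta> (\<iota> W)"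
  using * product_functional[OF X Y] by simp
 then show "nc_times A \<phi> \<iota> \<xi> \<eta> \<zeta>"
  unfolding nc_times_def using X Y by (intro exI[of _ X] exI[of _ Y]) simp
qed

end

section \<open>Resolvents\<close>

text \<open>The map \<open>x \<mapsto> x - \<tau> (B x - y)\<close> is a contraction for small \<open>\<tau> > 0\<close>.\<close>

lemma coercive_solvable:
 fixes B :: "'h::complex_hilbert_space op"
 assumes B: "bounded_op B" and coercive: "!!x. (norm x)\<^sup>2 \<le> Re (cinner (B x) x)"
 shows "\<exists>x. B x = y"
proof -
 obtain K0 where K0: "K0 \<ge> 0" "!!x. norm (B x) \<le> K0 * norm x" using bounded_op_bound[OF B] by blast
 define K where "K = K0 + 1"
 have K: "K \<ge> 1" using K0 by (simp add: K_def)
 have KB: "norm (B x) \<le> K * norm x" for x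
  using K0(2)[of x] by (simp add: K_def algebra_simps) (smt (verit) norm_ge_zero)
 define \<tau> where "\<tau> = 1 / K\<^sup>2"
 have \<tau>: "\<tau> > 0" "\<tau> * K\<^sup>2 = 1" using K by (auto simp: \<tau>_def)
 have \<tau>1: "\<tau> \<le> 1" using K by (simp add: \<tau>_def one_le_power)
 define c where "c = sqrt (1 - \<tau>)"
 have c: "0 \<le> c" "c < 1" using \<tau> \<tau>1 by (auto simp: c_def)
 define \<Phi> where "\<Phi> x = x - \<tau> *\<^sub>R (B x - y)" for x
 have contr: "norm (z - \<tau> *\<^sub>R B z) \<le> c * norm z" for z
 proof -
  have sym: "Re (cinner z (B z)) = Re (cinner (B z) z)" by (subst cinner_commute) simp
  have "(norm (z + (- \<tau>) *\<^sub>R B z))\<^sup>2 = (norm z)\<^sup>2 - 2 * \<tau> * Re (cinner (B z) z) + \<tau>\<^sup>2 * (norm (B z))\<^sup>2"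
   using \<tau> by (subst norm_add_sq) (simp add: cinner_minus_right cinner_scaleR_right sym power_mult_distrib)
  also have "\<dots> \<le> (norm z)\<^sup>2 - 2 * \<tau> * (norm z)\<^sup>2 + \<tau>\<^sup>2 * (K * norm z)\<^sup>2"
  proof -
   have "\<tau> * (norm z)\<^sup>2 \<le> \<tau> * Re (cinner (B z) z)" using \<tau> coercive[of z] by (intro mult_left_mono) auto
   moreover have "\<tau>\<^sup>2 * (norm (B z))\<^sup>2 \<le> \<tau>\<^sup>2 * (K * norm z)\<^sup>2" using KB[of z] by (intro mult_left_mono power_mono) auto
   ultimately show ?thesis by linarith
  qed
  also have "\<tau>\<^sup>2 * (K * norm z)\<^sup>2 = \<tau> * (norm z)\<^sup>2"
  proof -
   have "\<tau>\<^sup>2 * (K * norm z)\<^sup>2 = (\<tau> * K\<^sup>2) * (\<tau> * (norm z)\<^sup>2)" by (simp add: power2_eq_square)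
   then show ?thesis by (simp add: \<tau>)
  qed
  also have "(norm z)\<^sup>2 - 2 * \<tau> * (norm z)\<^sup>2 + \<tau> * (norm z)\<^sup>2 = (1 - \<tau>) * (norm z)\<^sup>2" by (simp add: algebra_simps)
  also have "\<dots> = (c * norm z)\<^sup>2" using \<tau>1 by (simp add: c_def power_mult_distrib)
  finally have "norm (z + (- \<tau>) *\<^sub>R B z) \<le> c * norm z" by (rule power2_le_imp_le) (simp add: c)
  then show ?thesis by simp
 qed
 have "dist (\<Phi> u) (\<Phi> v) \<le> c * dist u v" for u v
 proof -
  have "\<Phi> u - \<Phi> v = (u - v) - \<tau> *\<^sub>R B (u - v)"
   by (simp add: \<Phi>_def bounded_op_diff[OF B] algebra_simps)
  then show ?thesis using contr[of "u - v"] by (simp add: dist_norm)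
 qed
 then have "\<exists>!x. \<Phi> x = x" by (intro banach_fix_type[OF c]) auto
 then obtain x where "\<Phi> x = x" by blast
 then have "B x = y" using \<tau> by (simp add: \<Phi>_def)
 then show ?thesis by blast
qed

context nc_L2_completion
begin

lemma resolvent_ex:
 assumes a: "a \<in> A" and \<epsilon>: "\<epsilon> > 0"
 shows "\<exists>e\<in>A. adj e = e \<and> op_bound e 1 \<and> op_bound (adj a \<circ> e) (1 / sqrt \<epsilon>) \<and>
  (\<forall>x. e x + complex_of_real \<epsilon> *\<^sub>C a (adj a (e x)) = x) \<and>
  (\<forall>x. e (x + complex_of_real \<epsilon> *\<^sub>C a (adj a x)) = x)"
proof -
 define B where "B x = x + complex_of_real \<epsilon> *\<^sub>C a (adj a x)" for x
 note ba = A_bounded[OF a] and bad = bounded_op_adj[OF A_bounded[OF a]]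
 have B_eq: "B = (%x. id x + complex_of_real \<epsilon> *\<^sub>C (a \<circ> adj a) x)" by (auto simp: B_def)
 have BA: "B \<in> A" unfolding B_eq by (intro A_plus A_id A_scale A_comp A_adj a)
 note bB = A_bounded[OF BA]
 have re: "Re (cinner (B x) x) = (norm x)\<^sup>2 + \<epsilon> * (norm (adj a x))\<^sup>2" for x
 proof -
  have "cinner (a (adj a x)) x = cinner (adj a x) (adj a x)" by (rule cinner_adj[OF ba])
  then show ?thesis by (simp add: B_def cinner_add_left cinner_scaleC_left norm_sq_eq_cinner)
 qed
 have sa: "cinner (B x) y = cinner x (B y)" for x y
  by (simp add: B_def cinner_add_left cinner_add_right cinner_scaleC_left cinner_scaleC_right
    cinner_adj[OF ba] cinner_adj'[OF ba, symmetric])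
 have "\<exists>x. B x = y" for y
  by (rule coercive_solvable[OF bB]) (use \<epsilon> in \<open>simp add: re\<close>)
 then have "\<forall>y. \<exists>x. B x = y" by blast
 from choice[OF this] obtain e where e: "\<forall>y. B (e y) = y" by blast
 have inj: "x = y" if "B x = B y" for x y
 proof -
  have "B (x - y) = 0" using that by (simp add: bounded_op_diff[OF bB])
  moreover have "0 \<le> \<epsilon> * (norm (adj a (x - y)))\<^sup>2" using \<epsilon> by simp
  moreover from calculation(1) have "(norm (x - y))\<^sup>2 + \<epsilon> * (norm (adj a (x - y)))\<^sup>2 = 0"
   using re[of "x - y"] by simp
  ultimately have "(norm (x - y))\<^sup>2 \<le> 0" by linarith
  then show ?thesis by simp
 qed
 have eB: "e (B x) = x" for x by (rule inj) (use e in blast)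
 have key: "(norm (e y))\<^sup>2 + \<epsilon> * (norm (adj a (e y)))\<^sup>2 \<le> norm y * norm (e y)" for y
 proof -
  have "Re (cinner y (e y)) = (norm (e y))\<^sup>2 + \<epsilon> * (norm (adj a (e y)))\<^sup>2" using re[of "e y"] e by simp
  moreover have "Re (cinner y (e y)) \<le> norm y * norm (e y)"
   using cinner_Cauchy_Schwarz[of y "e y"] complex_Re_le_cmod[of "cinner y (e y)"] by linarith
  ultimately show ?thesis by linarith
 qed
 have e1: "norm (e y) \<le> norm y" for y
 proof (cases "e y = 0")
  case False
  have "0 \<le> \<epsilon> * (norm (adj a (e y)))\<^sup>2" using \<epsilon> by simp
  then have "norm (e y) * norm (e y) \<le> norm y * norm (e y)" using key[of y] by (simp add: power2_eq_square)
  then show ?thesis using False by simp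
 qed simp
 have "bounded_op e"
 proof (rule bounded_opI[of _ 1])
  show "e (x + y) = e x + e y" for x y
   by (rule inj) (simp add: e[rule_format] bounded_op_add[OF bB])
  show "e (c *\<^sub>C x) = c *\<^sub>C e x" for c x
   by (rule inj) (simp add: e[rule_format] bounded_op_scaleC[OF bB])
 qed (use e1 in simp)
 moreover from this have "e \<in> A"
  by (intro A_inverse[OF BA]) (use e eB in \<open>auto simp: fun_eq_iff\<close>)
 moreover have "adj e = e"
 proof (rule adj_unique)
  show "cinner (e x) y = cinner x (e y)" for x y
   using sa[of "e x" "e y"] by (simp add: e[rule_format])
 qed fact+
 moreover have "norm (adj a (e y)) \<le> 1 / sqrt \<epsilon> * norm y" for y
 proof -
  have "norm y * norm (e y) \<le> norm y * norm y" using e1[of y] by (intro mult_left_mono) auto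
  moreover have "0 \<le> (norm (e y))\<^sup>2" by simp
  ultimately have "\<epsilon> * (norm (adj a (e y)))\<^sup>2 \<le> (norm y)\<^sup>2" using key[of y] unfolding power2_eq_square by linarith
  then have "(norm (adj a (e y)))\<^sup>2 \<le> (norm y)\<^sup>2 / \<epsilon>" using \<epsilon> by (simp add: field_simps)
  also have "\<dots> = (1 / sqrt \<epsilon> * norm y)\<^sup>2" using \<epsilon> by (simp add: power_mult_distrib power_divide)
  finally show ?thesis by (rule power2_le_imp_le) (use \<epsilon> in simp)
 qed
 moreover have "e x + complex_of_real \<epsilon> *\<^sub>C a (adj a (e x)) = x" for x using e[rule_format, of x] by (simp only: B_def)
 moreover have "e (x + complex_of_real \<epsilon> *\<^sub>C a (adj a x)) = x" for x using eB[of x] by (simp only: B_def)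
 ultimately show ?thesis using e1 \<epsilon> by (intro bexI[of _ e]) (auto simp: op_bound_def)
qed

lemma bounded_linear_lmul: "W \<in> A ==> bounded_linear (lmul W)"
proof -
 assume W: "W \<in> A"
 obtain K where K: "op_bound W K" using A_op_bound[OF W] by blast
 show ?thesis
 proof (rule bounded_linear_intro)
  show "lmul W (r *\<^sub>R x) = r *\<^sub>R lmul W x" for r x
   using lmul_scale[OF W, of "complex_of_real r" x] by (simp add: scaleC_of_real)
  show "norm (lmul W x) \<le> norm x * K" for x using norm_lmul[OF W K, of x] by (simp add: mult.commute)
 qed (rule lmul_add[OF W])
qed

lemmas tendsto_lmul = bounded_linear.tendsto[OF bounded_linear_lmul]

lemma lmul_strong_convergent:
 assumes w: "!!j. w j \<in> A" "!!j. op_bound (w j) C" and conv: "convergent (%j. \<iota> (w j))"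
 shows "convergent (%j. lmul (w j) \<xi>)"
proof (rule Cauchy_convergent, rule metric_CauchyI)
 fix r :: real assume r: "r > 0"
 have C0: "C \<ge> 0" using w(2)[of 0] by (simp add: op_bound_def)
 obtain X where X: "approx X \<xi>" using approx_ex by blast
 then have lim: "(%i. \<iota> (X i)) \<longlonglongrightarrow> \<xi>" and XA: "X i \<in> A" for i by auto
 have "r / (4 * (C + 1)) > 0" using r C0 by simp
 from metric_LIMSEQ_D[OF lim this] obtain i where i: "dist (\<iota> (X i)) \<xi> < r / (4 * (C + 1))" by blast
 obtain K where K: "op_bound (X i) K" using A_op_bound[OF XA] by blast
 have K0: "K \<ge> 0" using K by (simp add: op_bound_def)
 have "Cauchy (%j. \<iota> (w j))" using conv by (rule convergent_Cauchy)
 moreover have "r / (2 * (K + 1)) > 0" using r K0 by simp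
 ultimately obtain N where N: "!!j k. j \<ge> N ==> k \<ge> N ==> dist (\<iota> (w j)) (\<iota> (w k)) < r / (2 * (K + 1))"
  using metric_CauchyD by blast
 have "dist (lmul (w j) \<xi>) (lmul (w k) \<xi>) < r" if jk: "j \<ge> N" "k \<ge> N" for j k
 proof -
  have eq: "lmul (w j) \<xi> - lmul (w k) \<xi> = lmul (w j) (\<xi> - \<iota> (X i)) - lmul (w k) (\<xi> - \<iota> (X i))
    + \<iota> ((%x. w j x - w k x) \<circ> X i)"
  proof -
   have "\<iota> ((%x. w j x - w k x) \<circ> X i) = lmul (w j) (\<iota> (X i)) - lmul (w k) (\<iota> (X i))"
    using lmul_iota[OF A_diff[OF w(1) w(1)] XA, of j k i] lmul_minus_op[OF w(1) w(1)] by simp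
   then show ?thesis by (simp add: lmul_diff w)
  qed
  have small: "C * norm (\<xi> - \<iota> (X i)) \<le> r / 4"
  proof -
   have "C * norm (\<xi> - \<iota> (X i)) \<le> (C + 1) * (r / (4 * (C + 1)))"
    using i C0 by (intro mult_mono) (auto simp: dist_norm norm_minus_commute)
   also have "\<dots> = r / 4" using C0 by (simp add: field_simps)
   finally show ?thesis .
  qed
  have "norm (lmul (w j) (\<xi> - \<iota> (X i))) \<le> r / 4" for j
   using norm_lmul[OF w(1)[of j] w(2)[of j], of "\<xi> - \<iota> (X i)"] small by linarith
  moreover have "norm (\<iota> ((%x. w j x - w k x) \<circ> X i)) < r / 2"
  proof -
   have "norm (\<iota> ((%x. w j x - w k x) \<circ> X i)) \<le> K * norm (\<iota> (%x. w j x - w k x))"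
    by (rule norm_iota_comp_right[OF A_diff[OF w(1) w(1)] XA K])
   also have "\<dots> \<le> (K + 1) * norm (\<iota> (w j) - \<iota> (w k))"
    by (simp add: iota_diff w mult_right_mono)
   also have "\<dots> < (K + 1) * (r / (2 * (K + 1)))"
    using N[OF jk] K0 by (intro mult_strict_left_mono) (auto simp: dist_norm)
   also have "\<dots> = r / 2" using K0 by (simp add: field_simps)
   finally show ?thesis .
  qed
  moreover have "norm (a - b + c) \<le> norm a + norm b + norm c" for a b c :: 'l
   using norm_triangle_ineq[of "a - b" c] norm_triangle_ineq4[of a b] by linarith
  ultimately have "norm (lmul (w j) (\<xi> - \<iota> (X i)) - lmul (w k) (\<xi> - \<iota> (X i))
    + \<iota> ((%x. w j x - w k x) \<circ> X i)) < r / 4 + r / 4 + r / 2" by (meson add_mono add_le_less_mono le_less_trans)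
  then show ?thesis by (simp add: dist_norm eq)
 qed
 then show "\<exists>M. \<forall>j\<ge>M. \<forall>k\<ge>M. dist (lmul (w j) \<xi>) (lmul (w k) \<xi>) < r" by blast
qed

text \<open>\<open>E\<close> is the limit of the resolvents \<open>e\<^sub>j = (1 + \<epsilon> a\<^sub>j a\<^sub>j\<^sup>*)\<^sup>-\<^sup>1\<close> for bounded \<open>a\<^sub>j \<rightarrow> a\<close>, and \<open>T\<close> that of the
 left multiplications by the uniformly bounded \<open>x\<^sub>j = e\<^sub>j a\<^sub>j\<close>: morally, \<open>E\<close> is a bounded
 operator that makes \<open>T = E a\<close> bounded.\<close>

definition truncation ::
 "'l => (nat => 'h op) => (nat => 'h op) => ('l => 'l) => ('l => 'l) => bool" where
 "truncation a e x E T \<longleftrightarrow> (\<forall>j. e j \<in> A \<and> x j \<in> A \<and> adj (e j) = e j) \<and>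
  (\<forall>\<xi>. (%j. lmul (e j) \<xi>) \<longlonglongrightarrow> E \<xi>) \<and> (\<forall>\<xi>. (%j. lmul (x j) \<xi>) \<longlonglongrightarrow> T \<xi>) \<and>
  (%j. \<iota> (x j)) \<longlonglongrightarrow> E a"

lemma truncation_ex:
 assumes \<epsilon>: "\<epsilon> > 0"
 shows "\<exists>e x E T. truncation a e x E T \<and> (\<forall>\<xi>. norm (E \<xi>) \<le> norm \<xi>) \<and> (\<forall>\<xi> \<eta>. E (\<xi> - \<eta>) = E \<xi> - E \<eta>) \<and>
  (\<forall>V\<in>A. \<forall>K. op_bound V K --> norm (E (\<iota> V) - \<iota> V) \<le> K * (sqrt \<epsilon> * norm a))"
proof -
 obtain p where p: "approx p a" using approx_ex by blast
 then have pA: "p j \<in> A" and plim: "(%j. \<iota> (p j)) \<longlonglongrightarrow> a" for j by auto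
 define P where "P j e \<longleftrightarrow> e \<in> A \<and> adj e = e \<and> op_bound e 1 \<and> op_bound (adj (p j) \<circ> e) (1 / sqrt \<epsilon>) \<and>
  (\<forall>x. e x + complex_of_real \<epsilon> *\<^sub>C p j (adj (p j) (e x)) = x) \<and>
  (\<forall>x. e (x + complex_of_real \<epsilon> *\<^sub>C p j (adj (p j) x)) = x)" for j e
 have "\<exists>e. P j e" for j using resolvent_ex[OF pA \<epsilon>, of j] unfolding P_def by blast
 then have "\<forall>j. \<exists>e. P j e" by blast
 from choice[OF this] obtain e where e: "\<forall>j. P j (e j)" by blast
 have eA: "e j \<in> A" and eadj: "adj (e j) = e j" and e1: "op_bound (e j) 1"
  and ae: "op_bound (adj (p j) \<circ> e j) (1 / sqrt \<epsilon>)"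
  and Be: "e j x + complex_of_real \<epsilon> *\<^sub>C p j (adj (p j) (e j x)) = x"
  and eB: "e j (x + complex_of_real \<epsilon> *\<^sub>C p j (adj (p j) x)) = x" for j x
  using e unfolding P_def by blast+
 define x where "x j = e j \<circ> p j" for j
 have xA: "x j \<in> A" for j by (simp add: x_def A_comp eA pA)
 have adjae: "adj (adj (p j) \<circ> e j) = x j" for j
  using adj_comp[OF A_bounded[OF A_adj[OF pA]] A_bounded[OF eA], of j j] adj_adj[OF A_bounded[OF pA], of j]
  by (simp add: x_def eadj)
 have xb: "op_bound (x j) (1 / sqrt \<epsilon>)" for j
  using op_bound_adj[OF A_bounded[OF A_comp[OF A_adj[OF pA] eA]] ae] by (simp only: adjae)
 have diff: "norm (\<iota> (e j) - \<iota> (e k)) \<le> 2 * sqrt \<epsilon> * norm (\<iota> (p k) - \<iota> (p j))" for j k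
 proof -
  define d where "d = (%y. p k y - p j y)"
  define u where "u = e j \<circ> (d \<circ> (adj (p k) \<circ> e k))"
  define v where "v = (x j \<circ> adj d) \<circ> e k"
  have dA: "d \<in> A" unfolding d_def by (intro A_diff pA)
  have uA: "u \<in> A" and vA: "v \<in> A" unfolding u_def v_def by (intro A_comp eA dA A_adj pA xA)+
  have pointwise: "e j y - e k y = complex_of_real \<epsilon> *\<^sub>C u y + complex_of_real \<epsilon> *\<^sub>C v y" for y
  proof -
   define z where "z = e k y"
   have y: "y = z + complex_of_real \<epsilon> *\<^sub>C p k (adj (p k) z)" using Be[of k y] by (simp add: z_def)
   have "e j y = e j (z + complex_of_real \<epsilon> *\<^sub>C p j (adj (p j) z)) +
     complex_of_real \<epsilon> *\<^sub>C e j (p k (adj (p k) z) - p j (adj (p j) z))"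
    unfolding y by (simp add: bounded_op_add[OF A_bounded[OF eA]] bounded_op_diff[OF A_bounded[OF eA]]
      bounded_op_scaleC[OF A_bounded[OF eA]] scaleC_diff_right)
   also have "e j (z + complex_of_real \<epsilon> *\<^sub>C p j (adj (p j) z)) = z" by (rule eB)
   also have "p k (adj (p k) z) - p j (adj (p j) z) = d (adj (p k) z) + p j (adj d z)"
    by (simp add: d_def adj_diff pA bounded_op_diff[OF A_bounded[OF pA]])
   finally show ?thesis
    by (simp add: u_def v_def x_def z_def scaleC_add_right bounded_op_add[OF A_bounded[OF eA]])
  qed
  have "\<iota> (e j) - \<iota> (e k) = \<iota> (%y. e j y - e k y)" by (simp add: iota_diff eA)
  also have "(%y. e j y - e k y) = (%y. complex_of_real \<epsilon> *\<^sub>C u y + complex_of_real \<epsilon> *\<^sub>C v y)"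
   by (rule ext) (rule pointwise)
  also have "\<iota> \<dots> = complex_of_real \<epsilon> *\<^sub>C \<iota> u + complex_of_real \<epsilon> *\<^sub>C \<iota> v"
   by (simp add: iota_add A_scale uA vA iota_scale)
  finally have "norm (\<iota> (e j) - \<iota> (e k)) \<le> \<epsilon> * norm (\<iota> u) + \<epsilon> * norm (\<iota> v)"
   using norm_triangle_ineq[of "complex_of_real \<epsilon> *\<^sub>C \<iota> u" "complex_of_real \<epsilon> *\<^sub>C \<iota> v"] \<epsilon>
   by (simp add: norm_scaleC)
  moreover have "norm (\<iota> u) \<le> 1 / sqrt \<epsilon> * norm (\<iota> d)"
  proof -
   have "norm (\<iota> u) \<le> 1 * norm (\<iota> (d \<circ> (adj (p k) \<circ> e k)))"
    unfolding u_def by (intro norm_iota_comp_left A_comp dA A_adj pA eA e1)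
   also have "norm (\<iota> (d \<circ> (adj (p k) \<circ> e k))) \<le> 1 / sqrt \<epsilon> * norm (\<iota> d)"
    by (intro norm_iota_comp_right A_comp dA A_adj pA eA ae)
   finally show ?thesis by simp
  qed
  moreover have "norm (\<iota> v) \<le> 1 / sqrt \<epsilon> * norm (\<iota> d)"
  proof -
   have "norm (\<iota> v) \<le> 1 * norm (\<iota> (x j \<circ> adj d))"
    unfolding v_def by (intro norm_iota_comp_right A_comp dA A_adj xA eA e1)
   also have "norm (\<iota> (x j \<circ> adj d)) \<le> 1 / sqrt \<epsilon> * norm (\<iota> (adj d))"
    by (intro norm_iota_comp_left A_adj dA xA xb)
   finally show ?thesis by (simp add: norm_iota_adj dA)
  qed
  moreover have "\<epsilon> * (1 / sqrt \<epsilon> * norm (\<iota> d)) = sqrt \<epsilon> * norm (\<iota> d)"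
  proof -
   have "\<epsilon> * (1 / sqrt \<epsilon> * norm (\<iota> d)) = (\<epsilon> / sqrt \<epsilon>) * norm (\<iota> d)" by simp
   then show ?thesis using \<epsilon> by (simp only: real_div_sqrt less_imp_le)
  qed
  moreover have "\<epsilon> * norm (\<iota> u) \<le> \<epsilon> * (1 / sqrt \<epsilon> * norm (\<iota> d))" "\<epsilon> * norm (\<iota> v) \<le> \<epsilon> * (1 / sqrt \<epsilon> * norm (\<iota> d))"
   using calculation(2,3) \<epsilon> by (auto intro!: mult_left_mono simp del: times_divide_eq_left)
  ultimately have "norm (\<iota> (e j) - \<iota> (e k)) \<le> 2 * (sqrt \<epsilon> * norm (\<iota> d))" by linarith
  then show ?thesis by (simp add: d_def iota_diff pA)
 qed
 have "convergent (%j. \<iota> (e j))"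
 proof (rule Cauchy_convergent, rule metric_CauchyI)
  fix r :: real assume "r > 0"
  then have r: "r / (2 * sqrt \<epsilon>) > 0" using \<epsilon> by simp
  have "Cauchy (%j. \<iota> (p j))" using plim by (rule LIMSEQ_imp_Cauchy)
  from metric_CauchyD[OF this r] obtain N where
   N: "!!j k. j \<ge> N ==> k \<ge> N ==> dist (\<iota> (p j)) (\<iota> (p k)) < r / (2 * sqrt \<epsilon>)" by blast
  have "dist (\<iota> (e j)) (\<iota> (e k)) < r" if "j \<ge> N" "k \<ge> N" for j k
  proof -
   have "norm (\<iota> (e j) - \<iota> (e k)) \<le> 2 * sqrt \<epsilon> * norm (\<iota> (p k) - \<iota> (p j))" by (rule diff)
   also have "\<dots> < 2 * sqrt \<epsilon> * (r / (2 * sqrt \<epsilon>))"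
    using N[OF that] \<epsilon> by (intro mult_strict_left_mono) (auto simp: dist_norm norm_minus_commute)
   also have "\<dots> = r" using \<epsilon> by simp
   finally show ?thesis by (simp add: dist_norm)
  qed
  then show "\<exists>M. \<forall>j\<ge>M. \<forall>k\<ge>M. dist (\<iota> (e j)) (\<iota> (e k)) < r" by blast
 qed
 then have ec: "convergent (%j. lmul (e j) \<xi>)" for \<xi> by (rule lmul_strong_convergent[OF eA e1])
 define E where "E \<xi> = lim (%j. lmul (e j) \<xi>)" for \<xi>
 have E: "(%j. lmul (e j) \<xi>) \<longlonglongrightarrow> E \<xi>" for \<xi> using ec unfolding E_def by (simp add: convergent_LIMSEQ_iff)
 have xE: "(%j. \<iota> (x j)) \<longlonglongrightarrow> E a"
 proof -
  have z: "(%j. lmul (e j) (\<iota> (p j) - a)) \<longlonglongrightarrow> 0"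
  proof (rule Lim_null_comparison)
   show "\<forall>\<^sub>F j in sequentially. norm (lmul (e j) (\<iota> (p j) - a)) \<le> norm (\<iota> (p j) - a)"
    using norm_lmul[OF eA e1] by (intro always_eventually allI) simp
   show "(%j. norm (\<iota> (p j) - a)) \<longlonglongrightarrow> 0" using plim by (simp add: LIM_zero tendsto_norm_zero)
  qed
  have "lmul (e j) (\<iota> (p j) - a) + lmul (e j) a = \<iota> (x j)" for j
   by (simp add: lmul_diff eA lmul_iota pA x_def)
  then show ?thesis using tendsto_add[OF z E[of a]] by simp
 qed
 then have "convergent (%j. \<iota> (x j))" by (rule convergentI)
 then have xc: "convergent (%j. lmul (x j) \<xi>)" for \<xi> by (rule lmul_strong_convergent[OF xA xb])
 define T where "T \<xi> = lim (%j. lmul (x j) \<xi>)" for \<xi>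
 have T: "(%j. lmul (x j) \<xi>) \<longlonglongrightarrow> T \<xi>" for \<xi> using xc unfolding T_def by (simp add: convergent_LIMSEQ_iff)
 have tr: "truncation a e x E T" unfolding truncation_def using eA xA eadj E T xE by blast
 have E1: "norm (E \<xi>) \<le> norm \<xi>" for \<xi>
 proof (rule LIMSEQ_le_const2[OF tendsto_norm[OF E]])
  show "\<exists>N. \<forall>j\<ge>N. norm (lmul (e j) \<xi>) \<le> norm \<xi>" using norm_lmul[OF eA e1, of _ \<xi>] by simp
 qed
 have Ed: "E (\<xi> - \<eta>) = E \<xi> - E \<eta>" for \<xi> \<eta>
  by (rule LIMSEQ_unique[OF E]) (simp add: lmul_diff eA tendsto_diff[OF E E])
 have EV: "norm (E (\<iota> V) - \<iota> V) \<le> K * (sqrt \<epsilon> * norm a)" if V: "V \<in> A" "op_bound V K" for V K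
 proof (rule LIMSEQ_le)
  show "(%j. norm (lmul (e j) (\<iota> V) - \<iota> V)) \<longlonglongrightarrow> norm (E (\<iota> V) - \<iota> V)"
   by (intro tendsto_norm tendsto_diff E tendsto_const)
  show "(%j. K * (sqrt \<epsilon> * norm (\<iota> (p j)))) \<longlonglongrightarrow> K * (sqrt \<epsilon> * norm a)"
   by (intro tendsto_mult tendsto_const tendsto_norm plim)
  have "norm (lmul (e j) (\<iota> V) - \<iota> V) \<le> K * (sqrt \<epsilon> * norm (\<iota> (p j)))" for j
  proof -
   define q where "q = p j \<circ> (adj (p j) \<circ> e j)"
   have qA: "q \<in> A" unfolding q_def by (intro A_comp A_adj pA eA)
   have "e j (V y) - V y = (- complex_of_real \<epsilon>) *\<^sub>C q (V y)" for y
    using Be[of j "V y"] scaleC_minus1[of "complex_of_real \<epsilon> *\<^sub>C q (V y)"]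
    by (simp add: q_def scaleC_scaleC) (metis add_diff_cancel_left' minus_diff_eq)
   then have "(%y. (e j \<circ> V) y - V y) = (%y. (- complex_of_real \<epsilon>) *\<^sub>C (q \<circ> V) y)" by (intro ext) simp
   then have "lmul (e j) (\<iota> V) - \<iota> V = (- complex_of_real \<epsilon>) *\<^sub>C \<iota> (q \<circ> V)"
    using iota_diff[OF A_comp[OF eA V(1)] V(1), of j] iota_scale[OF A_comp[OF qA V(1)], of "- complex_of_real \<epsilon>"]
    by (simp add: lmul_iota eA V)
   then have "norm (lmul (e j) (\<iota> V) - \<iota> V) = \<epsilon> * norm (\<iota> (q \<circ> V))" using \<epsilon> by (simp add: norm_scaleC)
   also have "norm (\<iota> (q \<circ> V)) \<le> K * norm (\<iota> q)" by (rule norm_iota_comp_right[OF qA V])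
   also have "norm (\<iota> q) \<le> 1 / sqrt \<epsilon> * norm (\<iota> (p j))"
    unfolding q_def by (intro norm_iota_comp_right A_comp pA A_adj eA ae)
   finally have "norm (lmul (e j) (\<iota> V) - \<iota> V) \<le> \<epsilon> * (K * (1 / sqrt \<epsilon> * norm (\<iota> (p j))))"
    using \<epsilon> V by (auto simp: op_bound_def mult_left_mono)
   also have "\<dots> = K * ((\<epsilon> / sqrt \<epsilon>) * norm (\<iota> (p j)))" by simp
   finally show ?thesis using \<epsilon> by (simp only: real_div_sqrt less_imp_le)
  qed
  then show "\<exists>N. \<forall>j\<ge>N. norm (lmul (e j) (\<iota> V) - \<iota> V) \<le> K * (sqrt \<epsilon> * norm (\<iota> (p j)))" by blast
 qed
 show ?thesis using tr E1 Ed EV by blast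
qed

lemma truncation_seq_ex:
 "\<exists>e x E T. (\<forall>n::nat. truncation a (e n) (x n) (E n) (T n)) \<and> (\<forall>\<xi>. (%n. E n \<xi>) \<longlonglongrightarrow> \<xi>)"
proof -
 define Q where "Q n e x E T \<longleftrightarrow> truncation a e x E T \<and> (\<forall>\<xi>. norm (E \<xi>) \<le> norm \<xi>) \<and> (\<forall>\<xi> \<eta>. E (\<xi> - \<eta>) = E \<xi> - E \<eta>) \<and>
  (\<forall>V\<in>A. \<forall>K. op_bound V K --> norm (E (\<iota> V) - \<iota> V) \<le> K * (sqrt (1 / real (Suc n)) * norm a))" for n e x E T
 have "\<exists>e x E T. Q n e x E T" for n
  unfolding Q_def by (rule truncation_ex) simp
 then obtain e x E T where Q: "!!n. Q n (e n) (x n) (E n) (T n)" by metis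
 have tr: "truncation a (e n) (x n) (E n) (T n)" and E1: "norm (E n \<xi>) \<le> norm \<xi>"
  and Ed: "E n (\<xi> - \<eta>) = E n \<xi> - E n \<eta>"
  and EV: "V \<in> A ==> op_bound V K ==> norm (E n (\<iota> V) - \<iota> V) \<le> K * (sqrt (1 / real (Suc n)) * norm a)"
  for n \<xi> \<eta> V K using Q[of n] unfolding Q_def by blast+
 have "(%n. E n \<xi>) \<longlonglongrightarrow> \<xi>" for \<xi>
 proof (rule metric_LIMSEQ_I)
  fix r :: real assume r: "r > 0"
  obtain X where X: "approx X \<xi>" using approx_ex by blast
  then have lim: "(%i. \<iota> (X i)) \<longlonglongrightarrow> \<xi>" and XA: "X i \<in> A" for i by auto
  have "r / 4 > 0" using r by simp
  from metric_LIMSEQ_D[OF lim this] obtain i where i: "dist (\<iota> (X i)) \<xi> < r / 4" by blast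
  obtain K where K: "op_bound (X i) K" using A_op_bound[OF XA] by blast
  have "(%n. 1 / real (Suc n)) \<longlonglongrightarrow> 0" by (rule LIMSEQ_Suc[OF lim_const_over_n])
  then have "(%n. sqrt (1 / real (Suc n))) \<longlonglongrightarrow> sqrt 0" by (rule tendsto_real_sqrt)
  then have "(%n. K * (sqrt (1 / real (Suc n)) * norm a)) \<longlonglongrightarrow> K * (sqrt 0 * norm a)"
   by (intro tendsto_mult tendsto_const)
  then have "(%n. K * (sqrt (1 / real (Suc n)) * norm a)) \<longlonglongrightarrow> 0" by simp
  moreover have "r / 2 > 0" using r by simp
  ultimately obtain N where N: "!!n. n \<ge> N ==> K * (sqrt (1 / real (Suc n)) * norm a) < r / 2"
   by (metis (no_types, lifting) order_tendstoD(2) eventually_sequentially)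
  have "dist (E n \<xi>) \<xi> < r" if "n \<ge> N" for n
  proof -
   have "E n \<xi> - \<xi> = E n (\<xi> - \<iota> (X i)) + (E n (\<iota> (X i)) - \<iota> (X i)) + (\<iota> (X i) - \<xi>)" by (simp add: Ed)
   moreover have n1: "norm (E n (\<xi> - \<iota> (X i))) < r / 4"
    using E1[of n "\<xi> - \<iota> (X i)"] i by (simp add: dist_norm norm_minus_commute)
   moreover have n2: "norm (E n (\<iota> (X i)) - \<iota> (X i)) < r / 2" using EV[OF XA K, of n] N[OF that] by linarith
   moreover have n3: "norm (\<iota> (X i) - \<xi>) < r / 4" using i by (simp add: dist_norm)
   moreover have n4: "norm (a + b + c) \<le> norm a + norm b + norm c" for a b c :: 'l
    using norm_triangle_ineq[of "a + b" c] norm_triangle_ineq[of a b] by linarith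
   ultimately have "norm (E n \<xi> - \<xi>) < r / 4 + r / 2 + r / 4" 
    using n4[of "E n (\<xi> - \<iota> (X i))" "E n (\<iota> (X i)) - \<iota> (X i)" "\<iota> (X i) - \<xi>"] n1 n2 n3 by simp
   then show ?thesis by (simp add: dist_norm)
  qed
  then show "\<exists>N. \<forall>n\<ge>N. dist (E n \<xi>) \<xi> < r" by blast
 qed
 then show ?thesis using tr by blast
qed

section \<open>Associativity of the product of square-integrable elements\<close>

lemma nc_timesD: "nc_times A \<phi> \<iota> \<xi> \<eta> \<zeta> ==> W \<in> A ==> cinner \<zeta> (\<iota> W) = cinner \<xi> (lmul W (J \<eta>))"
 by (simp only: nc_times_iff)

lemma nc_timesI: "(!!W. W \<in> A ==> cinner \<zeta> (\<iota> W) = cinner \<xi> (lmul W (J \<eta>))) ==> nc_times A \<phi> \<iota> \<xi> \<eta> \<zeta>"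
 unfolding nc_times_iff by (rule ballI)

lemma nc_times_unique: "nc_times A \<phi> \<iota> \<xi> \<eta> \<zeta> ==> nc_times A \<phi> \<iota> \<xi> \<eta> \<zeta>' ==> \<zeta> = \<zeta>'"
 by (rule cinner_iota_ext) (simp add: nc_timesD)

lemma truncation_product:
 assumes tr: "truncation a e x E T" and abd: "nc_times A \<phi> \<iota> a b d"
 shows "E d = T b"
proof (rule cinner_iota_ext)
 fix V assume V: "V \<in> A"
 have eA: "e j \<in> A" and xA: "x j \<in> A" and eadj: "adj (e j) = e j"
  and E: "(%j. lmul (e j) \<xi>) \<longlonglongrightarrow> E \<xi>" and T: "(%j. lmul (x j) \<xi>) \<longlonglongrightarrow> T \<xi>"
  and xE: "(%j. \<iota> (x j)) \<longlonglongrightarrow> E a" for j \<xi>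
  using tr unfolding truncation_def by blast+
 have 1: "cinner (lmul (e j) d) (\<iota> V) = cinner (lmul (e j) a) (lmul V (J b))" for j
 proof -
  have "cinner (lmul (e j) d) (\<iota> V) = cinner d (\<iota> (e j \<circ> V))"
   by (simp add: cinner_lmul eA eadj lmul_iota V)
  also have "\<dots> = cinner a (lmul (e j) (lmul V (J b)))"
   by (simp add: nc_timesD[OF abd A_comp[OF eA V]] lmul_comp eA V)
  also have "\<dots> = cinner (lmul (e j) a) (lmul V (J b))" by (simp add: cinner_lmul eA eadj)
  finally show ?thesis .
 qed
 have 2: "cinner (lmul (x j) b) (\<iota> V) = cinner (\<iota> (x j)) (lmul V (J b))" for j
 proof -
  have "cinner (lmul (x j) b) (\<iota> V) = cinner b (\<iota> (adj (x j) \<circ> V))"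
   by (simp add: cinner_lmul xA lmul_iota A_adj V)
  also have "\<dots> = cinner b (J (\<iota> (adj V \<circ> x j)))"
   by (simp add: J_iota A_comp A_adj V xA adj_comp A_bounded bounded_op_adj adj_adj)
  also have "\<dots> = cinner (\<iota> (adj V \<circ> x j)) (J b)" by (rule cinner_J_swap)
  also have "\<dots> = cinner (lmul (adj V) (\<iota> (x j))) (J b)" by (simp add: lmul_iota A_adj V xA)
  also have "\<dots> = cinner (\<iota> (x j)) (lmul V (J b))" by (simp add: cinner_lmul A_adj V adj_adj A_bounded)
  finally show ?thesis .
 qed
 have "(%j. cinner (lmul (e j) a) (lmul V (J b))) \<longlonglongrightarrow> cinner (E d) (\<iota> V)"
  using tendsto_cinner[OF E[of d] tendsto_const[of "\<iota> V"]] by (simp only: 1)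
 from LIMSEQ_unique[OF this tendsto_cinner[OF E tendsto_const]]
 have "cinner (E d) (\<iota> V) = cinner (E a) (lmul V (J b))" .
 moreover have "(%j. cinner (\<iota> (x j)) (lmul V (J b))) \<longlonglongrightarrow> cinner (T b) (\<iota> V)"
  using tendsto_cinner[OF T[of b] tendsto_const[of "\<iota> V"]] by (simp only: 2)
 from LIMSEQ_unique[OF this tendsto_cinner[OF xE tendsto_const]]
 have "cinner (T b) (\<iota> V) = cinner (E a) (lmul V (J b))" .
 ultimately show "cinner (E d) (\<iota> V) = cinner (T b) (\<iota> V)" by simp
qed

lemma nc_times_J:
 assumes "nc_times A \<phi> \<iota> b c d" shows "nc_times A \<phi> \<iota> (J c) (J b) (J d)"
proof (rule nc_timesI)
 fix W assume W: "W \<in> A"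
 have "cinner (J d) (\<iota> W) = cinner (J d) (J (\<iota> (adj W)))" by (simp add: J_iota A_adj W adj_adj A_bounded)
 also have "\<dots> = cnj (cinner d (\<iota> (adj W)))" by (subst cinner_J) (rule cinner_commute)
 also have "\<dots> = cnj (cinner b (lmul (adj W) (J c)))" by (simp add: nc_timesD[OF assms A_adj[OF W]])
 also have "\<dots> = cinner (lmul (adj W) (J c)) b" by (rule cinner_commute[symmetric])
 also have "\<dots> = cinner (J c) (lmul W b)" by (simp add: cinner_lmul A_adj W adj_adj A_bounded)
 finally show "cinner (J d) (\<iota> W) = cinner (J c) (lmul W (J (J b)))" by simp
qed

text \<open>Products of square-integrable elements are only integrable, so \<open>(a b) c = a (b c)\<close> is an identity of
 functionals on \<open>A\<close>. It holds for the bounded truncations \<open>E a\<close> and \<open>c E'\<close>, and the truncations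
 can be removed as \<open>E\<close> and \<open>E'\<close> tend to the identity.\<close>

lemma nc_times_assoc:
 assumes abd: "nc_times A \<phi> \<iota> a b d" and bcd: "nc_times A \<phi> \<iota> b c d'"
 shows "nc_times A \<phi> \<iota> d c z \<longleftrightarrow> nc_times A \<phi> \<iota> a d' z"
proof -
 have main: "cinner d (lmul W (J c)) = cinner a (lmul W (J d'))" if W: "W \<in> A" for W
 proof -
  obtain e x E T where tr: "!!n. truncation a (e n) (x n) (E n) (T n)" and Elim: "!!\<xi>. (%n. E n \<xi>) \<longlonglongrightarrow> \<xi>"
   using truncation_seq_ex[of a] by metis
  obtain e' y E' T' where tr': "!!n. truncation (J c) (e' n) (y n) (E' n) (T' n)" and Elim': "!!\<xi>. (%n. E' n \<xi>) \<longlonglongrightarrow> \<xi>"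
   using truncation_seq_ex[of "J c"] by metis
  have eq: "cinner (E n d) (lmul W (E' n (J c))) = cinner (E n a) (lmul W (E' n (J d')))" for n
  proof -
   have xA: "x n j \<in> A" and T: "(%j. lmul (x n j) \<xi>) \<longlonglongrightarrow> T n \<xi>" and xE: "(%j. \<iota> (x n j)) \<longlonglongrightarrow> E n a" for j \<xi>
    using tr[of n] unfolding truncation_def by blast+
   have yA: "y n j \<in> A" and T': "(%j. lmul (y n j) \<xi>) \<longlonglongrightarrow> T' n \<xi>" and yE: "(%j. \<iota> (y n j)) \<longlonglongrightarrow> E' n (J c)" for j \<xi>
    using tr'[of n] unfolding truncation_def by blast+
   have 1: "cinner (lmul (x n j) b) (lmul W (\<iota> (y n j))) = cinner b (\<iota> (adj (x n j) \<circ> (W \<circ> y n j)))" for j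
    by (simp add: cinner_lmul xA lmul_iota W yA A_adj A_comp)
   have 2: "cinner (\<iota> (x n j)) (lmul W (lmul (y n j) (J b))) = cinner b (\<iota> (adj (x n j) \<circ> (W \<circ> y n j)))" for j
   proof -
    have WyA: "W \<circ> y n j \<in> A" by (intro A_comp W yA)
    have "cinner (\<iota> (x n j)) (lmul W (lmul (y n j) (J b))) = cinner (\<iota> (x n j)) (lmul (adj (adj (W \<circ> y n j))) (J b))"
     by (simp only: lmul_comp[OF W yA] adj_adj[OF A_bounded[OF WyA]])
    also have "\<dots> = cinner (lmul (adj (W \<circ> y n j)) (\<iota> (x n j))) (J b)"
     by (rule cinner_lmul[OF A_adj[OF WyA], symmetric])
    also have "\<dots> = cinner (\<iota> (adj (W \<circ> y n j) \<circ> x n j)) (J b)" by (simp only: lmul_iota[OF A_adj[OF WyA] xA])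
    also have "\<dots> = cinner b (J (\<iota> (adj (W \<circ> y n j) \<circ> x n j)))" by (rule cinner_J_swap)
    also have "J (\<iota> (adj (W \<circ> y n j) \<circ> x n j)) = \<iota> (adj (x n j) \<circ> (W \<circ> y n j))"
     by (simp only: J_iota[OF A_comp[OF A_adj[OF WyA] xA]] adj_comp[OF A_bounded[OF A_adj[OF WyA]] A_bounded[OF xA]]
       adj_adj[OF A_bounded[OF WyA]])
    finally show ?thesis .
   qed
   have "(%j. cinner b (\<iota> (adj (x n j) \<circ> (W \<circ> y n j)))) \<longlonglongrightarrow> cinner (T n b) (lmul W (E' n (J c)))"
    using tendsto_cinner[OF T[of b] tendsto_lmul[OF W yE]] by (simp only: 1)
   moreover have "(%j. cinner b (\<iota> (adj (x n j) \<circ> (W \<circ> y n j)))) \<longlonglongrightarrow> cinner (E n a) (lmul W (T' n (J b)))"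
    using tendsto_cinner[OF xE tendsto_lmul[OF W T'[of "J b"]]] by (simp only: 2)
   ultimately have "cinner (T n b) (lmul W (E' n (J c))) = cinner (E n a) (lmul W (T' n (J b)))"
    by (rule LIMSEQ_unique)
   then show ?thesis
    using truncation_product[OF tr abd, of n] truncation_product[OF tr' nc_times_J[OF bcd], of n] by simp
  qed
  have "(%n. cinner (E n a) (lmul W (E' n (J d')))) \<longlonglongrightarrow> cinner d (lmul W (J c))"
   using tendsto_cinner[OF Elim[of d] tendsto_lmul[OF W Elim'[of "J c"]]] by (simp only: eq)
  from LIMSEQ_unique[OF this tendsto_cinner[OF Elim tendsto_lmul[OF W Elim']]] show ?thesis .
 qed
 show ?thesis unfolding nc_times_iff using main by simp
qed

lemma nc_times_id_left: "nc_times A \<phi> \<iota> (\<iota> id) \<xi> \<xi>"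
proof (rule nc_timesI)
 fix W assume W: "W \<in> A"
 have "cinner (\<iota> id) (lmul W (J \<xi>)) = cinner (lmul (adj W) (\<iota> id)) (J \<xi>)"
  using cinner_lmul[OF A_adj[OF W], of "\<iota> id" "J \<xi>"] by (simp only: adj_adj[OF A_bounded[OF W]])
 also have "\<dots> = cinner (J (\<iota> W)) (J \<xi>)" by (simp add: lmul_iota A_adj W A_id J_iota)
 finally show "cinner \<xi> (\<iota> W) = cinner (\<iota> id) (lmul W (J \<xi>))" by (simp add: cinner_J)
qed

lemma nc_times_id_right: "nc_times A \<phi> \<iota> \<xi> (\<iota> id) \<xi>"
 by (rule nc_timesI) (simp add: lmul_iota A_id)

lemma nc_times_add_right:
 "nc_times A \<phi> \<iota> \<xi> \<eta> \<zeta> ==> nc_times A \<phi> \<iota> \<xi> \<eta>' \<zeta>' ==> nc_times A \<phi> \<iota> \<xi> (\<eta> + \<eta>') (\<zeta> + \<zeta>')"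
 by (rule nc_timesI) (simp add: nc_timesD J_add lmul_add cinner_add_left cinner_add_right)

lemma nc_times_add_left:
 "nc_times A \<phi> \<iota> \<xi> \<eta> \<zeta> ==> nc_times A \<phi> \<iota> \<xi>' \<eta> \<zeta>' ==> nc_times A \<phi> \<iota> (\<xi> + \<xi>') \<eta> (\<zeta> + \<zeta>')"
 by (rule nc_timesI) (simp add: nc_timesD cinner_add_left)

lemma nc_times_scale_right:
 "nc_times A \<phi> \<iota> \<xi> \<eta> \<zeta> ==> nc_times A \<phi> \<iota> \<xi> (c *\<^sub>C \<eta>) (c *\<^sub>C \<zeta>)"
 by (rule nc_timesI) (simp add: nc_timesD J_scale lmul_scale cinner_scaleC_left cinner_scaleC_right)

lemma nc_times_scale_left:
 "nc_times A \<phi> \<iota> \<xi> \<eta> \<zeta> ==> nc_times A \<phi> \<iota> (c *\<^sub>C \<xi>) \<eta> (c *\<^sub>C \<zeta>)"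
 by (rule nc_timesI) (simp add: nc_timesD cinner_scaleC_left)

lemma J_zero [simp]: "J 0 = 0"
 using J_scale[of 0 0] by simp

lemma nc_times_zero_right: "nc_times A \<phi> \<iota> \<xi> 0 0"
 by (rule nc_timesI) (simp add: bounded_linear.linear[OF bounded_linear_lmul, THEN linear_0])

lemma nc_times_zero_left: "nc_times A \<phi> \<iota> 0 \<xi> 0"
 by (rule nc_timesI) simp

lemma nc_word_unique:
 "nc_word A \<phi> \<iota> xs \<zeta> ==> nc_word A \<phi> \<iota> xs \<zeta>' ==> \<zeta> = \<zeta>'"
proof (induction arbitrary: \<zeta>' rule: nc_word.induct)
 case Nil
 then show ?case by (cases rule: nc_word.cases) auto
next
 case (Cons \<xi>s \<eta> \<xi> \<zeta>)
 from Cons.prems obtain \<eta>' where "nc_word A \<phi> \<iota> \<xi>s \<eta>'" "nc_times A \<phi> \<iota> \<xi> \<eta>' \<zeta>'"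
  by (cases rule: nc_word.cases) auto
 then show ?case using Cons.IH Cons.hyps(2) nc_times_unique by blast
qed

end

section \<open>Words in self-adjoint elements\<close>

text \<open>\<open>W u\<close> is the product of the word \<open>u\<close>, which is assumed to exist in \<open>L\<^sup>2\<close>.\<close>

locale nc_words = nc_L2_completion A \<phi> \<iota>
 for A :: "'h::complex_hilbert_space op set" and \<phi> :: "'h op => complex"
  and \<iota> :: "'h op => 'l::complex_hilbert_space" +
 fixes X :: "nat => 'l" and L :: "nat set" and W :: "nat list => 'l"
 assumes word: "set u \<subseteq> L ==> nc_word A \<phi> \<iota> (map X u) (W u)"
  and selfadjoint: "i \<in> L ==> J (X i) = X i"
begin

lemma W_Nil: "W [] = \<iota> id"
 using nc_word_unique[OF word[of "[]"]] nc_word.Nil[of A \<phi> \<iota>] by simp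

lemma W_Cons: assumes "i \<in> L" "set u \<subseteq> L" shows "nc_times A \<phi> \<iota> (X i) (W u) (W (i # u))"
proof -
 have "nc_word A \<phi> \<iota> (X i # map X u) (W (i # u))" using word[of "i # u"] assms by simp
 then obtain \<eta> where \<eta>: "nc_word A \<phi> \<iota> (map X u) \<eta>" "nc_times A \<phi> \<iota> (X i) \<eta> (W (i # u))"
  by (cases rule: nc_word.cases) auto
 have "\<eta> = W u" by (rule nc_word_unique[OF \<eta>(1) word[OF assms(2)]])
 then show ?thesis using \<eta>(2) by simp
qed

lemma W_append: "set u \<subseteq> L ==> set v \<subseteq> L ==> nc_times A \<phi> \<iota> (W u) (W v) (W (u @ v))"
proof (induction u)
 case Nil
 then show ?case by (simp add: W_Nil nc_times_id_left)
next
 case (Cons i u)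
 have "nc_times A \<phi> \<iota> (W (i # u)) (W v) (W (i # u @ v)) \<longleftrightarrow> nc_times A \<phi> \<iota> (X i) (W (u @ v)) (W (i # u @ v))"
  by (rule nc_times_assoc[OF W_Cons]) (use Cons in auto)
 moreover have "nc_times A \<phi> \<iota> (X i) (W (u @ v)) (W (i # u @ v))"
  by (rule W_Cons) (use Cons in auto)
 ultimately show ?case by simp
qed

lemma W_single: assumes "i \<in> L" shows "W [i] = X i"
proof -
 have "nc_times A \<phi> \<iota> (X i) (\<iota> id) (W [i])" using W_Cons[OF assms, of "[]"] by (simp add: W_Nil)
 from nc_times_unique[OF this nc_times_id_right] show ?thesis .
qed

lemma J_W: "set u \<subseteq> L ==> J (W u) = W (rev u)"
proof (induction u)
 case Nil
 then show ?case by (simp add: W_Nil)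
next
 case (Cons i u)
 have "nc_times A \<phi> \<iota> (J (W u)) (J (X i)) (J (W (i # u)))"
  by (rule nc_times_J[OF W_Cons]) (use Cons in auto)
 then have "nc_times A \<phi> \<iota> (W (rev u)) (X i) (J (W (i # u)))"
  using Cons selfadjoint[of i] by simp
 moreover have "nc_times A \<phi> \<iota> (W (rev u)) (W [i]) (W (rev u @ [i]))"
  by (rule W_append) (use Cons in auto)
 ultimately show ?case using nc_times_unique W_single[of i] Cons.prems by simp
qed

definition tau :: "nat list => complex" where
 "tau u = nc_trace \<iota> (W u)"

lemma cinner_W: assumes "set u \<subseteq> L" "set v \<subseteq> L" shows "cinner (W u) (W v) = tau (u @ rev v)"
proof -
 have "cinner (W (u @ rev v)) (\<iota> id) = cinner (W u) (lmul id (J (W (rev v))))"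
  by (rule nc_timesD[OF W_append A_id]) (use assms in auto)
 then show ?thesis using J_W[of "rev v"] assms by (simp add: tau_def nc_trace_def)
qed

lemma tau_cyclic: assumes "set u \<subseteq> L" "set v \<subseteq> L" shows "tau (u @ v) = tau (v @ u)"
proof -
 have "tau (u @ v) = cinner (W u) (J (W v))" using cinner_W[of u "rev v"] J_W[of v] assms by simp
 also have "\<dots> = cinner (W v) (J (W u))" by (rule cinner_J_swap)
 also have "\<dots> = tau (v @ u)" using cinner_W[of v "rev u"] J_W[of u] assms by simp
 finally show ?thesis .
qed

end

section \<open>Partial integration of functions of labelled coordinates\<close>

abbreviation halfline :: "real measure" where
 "halfline \<equiv> restrict_space lborel {0..}"

interpretation halfline: sigma_finite_measure halfline
 by (rule sigma_finite_measure_restrict_space) (auto intro: lborel.sigma_finite_measure_axioms)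

interpretation hl: product_sigma_finite "%_::nat. halfline"
 by unfold_locales

abbreviation PM :: "nat set => (nat => real) measure" where
 "PM J \<equiv> Pi\<^sub>M J (%_. halfline)"

abbreviation NM :: "(nat => real) measure" where
 "NM \<equiv> PM UNIV"

definition ov :: "nat set => (nat => real) => (nat => real) => nat => real" where
 "ov C t s = (%i. if i \<in> C then s i else t i)"

definition lm :: "nat set => ((nat => real) => ennreal) => (nat => real) => ennreal" where
 "lm C \<phi> t = (\<integral>\<^sup>+ s. \<phi> (ov C t s) \<partial>PM C)"

definition cm :: "nat set => ((nat => real) => complex) => (nat => real) => complex" where
 "cm C \<phi> t = (\<integral> s. \<phi> (ov C t s) \<partial>PM C)"

definition dep :: "nat set => ((nat => real) => 'b) => bool" where
 "dep J \<phi> \<longleftrightarrow> (\<forall>t t'. (\<forall>i\<in>J. t i = t' i) --> \<phi> t = \<phi> t')"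

lemma space_NM: "t \<in> space NM \<longleftrightarrow> (\<forall>i. 0 \<le> t i)"
 by (auto simp: space_PiM PiE_def space_restrict_space)

lemma measurable_ov: "(%(t, s). ov C t s) \<in> NM \<Otimes>\<^sub>M PM C \<rightarrow>\<^sub>M NM"
proof (rule measurable_PiM_single')
 fix i :: nat
 show "(%x. (case x of (t, s) => ov C t s) i) \<in> NM \<Otimes>\<^sub>M PM C \<rightarrow>\<^sub>M halfline"
 proof (cases "i \<in> C")
  case True
  then have "(%x. (case x of (t, s) => ov C t s) i) = (%x. snd x i)" by (auto simp: ov_def)
  then show ?thesis using True by simp
 next
  case False
  then have "(%x. (case x of (t, s) => ov C t s) i) = (%x. fst x i)" by (auto simp: ov_def)
  then show ?thesis by simp
 qed
next
 show "(%(t, s). ov C t s) \<in> space (NM \<Otimes>\<^sub>M PM C) \<rightarrow> UNIV \<rightarrow>\<^sub>E space halfline"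
  by (auto simp: space_pair_measure space_PiM PiE_def ov_def Pi_iff)
qed

lemma measurable_ov2: "t \<in> space NM ==> ov C t \<in> PM C \<rightarrow>\<^sub>M NM"
 using measurable_compose[OF measurable_Pair1' measurable_ov, of t] by simp

lemma measurable_ov_section: "\<phi> \<in> NM \<rightarrow>\<^sub>M M ==> t \<in> space NM ==> (%s. \<phi> (ov C t s)) \<in> PM C \<rightarrow>\<^sub>M M"
 by (rule measurable_compose[OF measurable_ov2])

lemma ov_space: "t \<in> space NM ==> s \<in> space (PM C) ==> ov C t s \<in> space NM"
 by (auto simp: space_NM space_PiM PiE_def Pi_iff ov_def space_restrict_space)

lemma measurable_lm [measurable]:
 assumes "finite C" and [measurable]: "\<phi> \<in> borel_measurable NM"
 shows "lm C \<phi> \<in> borel_measurable NM"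
proof -
 interpret sigma_finite_measure "PM C" by (rule hl.sigma_finite[OF assms(1)])
 have "(%(t, s). \<phi> (ov C t s)) \<in> borel_measurable (NM \<Otimes>\<^sub>M PM C)"
  using measurable_compose[OF measurable_ov assms(2)] by (simp add: case_prod_unfold)
 then have "(%t. \<integral>\<^sup>+ s. \<phi> (ov C t s) \<partial>PM C) \<in> borel_measurable NM"
  by (rule borel_measurable_nn_integral)
 then show ?thesis by (simp add: lm_def[abs_def])
qed

lemma measurable_cm [measurable]:
 assumes "finite C" and [measurable]: "\<phi> \<in> borel_measurable NM"
 shows "cm C \<phi> \<in> borel_measurable NM"
proof -
 interpret sigma_finite_measure "PM C" by (rule hl.sigma_finite[OF assms(1)])
 have "(%(t, s). \<phi> (ov C t s)) \<in> borel_measurable (NM \<Otimes>\<^sub>M PM C)"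
  using measurable_compose[OF measurable_ov assms(2)] by (simp add: case_prod_unfold)
 then have "(%t. \<integral> s. \<phi> (ov C t s) \<partial>PM C) \<in> borel_measurable NM"
  by (rule borel_measurable_lebesgue_integral)
 then show ?thesis by (simp add: cm_def[abs_def])
qed

lemma ov_merge: "C \<inter> D = {} ==> ov (C \<union> D) t (merge C D (x, y)) = ov D (ov C t x) y"
 by (auto simp: ov_def merge_def fun_eq_iff)

lemma lm_Un:
 assumes "finite C" "finite D" "C \<inter> D = {}" and m: "\<phi> \<in> borel_measurable NM" and t: "t \<in> space NM"
 shows "lm (C \<union> D) \<phi> t = lm C (lm D \<phi>) t"
 unfolding lm_def
 by (subst hl.product_nn_integral_fold[OF assms(3,1,2)])
  (simp_all add: ov_merge assms(3) measurable_ov_section[OF m t])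

lemma cm_Un:
 assumes "finite C" "finite D" "C \<inter> D = {}" and m: "\<phi> \<in> borel_measurable NM" and t: "t \<in> space NM"
  and fin: "lm (C \<union> D) (%t. ennreal (cmod (\<phi> t))) t < \<infinity>"
 shows "cm (C \<union> D) \<phi> t = cm C (cm D \<phi>) t"
proof -
 have "integrable (PM (C \<union> D)) (%s. \<phi> (ov (C \<union> D) t s))"
  using fin measurable_ov_section[OF m t] unfolding lm_def by (simp add: integrable_iff_bounded)
 from hl.product_integral_fold[OF assms(3,1,2) this]
 show ?thesis by (simp add: cm_def ov_merge assms(3))
qed

lemma lm_empty [simp]: "lm {} \<phi> t = \<phi> t"
 unfolding lm_def ov_def by (subst hl.nn_integral_empty) auto

lemma lm_singleton:
 assumes m: "\<phi> \<in> borel_measurable NM" and t: "t \<in> space NM"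
 shows "lm {i} \<phi> t = (\<integral>\<^sup>+ x. \<phi> (t(i := x)) \<partial>halfline)"
proof -
 have meas: "(%x. \<phi> (t(i := x))) \<in> borel_measurable halfline"
 proof (rule measurable_compose[OF _ m], rule measurable_PiM_single')
  fix j
  show "(%x. (t(i := x)) j) \<in> halfline \<rightarrow>\<^sub>M halfline"
  proof (cases "j = i")
   case False
   then have "(%x. (t(i := x)) j) = (%_. t j)" by auto
   moreover have "t j \<in> space halfline" using t by (simp add: space_NM space_restrict_space)
   ultimately show ?thesis by simp
  qed simp
 qed (use t in \<open>auto simp: space_NM space_restrict_space\<close>)
 have "ov {i} t s = t(i := s i)" for s by (auto simp: ov_def)
 then show ?thesis using hl.product_nn_integral_singleton[OF meas] by (simp add: lm_def)
qed

lemma dep_mono: "dep J \<phi> ==> J \<subseteq> K ==> dep K \<phi>"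
 unfolding dep_def by blast

lemma depD: "dep J \<phi> ==> (!!i. i \<in> J ==> t i = t' i) ==> \<phi> t = \<phi> t'"
 unfolding dep_def by blast

lemma dep_lm: "dep J \<phi> ==> dep (J - C) (lm C \<phi>)"
 unfolding dep_def lm_def
proof (intro allI impI)
 fix t t' assume *: "\<forall>t t'. (\<forall>i\<in>J. t i = t' i) --> \<phi> t = \<phi> t'" and "\<forall>i\<in>J - C. t i = (t' i :: real)"
 then have "\<phi> (ov C t s) = \<phi> (ov C t' s)" for s by (auto simp: ov_def)
 then show "(\<integral>\<^sup>+ s. \<phi> (ov C t s) \<partial>PM C) = (\<integral>\<^sup>+ s. \<phi> (ov C t' s) \<partial>PM C)" by simp
qed

lemma dep_cm: "dep J \<phi> ==> dep (J - C) (cm C \<phi>)"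
 unfolding dep_def cm_def
proof (intro allI impI)
 fix t t' assume *: "\<forall>t t'. (\<forall>i\<in>J. t i = t' i) --> \<phi> t = \<phi> t'" and "\<forall>i\<in>J - C. t i = (t' i :: real)"
 then have "\<phi> (ov C t s) = \<phi> (ov C t' s)" for s by (auto simp: ov_def)
 then show "(\<integral> s. \<phi> (ov C t s) \<partial>PM C) = (\<integral> s. \<phi> (ov C t' s) \<partial>PM C)" by simp
qed

lemma dep_op2: "dep J \<phi> ==> dep K \<psi> ==> dep (J \<union> K) (%t. f (\<phi> t) (\<psi> t))"
 unfolding dep_def by (metis UnCI)

lemma dep_op1: "dep J \<phi> ==> dep J (%t. f (\<phi> t))"
 unfolding dep_def by metis

lemma dep_ov: "dep J \<phi> ==> J \<inter> C = {} ==> \<phi> (ov C t s) = \<phi> t"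
 by (rule depD) (auto simp: ov_def)

lemma lm_mono: "(!!t. t \<in> space NM ==> \<phi> t \<le> \<psi> t) ==> t \<in> space NM ==> lm C \<phi> t \<le> lm C \<psi> t"
 unfolding lm_def by (intro nn_integral_mono) (auto dest: ov_space)

lemma lm_cong: "(!!t. t \<in> space NM ==> \<phi> t = \<psi> t) ==> t \<in> space NM ==> lm C \<phi> t = lm C \<psi> t"
 unfolding lm_def by (intro nn_integral_cong) (auto dest: ov_space)

lemma lm_cmult:
 assumes "dep J a" "J \<inter> C = {}" "\<phi> \<in> borel_measurable NM" "t \<in> space NM"
 shows "lm C (%t. a t * \<phi> t) t = a t * lm C \<phi> t"
 unfolding lm_def using assms by (simp add: dep_ov nn_integral_cmult measurable_ov_section)

lemma cm_cmult:
 assumes "dep J a" "J \<inter> C = {}"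
 shows "cm C (%t. a t * \<phi> t) t = a t * cm C \<phi> t"
 unfolding cm_def using assms by (simp add: dep_ov)

lemma lm_Cauchy_Schwarz:
 assumes "\<phi> \<in> borel_measurable NM" "\<psi> \<in> borel_measurable NM" "t \<in> space NM"
 shows "(lm C (%t. \<phi> t * \<psi> t) t)\<^sup>2 \<le> lm C (%t. (\<phi> t)\<^sup>2) t * lm C (%t. (\<psi> t)\<^sup>2) t"
 unfolding lm_def by (rule Cauchy_Schwarz_nn_integral) (auto intro: measurable_ov_section assms)

lemma lm_mult_indep:
 assumes "finite X" "finite Y" "X \<inter> Y = {}" "dep U u" "U \<inter> Y = {}" "dep V v" "V \<inter> X = {}"
  and u: "u \<in> borel_measurable NM" and v: "v \<in> borel_measurable NM" and t: "t \<in> space NM"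
 shows "lm (X \<union> Y) (%t. u t * v t) t = lm X u t * lm Y v t"
proof -
 have "lm (X \<union> Y) (%t. u t * v t) t = lm X (lm Y (%t. u t * v t)) t"
  by (rule lm_Un) (use assms in auto)
 also have "\<dots> = lm X (%t. lm Y v t * u t) t"
  by (rule lm_cong) (use lm_cmult[OF assms(4,5) v] t in \<open>auto simp: mult.commute\<close>)
 also have "\<dots> = lm Y v t * lm X u t"
  by (rule lm_cmult[OF dep_lm[OF assms(6)]]) (use assms in auto)
 finally show ?thesis by (simp add: mult.commute)
qed

lemma norm_cm_le:
 assumes "\<phi> \<in> borel_measurable NM" "t \<in> space NM"
 shows "ennreal (cmod (cm C \<phi> t)) \<le> lm C (%t. ennreal (cmod (\<phi> t))) t"
proof (cases "integrable (PM C) (%s. \<phi> (ov C t s))")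
 case True
 then show ?thesis unfolding cm_def lm_def by (rule integral_norm_bound_ennreal)
qed (simp add: cm_def not_integrable_integral_eq)

section \<open>Tame sequences of kernels\<close>

text \<open>Sequences of functions on the half-line that are bounded in every \<open>L\<^sup>p\<close>, \<open>1 \<le> p < \<infinity>\<close>.\<close>

definition Lall :: "(nat => real => ennreal) => bool" where
 "Lall \<omega> \<longleftrightarrow> (\<forall>k. \<omega> k \<in> borel_measurable halfline) \<and>
  (\<forall>p\<ge>1. \<exists>B<\<infinity>. \<forall>k. (\<integral>\<^sup>+ x. (\<omega> k x) ^ p \<partial>halfline) \<le> B)"

lemma LallI:
 assumes "!!k. \<omega> k \<in> borel_measurable halfline"
  "!!p. p \<ge> 1 ==> \<exists>B<\<infinity>. \<forall>k. (\<integral>\<^sup>+ x. (\<omega> k x) ^ p \<partial>halfline) \<le> B"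
 shows "Lall \<omega>"
 using assms unfolding Lall_def by blast

lemma Lall_meas: "Lall \<omega> ==> \<omega> k \<in> borel_measurable halfline"
 unfolding Lall_def by blast

lemma Lall_bound: "Lall \<omega> ==> p \<ge> 1 ==> \<exists>B<\<infinity>. \<forall>k. (\<integral>\<^sup>+ x. (\<omega> k x) ^ p \<partial>halfline) \<le> B"
 unfolding Lall_def by blast

lemma Lall_mono:
 assumes "Lall \<mu>" "!!k. \<omega> k \<in> borel_measurable halfline" "!!k x. x \<ge> 0 ==> \<omega> k x \<le> \<mu> k x"
 shows "Lall \<omega>"
proof (rule LallI)
 fix p :: nat assume "p \<ge> 1"
 from Lall_bound[OF assms(1) this] obtain B where B: "B < \<infinity>" "!!k. (\<integral>\<^sup>+ x. (\<mu> k x) ^ p \<partial>halfline) \<le> B" by blast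
 have "(\<integral>\<^sup>+ x. (\<omega> k x) ^ p \<partial>halfline) \<le> (\<integral>\<^sup>+ x. (\<mu> k x) ^ p \<partial>halfline)" for k
  by (intro nn_integral_mono power_mono) (auto simp: space_restrict_space assms)
 then show "\<exists>B<\<infinity>. \<forall>k. (\<integral>\<^sup>+ x. (\<omega> k x) ^ p \<partial>halfline) \<le> B" using B order_trans by blast
qed (rule assms)

lemma ennreal_mult_le_sum_squares: "(a::ennreal) * b \<le> a\<^sup>2 + b\<^sup>2"
proof (cases "a \<le> b")
 case True
 then have "a * b \<le> b * b" by (rule mult_right_mono) simp
 then show ?thesis by (simp add: power2_eq_square add_increasing)
next
 case False
 then have "a * b \<le> a * a" by (intro mult_left_mono) auto
 then show ?thesis by (simp add: power2_eq_square add_increasing2)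
qed

lemma ennreal_power_add_le: "((a::ennreal) + b) ^ p \<le> 2 ^ p * (a ^ p + b ^ p)"
proof -
 have "(a + b) ^ p \<le> (2 * max a b) ^ p"
  by (intro power_mono) (auto simp: mult_2 add_mono)
 also have "\<dots> = 2 ^ p * (max a b) ^ p" by (rule power_mult_distrib)
 also have "(max a b) ^ p \<le> a ^ p + b ^ p" by (auto simp: max_def add_increasing add_increasing2)
 finally show ?thesis by (simp add: mult_left_mono)
qed

lemma Lall_add: assumes "Lall \<omega>" "Lall \<mu>" shows "Lall (%k x. \<omega> k x + \<mu> k x)"
proof (rule LallI)
 note [measurable] = Lall_meas[OF assms(1)] Lall_meas[OF assms(2)]
 show "(%x. \<omega> k x + \<mu> k x) \<in> borel_measurable halfline" for k by measurable
 fix p :: nat assume p: "p \<ge> 1"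
 obtain B C where B: "B < \<infinity>" "!!k. (\<integral>\<^sup>+ x. (\<omega> k x) ^ p \<partial>halfline) \<le> B"
  and C: "C < \<infinity>" "!!k. (\<integral>\<^sup>+ x. (\<mu> k x) ^ p \<partial>halfline) \<le> C"
  using Lall_bound[OF assms(1) p] Lall_bound[OF assms(2) p] by blast
 have "(\<integral>\<^sup>+ x. (\<omega> k x + \<mu> k x) ^ p \<partial>halfline) \<le> 2 ^ p * (B + C)" for k
 proof -
  have "(\<integral>\<^sup>+ x. (\<omega> k x + \<mu> k x) ^ p \<partial>halfline) \<le> (\<integral>\<^sup>+ x. 2 ^ p * ((\<omega> k x) ^ p + (\<mu> k x) ^ p) \<partial>halfline)"
   by (intro nn_integral_mono ennreal_power_add_le)
  also have "\<dots> = 2 ^ p * ((\<integral>\<^sup>+ x. (\<omega> k x) ^ p \<partial>halfline) + (\<integral>\<^sup>+ x. (\<mu> k x) ^ p \<partial>halfline))"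
   by (subst nn_integral_cmult, measurable) (simp add: nn_integral_add)
  also have "\<dots> \<le> 2 ^ p * (B + C)" by (intro mult_left_mono add_mono B C) simp
  finally show ?thesis .
 qed
 moreover have "2 ^ p * (B + C) < \<infinity>" using B(1) C(1) by (simp add: ennreal_mult_less_top power_less_top_ennreal)
 ultimately show "\<exists>B<\<infinity>. \<forall>k. (\<integral>\<^sup>+ x. (\<omega> k x + \<mu> k x) ^ p \<partial>halfline) \<le> B" by blast
qed

lemma Lall_mult: assumes "Lall \<omega>" "Lall \<mu>" shows "Lall (%k x. \<omega> k x * \<mu> k x)"
proof (rule LallI)
 note [measurable] = Lall_meas[OF assms(1)] Lall_meas[OF assms(2)]
 show "(%x. \<omega> k x * \<mu> k x) \<in> borel_measurable halfline" for k by measurable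
 fix p :: nat assume p: "p \<ge> 1"
 then have p2: "2 * p \<ge> 1" by simp
 obtain B C where B: "B < \<infinity>" "!!k. (\<integral>\<^sup>+ x. (\<omega> k x) ^ (2 * p) \<partial>halfline) \<le> B"
  and C: "C < \<infinity>" "!!k. (\<integral>\<^sup>+ x. (\<mu> k x) ^ (2 * p) \<partial>halfline) \<le> C"
  using Lall_bound[OF assms(1) p2] Lall_bound[OF assms(2) p2] by blast
 have "(\<integral>\<^sup>+ x. (\<omega> k x * \<mu> k x) ^ p \<partial>halfline) \<le> B + C" for k
 proof -
  have "(\<integral>\<^sup>+ x. (\<omega> k x * \<mu> k x) ^ p \<partial>halfline) \<le> (\<integral>\<^sup>+ x. (\<omega> k x) ^ (2 * p) + (\<mu> k x) ^ (2 * p) \<partial>halfline)"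
   using ennreal_mult_le_sum_squares
   by (intro nn_integral_mono) (simp add: power_mult_distrib power_mult mult.commute[of 2])
  also have "\<dots> = (\<integral>\<^sup>+ x. (\<omega> k x) ^ (2 * p) \<partial>halfline) + (\<integral>\<^sup>+ x. (\<mu> k x) ^ (2 * p) \<partial>halfline)"
   by (simp add: nn_integral_add)
  also have "\<dots> \<le> B + C" by (intro add_mono B C)
  finally show ?thesis .
 qed
 then show "\<exists>B<\<infinity>. \<forall>k. (\<integral>\<^sup>+ x. (\<omega> k x * \<mu> k x) ^ p \<partial>halfline) \<le> B" using B(1) C(1)
  by (intro exI[of _ "B + C"]) simp
qed

lemma Lall_zero: "Lall (%_ _. 0)"
 by (rule LallI) (auto simp: power_0_left intro!: exI[of _ 0])

lemma Lall_cmult: assumes "Lall \<omega>" "B < \<infinity>" shows "Lall (%k x. B * \<omega> k x)"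
proof (rule LallI)
 note [measurable] = Lall_meas[OF assms(1)]
 show "(%x. B * \<omega> k x) \<in> borel_measurable halfline" for k by measurable
 fix p :: nat assume p: "p \<ge> 1"
 obtain C where C: "C < \<infinity>" "!!k. (\<integral>\<^sup>+ x. (\<omega> k x) ^ p \<partial>halfline) \<le> C"
  using Lall_bound[OF assms(1) p] by blast
 have "(\<integral>\<^sup>+ x. (B * \<omega> k x) ^ p \<partial>halfline) \<le> B ^ p * C" for k
  using C(2)[of k] by (simp add: power_mult_distrib nn_integral_cmult mult_left_mono)
 moreover have "B ^ p * C < \<infinity>" using assms(2) C(1) by (simp add: ennreal_mult_less_top power_less_top_ennreal)
 ultimately show "\<exists>C<\<infinity>. \<forall>k. (\<integral>\<^sup>+ x. (B * \<omega> k x) ^ p \<partial>halfline) \<le> C" by blast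
qed

definition wt :: "(real => ennreal) => nat set => (nat => real) => ennreal" where
 "wt \<omega> J t = (\<Prod>i\<in>J. 1 + \<omega> (t i))"

lemma measurable_wt: assumes [measurable]: "\<omega> \<in> borel_measurable halfline" shows "wt \<omega> J \<in> borel_measurable NM"
 unfolding wt_def[abs_def] by measurable

lemma dep_wt: "dep J (wt \<omega> J)"
 unfolding dep_def wt_def by (auto intro!: prod.cong)

lemma wt_Un: "finite X ==> finite Y ==> X \<inter> Y = {} ==> wt \<omega> (X \<union> Y) t = wt \<omega> X t * wt \<omega> Y t"
 by (simp add: wt_def prod.union_disjoint)

lemma wt_ge_1: "1 \<le> wt \<omega> J t"
 unfolding wt_def by (rule prod_ge_1) simp

lemma wt_mono: "(!!x. x \<ge> 0 ==> \<omega> x \<le> \<mu> x) ==> t \<in> space NM ==> wt \<omega> J t \<le> wt \<mu> J t"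
 unfolding wt_def
 by (induction J rule: infinite_finite_induct) (auto simp: space_NM intro!: mult_mono add_left_mono)

text \<open>The weighted marginal density of \<open>h\<^sup>2\<close> in the coordinate \<open>j\<close>.\<close>

definition marg :: "nat set => nat => (nat => (nat => real) => ennreal) => (nat => real => ennreal) => nat => real => ennreal" where
 "marg J j h \<omega> k x = lm (J - {j}) (%t. (h k t)\<^sup>2 * wt (\<omega> k) (J - {j}) t) ((%_. 0)(j := x))"

definition nsq :: "nat set => ((nat => real) => ennreal) => ennreal" where
 "nsq J h = lm J (%t. (h t)\<^sup>2) (%_. 0)"

text \<open>With \<open>b\<close>, the sequence stays bounded in \<open>L\<^sup>2\<close> also after weighting all but one variable with functions bounded in all \<open>L\<^sup>p\<close>, and its remaining marginal is again bounded in all \<open>L\<^sup>p\<close>; this is what makes star contractions harmless.\<close>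

definition Tame :: "bool => nat set => (nat => (nat => real) => ennreal) => bool" where
 "Tame b J h \<longleftrightarrow> finite J \<and> (\<forall>k. h k \<in> borel_measurable NM \<and> dep J (h k)) \<and>
  (\<exists>B<\<infinity>. \<forall>k. nsq J (h k) \<le> B) \<and>
  (b --> (\<forall>\<omega>. Lall \<omega> --> (\<forall>j\<in>J. Lall (marg J j h \<omega>))))"

lemma TameD:
 assumes "Tame b J h"
 shows "finite J" "h k \<in> borel_measurable NM" "dep J (h k)" "\<exists>B<\<infinity>. \<forall>k. nsq J (h k) \<le> B"
  "b ==> Lall \<omega> ==> j \<in> J ==> Lall (marg J j h \<omega>)"
 using assms unfolding Tame_def by blast+

lemma zero_space_NM [simp]: "(%_. 0) \<in> space NM"
 by (simp add: space_NM)

lemma measurable_marg: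
 assumes "finite J" "h k \<in> borel_measurable NM" "\<omega> k \<in> borel_measurable halfline"
 shows "marg J j h \<omega> k \<in> borel_measurable halfline"
proof -
 note [measurable] = assms(2) measurable_wt[OF assms(3)]
 have "(%t. (h k t)\<^sup>2 * wt (\<omega> k) (J - {j}) t) \<in> borel_measurable NM"
  by measurable
 then have m: "lm (J - {j}) (%t. (h k t)\<^sup>2 * wt (\<omega> k) (J - {j}) t) \<in> borel_measurable NM"
  using assms by (intro measurable_lm) auto
 have "(%x. (%_. 0)(j := x)) \<in> halfline \<rightarrow>\<^sub>M NM"
 proof (rule measurable_PiM_single')
  fix i show "(%x. ((%_. 0)(j := x)) i) \<in> halfline \<rightarrow>\<^sub>M halfline"
   by (cases "i = j") (auto simp: space_restrict_space)
 qed (auto simp: space_restrict_space)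
 from measurable_compose[OF this m] show ?thesis by (simp add: marg_def[abs_def])
qed

lemma marg_eq:
 assumes "dep J (h k)" "j \<in> J"
 shows "lm (J - {j}) (%t. (h k t)\<^sup>2 * wt (\<omega> k) (J - {j}) t) t = marg J j h \<omega> k (t j)"
proof -
 have "dep J (%t. (h k t)\<^sup>2 * wt (\<omega> k) (J - {j}) t)"
  by (rule dep_mono[OF dep_op2[OF dep_op1[OF assms(1), of "%x. x\<^sup>2"] dep_wt[of "J - {j}" "\<omega> k"], of "(*)"]]) auto
 then have "dep (J - (J - {j})) (lm (J - {j}) (%t. (h k t)\<^sup>2 * wt (\<omega> k) (J - {j}) t))" by (rule dep_lm)
 then show ?thesis unfolding marg_def by (rule depD) (use assms in auto)
qed

lemma nsq_eq: assumes "dep J h" shows "lm J (%t. (h t)\<^sup>2) t = nsq J h"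
 unfolding nsq_def by (rule depD[OF dep_lm[OF dep_op1[OF assms]]]) auto

lemma lm_eq_marginal_integral:
 assumes "finite J" "j \<in> J" and m: "\<phi> \<in> borel_measurable NM" and t: "t \<in> space NM"
 shows "lm J \<phi> t = (\<integral>\<^sup>+ x. lm (J - {j}) \<phi> (t(j := x)) \<partial>halfline)"
proof -
 have "lm J \<phi> t = lm ({j} \<union> (J - {j})) \<phi> t" using assms by (simp add: insert_absorb)
 also have "\<dots> = lm {j} (lm (J - {j}) \<phi>) t" by (rule lm_Un) (use assms in auto)
 also have "\<dots> = (\<integral>\<^sup>+ x. lm (J - {j}) \<phi> (t(j := x)) \<partial>halfline)"
  by (rule lm_singleton) (use assms in auto)
 finally show ?thesis .
qed

lemma Tame_weighted_norm:
 assumes T: "Tame True J h" and \<omega>: "Lall \<omega>"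
 shows "\<exists>B<\<infinity>. \<forall>k t. t \<in> space NM --> lm J (%t. (h k t)\<^sup>2 * wt (\<omega> k) J t) t \<le> B"
proof (cases "J = {}")
 case True
 obtain B where B: "B < \<infinity>" "!!k. nsq J (h k) \<le> B" using TameD(4)[OF T] by blast
 have "(h k t)\<^sup>2 \<le> B" for k t
  using B(2)[of k] nsq_eq[OF TameD(3)[OF T], of k t] True by simp
 then show ?thesis using B(1) True by (auto simp: wt_def)
next
 case False
 then obtain j where j: "j \<in> J" by blast
 note fin = TameD(1)[OF T] and [measurable] = TameD(2)[OF T] and dp = TameD(3)[OF T]
 have mL: "Lall (marg J j h \<omega>)" using TameD(5)[OF T _ \<omega> j] by simp
 note [measurable] = Lall_meas[OF mL] Lall_meas[OF \<omega>] measurable_wt[OF Lall_meas[OF \<omega>]]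
 have sumL: "Lall (%k x. marg J j h \<omega> k x + \<omega> k x * marg J j h \<omega> k x)"
  by (intro Lall_add Lall_mult mL \<omega>)
 obtain B where B: "B < \<infinity>" "!!k. (\<integral>\<^sup>+ x. (marg J j h \<omega> k x + \<omega> k x * marg J j h \<omega> k x) ^ 1 \<partial>halfline) \<le> B"
  using Lall_bound[OF sumL, of 1] by blast
 have "lm J (%t. (h k t)\<^sup>2 * wt (\<omega> k) J t) t \<le> B" if t: "t \<in> space NM" for k t
 proof -
  have "lm J (%t. (h k t)\<^sup>2 * wt (\<omega> k) J t) t = (\<integral>\<^sup>+ x. lm (J - {j}) (%t. (h k t)\<^sup>2 * wt (\<omega> k) J t) (t(j := x)) \<partial>halfline)"
   by (rule lm_eq_marginal_integral[OF fin j _ t]) measurable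
  also have "\<dots> = (\<integral>\<^sup>+ x. marg J j h \<omega> k x + \<omega> k x * marg J j h \<omega> k x \<partial>halfline)"
  proof (rule nn_integral_cong)
   fix x assume "x \<in> space halfline"
   then have tx: "t(j := x) \<in> space NM" using t by (auto simp: space_NM space_restrict_space)
   have "wt (\<omega> k) J t = (1 + \<omega> k (t j)) * wt (\<omega> k) (J - {j}) t" for t
    unfolding wt_def using fin j by (simp add: prod.remove)
   then have "lm (J - {j}) (%t. (h k t)\<^sup>2 * wt (\<omega> k) J t) (t(j := x)) =
     lm (J - {j}) (%t. (1 + \<omega> k (t j)) * ((h k t)\<^sup>2 * wt (\<omega> k) (J - {j}) t)) (t(j := x))"
    by (simp add: mult_ac)
   also have "\<dots> = (1 + \<omega> k ((t(j := x)) j)) * lm (J - {j}) (%t. (h k t)\<^sup>2 * wt (\<omega> k) (J - {j}) t) (t(j := x))"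
    by (rule lm_cmult[of "{j}"]) (use tx in \<open>auto simp: dep_def\<close>)
   also have "\<dots> = (1 + \<omega> k x) * marg J j h \<omega> k x" by (simp add: marg_eq[where h = h and k = k, OF dp j])
   finally show "lm (J - {j}) (%t. (h k t)\<^sup>2 * wt (\<omega> k) J t) (t(j := x)) = marg J j h \<omega> k x + \<omega> k x * marg J j h \<omega> k x"
    by (simp add: distrib_right)
  qed
  also have "\<dots> \<le> B" using B(2)[of k] by simp
  finally show ?thesis .
 qed
 then show ?thesis using B(1) by blast
qed

lemma Tame_mono:
 assumes T: "Tame b J h'" and m: "!!k. h k \<in> borel_measurable NM" and d: "!!k. dep J (h k)"
  and le: "!!k t. t \<in> space NM ==> h k t \<le> h' k t"
 shows "Tame b J h"
proof -
 have *: "lm K (%t. (h k t)\<^sup>2 * u t) t \<le> lm K (%t. (h' k t)\<^sup>2 * u t) t" if "t \<in> space NM" for k K u t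
  by (rule lm_mono[OF _ that]) (intro mult_right_mono power_mono le, auto)
 have "nsq J (h k) \<le> nsq J (h' k)" for k
  unfolding nsq_def using *[of "%_. 0" J k "%_. 1"] by simp
 moreover have "Lall (marg J j h \<omega>)" if "b" "Lall \<omega>" "j \<in> J" for \<omega> j
 proof (rule Lall_mono[OF TameD(5)[OF T that]])
  show "marg J j h \<omega> k \<in> borel_measurable halfline" for k
   by (rule measurable_marg[where h = h, OF TameD(1)[OF T] m Lall_meas[OF that(2)]])
  show "marg J j h \<omega> k x \<le> marg J j h' \<omega> k x" if "x \<ge> 0" for k x
   unfolding marg_def by (rule *) (use that in \<open>auto simp: space_NM\<close>)
 qed
 ultimately show ?thesis
  unfolding Tame_def using TameD(1,4)[OF T] m d by (meson order_trans)
qed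

section \<open>Gluing two kernels along common coordinates\<close>

definition glue :: "nat set => ((nat => real) => ennreal) => ((nat => real) => ennreal) => (nat => real) => ennreal" where
 "glue C h w = lm C (%t. h t * w t)"

text \<open>\<open>C\<close> is integrated out; at most one further coordinate may be shared, and only if \<open>b\<close> holds.\<close>

definition gluable :: "bool => nat set => nat set => nat set => bool" where
 "gluable b J1 J2 C \<longleftrightarrow> C \<subseteq> J1 \<inter> J2 \<and> (J1 \<inter> J2 \<subseteq> C \<or> (b \<and> (\<exists>x. x \<notin> C \<and> J1 \<inter> J2 = insert x C)))"

lemma gluable_sym: "gluable b J1 J2 C \<longleftrightarrow> gluable b J2 J1 C"
 by (simp add: gluable_def Int_commute)

lemma glue_sym: "glue C h w = glue C w h"
 by (simp add: glue_def mult.commute)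

lemma measurable_glue:
 "finite C ==> h \<in> borel_measurable NM ==> w \<in> borel_measurable NM ==> glue C h w \<in> borel_measurable NM"
 unfolding glue_def by (intro measurable_lm borel_measurable_times_ennreal)

lemma dep_glue: "dep J1 h ==> dep J2 w ==> dep (J1 \<union> J2 - C) (glue C h w)"
 unfolding glue_def by (intro dep_lm dep_op2)

lemma glue_sq_le:
 assumes "h \<in> borel_measurable NM" "w \<in> borel_measurable NM" "t \<in> space NM"
 shows "(glue C h w t)\<^sup>2 \<le> lm C (%t. (h t)\<^sup>2) t * lm C (%t. (w t)\<^sup>2) t"
 unfolding glue_def by (rule lm_Cauchy_Schwarz[OF assms])

lemma weight_mono: "(a::ennreal) \<le> b ==> c \<le> d ==> a * c \<le> b * d"
 by (rule mult_mono) auto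

text \<open>Integrating a weighted square first over \<open>C\<close> and then over \<open>K\<close> is dominated by integrating it
 over \<open>C \<union> K\<close> with weights on \<open>C\<close> as well.\<close>

lemma lm_sq_weight_le:
 assumes fin: "finite C" "finite K" and disj: "K \<inter> C = {}" and h: "h \<in> borel_measurable NM"
  and \<omega>: "\<omega> \<in> borel_measurable halfline" and t: "t \<in> space NM"
 shows "lm K (%t. lm C (%t. (h t)\<^sup>2) t * wt \<omega> K t) t \<le> lm (K \<union> C) (%t. (h t)\<^sup>2 * wt \<omega> (K \<union> C) t) t"
proof -
 note [measurable] = h measurable_wt[OF \<omega>]
 have "lm K (%t. lm C (%t. (h t)\<^sup>2) t * wt \<omega> K t) t = lm K (lm C (%t. wt \<omega> K t * (h t)\<^sup>2)) t"
 proof (rule lm_cong[OF _ t])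
  fix t assume "t \<in> space NM"
  then have "lm C (%t. wt \<omega> K t * (h t)\<^sup>2) t = wt \<omega> K t * lm C (%t. (h t)\<^sup>2) t"
   by (intro lm_cmult[OF dep_wt disj]) auto
  then show "lm C (%t. (h t)\<^sup>2) t * wt \<omega> K t = lm C (%t. wt \<omega> K t * (h t)\<^sup>2) t"
   by (simp only: mult.commute)
 qed
 also have "\<dots> = lm (K \<union> C) (%t. wt \<omega> K t * (h t)\<^sup>2) t"
  by (rule lm_Un[symmetric]) (use fin disj t in auto)
 also have "\<dots> \<le> lm (K \<union> C) (%t. (h t)\<^sup>2 * wt \<omega> (K \<union> C) t) t"
 proof (rule lm_mono[OF _ t])
  fix t
  have "(h t)\<^sup>2 * (wt \<omega> K t * 1) \<le> (h t)\<^sup>2 * (wt \<omega> K t * wt \<omega> C t)"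
   by (intro mult_left_mono wt_ge_1) auto
  then show "wt \<omega> K t * (h t)\<^sup>2 \<le> (h t)\<^sup>2 * wt \<omega> (K \<union> C) t"
   using fin disj by (simp add: wt_Un mult.commute)
 qed
 finally show ?thesis .
qed

lemma Lall_marg_glue_left:
 assumes h: "Tame True J1 h" and w: "Tame True J2 w" and g: "gluable True J1 J2 C"
  and \<omega>: "Lall \<omega>" and j: "j \<in> J1 - C"
 shows "Lall (marg (J1 \<union> J2 - C) j (%k. glue C (h k) (w k)) \<omega>)"
proof -
 note fin1 = TameD(1)[OF h] and fin2 = TameD(1)[OF w]
 note mh [measurable] = TameD(2)[OF h] and mw [measurable] = TameD(2)[OF w]
 note dh = TameD(3)[OF h] and dw = TameD(3)[OF w]
 note m\<omega> = Lall_meas[OF \<omega>]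
 note [measurable] = measurable_wt[OF m\<omega>]
 have C: "C \<subseteq> J1" "C \<subseteq> J2" using g by (auto simp: gluable_def)
 have finC: "finite C" using C fin1 finite_subset by blast
 define J where "J = J1 \<union> J2 - C"
 define Hs where "Hs k = lm C (%t. (h k t)\<^sup>2)" for k
 define Ws where "Ws k = lm C (%t. (w k t)\<^sup>2)" for k
 have [measurable]: "Hs k \<in> borel_measurable NM" "Ws k \<in> borel_measurable NM" for k
  unfolding Hs_def Ws_def using finC by (auto intro!: measurable_lm)
 have dHs: "dep (J1 - C) (Hs k)" and dWs: "dep (J2 - C) (Ws k)" for k
  unfolding Hs_def Ws_def by (intro dep_lm dep_op1[of _ _ "%x. x\<^sup>2"] dh dw)+
 have mg: "marg J j (%k. glue C (h k) (w k)) \<omega> k \<in> borel_measurable halfline" for k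
  by (rule measurable_marg) (use fin1 fin2 finC m\<omega> mh mw in \<open>auto simp: J_def intro!: measurable_glue\<close>)
 have ub: "marg J j (%k. glue C (h k) (w k)) \<omega> k x \<le>
   lm (J - {j}) (%t. Hs k t * Ws k t * wt (\<omega> k) (J - {j}) t) ((%_. 0)(j := x))" if "x \<ge> 0" for k x
  unfolding marg_def
  by (rule lm_mono) (use that in \<open>auto simp: space_NM Hs_def Ws_def intro!: mult_right_mono glue_sq_le mh mw\<close>)
 consider (plain) "j \<notin> J2" "J1 \<inter> J2 \<subseteq> C" | (both) "j \<in> J2" "J1 \<inter> J2 = insert j C"
  | (star) x where "j \<notin> J2" "x \<notin> C" "J1 \<inter> J2 = insert x C"
 proof (cases "J1 \<inter> J2 \<subseteq> C")
  case True
  then show ?thesis using j by (intro plain) auto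
 next
  case False
  then obtain x where x: "x \<notin> C" "J1 \<inter> J2 = insert x C" using g by (auto simp: gluable_def)
  show ?thesis
  proof (cases "x = j")
   case True
   then show ?thesis using x by (intro both) auto
  next
   case False
   have "j \<notin> J2"
   proof
    assume "j \<in> J2"
    then have "j \<in> insert x C" unfolding x(2)[symmetric] using j by simp
    then show False using False j by auto
   qed
   then show ?thesis by (rule star[OF _ x])
  qed
 qed
 then show ?thesis
 proof cases
  case plain
  obtain B where B: "B < \<infinity>" "!!k t. t \<in> space NM ==> lm J2 (%t. (w k t)\<^sup>2 * wt (\<omega> k) J2 t) t \<le> B"
   using Tame_weighted_norm[OF w \<omega>] by blast
  have "Lall (%k x. B * marg J1 j h \<omega> k x)" using TameD(5)[OF h _ \<omega>, of j] j B(1) by (intro Lall_cmult) auto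
  moreover have "marg J j (%k. glue C (h k) (w k)) \<omega> k x \<le> B * marg J1 j h \<omega> k x" if x: "x \<ge> 0" for k x
  proof -
   define t0 where "t0 = ((%_. 0)(j := x) :: nat => real)"
   have t0: "t0 \<in> space NM" using x by (auto simp: t0_def space_NM)
   define K1 where "K1 = J1 - C - {j}"
   define K2 where "K2 = J2 - C"
   have K: "J - {j} = K1 \<union> K2" "K1 \<inter> K2 = {}" "finite K1" "finite K2" "K1 \<inter> C = {}" "K2 \<inter> C = {}"
    "K1 \<union> C = J1 - {j}" "K2 \<union> C = J2"
    using plain j fin1 fin2 C by (auto simp: J_def K1_def K2_def)
   have "lm (J - {j}) (%t. Hs k t * Ws k t * wt (\<omega> k) (J - {j}) t) t0 =
     lm (K1 \<union> K2) (%t. (Hs k t * wt (\<omega> k) K1 t) * (Ws k t * wt (\<omega> k) K2 t)) t0"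
    by (simp add: K(1) wt_Un K(2-4) mult_ac)
   also have "\<dots> = lm K1 (%t. Hs k t * wt (\<omega> k) K1 t) t0 * lm K2 (%t. Ws k t * wt (\<omega> k) K2 t) t0"
   proof (rule lm_mult_indep[OF K(3,4,2)])
    show "dep (J1 - C) (%t. Hs k t * wt (\<omega> k) K1 t)"
     by (rule dep_mono[OF dep_op2[OF dHs dep_wt]]) (auto simp: K1_def)
    show "dep (J2 - C) (%t. Ws k t * wt (\<omega> k) K2 t)"
     by (rule dep_mono[OF dep_op2[OF dWs dep_wt]]) (auto simp: K2_def)
   qed (use plain j t0 C in \<open>auto simp: K1_def K2_def\<close>)
   also have "\<dots> \<le> lm (K1 \<union> C) (%t. (h k t)\<^sup>2 * wt (\<omega> k) (K1 \<union> C) t) t0 *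
     lm (K2 \<union> C) (%t. (w k t)\<^sup>2 * wt (\<omega> k) (K2 \<union> C) t) t0"
    unfolding Hs_def Ws_def
    by (intro weight_mono lm_sq_weight_le finC K t0 m\<omega> mh mw)
   also have "\<dots> \<le> marg J1 j h \<omega> k x * B"
    unfolding K(7,8) by (intro weight_mono B(2) t0) (simp add: marg_def t0_def)
   finally have "lm (J - {j}) (%t. Hs k t * Ws k t * wt (\<omega> k) (J - {j}) t) t0 \<le> B * marg J1 j h \<omega> k x"
    by (simp only: mult.commute)
   then show ?thesis by (rule order_trans[OF ub[OF x, of k, folded t0_def]])
  qed
  ultimately show ?thesis unfolding J_def[symmetric] by (rule Lall_mono[OF _ mg])
 next
  case both
  have "Lall (%k x. marg J1 j h \<omega> k x * marg J2 j w \<omega> k x)"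
   using TameD(5)[OF h _ \<omega>, of j] TameD(5)[OF w _ \<omega>, of j] j both by (intro Lall_mult) auto
  moreover have "marg J j (%k. glue C (h k) (w k)) \<omega> k x \<le> marg J1 j h \<omega> k x * marg J2 j w \<omega> k x" if x: "x \<ge> 0" for k x
  proof -
   define t0 where "t0 = ((%_. 0)(j := x) :: nat => real)"
   have t0: "t0 \<in> space NM" using x by (auto simp: t0_def space_NM)
   define K1 where "K1 = J1 - C - {j}"
   define K2 where "K2 = J2 - C - {j}"
   have K: "J - {j} = K1 \<union> K2" "K1 \<inter> K2 = {}" "finite K1" "finite K2" "K1 \<inter> C = {}" "K2 \<inter> C = {}"
    "K1 \<union> C = J1 - {j}" "K2 \<union> C = J2 - {j}"
    using both j fin1 fin2 C by (auto simp: J_def K1_def K2_def)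
   have "lm (J - {j}) (%t. Hs k t * Ws k t * wt (\<omega> k) (J - {j}) t) t0 =
     lm (K1 \<union> K2) (%t. (Hs k t * wt (\<omega> k) K1 t) * (Ws k t * wt (\<omega> k) K2 t)) t0"
    by (simp add: K(1) wt_Un K(2-4) mult_ac)
   also have "\<dots> = lm K1 (%t. Hs k t * wt (\<omega> k) K1 t) t0 * lm K2 (%t. Ws k t * wt (\<omega> k) K2 t) t0"
   proof (rule lm_mult_indep[OF K(3,4,2)])
    show "dep (J1 - C) (%t. Hs k t * wt (\<omega> k) K1 t)"
     by (rule dep_mono[OF dep_op2[OF dHs dep_wt]]) (auto simp: K1_def)
    show "dep (J2 - C) (%t. Ws k t * wt (\<omega> k) K2 t)"
     by (rule dep_mono[OF dep_op2[OF dWs dep_wt]]) (auto simp: K2_def)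
   qed (use both j t0 C in \<open>auto simp: K1_def K2_def\<close>)
   also have "\<dots> \<le> lm (K1 \<union> C) (%t. (h k t)\<^sup>2 * wt (\<omega> k) (K1 \<union> C) t) t0 *
     lm (K2 \<union> C) (%t. (w k t)\<^sup>2 * wt (\<omega> k) (K2 \<union> C) t) t0"
    unfolding Hs_def Ws_def
    by (intro weight_mono lm_sq_weight_le finC K t0 m\<omega> mh mw)
   also have "\<dots> = marg J1 j h \<omega> k x * marg J2 j w \<omega> k x"
    unfolding K(7,8) by (simp add: marg_def t0_def)
   finally show ?thesis by (rule order_trans[OF ub[OF x, of k, folded t0_def]])
  qed
  ultimately show ?thesis unfolding J_def[symmetric] by (rule Lall_mono[OF _ mg])
 next
  case star
  have xJ: "x \<in> J1" "x \<in> J2" "x \<noteq> j" using star by auto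
  have Lw: "Lall (marg J2 x w \<omega>)" using TameD(5)[OF w _ \<omega> xJ(2)] by simp
  define \<omega>' where "\<omega>' k y = \<omega> k y + (marg J2 x w \<omega> k y + \<omega> k y * marg J2 x w \<omega> k y)" for k y
  have L': "Lall \<omega>'" unfolding \<omega>'_def[abs_def] by (intro Lall_add Lall_mult \<omega> Lw)
  note m\<omega>' = Lall_meas[OF L']
  note [measurable] = Lall_meas[OF Lw] m\<omega> measurable_wt[OF m\<omega>']
  have "Lall (marg J1 j h \<omega>')" using TameD(5)[OF h _ L', of j] j by auto
  moreover have "marg J j (%k. glue C (h k) (w k)) \<omega> k y \<le> marg J1 j h \<omega>' k y" if y: "y \<ge> 0" for k y
  proof -
   define t0 where "t0 = ((%_. 0)(j := y) :: nat => real)"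
   have t0: "t0 \<in> space NM" using y by (auto simp: t0_def space_NM)
   define K1 where "K1 = J1 - C - {j, x}"
   define K2 where "K2 = J2 - C - {x}"
   have K: "J - {j} = {x} \<union> (K1 \<union> K2)" "K1 \<inter> K2 = {}" "finite K1" "finite K2" "K1 \<inter> C = {}" "K2 \<inter> C = {}"
    "K1 \<union> C = J1 - {j} - {x}" "K2 \<union> C = J2 - {x}" "{x} \<inter> (K1 \<union> K2) = {}"
    using star j fin1 fin2 C by (auto simp: J_def K1_def K2_def)
   have "lm (J - {j}) (%t. Hs k t * Ws k t * wt (\<omega> k) (J - {j}) t) t0 =
     lm {x} (lm (K1 \<union> K2) (%t. Hs k t * Ws k t * wt (\<omega> k) (J - {j}) t)) t0"
    unfolding K(1) by (rule lm_Un) (use K t0 in auto)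
   also have "\<dots> \<le> lm {x} (lm (J1 - {j} - {x}) (%t. (h k t)\<^sup>2 * wt (\<omega>' k) (J1 - {j}) t)) t0"
   proof (rule lm_mono[OF _ t0])
    fix t assume t: "t \<in> space NM"
    have "lm (K1 \<union> K2) (%t. Hs k t * Ws k t * wt (\<omega> k) (J - {j}) t) t =
      lm (K1 \<union> K2) (%t. (1 + \<omega> k (t x)) * ((Hs k t * wt (\<omega> k) K1 t) * (Ws k t * wt (\<omega> k) K2 t))) t"
    proof -
     have "wt (\<omega> k) (J - {j}) t = (1 + \<omega> k (t x)) * (wt (\<omega> k) K1 t * wt (\<omega> k) K2 t)" for t
      unfolding K(1) using K by (subst wt_Un) (auto simp: wt_Un wt_def[of _ "{x}"])
     then show ?thesis by (simp add: mult_ac)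
    qed
    also have "\<dots> = (1 + \<omega> k (t x)) * lm (K1 \<union> K2) (%t. (Hs k t * wt (\<omega> k) K1 t) * (Ws k t * wt (\<omega> k) K2 t)) t"
     by (rule lm_cmult[of "{x}"]) (use t K in \<open>auto simp: dep_def\<close>)
    finally have one: "lm (K1 \<union> K2) (%t. Hs k t * Ws k t * wt (\<omega> k) (J - {j}) t) t =
      (1 + \<omega> k (t x)) * lm (K1 \<union> K2) (%t. (Hs k t * wt (\<omega> k) K1 t) * (Ws k t * wt (\<omega> k) K2 t)) t" .
    have "lm (K1 \<union> K2) (%t. (Hs k t * wt (\<omega> k) K1 t) * (Ws k t * wt (\<omega> k) K2 t)) t =
      lm K1 (%t. Hs k t * wt (\<omega> k) K1 t) t * lm K2 (%t. Ws k t * wt (\<omega> k) K2 t) t"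
    proof (rule lm_mult_indep[OF K(3,4,2)])
     show "dep (J1 - C) (%t. Hs k t * wt (\<omega> k) K1 t)"
      by (rule dep_mono[OF dep_op2[OF dHs dep_wt]]) (auto simp: K1_def)
     show "dep (J2 - C) (%t. Ws k t * wt (\<omega> k) K2 t)"
      by (rule dep_mono[OF dep_op2[OF dWs dep_wt]]) (auto simp: K2_def)
    qed (use star j t C in \<open>auto simp: K1_def K2_def\<close>)
    also have "\<dots> \<le> lm (K1 \<union> C) (%t. (h k t)\<^sup>2 * wt (\<omega> k) (K1 \<union> C) t) t *
      lm (K2 \<union> C) (%t. (w k t)\<^sup>2 * wt (\<omega> k) (K2 \<union> C) t) t"
     unfolding Hs_def Ws_def
     by (intro weight_mono lm_sq_weight_le finC K t m\<omega> mh mw)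
    also have "\<dots> \<le> lm (J1 - {j} - {x}) (%t. (h k t)\<^sup>2 * wt (\<omega>' k) (J1 - {j} - {x}) t) t * marg J2 x w \<omega> k (t x)"
     unfolding K(7,8)
     by (intro weight_mono lm_mono t mult_left_mono wt_mono) (auto simp: \<omega>'_def marg_eq[where h = w and k = k, OF dw xJ(2)])
    finally have two: "lm (K1 \<union> K2) (%t. (Hs k t * wt (\<omega> k) K1 t) * (Ws k t * wt (\<omega> k) K2 t)) t \<le>
      lm (J1 - {j} - {x}) (%t. (h k t)\<^sup>2 * wt (\<omega>' k) (J1 - {j} - {x}) t) t * marg J2 x w \<omega> k (t x)" .
    have "lm (K1 \<union> K2) (%t. Hs k t * Ws k t * wt (\<omega> k) (J - {j}) t) t \<le> (1 + \<omega> k (t x)) *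
      (lm (J1 - {j} - {x}) (%t. (h k t)\<^sup>2 * wt (\<omega>' k) (J1 - {j} - {x}) t) t * marg J2 x w \<omega> k (t x))"
     unfolding one by (rule mult_left_mono[OF two]) simp
    also have "\<dots> = ((1 + \<omega> k (t x)) * marg J2 x w \<omega> k (t x)) *
      lm (J1 - {j} - {x}) (%t. (h k t)\<^sup>2 * wt (\<omega>' k) (J1 - {j} - {x}) t) t"
     by (simp only: mult_ac)
    also have "\<dots> \<le> (1 + \<omega>' k (t x)) * lm (J1 - {j} - {x}) (%t. (h k t)\<^sup>2 * wt (\<omega>' k) (J1 - {j} - {x}) t) t"
     by (intro mult_right_mono) (auto simp: \<omega>'_def distrib_right add_increasing)
    also have "\<dots> = lm (J1 - {j} - {x}) (%t. (1 + \<omega>' k (t x)) * ((h k t)\<^sup>2 * wt (\<omega>' k) (J1 - {j} - {x}) t)) t"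
     by (rule lm_cmult[of "{x}", symmetric]) (use t in \<open>auto simp: dep_def\<close>)
    also have "\<dots> = lm (J1 - {j} - {x}) (%t. (h k t)\<^sup>2 * wt (\<omega>' k) (J1 - {j}) t) t"
    proof -
     have "wt (\<omega>' k) (J1 - {j}) t = (1 + \<omega>' k (t x)) * wt (\<omega>' k) (J1 - {j} - {x}) t" for t
      unfolding wt_def using fin1 xJ by (intro prod.remove) auto
     then show ?thesis by (simp add: mult_ac)
    qed
    finally show "lm (K1 \<union> K2) (%t. Hs k t * Ws k t * wt (\<omega> k) (J - {j}) t) t \<le>
      lm (J1 - {j} - {x}) (%t. (h k t)\<^sup>2 * wt (\<omega>' k) (J1 - {j}) t) t" .
   qed
   also have "\<dots> = lm ({x} \<union> (J1 - {j} - {x})) (%t. (h k t)\<^sup>2 * wt (\<omega>' k) (J1 - {j}) t) t0"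
    by (rule lm_Un[symmetric]) (use fin1 t0 in auto)
   also have "{x} \<union> (J1 - {j} - {x}) = J1 - {j}" using xJ by auto
   finally have "lm (J - {j}) (%t. Hs k t * Ws k t * wt (\<omega> k) (J - {j}) t) t0 \<le> marg J1 j h \<omega>' k y"
    by (simp only: marg_def t0_def)
   then show ?thesis by (rule order_trans[OF ub[OF y, of k, folded t0_def]])
  qed
  ultimately show ?thesis unfolding J_def[symmetric] by (rule Lall_mono[OF _ mg])
 qed
qed

text \<open>The squared norm of a glued kernel, in the two cases of \<open>gluable\<close>.\<close>

lemma nsq_glue_plain:
 assumes fin: "finite J1" "finite J2" and m: "h \<in> borel_measurable NM" "w \<in> borel_measurable NM"
  and d: "dep J1 h" "dep J2 w" and C: "C = J1 \<inter> J2"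
 shows "nsq (J1 \<union> J2 - C) (glue C h w) \<le> nsq J1 h * nsq J2 w"
proof -
 note [measurable] = m
 have finC: "finite C" using fin C by auto
 define Hs where "Hs = lm C (%t. (h t)\<^sup>2)"
 define Ws where "Ws = lm C (%t. (w t)\<^sup>2)"
 have [measurable]: "Hs \<in> borel_measurable NM" "Ws \<in> borel_measurable NM"
  unfolding Hs_def Ws_def using finC by (auto intro!: measurable_lm)
 have dHs: "dep (J1 - C) Hs" and dWs: "dep (J2 - C) Ws"
  unfolding Hs_def Ws_def by (intro dep_lm dep_op1[of _ _ "%x. x\<^sup>2"] d)+
 have "nsq (J1 \<union> J2 - C) (glue C h w) \<le> lm (J1 \<union> J2 - C) (%t. Hs t * Ws t) (%_. 0)"
  unfolding nsq_def Hs_def Ws_def by (intro lm_mono glue_sq_le m) auto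
 also have "\<dots> = lm (J1 - C) Hs (%_. 0) * lm (J2 - C) Ws (%_. 0)"
 proof -
  have "J1 \<union> J2 - C = (J1 - C) \<union> (J2 - C)" by auto
  then show ?thesis
   by (simp only:) (rule lm_mult_indep[OF _ _ _ dHs _ dWs], use fin C in auto)
 qed
 also have "lm (J1 - C) Hs (%_. 0) = lm ((J1 - C) \<union> C) (%t. (h t)\<^sup>2) (%_. 0)"
  unfolding Hs_def by (rule lm_Un[symmetric]) (use fin finC in auto)
 also have "(J1 - C) \<union> C = J1" using C by auto
 also have "lm (J2 - C) Ws (%_. 0) = lm ((J2 - C) \<union> C) (%t. (w t)\<^sup>2) (%_. 0)"
  unfolding Ws_def by (rule lm_Un[symmetric]) (use fin finC in auto)
 also have "(J2 - C) \<union> C = J2" using C by auto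
 finally show ?thesis by (simp add: nsq_def)
qed

definition umarg :: "nat set => nat => ((nat => real) => ennreal) => real => ennreal" where
 "umarg J j h x = lm (J - {j}) (%t. (h t)\<^sup>2) ((%_. 0)(j := x))"

lemma umarg_eq_marg: "umarg J j (h k) x = marg J j h (%_ _. 0) k x"
 by (simp add: umarg_def marg_def wt_def)

lemma nsq_glue_star:
 assumes fin: "finite J1" "finite J2" and m: "h \<in> borel_measurable NM" "w \<in> borel_measurable NM"
  and d: "dep J1 h" "dep J2 w" and C: "J1 \<inter> J2 = insert x C" "x \<notin> C"
 shows "nsq (J1 \<union> J2 - C) (glue C h w) \<le> (\<integral>\<^sup>+ y. umarg J1 x h y * umarg J2 x w y \<partial>halfline)"
proof -
 note [measurable] = m
 have finC: "finite C" by (rule finite_subset[OF _ fin(1)]) (use C in auto)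
 define Hs where "Hs = lm C (%t. (h t)\<^sup>2)"
 define Ws where "Ws = lm C (%t. (w t)\<^sup>2)"
 have [measurable]: "Hs \<in> borel_measurable NM" "Ws \<in> borel_measurable NM"
  unfolding Hs_def Ws_def using finC by (auto intro!: measurable_lm)
 have dHs: "dep (J1 - C) Hs" and dWs: "dep (J2 - C) Ws"
  unfolding Hs_def Ws_def by (intro dep_lm dep_op1[of _ _ "%x. x\<^sup>2"] d)+
 have xJ: "x \<in> J1" "x \<in> J2" using C by auto
 define K1 where "K1 = J1 - C - {x}"
 define K2 where "K2 = J2 - C - {x}"
 have K: "J1 \<union> J2 - C - {x} = K1 \<union> K2" "finite K1" "finite K2" "K1 \<inter> K2 = {}"
  "K1 \<union> C = J1 - {x}" "K2 \<union> C = J2 - {x}" "K1 \<inter> C = {}" "K2 \<inter> C = {}"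
  using C fin by (auto simp: K1_def K2_def)
 have "nsq (J1 \<union> J2 - C) (glue C h w) \<le> lm (J1 \<union> J2 - C) (%t. Hs t * Ws t) (%_. 0)"
  unfolding nsq_def Hs_def Ws_def by (intro lm_mono glue_sq_le m) auto
 also have "\<dots> = (\<integral>\<^sup>+ y. lm (J1 \<union> J2 - C - {x}) (%t. Hs t * Ws t) ((%_. 0)(x := y)) \<partial>halfline)"
  by (rule lm_eq_marginal_integral) (use fin xJ C in auto)
 also have "\<dots> = (\<integral>\<^sup>+ y. umarg J1 x h y * umarg J2 x w y \<partial>halfline)"
 proof (rule nn_integral_cong)
  fix y assume "y \<in> space halfline"
  then have t: "(%_. 0)(x := y) \<in> space NM" by (auto simp: space_NM space_restrict_space)
  have "lm (K1 \<union> K2) (%t. Hs t * Ws t) ((%_. 0)(x := y)) = lm K1 Hs ((%_. 0)(x := y)) * lm K2 Ws ((%_. 0)(x := y))"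
   by (rule lm_mult_indep[OF K(2-4) dHs _ dWs]) (use t C in \<open>auto simp: K1_def K2_def\<close>)
  moreover have "lm K1 Hs ((%_. 0)(x := y)) = umarg J1 x h y"
   unfolding Hs_def umarg_def K(5)[symmetric] by (rule lm_Un[symmetric]) (use t K finC in auto)
  moreover have "lm K2 Ws ((%_. 0)(x := y)) = umarg J2 x w y"
   unfolding Ws_def umarg_def K(6)[symmetric] by (rule lm_Un[symmetric]) (use t K finC in auto)
  ultimately show "lm (J1 \<union> J2 - C - {x}) (%t. Hs t * Ws t) ((%_. 0)(x := y)) = umarg J1 x h y * umarg J2 x w y"
   by (simp add: K(1))
 qed
 finally show ?thesis .
qed

lemma Lall_umarg: "Tame b J h ==> b ==> j \<in> J ==> Lall (%k. umarg J j (h k))"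
proof -
 assume "Tame b J h" b "j \<in> J"
 then have "Lall (marg J j h (%_ _. 0))" using TameD(5)[OF _ _ Lall_zero] by blast
 moreover have "(%k. umarg J j (h k)) = marg J j h (%_ _. 0)" by (intro ext) (rule umarg_eq_marg)
 ultimately show ?thesis by simp
qed

text \<open>Tame sequences are closed under gluing: the weighted marginals of the glued kernel are dominated by
 weighted marginals of one factor, with those of the other factor as a new weight.\<close>

lemma Tame_glue:
 assumes h: "Tame b J1 h" and w: "Tame b J2 w" and g: "gluable b J1 J2 C"
 shows "Tame b (J1 \<union> J2 - C) (%k. glue C (h k) (w k))"
proof -
 note fin1 = TameD(1)[OF h] and fin2 = TameD(1)[OF w]
 note mh [measurable] = TameD(2)[OF h] and mw [measurable] = TameD(2)[OF w]
 note dh = TameD(3)[OF h] and dw = TameD(3)[OF w]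
 have C: "C \<subseteq> J1" "C \<subseteq> J2" using g by (auto simp: gluable_def)
 have finC: "finite C" using C fin1 finite_subset by blast
 have bound: "\<exists>B<\<infinity>. \<forall>k. nsq (J1 \<union> J2 - C) (glue C (h k) (w k)) \<le> B"
 proof (cases "J1 \<inter> J2 \<subseteq> C")
  case True
  then have C_eq: "C = J1 \<inter> J2" using C by auto
  obtain B1 B2 where B: "B1 < \<infinity>" "!!k. nsq J1 (h k) \<le> B1" "B2 < \<infinity>" "!!k. nsq J2 (w k) \<le> B2"
   using TameD(4)[OF h] TameD(4)[OF w] by blast
  have "nsq (J1 \<union> J2 - C) (glue C (h k) (w k)) \<le> B1 * B2" for k
   using nsq_glue_plain[OF fin1 fin2 mh mw dh dw C_eq, of k k] weight_mono[OF B(2,4)[of k]] by (rule order_trans)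
  then show ?thesis using B(1,3) by (intro exI[of _ "B1 * B2"]) (simp add: ennreal_mult_less_top)
 next
  case False
  then obtain x where x: "b" "x \<notin> C" "J1 \<inter> J2 = insert x C" using g by (auto simp: gluable_def)
  have "Lall (%k y. umarg J1 x (h k) y * umarg J2 x (w k) y)"
   using Lall_umarg[OF h] Lall_umarg[OF w] x by (intro Lall_mult) auto
  from Lall_bound[OF this, of 1] obtain B where
   B: "B < \<infinity>" "!!k. (\<integral>\<^sup>+ y. umarg J1 x (h k) y * umarg J2 x (w k) y \<partial>halfline) \<le> B" by auto
  have "nsq (J1 \<union> J2 - C) (glue C (h k) (w k)) \<le> B" for k
   using nsq_glue_star[OF fin1 fin2 mh mw dh dw x(3,2)] B(2)[of k] by (rule order_trans)
  then show ?thesis using B(1) by blast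
 qed
 moreover have "Lall (marg (J1 \<union> J2 - C) j (%k. glue C (h k) (w k)) \<omega>)" if b: b and \<omega>: "Lall \<omega>" and j: "j \<in> J1 \<union> J2 - C" for \<omega> j
 proof (cases "j \<in> J1")
  case True
  then show ?thesis using Lall_marg_glue_left[of J1 h J2 w C \<omega> j] h w g b \<omega> j by simp
 next
  case False
  then have "Lall (marg (J2 \<union> J1 - C) j (%k. glue C (w k) (h k)) \<omega>)"
   using Lall_marg_glue_left[of J2 w J1 h C \<omega> j] h w g b \<omega> j by (simp add: gluable_sym)
  then show ?thesis by (simp add: glue_sym[of C "w _"] Un_commute)
 qed
 ultimately show ?thesis
  unfolding Tame_def using fin1 fin2 finC mh mw dh dw by (auto intro!: measurable_glue dep_glue)
qed

lemma ennreal_power2_tendsto_0: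
 fixes a :: "nat => ennreal"
 assumes le: "!!k. (a k)\<^sup>2 \<le> c k" and c: "c \<longlonglongrightarrow> 0"
 shows "a \<longlonglongrightarrow> 0"
proof (rule order_tendstoI)
 fix e :: ennreal assume e: "0 < e"
 then have "0 < e\<^sup>2" by (simp add: power2_eq_square ennreal_zero_less_mult_iff)
 with c have "eventually (%k. c k < e\<^sup>2) sequentially" by (rule order_tendstoD)
 then show "eventually (%k. a k < e) sequentially"
 proof (rule eventually_mono)
  fix k assume "c k < e\<^sup>2"
  then have "(a k)\<^sup>2 < e\<^sup>2" using le[of k] by (rule le_less_trans[rotated])
  then show "a k < e" by (meson not_less power_mono zero_le)
 qed
qed simp

lemma tendsto_mult_bounded_0:
 fixes a :: "nat => ennreal"
 assumes "a \<longlonglongrightarrow> 0" "B < \<infinity>" "!!k. c k \<le> a k * B"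
 shows "c \<longlonglongrightarrow> 0"
proof -
 have "(%k. B * a k) \<longlonglongrightarrow> B * 0" using assms(1,2) by (intro ennreal_tendsto_cmult) auto
 then have lim: "(%k. a k * B) \<longlonglongrightarrow> 0" by (simp add: mult.commute)
 show ?thesis
 proof (rule tendsto_sandwich[OF _ _ tendsto_const lim])
  show "\<forall>\<^sub>F k in sequentially. c k \<le> a k * B" using assms(3) by simp
 qed simp
qed

text \<open>Along a shared coordinate, a null sequence stays null by the Cauchy-Schwarz inequality against \<open>h\<close>
 itself, as \<open>\<integral> h\<^sup>2 w\<^sup>2 \<le> (\<integral> h\<^sup>2)\<^sup>1\<^sup>/\<^sup>2 (\<integral> h\<^sup>2 \<rho>\<^sup>2)\<^sup>1\<^sup>/\<^sup>2\<close> with the marginal \<open>\<rho>\<close> of \<open>w\<^sup>2\<close>.\<close>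

lemma null_glue:
 assumes h: "Tame b J1 h" and w: "Tame b J2 w" and g: "gluable b J1 J2 C"
  and null: "(%k. nsq J1 (h k)) \<longlonglongrightarrow> 0"
 shows "(%k. nsq (J1 \<union> J2 - C) (glue C (h k) (w k))) \<longlonglongrightarrow> 0"
proof -
 note fin1 = TameD(1)[OF h] and fin2 = TameD(1)[OF w]
 note mh [measurable] = TameD(2)[OF h] and mw [measurable] = TameD(2)[OF w]
 note dh = TameD(3)[OF h] and dw = TameD(3)[OF w]
 show ?thesis
 proof (cases "J1 \<inter> J2 \<subseteq> C")
  case True
  then have C_eq: "C = J1 \<inter> J2" using g by (auto simp: gluable_def)
  obtain B where B: "B < \<infinity>" "!!k. nsq J2 (w k) \<le> B" using TameD(4)[OF w] by blast
  have "nsq (J1 \<union> J2 - C) (glue C (h k) (w k)) \<le> nsq J1 (h k) * B" for k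
   using nsq_glue_plain[OF fin1 fin2 mh mw dh dw C_eq, of k k] mult_left_mono[OF B(2), of "nsq J1 (h k)" k]
   by (rule order_trans) simp
  then show ?thesis by (rule tendsto_mult_bounded_0[OF null B(1)])
 next
  case False
  then obtain x where x: "b" "x \<notin> C" "J1 \<inter> J2 = insert x C" using g by (auto simp: gluable_def)
  have xJ: "x \<in> J1" "x \<in> J2" using x by auto
  have L1: "Lall (%k. umarg J1 x (h k))" and L2: "Lall (%k. umarg J2 x (w k))"
   using Lall_umarg[OF h] Lall_umarg[OF w] x by auto
  note [measurable] = Lall_meas[OF L1] Lall_meas[OF L2]
  have "Lall (%k y. umarg J1 x (h k) y * (umarg J2 x (w k) y * umarg J2 x (w k) y))"
   by (intro Lall_mult L1 L2)
  from Lall_bound[OF this, of 1] obtain B where B: "B < \<infinity>"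
   "!!k. (\<integral>\<^sup>+ y. umarg J1 x (h k) y * (umarg J2 x (w k) y * umarg J2 x (w k) y) \<partial>halfline) \<le> B" by auto
  have pull: "(\<integral>\<^sup>+ y. umarg J1 x (h k) y * r y \<partial>halfline) = lm J1 (%t. (h k t)\<^sup>2 * r (t x)) (%_. 0)"
   if [measurable]: "r \<in> borel_measurable halfline" for k r
  proof -
   have "lm J1 (%t. (h k t)\<^sup>2 * r (t x)) (%_. 0) =
     (\<integral>\<^sup>+ y. lm (J1 - {x}) (%t. (h k t)\<^sup>2 * r (t x)) ((%_. 0)(x := y)) \<partial>halfline)"
    by (rule lm_eq_marginal_integral[OF fin1 xJ(1)]) auto
   also have "\<dots> = (\<integral>\<^sup>+ y. umarg J1 x (h k) y * r y \<partial>halfline)"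
   proof (rule nn_integral_cong)
    fix y assume "y \<in> space halfline"
    then have t: "(%_. 0)(x := y) \<in> space NM" by (auto simp: space_NM space_restrict_space)
    have "lm (J1 - {x}) (%t. r (t x) * (h k t)\<^sup>2) ((%_. 0)(x := y)) =
      r (((%_. 0)(x := y)) x) * lm (J1 - {x}) (%t. (h k t)\<^sup>2) ((%_. 0)(x := y))"
     by (rule lm_cmult[of "{x}"]) (use t in \<open>auto simp: dep_def\<close>)
    then show "lm (J1 - {x}) (%t. (h k t)\<^sup>2 * r (t x)) ((%_. 0)(x := y)) = umarg J1 x (h k) y * r y"
     by (simp add: umarg_def mult.commute)
   qed
   finally show ?thesis by simp
  qed
  define I where "I k = (\<integral>\<^sup>+ y. umarg J1 x (h k) y * umarg J2 x (w k) y \<partial>halfline)" for k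
  have sq: "(I k)\<^sup>2 \<le> nsq J1 (h k) * B" for k
  proof -
   have [measurable]: "(%t. umarg J2 x (w k) (t x)) \<in> borel_measurable NM" by measurable
   have "(I k)\<^sup>2 = (lm J1 (%t. h k t * (h k t * umarg J2 x (w k) (t x))) (%_. 0))\<^sup>2"
    unfolding I_def by (subst pull) (auto simp: power2_eq_square mult_ac)
   also have "\<dots> \<le> lm J1 (%t. (h k t)\<^sup>2) (%_. 0) * lm J1 (%t. (h k t * umarg J2 x (w k) (t x))\<^sup>2) (%_. 0)"
    by (rule lm_Cauchy_Schwarz) auto
   also have "lm J1 (%t. (h k t * umarg J2 x (w k) (t x))\<^sup>2) (%_. 0) =
     (\<integral>\<^sup>+ y. umarg J1 x (h k) y * (umarg J2 x (w k) y * umarg J2 x (w k) y) \<partial>halfline)"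
    by (subst pull) (auto simp: power2_eq_square mult_ac)
   also have "\<dots> \<le> B" using B(2)[of k] by simp
   finally show ?thesis by (simp add: nsq_def mult_left_mono)
  qed
  have lim: "I \<longlonglongrightarrow> 0"
   by (rule ennreal_power2_tendsto_0[OF sq tendsto_mult_bounded_0[OF null B(1) order_refl]])
  show ?thesis
  proof (rule tendsto_sandwich[OF _ _ tendsto_const lim])
   show "\<forall>\<^sub>F k in sequentially. nsq (J1 \<union> J2 - C) (glue C (h k) (w k)) \<le> I k"
    using nsq_glue_star[OF fin1 fin2 mh mw dh dw x(3,2)] by (simp add: I_def)
  qed simp
 qed
qed

section \<open>Complex kernels in labelled coordinates\<close>

definition nabs :: "(nat => (nat => real) => complex) => nat => (nat => real) => ennreal" where
 "nabs H k t = ennreal (cmod (H k t))"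

definition cnsq :: "nat set => ((nat => real) => complex) => ennreal" where
 "cnsq J h = nsq J (%t. ennreal (cmod (h t)))"

text \<open>Complex kernels are tame if their absolute values are.\<close>

definition cTame :: "bool => nat set => (nat => (nat => real) => complex) => bool" where
 "cTame b J H \<longleftrightarrow> (\<forall>k. H k \<in> borel_measurable NM \<and> dep J (H k)) \<and> Tame b J (nabs H)"

definition cnull :: "nat set => (nat => (nat => real) => complex) => bool" where
 "cnull J H \<longleftrightarrow> (%k. cnsq J (H k)) \<longlonglongrightarrow> 0"

definition cg :: "nat set => ((nat => real) => complex) => ((nat => real) => complex) => (nat => real) => complex" where
 "cg C h w = cm C (%t. h t * w t)"

lemma cTameD:
 assumes "cTame b J H"
 shows "H k \<in> borel_measurable NM" "dep J (H k)" "Tame b J (nabs H)" "finite J"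
 using assms TameD(1) unfolding cTame_def by blast+

lemma cnsq_nabs: "cnsq J (H k) = nsq J (nabs H k)"
 by (simp add: cnsq_def nabs_def[abs_def])

lemma cg_sym: "cg C h w = cg C w h"
 by (simp add: cg_def mult.commute)

lemma measurable_cg:
 "finite C ==> h \<in> borel_measurable NM ==> w \<in> borel_measurable NM ==> cg C h w \<in> borel_measurable NM"
 unfolding cg_def by (intro measurable_cm borel_measurable_times)

lemma dep_cg: "dep J1 h ==> dep J2 w ==> dep (J1 \<union> J2 - C) (cg C h w)"
 unfolding cg_def by (intro dep_cm dep_op2)

lemma cg_le_glue:
 assumes "h \<in> borel_measurable NM" "w \<in> borel_measurable NM" "t \<in> space NM"
 shows "ennreal (cmod (cg C h w t)) \<le> glue C (%t. ennreal (cmod (h t))) (%t. ennreal (cmod (w t))) t"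
 unfolding cg_def glue_def using norm_cm_le[of "%t. h t * w t" t C] assms
 by (simp add: norm_mult ennreal_mult borel_measurable_times)

lemma gluable_finite: "finite J1 ==> gluable b J1 J2 C ==> finite C"
 unfolding gluable_def by (meson finite_subset le_inf_iff)

lemma cTame_cg:
 assumes h: "cTame b J1 H" and w: "cTame b J2 W" and g: "gluable b J1 J2 C"
 shows "cTame b (J1 \<union> J2 - C) (%k. cg C (H k) (W k))"
proof -
 have fC: "finite C" by (rule gluable_finite[OF cTameD(4)[OF h] g])
 have m: "cg C (H k) (W k) \<in> borel_measurable NM" for k
  by (intro measurable_cg fC cTameD(1)[OF h] cTameD(1)[OF w])
 have d: "dep (J1 \<union> J2 - C) (cg C (H k) (W k))" for k
  by (intro dep_cg cTameD(2)[OF h] cTameD(2)[OF w])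
 have "Tame b (J1 \<union> J2 - C) (nabs (%k. cg C (H k) (W k)))"
 proof (rule Tame_mono[OF Tame_glue[OF cTameD(3)[OF h] cTameD(3)[OF w] g]])
  show "nabs (%k. cg C (H k) (W k)) k \<in> borel_measurable NM" for k
   unfolding nabs_def[abs_def] using m[of k] by measurable
  show "dep (J1 \<union> J2 - C) (nabs (%k. cg C (H k) (W k)) k)" for k
   unfolding nabs_def[abs_def] by (rule dep_op1[OF d])
  show "nabs (%k. cg C (H k) (W k)) k t \<le> glue C (nabs H k) (nabs W k) t" if "t \<in> space NM" for k t
   unfolding nabs_def[abs_def] by (rule cg_le_glue[OF cTameD(1)[OF h] cTameD(1)[OF w] that])
 qed
 then show ?thesis unfolding cTame_def using m d by blast
qed

lemma cnull_cg:
 assumes h: "cTame b J1 H" and w: "cTame b J2 W" and g: "gluable b J1 J2 C" and null: "cnull J1 H"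
 shows "cnull (J1 \<union> J2 - C) (%k. cg C (H k) (W k))"
 unfolding cnull_def
proof (rule tendsto_sandwich[OF _ _ tendsto_const])
 have "(%k. nsq J1 (nabs H k)) \<longlonglongrightarrow> 0" using null unfolding cnull_def cnsq_nabs .
 from null_glue[OF cTameD(3)[OF h] cTameD(3)[OF w] g this]
 show "(%k. nsq (J1 \<union> J2 - C) (glue C (nabs H k) (nabs W k))) \<longlonglongrightarrow> 0" .
 have "cnsq (J1 \<union> J2 - C) (cg C (H k) (W k)) \<le> nsq (J1 \<union> J2 - C) (glue C (nabs H k) (nabs W k))" for k
  unfolding cnsq_def nsq_def nabs_def[abs_def]
  by (intro lm_mono power_mono cg_le_glue cTameD(1)[OF h] cTameD(1)[OF w]) auto
 then show "\<forall>\<^sub>F k in sequentially. cnsq (J1 \<union> J2 - C) (cg C (H k) (W k)) \<le> nsq (J1 \<union> J2 - C) (glue C (nabs H k) (nabs W k))"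
  by simp
qed simp

text \<open>Fubini's theorem: both sides are almost everywhere the integral of the product of all three kernels.\<close>

lemma cnsq_cg_assoc:
 assumes f: "cTame b J1 F" and v: "cTame b J2 V" and w: "cTame b J3 W"
  and g1: "gluable b J2 J3 D" and g2: "gluable b J1 (J2 \<union> J3 - D) C"
  and sets: "D \<inter> J1 = {}" "C \<union> D = C' \<union> D'" "C \<inter> D = {}" "C' \<inter> D' = {}" "D' \<inter> J3 = {}"
 shows "cnsq (J1 \<union> (J2 \<union> J3 - D) - C) (cg C (F k) (cg D (V k) (W k))) =
  cnsq (J1 \<union> (J2 \<union> J3 - D) - C) (cg C' (cg D' (F k) (V k)) (W k))"
proof -
 note mf [measurable] = cTameD(1)[OF f] and mv [measurable] = cTameD(1)[OF v] and mw [measurable] = cTameD(1)[OF w]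
 note df = cTameD(2)[OF f] and dv = cTameD(2)[OF v] and dw = cTameD(2)[OF w]
 have fD: "finite D" by (rule gluable_finite[OF cTameD(4)[OF v] g1])
 have fC: "finite C" by (rule gluable_finite[OF cTameD(4)[OF f] g2])
 have "finite (C' \<union> D')" using fC fD sets(2) by (metis finite_UnI)
 then have fC': "finite C'" and fD': "finite D'" by auto
 define J where "J = J1 \<union> (J2 \<union> J3 - D) - C"
 define P where "P t = F k t * (V k t * W k t)" for t
 have mP [measurable]: "P \<in> borel_measurable NM" unfolding P_def by measurable
 define L where "L = glue C (nabs F k) (glue D (nabs V k) (nabs W k))"
 have mn [measurable]: "nabs F k \<in> borel_measurable NM" "nabs V k \<in> borel_measurable NM" "nabs W k \<in> borel_measurable NM"
  unfolding nabs_def[abs_def] by measurable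
 have mL: "L \<in> borel_measurable NM" unfolding L_def by (intro measurable_glue fC fD mn)
 have Leq: "lm (C \<union> D) (%t. ennreal (cmod (P t))) t = L t" if t: "t \<in> space NM" for t
 proof -
  have "L t = lm C (lm D (%t. ennreal (cmod (P t)))) t"
   unfolding L_def glue_def
  proof (rule lm_cong[OF _ t])
   fix t assume t: "t \<in> space NM"
   have "nabs F k t * lm D (%t. nabs V k t * nabs W k t) t = lm D (%t. nabs F k t * (nabs V k t * nabs W k t)) t"
    by (rule lm_cmult[of J1, symmetric]) (use df sets t in \<open>auto simp: nabs_def[abs_def] intro: dep_op1\<close>)
   then show "nabs F k t * lm D (%t. nabs V k t * nabs W k t) t = lm D (%t. ennreal (cmod (P t))) t"
    by (simp add: nabs_def P_def norm_mult ennreal_mult)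
  qed
  also have "\<dots> = lm (C \<union> D) (%t. ennreal (cmod (P t))) t"
   by (rule lm_Un[symmetric]) (use fC fD sets t in auto)
  finally show ?thesis by simp
 qed
 have T: "Tame b J (%k. glue C (nabs F k) (glue D (nabs V k) (nabs W k)))"
  unfolding J_def by (intro Tame_glue cTameD(3)[OF f] cTameD(3)[OF v] cTameD(3)[OF w] g1 g2)
 obtain B where "B < \<infinity>" "nsq J L \<le> B" using TameD(4)[OF T] unfolding L_def by blast
 then have fin: "nsq J L < \<infinity>" by (rule le_less_trans[rotated])
 have m: "(%s. (L (ov J (%_. 0) s))\<^sup>2) \<in> borel_measurable (PM J)"
  using measurable_ov_section[OF mL zero_space_NM, of J] by measurable
 have "AE s in PM J. (L (ov J (%_. 0) s))\<^sup>2 \<noteq> \<infinity>"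
  by (rule nn_integral_PInf_AE[OF m]) (use fin in \<open>simp add: nsq_def lm_def\<close>)
 moreover have "AE s in PM J. s \<in> space (PM J)" by (rule AE_space)
 ultimately have "AE s in PM J. cg C (F k) (cg D (V k) (W k)) (ov J (%_. 0) s) = cg C' (cg D' (F k) (V k)) (W k) (ov J (%_. 0) s)"
 proof eventually_elim
  fix s assume s: "(L (ov J (%_. 0) s))\<^sup>2 \<noteq> \<infinity>" "s \<in> space (PM J)"
  define t where "t = ov J (%_. 0) s"
  have t: "t \<in> space NM" unfolding t_def by (rule ov_space[OF zero_space_NM s(2)])
  have Lt: "L t < \<infinity>" using s(1) by (cases "L t") (auto simp: t_def top_power_ennreal less_top[symmetric])
  have "cm D P = (%t. F k t * cg D (V k) (W k) t)"
   unfolding P_def[abs_def] cg_def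
   by (intro ext cm_cmult[OF df[of k]]) (use sets in blast)
  then have "cg C (F k) (cg D (V k) (W k)) t = cm C (cm D P) t" by (simp add: cg_def)
  also have "\<dots> = cm (C \<union> D) P t"
   by (rule cm_Un[symmetric]) (use fC fD sets t Lt Leq[OF t] in auto)
  also have "C \<union> D = C' \<union> D'" by (rule sets)
  also have "cm (C' \<union> D') P t = cm C' (cm D' P) t"
   by (rule cm_Un) (use fC' fD' sets t Lt Leq[OF t] in auto)
  also have "\<dots> = cg C' (cg D' (F k) (V k)) (W k) t"
  proof -
   have "P = (%t. W k t * (F k t * V k t))" by (auto simp: P_def)
   then have "cm D' P = (%t. cg D' (F k) (V k) t * W k t)"
    using cm_cmult[OF dw, where C = D' and \<phi> = "%t. F k t * V k t"] sets by (auto simp: cg_def Int_commute)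
   then show ?thesis by (simp add: cg_def)
  qed
  finally show "cg C (F k) (cg D (V k) (W k)) (ov J (%_. 0) s) = cg C' (cg D' (F k) (V k)) (W k) (ov J (%_. 0) s)"
   by (simp add: t_def)
 qed
 then have "AE s in PM J. (ennreal (cmod (cg C (F k) (cg D (V k) (W k)) (ov J (%_. 0) s))))\<^sup>2 =
   (ennreal (cmod (cg C' (cg D' (F k) (V k)) (W k) (ov J (%_. 0) s))))\<^sup>2"
  by eventually_elim simp
 then show ?thesis unfolding J_def[symmetric] cnsq_def nsq_def lm_def by (rule nn_integral_cong_AE)
qed

text \<open>\<open>V\<close> has the coordinates \<open>X \<union> Y \<union> D\<close> and \<open>W\<close> the coordinates \<open>Y \<union> Z \<union> D\<close>; \<open>D\<close> is integrated out,
 and \<open>F\<close> touches \<open>T\<close>, where all but \<open>S\<close> is integrated out. If gluing \<open>F\<close> to \<open>V\<close> alone already gives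
 a null sequence, then so does gluing \<open>F\<close> to the compound.\<close>

lemma cnull_cg_touching_left:
 assumes f: "cTame b J1 F" and v: "cTame b (X \<union> Y \<union> D) V" and w: "cTame b (Y \<union> Z \<union> D) W"
  and disj: "X \<inter> Y = {}" "X \<inter> Z = {}" "Y \<inter> Z = {}" "D \<inter> (X \<union> Y \<union> Z) = {}" "J1 \<inter> D = {}"
  and T: "T = J1 \<inter> (X \<union> Y \<union> Z)" and S: "S \<subseteq> T" "S = {} \<or> b \<and> (\<exists>x. S = {x})"
  and Y: "Y = {} \<or> b \<and> (\<exists>y. Y = {y})"
  and cond: "S \<inter> X \<noteq> {} ==> T \<inter> Y = {}" "S \<inter> Z \<noteq> {} ==> Y \<subseteq> T"
  and null: "cnull (J1 \<union> (X \<union> Y \<union> D) - (T \<inter> X - S)) (%k. cg (T \<inter> X - S) (F k) (V k))"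
 shows "cnull (J1 \<union> (X \<union> Y \<union> Z) - (T - S)) (%k. cg (T - S) (F k) (cg D (V k) (W k)))"
proof -
 define D' where "D' = T \<inter> X - S"
 define C' where "C' = D \<union> ((T - S) \<inter> (Y \<union> Z))"
 have g0: "gluable b (X \<union> Y \<union> D) (Y \<union> Z \<union> D) D"
 proof -
  have "(X \<union> Y \<union> D) \<inter> (Y \<union> Z \<union> D) = Y \<union> D" using disj by blast
  then show ?thesis using Y disj by (auto simp: gluable_def)
 qed
 have e0: "X \<union> Y \<union> D \<union> (Y \<union> Z \<union> D) - D = X \<union> Y \<union> Z" using disj by blast
 have gC: "gluable b J1 (X \<union> Y \<union> D \<union> (Y \<union> Z \<union> D) - D) (T - S)"
 proof -
  have "J1 \<inter> (X \<union> Y \<union> Z) = T" using T by simp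
  then show ?thesis unfolding e0 gluable_def using S by auto
 qed
 have g1: "gluable b J1 (X \<union> Y \<union> D) D'"
 proof -
  have e: "J1 \<inter> (X \<union> Y \<union> D) = (T \<inter> X) \<union> (T \<inter> Y)" using T disj by blast
  show ?thesis
  proof (cases "S \<inter> X = {}")
   case True
   then have "J1 \<inter> (X \<union> Y \<union> D) = D' \<union> (T \<inter> Y)" unfolding e D'_def by blast
   moreover have "T \<inter> Y = {} \<or> b \<and> (\<exists>y. T \<inter> Y = {y} \<and> y \<notin> D')" using Y disj unfolding D'_def by auto
   ultimately show ?thesis unfolding gluable_def by auto
  next
   case False
   then obtain x where x: "S = {x}" "x \<in> X" b using S(2) by blast
   have "J1 \<inter> (X \<union> Y \<union> D) = insert x D'" unfolding e D'_def using cond(1)[OF False] x S(1) by blast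
   moreover have "x \<notin> D'" using x by (simp add: D'_def)
   ultimately show ?thesis unfolding gluable_def using x(3) by auto
  qed
 qed
 have tame1: "cTame b (J1 \<union> (X \<union> Y \<union> D) - D') (%k. cg D' (F k) (V k))" by (rule cTame_cg[OF f v g1])
 have g2: "gluable b (J1 \<union> (X \<union> Y \<union> D) - D') (Y \<union> Z \<union> D) C'"
 proof -
  have e: "(J1 \<union> (X \<union> Y \<union> D) - D') \<inter> (Y \<union> Z \<union> D) = (T \<inter> Z) \<union> Y \<union> D"
   using T disj unfolding D'_def by blast
  show ?thesis
  proof (cases "S \<inter> Z = {}")
   case True
   then have "(T \<inter> Z) \<union> Y \<union> D = C' \<union> (Y - (T - S))" unfolding C'_def by blast
   moreover have "Y - (T - S) = {} \<or> b \<and> (\<exists>y. Y - (T - S) = {y} \<and> y \<notin> C')"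
    using Y disj unfolding C'_def by auto
   ultimately show ?thesis unfolding gluable_def e by auto
  next
   case False
   then obtain x where x: "S = {x}" "x \<in> Z" b using S(2) by blast
   have "(T \<inter> Z) \<union> Y \<union> D = insert x C'"
    using cond(2)[OF False] x S(1) disj unfolding C'_def by blast
   moreover have "x \<notin> C'" using x disj unfolding C'_def by auto
   ultimately show ?thesis unfolding gluable_def e using x(3) by auto
  qed
 qed
 have J: "J1 \<union> (X \<union> Y \<union> D) - D' \<union> (Y \<union> Z \<union> D) - C' = J1 \<union> (X \<union> Y \<union> Z) - (T - S)"
  using T disj S unfolding C'_def D'_def by blast
 have "cnull (J1 \<union> (X \<union> Y \<union> D) - D' \<union> (Y \<union> Z \<union> D) - C') (%k. cg C' (cg D' (F k) (V k)) (W k))"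
  by (rule cnull_cg[OF tame1 w g2]) (use null in \<open>simp add: D'_def\<close>)
 then have "cnull (J1 \<union> (X \<union> Y \<union> Z) - (T - S)) (%k. cg C' (cg D' (F k) (V k)) (W k))" by (simp only: J)
 moreover have "cnsq (J1 \<union> (X \<union> Y \<union> Z) - (T - S)) (cg (T - S) (F k) (cg D (V k) (W k))) =
   cnsq (J1 \<union> (X \<union> Y \<union> Z) - (T - S)) (cg C' (cg D' (F k) (V k)) (W k))" for k
  unfolding e0[symmetric]
  by (rule cnsq_cg_assoc[OF f v w g0 gC]) (use T disj S in \<open>auto simp: C'_def D'_def\<close>)
 ultimately show ?thesis unfolding cnull_def by simp
qed

lemma cnull_cg_touching_right:
 assumes f: "cTame b J1 F" and v: "cTame b (X \<union> Y \<union> D) V" and w: "cTame b (Y \<union> Z \<union> D) W"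
  and disj: "X \<inter> Y = {}" "X \<inter> Z = {}" "Y \<inter> Z = {}" "D \<inter> (X \<union> Y \<union> Z) = {}" "J1 \<inter> D = {}"
  and T: "T = J1 \<inter> (X \<union> Y \<union> Z)" "T \<subseteq> Z" and S: "S \<subseteq> T" "S = {} \<or> b \<and> (\<exists>x. S = {x})"
  and Y: "Y = {} \<or> b \<and> (\<exists>y. Y = {y})"
  and null: "cnull (J1 \<union> (Y \<union> Z \<union> D) - (T - S)) (%k. cg (T - S) (F k) (W k))"
 shows "cnull (J1 \<union> (X \<union> Y \<union> Z) - (T - S)) (%k. cg (T - S) (F k) (cg D (V k) (W k)))"
proof -
 have "cnull (J1 \<union> (Z \<union> Y \<union> X) - (T - S)) (%k. cg (T - S) (F k) (cg D (W k) (V k)))"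
 proof (rule cnull_cg_touching_left[where b = b])
  show "cTame b J1 F" "cTame b (Z \<union> Y \<union> D) W" "cTame b (Y \<union> X \<union> D) V"
   using f v w by (simp_all add: Un_ac)
  have "T \<inter> Z - S = T - S" using T(2) by blast
  then show "cnull (J1 \<union> (Z \<union> Y \<union> D) - (T \<inter> Z - S)) (%k. cg (T \<inter> Z - S) (F k) (W k))"
   using null by (simp add: Un_ac)
  show "T = J1 \<inter> (Z \<union> Y \<union> X)" using T(1) by blast
  show "T \<inter> Y = {}" if "S \<inter> Z \<noteq> {}" using T(2) disj by blast
  show "Y \<subseteq> T" if "S \<inter> X \<noteq> {}" using that S T(2) disj by blast
 qed (use disj S Y in blast)+
 then show ?thesis by (simp add: cg_sym[of D "W _"] Un_ac)
qed

section \<open>Relabelling the arguments of a kernel\<close>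

definition lab :: "nat => (nat => nat) => kernel => (nat => real) => complex" where
 "lab n l f t = f (\<lambda>i\<in>{..<n}. t (l i))"

lemma Rp_PM: "Rp n = PM {..<n}"
 by (simp add: Rp_def)

lemma measurable_lab:
 assumes "f \<in> borel_measurable (Rp n)" shows "lab n l f \<in> borel_measurable NM"
proof -
 have "(%t. \<lambda>i\<in>{..<n}. t (l i)) \<in> NM \<rightarrow>\<^sub>M PM {..<n}"
  by (intro measurable_restrict measurable_component_singleton) simp
 from measurable_compose[OF this] assms show ?thesis by (simp add: lab_def[abs_def] Rp_PM)
qed

lemma dep_lab: "dep (l ` {..<n}) (lab n l f)"
proof -
 have "(\<lambda>i\<in>{..<n}. t (l i)) = (\<lambda>i\<in>{..<n}. t' (l i))" if "\<forall>i\<in>l ` {..<n}. t i = t' i" for t t' :: "nat => real"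
  using that by (auto simp: restrict_def)
 then show ?thesis unfolding dep_def lab_def by metis
qed

lemma lab_cong: "(!!i. i < n ==> l i = l' i) ==> lab n l f = lab n l' f"
 unfolding lab_def by (intro ext arg_cong[where f = f]) (auto simp: restrict_def)

lemma distr_relabel:
 assumes inj: "inj_on d {..<p}"
 shows "distr (PM {..<p}) (PM (d ` {..<p})) (%s. \<lambda>j\<in>d ` {..<p}. s (inv_into {..<p} d j)) = PM (d ` {..<p})"
  (is "distr ?P ?Q ?r = _")
proof (rule hl.PiM_eqI)
 have inv: "inv_into {..<p} d j < p" if "j \<in> d ` {..<p}" for j using inv_into_into[OF that] by simp
 have r: "?r \<in> ?P \<rightarrow>\<^sub>M ?Q"
  by (intro measurable_restrict measurable_component_singleton) (simp add: inv)
 fix X :: "nat => real set" assume X: "!!i. i \<in> d ` {..<p} ==> X i \<in> sets halfline"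
 have XS: "X i \<subseteq> space halfline" if "i \<in> d ` {..<p}" for i using sets.sets_into_space[OF X[OF that]] .
 have vimage: "?r -` Pi\<^sub>E (d ` {..<p}) X \<inter> space ?P = Pi\<^sub>E {..<p} (%i. X (d i))"
 proof (intro set_eqI iffI)
  fix s assume "s \<in> ?r -` Pi\<^sub>E (d ` {..<p}) X \<inter> space ?P"
  then have *: "!!j. j \<in> d ` {..<p} ==> s (inv_into {..<p} d j) \<in> X j" and "s \<in> extensional {..<p}"
   by (auto simp: space_PiM PiE_iff)
  then show "s \<in> Pi\<^sub>E {..<p} (%i. X (d i))"
   using inv_into_f_f[OF inj] by (auto simp: PiE_iff) (metis imageI lessThan_iff)
 next
  fix s assume s: "s \<in> Pi\<^sub>E {..<p} (%i. X (d i))"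
  then have "s (inv_into {..<p} d j) \<in> X j" if "j \<in> d ` {..<p}" for j
  proof -
   have "s (inv_into {..<p} d j) \<in> X (d (inv_into {..<p} d j))" using s inv[OF that] by (simp add: PiE_iff)
   then show ?thesis by (simp only: f_inv_into_f[OF that])
  qed
  moreover have "s \<in> space ?P"
   using s XS by (fastforce simp: space_PiM PiE_iff)
  ultimately show "s \<in> ?r -` Pi\<^sub>E (d ` {..<p}) X \<inter> space ?P" by (auto simp: PiE_iff)
 qed
 have "emeasure (distr ?P ?Q ?r) (Pi\<^sub>E (d ` {..<p}) X) = emeasure ?P (Pi\<^sub>E {..<p} (%i. X (d i)))"
  by (subst emeasure_distr[OF r]) (auto simp: vimage intro!: sets_PiM_I_finite X)
 also have "\<dots> = (\<Prod>i\<in>{..<p}. emeasure halfline (X (d i)))"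
  by (rule hl.emeasure_PiM) (auto intro: X)
 also have "\<dots> = (\<Prod>j\<in>d ` {..<p}. emeasure halfline (X j))"
  by (simp add: prod.reindex[OF inj])
 finally show "emeasure (distr ?P ?Q ?r) (Pi\<^sub>E (d ` {..<p}) X) = (\<Prod>j\<in>d ` {..<p}. emeasure halfline (X j))" .
qed auto

definition relab :: "nat => (nat => nat) => (nat => real) => (nat => real) => nat => real" where
 "relab p d t s = (%i. if i \<in> d ` {..<p} then s (inv_into {..<p} d i) else t i)"

lemma ov_relab: "ov (d ` {..<p}) t (\<lambda>j\<in>d ` {..<p}. s (inv_into {..<p} d j)) = relab p d t s"
 by (auto simp: ov_def relab_def)

lemma measurable_relabel: "(%s. \<lambda>j\<in>d ` {..<p}. s (inv_into {..<p} d j)) \<in> PM {..<p} \<rightarrow>\<^sub>M PM (d ` {..<p})"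
proof (intro measurable_restrict measurable_component_singleton)
 show "inv_into {..<p} d j \<in> {..<p}" if "j \<in> d ` {..<p}" for j using inv_into_into[OF that] .
qed

lemma lm_relabel:
 assumes "inj_on d {..<p}" "\<phi> \<in> borel_measurable NM" "t \<in> space NM"
 shows "lm (d ` {..<p}) \<phi> t = (\<integral>\<^sup>+ s. \<phi> (relab p d t s) \<partial>Rp p)"
 unfolding lm_def
 by (subst distr_relabel[OF assms(1), symmetric], subst nn_integral_distr)
  (auto simp: ov_relab Rp_PM measurable_relabel measurable_ov_section[OF assms(2,3)])

lemma cm_relabel:
 assumes "inj_on d {..<p}" "\<phi> \<in> borel_measurable NM" "t \<in> space NM"
 shows "cm (d ` {..<p}) \<phi> t = (\<integral> s. \<phi> (relab p d t s) \<partial>Rp p)"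
 unfolding cm_def
 by (subst distr_relabel[OF assms(1), symmetric], subst integral_distr)
  (auto simp: ov_relab Rp_PM measurable_relabel measurable_ov_section[OF assms(2,3)])

lemma relab_in: "inj_on d {..<p} ==> i < p ==> relab p d t s (d i) = s i"
 by (simp add: relab_def)

lemma relab_out: "i \<notin> d ` {..<p} ==> relab p d t s i = t i"
 by (simp add: relab_def)

definition n2 :: "nat => kernel => ennreal" where
 "n2 n f = (\<integral>\<^sup>+ s. (ennreal (cmod (f s)))\<^sup>2 \<partial>Rp n)"

lemma cnsq_lab:
 assumes inj: "inj_on l {..<n}" and f: "f \<in> borel_measurable (Rp n)"
 shows "cnsq (l ` {..<n}) (lab n l f) = n2 n f"
proof -
 have m: "(%t. (ennreal (cmod (lab n l f t)))\<^sup>2) \<in> borel_measurable NM"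
  using measurable_lab[OF f, of l] by measurable
 have "cnsq (l ` {..<n}) (lab n l f) = (\<integral>\<^sup>+ s. (ennreal (cmod (lab n l f (relab n l (%_. 0) s))))\<^sup>2 \<partial>Rp n)"
  unfolding cnsq_def nsq_def by (rule lm_relabel[OF inj m zero_space_NM])
 also have "\<dots> = n2 n f"
  unfolding n2_def
 proof (rule nn_integral_cong)
  fix s assume "s \<in> space (Rp n)"
  then have "s \<in> extensional {..<n}" by (auto simp: Rp_PM space_PiM PiE_iff)
  then have "(\<lambda>i\<in>{..<n}. relab n l (%_. 0) s (l i)) = s"
   by (intro ext) (auto simp: relab_in[OF inj] restrict_def extensional_def)
  then show "(ennreal (cmod (lab n l f (relab n l (%_. 0) s))))\<^sup>2 = (ennreal (cmod (f s)))\<^sup>2"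
   by (simp add: lab_def)
 qed
 finally show ?thesis .
qed

lemma lab_contraction:
 assumes p: "p \<le> n" "p \<le> m" and f: "f \<in> borel_measurable (Rp n)" and g: "g \<in> borel_measurable (Rp m)"
  and d: "inj_on d {..<p}" and disj: "d ` {..<p} \<inter> l ` {..<n + m - 2 * p} = {}" and t: "t \<in> space NM"
 shows "lab (n + m - 2 * p) l (contraction n m p f g) t =
  cg (d ` {..<p}) (lab n (%i. if i < n - p then l i else d (i - (n - p))) f)
   (lab m (%i. if i < p then d (p - 1 - i) else l (n - p + (i - p))) g) t"
proof -
 let ?l1 = "%i. if i < n - p then l i else d (i - (n - p))"
 let ?l2 = "%i. if i < p then d (p - 1 - i) else l (n - p + (i - p))"
 have out: "l i \<notin> d ` {..<p}" if "i < n + m - 2 * p" for i using disj that by blast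
 have "cg (d ` {..<p}) (lab n ?l1 f) (lab m ?l2 g) t =
   (\<integral> s. lab n ?l1 f (relab p d t s) * lab m ?l2 g (relab p d t s) \<partial>Rp p)"
  unfolding cg_def
  by (rule cm_relabel[OF d _ t]) (intro borel_measurable_times measurable_lab f g)
 also have "\<dots> = lab (n + m - 2 * p) l (contraction n m p f g) t"
 proof -
  have "(\<lambda>i\<in>{..<n}. relab p d t s (?l1 i)) =
    (\<lambda>i\<in>{..<n}. if i < n - p then (\<lambda>i\<in>{..<n + m - 2 * p}. t (l i)) i else s (i - (n - p)))" for s
   using p by (intro ext) (auto simp: restrict_def relab_in[OF d] relab_out[OF out])
  moreover have "(\<lambda>i\<in>{..<m}. relab p d t s (?l2 i)) =
    (\<lambda>i\<in>{..<m}. if i < p then s (p - 1 - i) else (\<lambda>i\<in>{..<n + m - 2 * p}. t (l i)) (n - p + (i - p)))" for s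
   using p by (intro ext) (auto simp: restrict_def relab_in[OF d] relab_out[OF out])
  ultimately show ?thesis unfolding lab_def contraction_def by simp
 qed
 finally show ?thesis by simp
qed

lemma lab_star_contraction:
 assumes p: "1 \<le> p" "p \<le> n" "p \<le> m" and f: "f \<in> borel_measurable (Rp n)" and g: "g \<in> borel_measurable (Rp m)"
  and d: "inj_on d {..<p - 1}" and disj: "d ` {..<p - 1} \<inter> l ` {..<n + m - 2 * p + 1} = {}" and t: "t \<in> space NM"
 shows "lab (n + m - 2 * p + 1) l (star_contraction n m p f g) t =
  cg (d ` {..<p - 1}) (lab n (%i. if i \<le> n - p then l i else d (n - 1 - i)) f)
   (lab m (%i. if i < p - 1 then d i else l (n - p + (i - (p - 1)))) g) t"
proof -
 let ?l1 = "%i. if i \<le> n - p then l i else d (n - 1 - i)"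
 let ?l2 = "%i. if i < p - 1 then d i else l (n - p + (i - (p - 1)))"
 have out: "l i \<notin> d ` {..<p - 1}" if "i < n + m - 2 * p + 1" for i using disj that by blast
 note d' = d[unfolded One_nat_def]
 have out': "l i \<notin> d ` {..<p - Suc 0}" if "i < n + m - 2 * p + 1" for i using out[OF that] by simp
 have "cg (d ` {..<p - 1}) (lab n ?l1 f) (lab m ?l2 g) t =
   (\<integral> s. lab n ?l1 f (relab (p - 1) d t s) * lab m ?l2 g (relab (p - 1) d t s) \<partial>Rp (p - 1))"
  unfolding cg_def
  by (rule cm_relabel[OF d _ t]) (intro borel_measurable_times measurable_lab f g)
 also have "\<dots> = lab (n + m - 2 * p + 1) l (star_contraction n m p f g) t"
 proof -
  have "(\<lambda>i\<in>{..<n}. relab (p - 1) d t s (?l1 i)) =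
    (\<lambda>i\<in>{..<n}. if i \<le> n - p then (\<lambda>i\<in>{..<n + m - 2 * p + 1}. t (l i)) i else s (n - 1 - i))" for s
   using p by (intro ext) (auto simp: restrict_def relab_in[OF d'] relab_out[OF out'])
  moreover have "(\<lambda>i\<in>{..<m}. relab (p - 1) d t s (?l2 i)) =
    (\<lambda>i\<in>{..<m}. if i < p - 1 then s i else (\<lambda>i\<in>{..<n + m - 2 * p + 1}. t (l i)) (n - p + (i - (p - 1))))" for s
   using p by (intro ext) (auto simp: restrict_def relab_in[OF d'] relab_out[OF out'])
  ultimately show ?thesis unfolding lab_def star_contraction_def by simp
 qed
 finally show ?thesis by simp
qed

section \<open>Tame and null sequences of kernels\<close>

definition kTame :: "bool => nat => (nat => kernel) => bool" where
 "kTame b q u \<longleftrightarrow> (\<forall>k. u k \<in> borel_measurable (Rp q)) \<and>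
  (\<forall>l. inj_on l {..<q} --> cTame b (l ` {..<q}) (%k. lab q l (u k)))"

definition kNull :: "nat => (nat => kernel) => bool" where
 "kNull q u \<longleftrightarrow> (%k. n2 q (u k)) \<longlonglongrightarrow> 0"

lemma kTameD:
 assumes "kTame b q u"
 shows "u k \<in> borel_measurable (Rp q)" "inj_on l {..<q} ==> cTame b (l ` {..<q}) (%k. lab q l (u k))"
 using assms unfolding kTame_def by blast+

lemma kNull_iff:
 assumes "inj_on l {..<q}" "!!k. u k \<in> borel_measurable (Rp q)"
 shows "kNull q u \<longleftrightarrow> cnull (l ` {..<q}) (%k. lab q l (u k))"
 unfolding kNull_def cnull_def by (simp add: cnsq_lab[OF assms])

lemma cnsq_cong: "(!!t. t \<in> space NM ==> h t = h' t) ==> cnsq J h = cnsq J h'"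
 unfolding cnsq_def nsq_def by (intro lm_cong) auto

lemma cnull_cong: "(!!k t. t \<in> space NM ==> h k t = h' k t) ==> cnull J h = cnull J h'"
proof -
 assume "!!k t. t \<in> space NM ==> h k t = h' k t"
 then have "cnsq J (h k) = cnsq J (h' k)" for k by (intro cnsq_cong)
 then show ?thesis unfolding cnull_def by simp
qed

lemma cTame_cong:
 assumes T: "cTame b J H" and m: "!!k. H' k \<in> borel_measurable NM" "!!k. dep J (H' k)"
  and eq: "!!k t. t \<in> space NM ==> H' k t = H k t"
 shows "cTame b J H'"
 unfolding cTame_def
proof (intro conjI allI m)
 show "Tame b J (nabs H')"
 proof (rule Tame_mono[OF cTameD(3)[OF T]])
  show "nabs H' k \<in> borel_measurable NM" for k unfolding nabs_def[abs_def] using m(1)[of k] by measurable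
  show "dep J (nabs H' k)" for k unfolding nabs_def[abs_def] by (rule dep_op1[OF m(2)])
 qed (simp add: nabs_def eq)
qed

lemma measurable_kernelI:
 assumes H: "H \<in> borel_measurable NM" and eq: "!!t. t \<in> space NM ==> lab N id h t = H t"
 shows "h \<in> borel_measurable (Rp N)"
proof -
 have "(%t. H (ov {..<N} (%_. 0) t)) \<in> borel_measurable (PM {..<N})"
  by (rule measurable_ov_section[OF H zero_space_NM])
 then show ?thesis unfolding Rp_PM
 proof (rule measurable_cong[THEN iffD1, rotated])
  fix t assume t: "t \<in> space (PM {..<N})"
  have "H (ov {..<N} (%_. 0) t) = lab N id h (ov {..<N} (%_. 0) t)"
   by (rule eq[symmetric]) (rule ov_space[OF zero_space_NM t])
  also have "(\<lambda>i\<in>{..<N}. ov {..<N} (%_. 0) t (id i)) = t"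
   using t by (intro ext) (auto simp: ov_def space_PiM PiE_iff extensional_def)
  then have "lab N id h (ov {..<N} (%_. 0) t) = h t" by (simp add: lab_def)
  finally show "H (ov {..<N} (%_. 0) t) = h t" .
 qed
qed

lemma fresh_labels_ex: "finite (U :: nat set) ==> \<exists>d :: nat => nat. inj d \<and> range d \<inter> U = {}"
proof (intro exI conjI)
 assume U: "finite U"
 show "inj (%i. Suc (Max (insert 0 U)) + i)" by (simp add: inj_def)
 show "range (%i. Suc (Max (insert 0 U)) + i) \<inter> U = {}"
 proof (intro equals0I)
  fix x assume x: "x \<in> range (%i. Suc (Max (insert 0 U)) + i) \<inter> U"
  then have "x \<le> Max (insert 0 U)" using U by (intro Max_ge) auto
  then show False using x by auto
 qed
qed

lemma image_diff_sub: "inj_on (l :: nat => nat) U ==> P \<subseteq> U ==> Q \<subseteq> U ==> l ` P - l ` Q = l ` (P - Q)"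
 using inj_on_image_set_diff[of l U P Q] by auto

lemma image_Int_sub: "inj_on (l :: nat => nat) U ==> P \<subseteq> U ==> Q \<subseteq> U ==> l ` P \<inter> l ` Q = l ` (P \<inter> Q)"
 using inj_on_image_Int[of l U P Q] by auto

section \<open>Contractions as gluings\<close>

text \<open>Contractions and star contractions in one family.\<close>

definition gcon :: "bool => nat => nat => nat => kernel => kernel => kernel" where
 "gcon c = (if c then star_contraction else contraction)"

abbreviation gord :: "bool => nat => nat => nat => nat" where
 "gord c q r p \<equiv> q + r - 2 * p + of_bool c"

definition glue_labels :: "bool => nat => nat => nat => (nat => nat) => nat set => (nat => nat) => (nat => nat) => bool" where
 "glue_labels c q r p l D l1 l2 \<longleftrightarrow> inj_on l1 {..<q} \<and> inj_on l2 {..<r} \<and>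
  l1 ` {..<q} = l ` {..<q - p + of_bool c} \<union> D \<and> l2 ` {..<r} = l ` {q - p..<gord c q r p} \<union> D \<and>
  (\<forall>i < q - p + of_bool c. l1 i = l i) \<and> (\<forall>i\<ge>q - p. l2 (i - (q - p) + (p - of_bool c)) = l i) \<and>
  l2 ` {..<p - of_bool c} = D \<and>
  (\<forall>h w t. h \<in> borel_measurable (Rp q) --> w \<in> borel_measurable (Rp r) --> t \<in> space NM -->
    lab (gord c q r p) l (gcon c q r p h w) t = cg D (lab q l1 h) (lab r l2 w) t)"

lemma glue_labelsD:
 assumes "glue_labels c q r p l D l1 l2"
 shows "inj_on l1 {..<q}" "inj_on l2 {..<r}" "l1 ` {..<q} = l ` {..<q - p + of_bool c} \<union> D"
  "l2 ` {..<r} = l ` {q - p..<gord c q r p} \<union> D" "i < q - p + of_bool c ==> l1 i = l i"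
  "i \<ge> q - p ==> l2 (i - (q - p) + (p - of_bool c)) = l i" "l2 ` {..<p - of_bool c} = D"
  "h \<in> borel_measurable (Rp q) ==> w \<in> borel_measurable (Rp r) ==> t \<in> space NM ==>
    lab (gord c q r p) l (gcon c q r p h w) t = cg D (lab q l1 h) (lab r l2 w) t"
proof -
 note a = assms[unfolded glue_labels_def]
 note a1 = conjunct2[OF a] note a2 = conjunct2[OF a1] note a3 = conjunct2[OF a2] note a4 = conjunct2[OF a3]
 note a5 = conjunct2[OF a4] note a6 = conjunct2[OF a5] note a7 = conjunct2[OF a6]
 show "inj_on l1 {..<q}" by (rule conjunct1[OF a])
 show "inj_on l2 {..<r}" by (rule conjunct1[OF a1])
 show "l1 ` {..<q} = l ` {..<q - p + of_bool c} \<union> D" by (rule conjunct1[OF a2])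
 show "l2 ` {..<r} = l ` {q - p..<gord c q r p} \<union> D" by (rule conjunct1[OF a3])
 show "i < q - p + of_bool c ==> l1 i = l i" by (rule mp[OF spec[OF conjunct1[OF a4]]])
 show "i \<ge> q - p ==> l2 (i - (q - p) + (p - of_bool c)) = l i" by (rule mp[OF spec[OF conjunct1[OF a5]]])
 show "l2 ` {..<p - of_bool c} = D" by (rule conjunct1[OF a6])
 show "h \<in> borel_measurable (Rp q) ==> w \<in> borel_measurable (Rp r) ==> t \<in> space NM ==>
    lab (gord c q r p) l (gcon c q r p h w) t = cg D (lab q l1 h) (lab r l2 w) t" by (rule a7[rule_format])
qed

lemma reflect_image: "(%j. P - 1 - j) ` {..<P} = {..<P::nat}"
proof (intro set_eqI iffI)
 fix i assume "i \<in> {..<P}"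
 then have "i = P - 1 - (P - 1 - i)" "P - 1 - i \<in> {..<P}" by auto
 then show "i \<in> (%j. P - 1 - j) ` {..<P}" by blast
qed auto

text \<open>Both kinds of contraction take the same form once arguments carry labels: label the arguments of the result by \<open>l\<close> and the integrated ones by \<open>D\<close>.\<close>

lemma glue_labels_ex:
 fixes l :: "nat => nat"
 assumes p: "of_bool c \<le> p" "p \<le> q" "p \<le> r" and l: "inj_on l {..<gord c q r p}"
  and D: "finite D" "card D = p - of_bool c" "D \<inter> l ` {..<gord c q r p} = {}"
 shows "\<exists>l1 l2. glue_labels c q r p l D l1 l2"
proof -
 define e where "e = (of_bool c :: nat)"
 have e1: "e \<le> 1" by (simp add: e_def)
 define M where "M = q - p + e"
 define P where "P = p - e"
 let ?N = "gord c q r p"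
 obtain d where d: "bij_betw d {..<P} D"
  using ex_bij_betw_nat_finite[OF D(1)] unfolding D(2) by (auto simp: P_def e_def lessThan_atLeast0)
 have dI: "d ` {..<P} = D" and di: "inj_on d {..<P}" using d by (auto simp: bij_betw_def)
 define l1 where "l1 i = (if i < M then l i else d (P - 1 - (i - M)))" for i
 define l2 where "l2 i = (if i < P then d i else l (q - p + (i - P)))" for i
 have MP: "M + P = q" "?N - (q - p) + P = r" "M \<le> ?N" "q - p \<le> ?N" using p e1 by (auto simp: M_def P_def e_def)
 have I1: "l1 ` {..<q} = l ` {..<M} \<union> D"
 proof -
  have "{..<q} = {..<M} \<union> (%j. M + j) ` {..<P}"
   using MP(1) by (auto simp: lessThan_atLeast0 image_add_atLeastLessThan)
  then have "l1 ` {..<q} = l1 ` {..<M} \<union> l1 ` (%j. M + j) ` {..<P}" by (simp only: image_Un)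
  also have "l1 ` (%j. M + j) ` {..<P} = d ` (%j. P - 1 - j) ` {..<P}"
   unfolding image_image by (rule image_cong) (auto simp: l1_def)
  also have "l1 ` {..<M} = l ` {..<M}" by (rule image_cong) (auto simp: l1_def)
  finally show ?thesis by (simp only: reflect_image dI)
 qed
 have L2: "l2 (i - (q - p) + P) = l i" if "q - p \<le> i" for i
 proof -
  have "\<not> i - (q - p) + P < P" "q - p + (i - (q - p) + P - P) = i" using that by arith+
  then show ?thesis by (simp only: l2_def if_False)
 qed
 have l2P: "l2 ` {..<P} = D" unfolding dI[symmetric] by (rule image_cong) (auto simp: l2_def)
 have I2: "l2 ` {..<r} = l ` {q - p..<?N} \<union> D"
 proof -
  have "{..<r} \<subseteq> {..<P} \<union> (%i. i - (q - p) + P) ` {q - p..<?N}"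
  proof
   fix i assume "i \<in> {..<r}"
   then have "i < P \<or> i = (i - P + (q - p)) - (q - p) + P \<and> i - P + (q - p) \<in> {q - p..<?N}" using MP by auto
   then show "i \<in> {..<P} \<union> (%i. i - (q - p) + P) ` {q - p..<?N}" by blast
  qed
  moreover have "{..<P} \<union> (%i. i - (q - p) + P) ` {q - p..<?N} \<subseteq> {..<r}" using MP by auto
  ultimately have "{..<r} = {..<P} \<union> (%i. i - (q - p) + P) ` {q - p..<?N}" by (rule equalityI)
  then have "l2 ` {..<r} = l2 ` {..<P} \<union> l2 ` (%i. i - (q - p) + P) ` {q - p..<?N}" by (simp only: image_Un)
  also have "l2 ` (%i. i - (q - p) + P) ` {q - p..<?N} = l ` {q - p..<?N}"
   unfolding image_image by (rule image_cong[OF refl], rule L2) simp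
  finally show ?thesis using l2P by blast
 qed
 have cd: "card (l ` B \<union> D) = card B + P" if B: "B \<subseteq> {..<?N}" "finite B" for B
 proof -
  have "card (l ` B) = card B" by (rule card_image[OF inj_on_subset[OF l B(1)]])
  moreover have "l ` B \<inter> D = {}" using D(3) B(1) by blast
  ultimately show ?thesis using B(2) D(1,2) by (simp add: card_Un_disjoint P_def e_def)
 qed
 have "card (l ` {..<M} \<union> D) = card {..<M} + P" by (rule cd) (use MP(3) in simp_all)
 also have "\<dots> = card {..<q}" using MP(1) by simp
 finally have i1: "inj_on l1 {..<q}" unfolding I1[symmetric] by (intro eq_card_imp_inj_on finite_lessThan)
 have "card (l ` {q - p..<?N} \<union> D) = card {q - p..<?N} + P" by (rule cd) auto
 also have "\<dots> = card {..<r}" unfolding card_atLeastLessThan card_lessThan by (rule MP(2))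
 finally have i2: "inj_on l2 {..<r}" unfolding I2[symmetric] by (intro eq_card_imp_inj_on finite_lessThan)
 have "lab ?N l (gcon c q r p h w) t = cg D (lab q l1 h) (lab r l2 w) t"
  if m: "h \<in> borel_measurable (Rp q)" "w \<in> borel_measurable (Rp r)" and t: "t \<in> space NM" for h w t
 proof (cases c)
  case False
  then have e: "M = q - p" "P = p" "?N = q + r - 2 * p" by (simp_all add: M_def P_def e_def)
  let ?d = "%j. d (p - 1 - j)"
  have "?d ` {..<p} = d ` (%j. p - 1 - j) ` {..<p}" by (simp only: image_image)
  also have "\<dots> = D" unfolding reflect_image using dI e(2) by simp
  finally have I: "?d ` {..<p} = D" .
  have "card (?d ` {..<p}) = card {..<p}" unfolding I using D(2) False by simp
  then have "inj_on ?d {..<p}" by (intro eq_card_imp_inj_on finite_lessThan)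
  moreover have "?d ` {..<p} \<inter> l ` {..<q + r - 2 * p} = {}" using D(3) False unfolding I by simp
  ultimately have "lab (q + r - 2 * p) l (contraction q r p h w) t =
    cg D (lab q (%i. if i < q - p then l i else ?d (i - (q - p))) h) (lab r (%i. if i < p then ?d (p - 1 - i) else l (q - p + (i - p))) w) t"
   using lab_contraction[OF p(2,3) m _ _ t, of ?d l] unfolding I by blast
  moreover have "lab q (%i. if i < q - p then l i else ?d (i - (q - p))) h = lab q l1 h"
   by (rule lab_cong) (simp add: l1_def e)
  moreover have "lab r (%i. if i < p then ?d (p - 1 - i) else l (q - p + (i - p))) w = lab r l2 w"
   by (rule lab_cong) (simp add: l2_def e)
  ultimately show ?thesis using False by (simp add: gcon_def)
 next
  case True
  then have e: "M = q - p + 1" "P = p - 1" "?N = q + r - 2 * p + 1" "1 \<le> p" using p by (simp_all add: M_def P_def e_def)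
  have "d ` {..<p - 1} \<inter> l ` {..<q + r - 2 * p + 1} = {}" using D(3) True dI e by simp
  then have "lab (q + r - 2 * p + 1) l (star_contraction q r p h w) t =
    cg D (lab q (%i. if i \<le> q - p then l i else d (q - 1 - i)) h) (lab r (%i. if i < p - 1 then d i else l (q - p + (i - (p - 1)))) w) t"
   using lab_star_contraction[OF e(4) p(2,3) m _ _ t, of d l] di dI unfolding e(2) by blast
  moreover have "lab q (%i. if i \<le> q - p then l i else d (q - 1 - i)) h = lab q l1 h"
   by (rule lab_cong) (use p e(4) in \<open>auto simp: l1_def e intro!: arg_cong[where f = d]\<close>)
  moreover have "lab r (%i. if i < p - 1 then d i else l (q - p + (i - (p - 1)))) w = lab r l2 w"
   by (rule lab_cong) (simp add: l2_def e)
  ultimately show ?thesis using True by (simp add: gcon_def)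
 qed
 then have "glue_labels c q r p l D l1 l2"
  unfolding glue_labels_def using i1 i2 I1 I2 L2 l2P unfolding M_def P_def e_def l1_def by simp
 then show ?thesis by blast
qed

lemma fresh_glue_labels:
 fixes l :: "nat => nat"
 assumes "of_bool c \<le> p" "p \<le> q" "p \<le> r" "inj_on l {..<gord c q r p}" and U: "finite U"
 obtains D l1 l2 where "finite D" "D \<inter> l ` {..<gord c q r p} = {}" "D \<inter> U = {}" "glue_labels c q r p l D l1 l2"
proof -
 obtain d :: "nat => nat" where d: "inj d" "range d \<inter> (U \<union> l ` {..<gord c q r p}) = {}"
  using fresh_labels_ex[of "U \<union> l ` {..<gord c q r p}"] U by auto
 let ?D = "d ` {..<p - of_bool c}"
 have D: "finite ?D" "card ?D = p - of_bool c"
  by (simp_all add: card_image[OF inj_on_subset[OF d(1)]])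
 have D': "?D \<inter> l ` {..<gord c q r p} = {}" "?D \<inter> U = {}" using d(2) by blast+
 obtain l1 l2 where "glue_labels c q r p l ?D l1 l2" using glue_labels_ex[OF assms(1-4) D D'(1)] by blast
 with D(1) D' show ?thesis by (rule that)
qed

text \<open>The labels of the two factors: \<open>X\<close> and \<open>Z\<close> belong to one of them, \<open>D\<close> is integrated out, and \<open>Y\<close>, with at most
 one element, is shared but not integrated out.\<close>

lemma glue_labels_sets:
 assumes L: "glue_labels c q r p l D l1 l2" and p: "p \<le> q" "p \<le> r" and l: "inj_on l {..<gord c q r p}"
  and D: "D \<inter> l ` {..<gord c q r p} = {}" and cb: "c --> b"
  and XYZ: "X = l ` {..<q - p}" "Y = l ` {q - p..<q - p + of_bool c}" "Z = l ` {q - p + of_bool c..<gord c q r p}"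
 shows "l1 ` {..<q} = X \<union> Y \<union> D" "l2 ` {..<r} = Y \<union> Z \<union> D" "l ` {..<gord c q r p} = X \<union> Y \<union> Z"
  "X \<inter> Y = {}" "X \<inter> Z = {}" "Y \<inter> Z = {}" "D \<inter> (X \<union> Y \<union> Z) = {}" "Y = {} \<or> b \<and> (\<exists>y. Y = {y})"
  "gluable b (l1 ` {..<q}) (l2 ` {..<r}) D" "l1 ` {..<q} \<union> l2 ` {..<r} - D = l ` {..<gord c q r p}"
  "l1 ` {..<q} \<inter> l2 ` {..<r} = Y \<union> D"
proof -
 let ?N = "gord c q r p" and ?M = "q - p + of_bool c"
 have M: "q - p \<le> ?M" "?M \<le> ?N" using p by auto
 have s: "{..<?M} = {..<q - p} \<union> {q - p..<?M}" "{q - p..<?N} = {q - p..<?M} \<union> {?M..<?N}"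
  "{..<?N} = {..<q - p} \<union> {q - p..<?M} \<union> {?M..<?N}" using M by auto
 show 1: "l1 ` {..<q} = X \<union> Y \<union> D" unfolding glue_labelsD(3)[OF L] s(1) image_Un XYZ(1) XYZ(2) ..
 show 2: "l2 ` {..<r} = Y \<union> Z \<union> D" unfolding glue_labelsD(4)[OF L] s(2) image_Un XYZ(2) XYZ(3) ..
 show 3: "l ` {..<?N} = X \<union> Y \<union> Z" unfolding s(3) image_Un XYZ(1) XYZ(2) XYZ(3) ..
 show 4: "X \<inter> Y = {}" unfolding XYZ(1) XYZ(2) by (subst image_Int_sub[OF l]) (use M in auto)
 show 5: "X \<inter> Z = {}" unfolding XYZ(1) XYZ(3) by (subst image_Int_sub[OF l]) (use M in auto)
 show 6: "Y \<inter> Z = {}" unfolding XYZ(2) XYZ(3) by (subst image_Int_sub[OF l]) (use M in auto)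
 show 7: "D \<inter> (X \<union> Y \<union> Z) = {}" using D unfolding 3 .
 show 8: "Y = {} \<or> b \<and> (\<exists>y. Y = {y})" unfolding XYZ(2) using cb by (cases c) auto
 show 9: "l1 ` {..<q} \<inter> l2 ` {..<r} = Y \<union> D" unfolding 1 2 using 4 5 6 7 by blast
 show "gluable b (l1 ` {..<q}) (l2 ` {..<r}) D" unfolding gluable_def 9 using 7 8 by auto
 show "l1 ` {..<q} \<union> l2 ` {..<r} - D = l ` {..<?N}" unfolding 1 2 3 using 7 by blast
qed

lemma measurable_gcon:
 assumes p: "of_bool c \<le> p" "p \<le> q" "p \<le> r" and h: "h \<in> borel_measurable (Rp q)" and w: "w \<in> borel_measurable (Rp r)"
 shows "gcon c q r p h w \<in> borel_measurable (Rp (gord c q r p))"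
proof -
 obtain D l1 l2 where D: "finite D" "D \<inter> id ` {..<gord c q r p} = {}" "D \<inter> {} = {}" and L: "glue_labels c q r p id D l1 l2"
  by (rule fresh_glue_labels[OF p inj_on_id finite.emptyI])
 show ?thesis
  by (rule measurable_kernelI[OF measurable_cg[OF D(1) measurable_lab[OF h] measurable_lab[OF w]] glue_labelsD(8)[OF L h w]])
qed

lemma kTame_gcon:
 assumes v: "kTame b q v" and w: "kTame b r w" and p: "of_bool c \<le> p" "p \<le> q" "p \<le> r" and cb: "c --> b"
 shows "kTame b (gord c q r p) (%k. gcon c q r p (v k) (w k))"
 unfolding kTame_def
proof (intro conjI allI impI)
 let ?N = "gord c q r p"
 show m: "gcon c q r p (v k) (w k) \<in> borel_measurable (Rp ?N)" for k
  by (rule measurable_gcon[OF p kTameD(1)[OF v] kTameD(1)[OF w]])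
 fix l :: "nat => nat" assume l: "inj_on l {..<?N}"
 obtain D l1 l2 where "finite D" and D: "D \<inter> l ` {..<?N} = {}" and "D \<inter> {} = {}" and L: "glue_labels c q r p l D l1 l2"
  by (rule fresh_glue_labels[OF p l finite.emptyI])
 note S = glue_labels_sets[OF L p(2,3) l D cb refl refl refl]
 have T: "cTame b (l ` {..<?N}) (%k. cg D (lab q l1 (v k)) (lab r l2 (w k)))"
  using cTame_cg[OF kTameD(2)[OF v glue_labelsD(1)[OF L]] kTameD(2)[OF w glue_labelsD(2)[OF L]] S(9)] unfolding S(10) .
 show "cTame b (l ` {..<?N}) (%k. lab ?N l (gcon c q r p (v k) (w k)))"
 proof (rule cTame_cong[OF T])
  fix k
  show "lab ?N l (gcon c q r p (v k) (w k)) \<in> borel_measurable NM" by (rule measurable_lab[OF m])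
  show "dep (l ` {..<?N}) (lab ?N l (gcon c q r p (v k) (w k)))" by (rule dep_lab)
  show "lab ?N l (gcon c q r p (v k) (w k)) t = cg D (lab q l1 (v k)) (lab r l2 (w k)) t" if "t \<in> space NM" for t
   by (rule glue_labelsD(8)[OF L kTameD(1)[OF v, of k] kTameD(1)[OF w, of k] that])
 qed
qed

section \<open>Kernels that asymptotically cannot be contracted\<close>

text \<open>Gluing \<open>f\<close> to the interval \<open>{a..<e}\<close> of arguments of \<open>v\<close>, where at most the last one is not integrated
 out, gives a null sequence; with \<open>init\<close>, this is only required of initial intervals.\<close>

definition NF :: "bool => bool => nat => (nat => kernel) => nat => (nat => kernel) => bool" where
 "NF b init n f q v \<longleftrightarrow> (\<forall>l lf a e S. inj_on l {..<q} --> inj_on lf {..<n} --> a < e --> e \<le> q --> (init --> a = 0) -->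
  l ` {..<q} \<inter> lf ` {..<n} = l ` {a..<e} --> (S = {} \<or> b \<and> S = {e - 1}) -->
  cnull (lf ` {..<n} \<union> l ` {..<q} - l ` ({a..<e} - S))
   (%k. cg (l ` ({a..<e} - S)) (lab n lf (f k)) (lab q l (v k))))"

lemma NFD:
 assumes "NF b init n f q v" "inj_on l {..<q}" "inj_on lf {..<n}" "a < e" "e \<le> q" "init ==> a = 0"
  "l ` {..<q} \<inter> lf ` {..<n} = l ` {a..<e}" "S = {} \<or> b \<and> S = {e - 1}"
 shows "cnull (lf ` {..<n} \<union> l ` {..<q} - l ` ({a..<e} - S))
   (%k. cg (l ` ({a..<e} - S)) (lab n lf (f k)) (lab q l (v k)))"
 using assms unfolding NF_def by blast

lemma NF_weaken: "NF b False n f q v ==> NF b init n f q v"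
 unfolding NF_def by blast

lemma cg_cong_right:
 "(!!t. t \<in> space NM ==> w t = w' t) ==> t \<in> space NM ==> cg C h w t = cg C h w' t"
 unfolding cg_def cm_def by (intro Bochner_Integration.integral_cong) (auto simp: ov_space)

text \<open>If an interval of arguments of a gluing of \<open>v\<close> and \<open>w\<close> meets the arguments of \<open>v\<close>, it meets them in an
 interval, and by associativity already gluing \<open>f\<close> to \<open>v\<close> alone there gives a null sequence; otherwise the interval
 lies among the arguments of \<open>w\<close>. An argument shared by \<open>v\<close> and \<open>w\<close> that is integrated out against \<open>f\<close> is
 the last one of \<open>v\<close>, whence the exception for the last argument of the interval.\<close>

lemma NF_gcon:
 assumes f: "kTame b n f" and v: "kTame b q v" and w: "kTame b r w"
  and p: "of_bool c \<le> p" "p \<le> q" "p \<le> r" and cb: "c --> b"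
  and nfv: "NF b init n f q v" and nfw: "\<not> init ==> NF b False n f r w" and init: "init ==> 0 < q - p + of_bool c"
 shows "NF b init n f (gord c q r p) (%k. gcon c q r p (v k) (w k))"
 unfolding NF_def
proof (intro allI impI)
 let ?N = "gord c q r p" and ?M = "q - p + of_bool c"
 fix l lf :: "nat => nat" and a e S
 assume l: "inj_on l {..<?N}" and lf: "inj_on lf {..<n}" and ae: "a < e" "e \<le> ?N" "init --> a = 0"
  and touch: "l ` {..<?N} \<inter> lf ` {..<n} = l ` {a..<e}" and S: "S = {} \<or> b \<and> S = {e - 1}"
 have "finite (lf ` {..<n})" by simp
 then obtain D l1 l2 where "finite D" and D: "D \<inter> l ` {..<?N} = {}" "D \<inter> lf ` {..<n} = {}" and L: "glue_labels c q r p l D l1 l2"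
  by (rule fresh_glue_labels[OF p l])
 note sets = glue_labels_sets[OF L p(2,3) l D(1) cb refl refl refl] and L = glue_labelsD[OF L]
 define X where "X = l ` {..<q - p}"
 define Y where "Y = l ` {q - p..<?M}"
 define Z where "Z = l ` {?M..<?N}"
 note sets = sets[folded X_def Y_def Z_def]
 define T where "T = l ` {a..<e}"
 have M: "q - p \<le> ?M" "?M \<le> ?N" "?M \<le> q" using p by auto
 have SN: "S \<subseteq> {a..<e}" using S ae by auto
 have aeN: "{a..<e} \<subseteq> {..<?N}" using ae by auto
 have TS: "T - l ` S = l ` ({a..<e} - S)"
  unfolding T_def by (rule image_diff_sub[OF l aeN]) (use SN aeN in blast)
 have JD: "lf ` {..<n} \<inter> D = {}" using D(2) by blast
 have tame1: "cTame b (X \<union> Y \<union> D) (%k. lab q l1 (v k))" using kTameD(2)[OF v L(1)] unfolding sets(1) .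
 have tame2: "cTame b (Y \<union> Z \<union> D) (%k. lab r l2 (w k))" using kTameD(2)[OF w L(2)] unfolding sets(2) .
 have Teq: "T = lf ` {..<n} \<inter> (X \<union> Y \<union> Z)" using touch unfolding T_def sets(3) by blast
 have ST: "l ` S \<subseteq> T" using SN by (auto simp: T_def)
 have S1: "l ` S = {} \<or> b \<and> (\<exists>x. l ` S = {x})" using S by auto
 have mem: "l i \<in> l ` B \<longleftrightarrow> i \<in> B" if "i < ?N" "B \<subseteq> {..<?N}" for i B
  using l that unfolding inj_on_def by blast
 have "cnull (lf ` {..<n} \<union> (X \<union> Y \<union> Z) - (T - l ` S))
   (%k. cg (T - l ` S) (lab n lf (f k)) (cg D (lab q l1 (v k)) (lab r l2 (w k))))"
 proof (cases "a < ?M")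
  case True
  define e1 where "e1 = min e ?M"
  define S' where "S' = (if e \<le> q - p then S else {q - p..<?M})"
  have TXS: "T \<inter> X - l ` S = l1 ` ({a..<e1} - S')"
  proof -
   have "T \<inter> X = l ` ({a..<e} \<inter> {..<q - p})"
    unfolding T_def X_def by (rule image_Int_sub[OF l aeN]) (use M in auto)
   then have "T \<inter> X - l ` S = l ` ({a..<e} \<inter> {..<q - p}) - l ` S" by simp
   also have "\<dots> = l ` ({a..<e} \<inter> {..<q - p} - S)" by (rule image_diff_sub[OF l]) (use SN aeN in auto)
   also have "{a..<e} \<inter> {..<q - p} - S = {a..<e1} - S'" using S M ae by (auto simp: e1_def S'_def)
   also have "l ` \<dots> = l1 ` \<dots>" by (rule image_cong) (auto simp: L(5) e1_def)
   finally show ?thesis .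
  qed
  have "cnull (lf ` {..<n} \<union> l1 ` {..<q} - l1 ` ({a..<e1} - S'))
   (%k. cg (l1 ` ({a..<e1} - S')) (lab n lf (f k)) (lab q l1 (v k)))"
  proof (rule NFD[OF nfv L(1) lf])
   show "a < e1" "e1 \<le> q" using ae M True by (auto simp: e1_def)
   have "l1 ` {..<q} \<inter> lf ` {..<n} = (X \<union> Y) \<inter> (l ` {..<?N} \<inter> lf ` {..<n})"
    unfolding sets(1,3) using JD by blast
   also have "X \<union> Y = l ` {..<?M}"
    unfolding X_def Y_def image_Un[symmetric] by (rule arg_cong[where f = "image l"]) auto
   also have "l ` {..<?M} \<inter> (l ` {..<?N} \<inter> lf ` {..<n}) = l ` ({..<?M} \<inter> {a..<e})"
    unfolding touch by (rule image_Int_sub[OF l]) (use M aeN in auto)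
   also have "{..<?M} \<inter> {a..<e} = {a..<e1}" by (auto simp: e1_def)
   also have "l ` {a..<e1} = l1 ` {a..<e1}" by (rule image_cong) (auto simp: L(5) e1_def)
   finally show "l1 ` {..<q} \<inter> lf ` {..<n} = l1 ` {a..<e1}" .
   show "S' = {} \<or> b \<and> S' = {e1 - 1}"
    using S cb by (cases c) (auto simp: e1_def S'_def)
  qed (use ae in auto)
  then have null: "cnull (lf ` {..<n} \<union> (X \<union> Y \<union> D) - (T \<inter> X - l ` S))
    (%k. cg (T \<inter> X - l ` S) (lab n lf (f k)) (lab q l1 (v k)))"
   unfolding TXS[symmetric] sets(1) .
  show ?thesis
  proof (rule cnull_cg_touching_left[where b = b, OF kTameD(2)[OF f lf] tame1 tame2 sets(4-7) JD Teq ST S1 sets(8) _ _ null])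
   show "T \<inter> Y = {}" if ne: "l ` S \<inter> X \<noteq> {}"
   proof -
    have "S = {e - 1}" using ne S by auto
    then have "l (e - 1) \<in> l ` {..<q - p}" using ne by (auto simp: X_def)
    then have "e - 1 \<in> {..<q - p}" by (rule iffD1[OF mem, rotated 2]) (use ae M in auto)
    then have "{a..<e} \<inter> {q - p..<?M} = {}" by auto
    then show ?thesis unfolding T_def Y_def by (subst image_Int_sub[OF l aeN]) (use M in auto)
   qed
   show "Y \<subseteq> T" if ne: "l ` S \<inter> Z \<noteq> {}"
   proof -
    have "S = {e - 1}" using ne S by auto
    then have "l (e - 1) \<in> l ` {?M..<?N}" using ne by (auto simp: Z_def)
    then have "e - 1 \<in> {?M..<?N}" by (rule iffD1[OF mem, rotated 2]) (use ae in auto)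
    then show ?thesis unfolding Y_def T_def using True by (intro image_mono) (cases c, auto)
   qed
  qed
 next
  case False
  define sh where "sh i = i - (q - p) + (p - of_bool c)" for i
  have "\<not> init"
  proof
   assume i: init
   have "a = 0" using ae(3) i by simp
   with init[OF i] False show False by (linarith | simp | presburger | (cases c; simp) | auto)
  qed
  then have nfw': "NF b False n f r w" by (rule nfw)
  have aM: "?M \<le> a" "q - p \<le> a" using False by auto
  have l2sh: "l2 ` sh ` B = l ` B" if "B \<subseteq> {a..<e}" for B
   unfolding image_image by (rule image_cong[OF refl]) (use that aM L(6) in \<open>auto simp: sh_def\<close>)
  have shI: "sh ` {a..<e} = {sh a..<sh e}"
  proof (intro set_eqI iffI)
   fix i assume "i \<in> {sh a..<sh e}"
   then have "sh a \<le> i" "i < sh e" by simp_all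
   then have "i = sh (i - (p - of_bool c) + (q - p))" "a \<le> i - (p - of_bool c) + (q - p)" "i - (p - of_bool c) + (q - p) < e"
    using aM unfolding sh_def by arith+
   then have "i = sh (i - (p - of_bool c) + (q - p))" "i - (p - of_bool c) + (q - p) \<in> {a..<e}" by simp_all
   then show "i \<in> sh ` {a..<e}" by blast
  qed (use aM in \<open>auto simp: sh_def\<close>)
  have shS: "sh ` S = {} \<or> b \<and> sh ` S = {sh e - 1}" using S ae aM by (auto simp: sh_def)
  have sh_diff: "{sh a..<sh e} - sh ` S = sh ` ({a..<e} - S)"
  proof -
   have "inj_on sh {a..<e}" using aM by (auto simp: inj_on_def sh_def)
   then show ?thesis unfolding shI[symmetric] by (rule image_diff_sub) (use SN in auto)
  qed
  have aeZ: "l ` {a..<e} \<subseteq> Z" unfolding Z_def using ae aM by (intro image_mono) auto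
  have "cnull (lf ` {..<n} \<union> l2 ` {..<r} - l2 ` ({sh a..<sh e} - sh ` S))
    (%k. cg (l2 ` ({sh a..<sh e} - sh ` S)) (lab n lf (f k)) (lab r l2 (w k)))"
  proof (rule NFD[OF nfw' L(2) lf _ _ _ _ shS])
   show "sh a < sh e" "sh e \<le> r" using ae p aM by (auto simp: sh_def)
   have "l2 ` {..<r} \<inter> lf ` {..<n} = (Y \<union> Z) \<inter> (l ` {..<?N} \<inter> lf ` {..<n})"
    unfolding sets(2,3) using JD by blast
   also have "\<dots> = l ` {a..<e}" unfolding touch using aeZ by blast
   also have "\<dots> = l2 ` {sh a..<sh e}" using l2sh[of "{a..<e}"] by (simp add: shI)
   finally show "l2 ` {..<r} \<inter> lf ` {..<n} = l2 ` {sh a..<sh e}" .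
  qed auto
  then have null: "cnull (lf ` {..<n} \<union> (Y \<union> Z \<union> D) - (T - l ` S))
    (%k. cg (T - l ` S) (lab n lf (f k)) (lab r l2 (w k)))"
   unfolding sh_diff l2sh[OF Diff_subset] TS sets(2) .
  show ?thesis
   by (rule cnull_cg_touching_right[where b = b, OF kTameD(2)[OF f lf] tame1 tame2 sets(4-7) JD Teq _ ST S1 sets(8) null])
    (use aeZ in \<open>simp add: T_def\<close>)
 qed
 then have *: "cnull (lf ` {..<n} \<union> l ` {..<?N} - l ` ({a..<e} - S))
   (%k. cg (l ` ({a..<e} - S)) (lab n lf (f k)) (cg D (lab q l1 (v k)) (lab r l2 (w k))))"
  unfolding TS sets(3) .
 show "cnull (lf ` {..<n} \<union> l ` {..<?N} - l ` ({a..<e} - S))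
   (%k. cg (l ` ({a..<e} - S)) (lab n lf (f k)) (lab ?N l (gcon c q r p (v k) (w k))))"
 proof (rule cnull_cong[THEN iffD2, OF _ *])
  fix k t assume t: "t \<in> space NM"
  show "cg (l ` ({a..<e} - S)) (lab n lf (f k)) (lab ?N l (gcon c q r p (v k) (w k))) t =
    cg (l ` ({a..<e} - S)) (lab n lf (f k)) (cg D (lab q l1 (v k)) (lab r l2 (w k))) t"
   by (rule cg_cong_right[OF _ t]) (rule L(8)[OF kTameD(1)[OF v, of k] kTameD(1)[OF w, of k]])
 qed
qed

lemma NF_tensor_initial:
 assumes "kTame b n f" "kTame b q v" "kTame b r w" "1 \<le> q" "NF b False n f q v"
 shows "NF b True n f (q + r) (%k. contraction q r 0 (v k) (w k))"
 using NF_gcon[OF assms(1-3), of False 0 True] NF_weaken[OF assms(5), of True] assms(4) by (simp add: gcon_def)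

text \<open>Partial integrals of nonnegative functions vanish exactly when the integrand does almost everywhere.\<close>

lemma lm_zero_iff:
 assumes "\<phi> \<in> borel_measurable NM" "t \<in> space NM"
 shows "lm C \<phi> t = 0 \<longleftrightarrow> (AE s in PM C. \<phi> (ov C t s) = 0)"
 unfolding lm_def by (rule nn_integral_0_iff_AE) (rule measurable_ov_section[OF assms])

text \<open>Gluing respects equality almost everywhere, by Fubini's theorem; symmetric kernels are only symmetric in this sense.\<close>

lemma cnsq_cg_AE_cong:
 assumes fin: "finite J1" "finite J2" and C: "C \<subseteq> J1 \<union> J2"
  and m: "F \<in> borel_measurable NM" "F' \<in> borel_measurable NM" "V \<in> borel_measurable NM"
  and d: "dep J1 F" "dep J1 F'" "dep J2 V"
  and null: "cnsq J1 (%t. F t - F' t) = 0"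
 shows "cnsq (J1 \<union> J2 - C) (cg C F V) = cnsq (J1 \<union> J2 - C) (cg C F' V)"
proof -
 note [measurable] = m
 define h where "h t = ennreal (cmod ((F t - F' t) * V t))" for t
 have mh [measurable]: "h \<in> borel_measurable NM" unfolding h_def[abs_def] by measurable
 have finC: "finite C" using fin C by (meson finite_UnI finite_subset)
 have dd: "dep J1 (%t. ennreal (cmod (F t - F' t)))"
  by (rule dep_op1[OF dep_op2[OF d(1,2), of minus, unfolded Un_absorb]])
 have h1: "lm J1 h t = 0" if t: "t \<in> space NM" for t
 proof -
  have "lm J1 (%t. (ennreal (cmod (F t - F' t)))\<^sup>2) t = 0"
   using null nsq_eq[OF dd, of t] by (simp add: cnsq_def)
  moreover have "(%t. (ennreal (cmod (F t - F' t)))\<^sup>2) \<in> borel_measurable NM" by measurable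
  ultimately have "AE s in PM J1. (ennreal (cmod (F (ov J1 t s) - F' (ov J1 t s))))\<^sup>2 = 0"
   using lm_zero_iff[OF _ t] by blast
  then have "AE s in PM J1. h (ov J1 t s) = 0"
   by (rule AE_mp) (rule AE_I2, simp add: h_def)
  then show ?thesis using lm_zero_iff[OF mh t] by blast
 qed
 have "lm (J1 \<union> J2) h (%_. 0) = lm ((J2 - J1) \<union> J1) h (%_. 0)" by (simp add: Un_commute)
 also have "\<dots> = lm (J2 - J1) (lm J1 h) (%_. 0)" by (rule lm_Un) (use fin in auto)
 also have "\<dots> = lm (J2 - J1) (%_. 0) (%_. 0)" by (rule lm_cong) (auto simp: h1)
 also have "\<dots> = 0" by (simp add: lm_def)
 finally have "lm (J1 \<union> J2) h (%_. 0) = 0" .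
 moreover have "lm ((J1 \<union> J2 - C) \<union> C) h (%_. 0) = lm (J1 \<union> J2 - C) (lm C h) (%_. 0)"
  by (rule lm_Un) (use fin finC in auto)
 moreover have "(J1 \<union> J2 - C) \<union> C = J1 \<union> J2" using C by blast
 ultimately have "lm (J1 \<union> J2 - C) (lm C h) (%_. 0) = 0" by simp
 then have ae: "AE s in PM (J1 \<union> J2 - C). lm C h (ov (J1 \<union> J2 - C) (%_. 0) s) = 0"
  by (subst (asm) lm_zero_iff) (auto intro!: measurable_lm mh finC)
 have eq: "cg C F V t = cg C F' V t" if "lm C h t = 0" and t: "t \<in> space NM" for t
 proof -
  have "AE s in PM C. h (ov C t s) = 0" using that lm_zero_iff[OF mh t] by blast
  then have "AE s in PM C. F (ov C t s) * V (ov C t s) = F' (ov C t s) * V (ov C t s)"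
   by (rule AE_mp) (rule AE_I2, auto simp: h_def ennreal_eq_0_iff)
  then show ?thesis unfolding cg_def cm_def
   by (intro integral_cong_AE measurable_ov_section[OF _ t] borel_measurable_times m)
 qed
 have "AE s in PM (J1 \<union> J2 - C). cg C F V (ov (J1 \<union> J2 - C) (%_. 0) s) = cg C F' V (ov (J1 \<union> J2 - C) (%_. 0) s)"
  using ae AE_space by eventually_elim (rule eq, auto intro: ov_space)
 then have "AE s in PM (J1 \<union> J2 - C). (ennreal (cmod (cg C F V (ov (J1 \<union> J2 - C) (%_. 0) s))))\<^sup>2 =
   (ennreal (cmod (cg C F' V (ov (J1 \<union> J2 - C) (%_. 0) s))))\<^sup>2"
  by eventually_elim simp
 then show ?thesis unfolding cnsq_def nsq_def lm_def by (rule nn_integral_cong_AE)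
qed

lemma measurable_permuted_kernel:
 assumes "f \<in> borel_measurable (Rp n)" "\<sigma> permutes {..<n}"
 shows "(%t. f (\<lambda>i\<in>{..<n}. t (\<sigma> i))) \<in> borel_measurable (Rp n)"
proof (rule measurable_compose[OF _ assms(1)])
 show "(%t. \<lambda>i\<in>{..<n}. t (\<sigma> i)) \<in> Rp n \<rightarrow>\<^sub>M Rp n"
  unfolding Rp_PM
 proof (rule measurable_restrict)
  fix i assume "i \<in> {..<n}"
  then have "\<sigma> i \<in> {..<n}" using permutes_in_image[OF assms(2)] by blast
  then show "(%t. t (\<sigma> i)) \<in> PM {..<n} \<rightarrow>\<^sub>M halfline" by (rule measurable_component_singleton)
 qed
qed

lemma relabelling_permutation:
 fixes l l' :: "nat => nat"
 assumes l: "inj_on l {..<n}" and l': "inj_on l' {..<n}" and im: "l ` {..<n} = l' ` {..<n}"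
 shows "\<exists>\<sigma>. \<sigma> permutes {..<n} \<and> (\<forall>i<n. l' i = l (\<sigma> i))"
proof -
 define \<sigma> where "\<sigma> i = (if i \<in> {..<n} then inv_into {..<n} l (l' i) else i)" for i
 have "bij_betw (inv_into {..<n} l \<circ> l') {..<n} {..<n}"
  by (rule bij_betw_trans[OF bij_betw_imageI[OF l' im[symmetric]] bij_betw_inv_into[OF bij_betw_imageI[OF l refl]]])
 moreover have "bij_betw (inv_into {..<n} l \<circ> l') {..<n} {..<n} \<longleftrightarrow> bij_betw \<sigma> {..<n} {..<n}"
  by (rule bij_betw_cong) (simp add: \<sigma>_def)
 ultimately have "\<sigma> permutes {..<n}"
  by (intro bij_imp_permutes) (auto simp: \<sigma>_def)
 moreover have "l' i = l (\<sigma> i)" if "i < n" for i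
 proof -
  have "l' i \<in> l ` {..<n}" using that im by blast
  then show ?thesis using that by (simp add: \<sigma>_def f_inv_into_f)
 qed
 ultimately show ?thesis by blast
qed

lemma cnsq_lab_relabel:
 fixes l l' :: "nat => nat"
 assumes f: "f \<in> borel_measurable (Rp n)" "symmetric_kernel n f"
  and l: "inj_on l {..<n}" "inj_on l' {..<n}" "l ` {..<n} = l' ` {..<n}"
 shows "cnsq (l ` {..<n}) (%t. lab n l f t - lab n l' f t) = 0"
proof -
 obtain \<sigma> where \<sigma>: "\<sigma> permutes {..<n}" "!!i. i < n ==> l' i = l (\<sigma> i)"
  using relabelling_permutation[OF l] by blast
 define f' where "f' t = f (\<lambda>i\<in>{..<n}. t (\<sigma> i))" for t
 have m: "f' \<in> borel_measurable (Rp n)"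
  unfolding f'_def[abs_def] by (rule measurable_permuted_kernel[OF f(1) \<sigma>(1)])
 have lab': "lab n l' f t = lab n l f' t" for t
  unfolding lab_def f'_def using \<sigma> permutes_in_image[OF \<sigma>(1)]
  by (intro arg_cong[where f = f]) (auto simp: fun_eq_iff restrict_def)
 have "(%t. lab n l f t - lab n l' f t) = lab n l (%t. f t - f' t)"
  unfolding lab' by (simp add: lab_def[abs_def])
 then have "cnsq (l ` {..<n}) (%t. lab n l f t - lab n l' f t) = n2 n (%t. f t - f' t)"
  using cnsq_lab[OF l(1), of "%t. f t - f' t"] f(1) m by simp
 also have "\<dots> = (\<integral>\<^sup>+ s. 0 \<partial>Rp n)"
  unfolding n2_def
 proof (rule nn_integral_cong_AE)
  have "AE t in Rp n. f t = f' t" using f(2) \<sigma>(1) unfolding symmetric_kernel_def f'_def by blast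
  then show "AE t in Rp n. (ennreal (cmod (f t - f' t)))\<^sup>2 = 0" by eventually_elim simp
 qed
 finally show ?thesis by simp
qed

text \<open>Almost everywhere symmetric kernels may be glued with their arguments in any order.\<close>

lemma cnsq_cg_relabel:
 fixes l1 l1' l2 l2' :: "nat => nat"
 assumes f: "f \<in> borel_measurable (Rp n)" "symmetric_kernel n f"
  and g: "g \<in> borel_measurable (Rp m)" "symmetric_kernel m g"
  and l1: "inj_on l1 {..<n}" "inj_on l1' {..<n}" "l1 ` {..<n} = l1' ` {..<n}"
  and l2: "inj_on l2 {..<m}" "inj_on l2' {..<m}" "l2 ` {..<m} = l2' ` {..<m}"
  and C: "C \<subseteq> l1 ` {..<n} \<union> l2 ` {..<m}"
 shows "cnsq (l1 ` {..<n} \<union> l2 ` {..<m} - C) (cg C (lab n l1 f) (lab m l2 g)) =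
  cnsq (l1 ` {..<n} \<union> l2 ` {..<m} - C) (cg C (lab n l1' f) (lab m l2' g))"
proof -
 note mf = measurable_lab[OF f(1)] and mg = measurable_lab[OF g(1)]
 have d1': "dep (l1 ` {..<n}) (lab n l1' f)" unfolding l1(3) by (rule dep_lab)
 have d2': "dep (l2 ` {..<m}) (lab m l2' g)" unfolding l2(3) by (rule dep_lab)
 have "cnsq (l1 ` {..<n} \<union> l2 ` {..<m} - C) (cg C (lab n l1 f) (lab m l2 g)) =
  cnsq (l1 ` {..<n} \<union> l2 ` {..<m} - C) (cg C (lab n l1' f) (lab m l2 g))"
  by (rule cnsq_cg_AE_cong[OF _ _ C mf mf mg dep_lab d1' dep_lab cnsq_lab_relabel[OF f l1]]) auto
 also have "\<dots> = cnsq (l2 ` {..<m} \<union> l1 ` {..<n} - C) (cg C (lab m l2 g) (lab n l1' f))"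
  by (simp only: cg_sym[of C "lab n l1' f"] Un_commute)
 also have "\<dots> = cnsq (l2 ` {..<m} \<union> l1 ` {..<n} - C) (cg C (lab m l2' g) (lab n l1' f))"
  by (rule cnsq_cg_AE_cong[OF _ _ _ mg mg mf dep_lab d2' d1' cnsq_lab_relabel[OF g l2]]) (use C in auto)
 also have "\<dots> = cnsq (l1 ` {..<n} \<union> l2 ` {..<m} - C) (cg C (lab n l1' f) (lab m l2' g))"
  by (simp only: cg_sym[of C "lab n l1' f"] Un_commute)
 finally show ?thesis .
qed

text \<open>For symmetric kernels, every way of gluing \<open>f\<close> to \<open>g\<close> is a contraction or a star contraction.\<close>

lemma cnull_glue_symmetric:
 fixes lf lg :: "nat => nat"
 assumes f: "!!k. f k \<in> borel_measurable (Rp n)" "!!k. symmetric_kernel n (f k)"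
  and g: "!!k. g k \<in> borel_measurable (Rp m)" "!!k. symmetric_kernel m (g k)"
  and null: "!!c p. (c --> b) ==> 1 \<le> p ==> p \<le> n ==> p \<le> m ==> kNull (gord c n m p) (%k. gcon c n m p (f k) (g k))"
  and lf: "inj_on lf {..<n}" and lg: "inj_on lg {..<m}" and T: "T = lf ` {..<n} \<inter> lg ` {..<m}" "T \<noteq> {}"
  and S: "S \<subseteq> T" "S = {} \<or> b \<and> (\<exists>y. S = {y})"
 shows "cnull (lf ` {..<n} \<union> lg ` {..<m} - (T - S)) (%k. cg (T - S) (lab n lf (f k)) (lab m lg (g k)))"
proof -
 define c where "c \<longleftrightarrow> S \<noteq> {}"
 define p where "p = card T"
 have cb: "c --> b" using S by (auto simp: c_def)
 have fT: "finite T" using T by simp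
 have cS: "card S = of_bool c" using S(2) by (auto simp: c_def)
 have p1: "1 \<le> p" using T fT by (simp add: p_def Suc_le_eq card_gt_0_iff)
 have pn: "p \<le> n" using card_mono[of "lf ` {..<n}" T] T(1) by (simp add: card_image[OF lf] p_def)
 have pm: "p \<le> m" using card_mono[of "lg ` {..<m}" T] T(1) by (simp add: card_image[OF lg] p_def)
 have cp: "of_bool c \<le> p" using p1 by simp
 let ?N = "gord c n m p" and ?M = "n - p + of_bool c"
 have MN: "?M \<le> ?N" "?N - ?M = m - p" using pn pm by auto
 define A where "A = lf ` {..<n} - T"
 define B where "B = lg ` {..<m} - T"
 have cA: "card A = n - p" and cB: "card B = m - p"
  using T by (simp_all add: A_def B_def card_Diff_subset fT card_image[OF lf] card_image[OF lg] p_def)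
 have fin: "finite A" "finite B" "finite S" using finite_subset[OF S(1) fT] by (simp_all add: A_def B_def)
 obtain hf where h1: "bij_betw hf {0..<n - p} A" using ex_bij_betw_nat_finite[OF fin(1)] unfolding cA by blast
 obtain hg where h2: "bij_betw hg {0..<m - p} B" using ex_bij_betw_nat_finite[OF fin(2)] unfolding cB by blast
 obtain hs where h3: "bij_betw hs {0..<of_bool c :: nat} S" using ex_bij_betw_nat_finite[OF fin(3)] unfolding cS by blast
 note h = h1 h2 h3
 define l where "l i = (if i < n - p then hf i else if i < ?M then hs (i - (n - p)) else hg (i - ?M))" for i
 have lA: "l ` {..<n - p} = A"
  using h(1) unfolding bij_betw_def lessThan_atLeast0 by (auto simp: l_def image_iff)
 have lS: "l ` {n - p..<?M} = S"
 proof -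
  have "{n - p..<?M} = (%i. n - p + i) ` {0..<of_bool c}" by simp
  then have "l ` {n - p..<?M} = l ` (%i. n - p + i) ` {0..<of_bool c}" by (simp only:)
  also have "\<dots> = hs ` {0..<of_bool c}" unfolding image_image by (rule image_cong) (auto simp: l_def)
  finally show ?thesis using h(3) by (simp add: bij_betw_def)
 qed
 have lB: "l ` {?M..<?N} = B"
 proof -
  have e: "?N = m - p + ?M" using MN by linarith
  have "(%i. ?M + i) ` {0..<m - p} = {?M..<m - p + ?M}" using image_add_atLeastLessThan[of ?M 0 "m - p"] by (simp only: add_0)
  then have "{?M..<?N} = (%i. ?M + i) ` {0..<m - p}" unfolding e by (rule sym)
  then have "l ` {?M..<?N} = l ` (%i. ?M + i) ` {0..<m - p}" by (simp only:)
  also have "\<dots> = hg ` {0..<m - p}" unfolding image_image by (rule image_cong) (auto simp: l_def)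
  finally show ?thesis using h(2) by (simp add: bij_betw_def)
 qed
 have s: "{..<?N} = {..<n - p} \<union> {n - p..<?M} \<union> {?M..<?N}" "{..<?M} = {..<n - p} \<union> {n - p..<?M}"
  "{n - p..<?N} = {n - p..<?M} \<union> {?M..<?N}" using MN by auto
 have lN: "l ` {..<?N} = A \<union> S \<union> B" unfolding s(1) image_Un lA lS lB ..
 have AB: "A \<inter> B = {}" "(A \<union> B) \<inter> S = {}" using T(1) S(1) by (auto simp: A_def B_def)
 have l: "inj_on l {..<?N}"
 proof (rule eq_card_imp_inj_on)
  have "card (A \<union> S \<union> B) = card A + card S + card B"
   using AB fT finite_subset[OF S(1) fT] by (subst card_Un_disjoint; (subst card_Un_disjoint)?) (auto simp: A_def B_def)
  then show "card (l ` {..<?N}) = card {..<?N}" unfolding lN cA cB cS using pn pm by simp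
 qed simp
 define D where "D = T - S"
 have D: "finite D" "card D = p - of_bool c" "D \<inter> l ` {..<?N} = {}"
  using fT cS S(1) unfolding lN by (auto simp: D_def p_def card_Diff_subset finite_subset[OF S(1) fT] A_def B_def)
 obtain l1 l2 where L: "glue_labels c n m p l D l1 l2" using glue_labels_ex[OF cp pn pm l D] by blast
 note U = glue_labels_sets[OF L pn pm l D(3) cb refl refl refl] and L = glue_labelsD[OF L]
 have i1: "lf ` {..<n} = l1 ` {..<n}" unfolding L(3) s(2) image_Un lA lS using S(1) T(1) by (auto simp: A_def D_def)
 have i2: "lg ` {..<m} = l2 ` {..<m}" unfolding L(4) s(3) image_Un lB lS using S(1) T(1) by (auto simp: B_def D_def)
 have "cnsq (lf ` {..<n} \<union> lg ` {..<m} - D) (cg D (lab n lf (f k)) (lab m lg (g k))) = n2 ?N (gcon c n m p (f k) (g k))" for k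
 proof -
  have "cnsq (lf ` {..<n} \<union> lg ` {..<m} - D) (cg D (lab n lf (f k)) (lab m lg (g k))) =
    cnsq (lf ` {..<n} \<union> lg ` {..<m} - D) (cg D (lab n l1 (f k)) (lab m l2 (g k)))"
   by (rule cnsq_cg_relabel[OF f g lf L(1) i1 lg L(2) i2]) (use T(1) in \<open>auto simp: D_def\<close>)
  also have "\<dots> = cnsq (l ` {..<?N}) (lab ?N l (gcon c n m p (f k) (g k)))"
   unfolding i1 i2 U(10) by (rule cnsq_cong) (rule L(8)[OF f(1) g(1), symmetric])
  also have "\<dots> = n2 ?N (gcon c n m p (f k) (g k))" by (rule cnsq_lab[OF l measurable_gcon[OF cp pn pm f(1) g(1)]])
  finally show ?thesis .
 qed
 then show ?thesis
  using null[OF cb p1 pn pm] unfolding D_def[symmetric] cnull_def kNull_def by simp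
qed

lemma NF_of_contractions:
 assumes f: "!!k. f k \<in> borel_measurable (Rp n)" "!!k. symmetric_kernel n (f k)"
  and g: "!!k. g k \<in> borel_measurable (Rp m)" "!!k. symmetric_kernel m (g k)"
  and null: "!!c p. (c --> b) ==> 1 \<le> p ==> p \<le> n ==> p \<le> m ==> kNull (gord c n m p) (%k. gcon c n m p (f k) (g k))"
 shows "NF b False n f m g" "NF b False m g n f"
proof -
 have *: "l ` ({a..<e} - S) = l ` {a..<e} - l ` S" "l ` S \<subseteq> l ` {a..<e}" "l ` S = {} \<or> b \<and> (\<exists>y. l ` S = {y})" "l ` {a..<e} \<noteq> {}"
  if "inj_on l {..<q}" "a < e" "e \<le> q" "S = {} \<or> b \<and> S = {e - 1}" for l :: "nat => nat" and q a e S
 proof -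
  have S: "S \<subseteq> {a..<e}" "{a..<e} \<subseteq> {..<q}" using that by auto
  show "l ` ({a..<e} - S) = l ` {a..<e} - l ` S" by (rule image_diff_sub[OF that(1) S(2) order_trans[OF S], symmetric])
 qed (use that in auto)
 show "NF b False n f m g"
  unfolding NF_def
 proof (intro allI impI)
  fix l lf :: "nat => nat" and a e S
  assume a: "inj_on l {..<m}" "inj_on lf {..<n}" "a < e" "e \<le> m" "l ` {..<m} \<inter> lf ` {..<n} = l ` {a..<e}" "S = {} \<or> b \<and> S = {e - 1}"
  note S = *[OF a(1,3,4,6)]
  show "cnull (lf ` {..<n} \<union> l ` {..<m} - l ` ({a..<e} - S)) (%k. cg (l ` ({a..<e} - S)) (lab n lf (f k)) (lab m l (g k)))"
   unfolding S(1) by (rule cnull_glue_symmetric[OF f g null a(2,1) _ S(4,2,3)]) (use a(5) in \<open>simp_all add: Int_commute\<close>)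
 qed
 show "NF b False m g n f"
  unfolding NF_def
 proof (intro allI impI)
  fix l lg :: "nat => nat" and a e S
  assume a: "inj_on l {..<n}" "inj_on lg {..<m}" "a < e" "e \<le> n" "l ` {..<n} \<inter> lg ` {..<m} = l ` {a..<e}" "S = {} \<or> b \<and> S = {e - 1}"
  note S = *[OF a(1,3,4,6)]
  have "cnull (l ` {..<n} \<union> lg ` {..<m} - (l ` {a..<e} - l ` S)) (%k. cg (l ` {a..<e} - l ` S) (lab n l (f k)) (lab m lg (g k)))"
   by (rule cnull_glue_symmetric[OF f g null a(1,2) _ S(4,2,3)]) (use a(5) in simp_all)
  then show "cnull (lg ` {..<m} \<union> l ` {..<n} - l ` ({a..<e} - S)) (%k. cg (l ` ({a..<e} - S)) (lab m lg (g k)) (lab n l (f k)))"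
   unfolding S(1) by (simp only: Un_commute cg_sym[of _ "lab n l (f _)"])
 qed
qed

text \<open>Gluing \<open>f\<close> to a tensor product \<open>u \<otimes> z\<close> along more arguments than \<open>u\<close> has reaches into \<open>z\<close>.\<close>

lemma NF_beyond_tensor:
 fixes l lf :: "nat => nat"
 assumes f: "kTame b n f" and u: "kTame b a u" and z: "kTame b c z" and nf: "NF b True n f c z"
  and l: "inj_on l {..<a + c}" and lf: "inj_on lf {..<n}" and p: "a < p" "p \<le> a + c"
  and touch: "l ` {..<a + c} \<inter> lf ` {..<n} = l ` {..<p}" and S: "S = {} \<or> b \<and> S = {p - 1}"
 shows "cnull (lf ` {..<n} \<union> l ` {..<a + c} - l ` ({..<p} - S))
   (%k. cg (l ` ({..<p} - S)) (lab n lf (f k)) (lab (a + c) l (contraction a c 0 (u k) (z k))))"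
proof -
 define l2 where "l2 i = l (a + i)" for i
 define X where "X = l2 ` {..<c}"
 define Z where "Z = l ` {..<a}"
 define T where "T = l ` {..<p}"
 have l1i: "inj_on l {..<a}" using l by (rule inj_on_subset) auto
 have l2i: "inj_on l2 {..<c}"
 proof (rule inj_onI)
  fix x y assume "x \<in> {..<c}" "y \<in> {..<c}" "l2 x = l2 y"
  then show "x = y" using inj_onD[OF l, of "a + x" "a + y"] by (simp add: l2_def)
 qed
 have shI: "l2 ` B = l ` (%i. a + i) ` B" for B unfolding image_image l2_def ..
 have XI: "X = l ` {a..<a + c}" unfolding X_def shI by (simp add: lessThan_atLeast0 add.commute)
 have pI: "{..<p} \<subseteq> {..<a + c}" using p by auto
 have SN: "S \<subseteq> {..<p}" using S p by auto
 have TS: "T - l ` S = l ` ({..<p} - S)"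
  unfolding T_def by (rule image_diff_sub[OF l pI order_trans[OF SN pI]])
 have XZ: "X \<union> Z = l ` {..<a + c}" unfolding XI Z_def image_Un[symmetric] by (rule arg_cong[where f = "image l"]) auto
 have XZd: "X \<inter> Z = {}" unfolding XI Z_def by (subst image_Int_sub[OF l]) auto
 have TX: "T \<inter> X = l ` {a..<p}"
  unfolding T_def XI by (subst image_Int_sub[OF l pI]) (use p in \<open>auto intro!: arg_cong[where f = "image l"]\<close>)
 define S' where "S' = (if S = {} then {} else {p - a - 1})"
 have S': "(%i. a + i) ` S' = S" using S p by (auto simp: S'_def)
 have TXS: "T \<inter> X - l ` S = l2 ` ({0..<p - a} - S')"
 proof -
  have "T \<inter> X - l ` S = l ` ({a..<p} - S)"
   unfolding TX by (rule image_diff_sub[OF l]) (use SN p in auto)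
  also have "{a..<p} - S = (%i. a + i) ` ({0..<p - a} - S')"
  proof -
   have "(%i. a + i) ` ({0..<p - a} - S') = (%i. a + i) ` {0..<p - a} - (%i. a + i) ` S'"
    by (rule image_set_diff) simp
   also have "(%i. a + i) ` {0..<p - a} = {a..<p}" using p by (simp add: add.commute)
   finally show ?thesis by (simp only: S')
  qed
  finally show ?thesis by (simp only: shI)
 qed
 have tX: "cTame b (X \<union> {} \<union> {}) (%k. lab c l2 (z k))" using kTameD(2)[OF z l2i] by (simp add: X_def)
 have tZ: "cTame b ({} \<union> Z \<union> {}) (%k. lab a l (u k))" using kTameD(2)[OF u l1i] by (simp add: Z_def)
 have "cnull (lf ` {..<n} \<union> l2 ` {..<c} - l2 ` ({0..<p - a} - S'))
   (%k. cg (l2 ` ({0..<p - a} - S')) (lab n lf (f k)) (lab c l2 (z k)))"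
 proof (rule NFD[OF nf l2i lf])
  have "l2 ` {..<c} \<inter> lf ` {..<n} = X \<inter> (l ` {..<a + c} \<inter> lf ` {..<n})" unfolding X_def[symmetric] XZ[symmetric] by blast
  also have "\<dots> = T \<inter> X" unfolding touch T_def by blast
  also have "\<dots> = l ` (%i. a + i) ` {0..<p - a}" unfolding TX using p by (simp add: add.commute)
  finally show "l2 ` {..<c} \<inter> lf ` {..<n} = l2 ` {0..<p - a}" by (simp only: shI)
  show "S' = {} \<or> b \<and> S' = {p - a - 1}" using S by (auto simp: S'_def)
 qed (use p in auto)
 then have null: "cnull (lf ` {..<n} \<union> (X \<union> {} \<union> {}) - (T \<inter> X - l ` S))
   (%k. cg (T \<inter> X - l ` S) (lab n lf (f k)) (lab c l2 (z k)))"
  unfolding TXS[symmetric] X_def[symmetric] by (simp only: Un_empty_right)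
 have "cnull (lf ` {..<n} \<union> (X \<union> {} \<union> Z) - (T - l ` S))
   (%k. cg (T - l ` S) (lab n lf (f k)) (cg {} (lab c l2 (z k)) (lab a l (u k))))"
 proof (rule cnull_cg_touching_left[where b = b, OF kTameD(2)[OF f lf] tX tZ _ XZd _ _ _ _ _ _ _ _ _ null])
  show "T = lf ` {..<n} \<inter> (X \<union> {} \<union> Z)" using touch unfolding T_def XZ[symmetric] by (simp add: Int_commute)
  show "l ` S \<subseteq> T" using SN by (auto simp: T_def)
  show "l ` S = {} \<or> b \<and> (\<exists>x. l ` S = {x})" using S by auto
 qed auto
 then have *: "cnull (lf ` {..<n} \<union> l ` {..<a + c} - l ` ({..<p} - S))
   (%k. cg (l ` ({..<p} - S)) (lab n lf (f k)) (cg {} (lab c l2 (z k)) (lab a l (u k))))"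
  unfolding TS XZ[symmetric] by (simp only: Un_empty_right)
 show ?thesis
 proof (rule cnull_cong[THEN iffD2, OF _ *])
  fix k t assume t: "t \<in> space NM"
  show "cg (l ` ({..<p} - S)) (lab n lf (f k)) (lab (a + c) l (contraction a c 0 (u k) (z k))) t =
    cg (l ` ({..<p} - S)) (lab n lf (f k)) (cg {} (lab c l2 (z k)) (lab a l (u k))) t"
  proof (rule cg_cong_right[OF _ t])
   fix t assume t: "t \<in> space NM"
   have i0: "inj_on id {..<0::nat}" "id ` {..<0::nat} \<inter> l ` {..<a + c - 2 * 0} = {}" by auto
   have "lab (a + c - 2 * 0) l (contraction a c 0 (u k) (z k)) t = cg (id ` {..<0})
     (lab a (%i. if i < a - 0 then l i else id (i - (a - 0))) (u k))
     (lab c (%i. if i < 0 then id (0 - 1 - i) else l (a - 0 + (i - 0))) (z k)) t"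
    by (rule lab_contraction[OF _ _ kTameD(1)[OF u] kTameD(1)[OF z] i0 t]) simp_all
   moreover have "lab a (%i. if i < a - 0 then l i else id (i - (a - 0))) (u k) = lab a l (u k)"
    by (rule lab_cong) simp
   moreover have "lab c (%i. if i < 0 then id (0 - 1 - i) else l (a - 0 + (i - 0))) (z k) = lab c l2 (z k)"
    by (rule lab_cong) (simp add: l2_def)
   ultimately show "lab (a + c) l (contraction a c 0 (u k) (z k)) t = cg {} (lab c l2 (z k)) (lab a l (u k)) t"
    by (simp add: cg_sym)
  qed
 qed
qed

lemma kNull_beyond_tensor:
 assumes f: "kTame b n f" and u: "kTame b a u" and z: "kTame b r z" and nf: "NF b True n f r z"
  and p: "a < p" "p \<le> n" "p \<le> a + r" and cb: "c --> b"
 shows "kNull (gord c n (a + r) p) (%k. gcon c n (a + r) p (f k) (contraction a r 0 (u k) (z k)))"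
proof -
 let ?N = "gord c n (a + r) p"
 have cp: "of_bool c \<le> p" using p(1) by (cases c) auto
 have t: "kTame b (a + r) (%k. contraction a r 0 (u k) (z k))"
  using kTame_gcon[OF u z, of False 0] by (simp add: gcon_def)
 obtain D l1 l2 where "finite D" and D: "D \<inter> id ` {..<?N} = {}" and "D \<inter> {} = {}" and L: "glue_labels c n (a + r) p id D l1 l2"
  by (rule fresh_glue_labels[OF cp p(2,3) inj_on_id finite.emptyI])
 note U = glue_labels_sets[OF L p(2,3) inj_on_id D cb refl refl refl] and L = glue_labelsD[OF L]
 define S where "S = (if c then {p - 1} else {})"
 have S: "S = {} \<or> b \<and> S = {p - 1}" using cb by (simp add: S_def)
 have DI: "l2 ` ({..<p} - S) = D" unfolding L(7)[symmetric] by (rule arg_cong[where f = "image l2"]) (auto simp: S_def)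
 have "l2 ` {..<p} = l2 ` S \<union> D"
  unfolding DI[symmetric] image_Un[symmetric] by (rule arg_cong[where f = "image l2"]) (use p in \<open>auto simp: S_def\<close>)
 also have "l2 ` S = id ` {n - p..<n - p + of_bool c}" using L(6)[of "n - p"] by (cases c) (auto simp: S_def)
 finally have touch: "l2 ` {..<a + r} \<inter> l1 ` {..<n} = l2 ` {..<p}" using U(11) by (simp only: Int_commute)
 have *: "cnull (id ` {..<?N}) (%k. cg D (lab n l1 (f k)) (lab (a + r) l2 (contraction a r 0 (u k) (z k))))"
  using NF_beyond_tensor[OF f u z nf L(2,1) p(1,3) touch S] by (simp only: DI U(10))
 have "cnull (id ` {..<?N}) (%k. lab ?N id (gcon c n (a + r) p (f k) (contraction a r 0 (u k) (z k))))"
 proof (rule cnull_cong[THEN iffD2, OF _ *])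
  show "lab ?N id (gcon c n (a + r) p (f k) (contraction a r 0 (u k) (z k))) t =
    cg D (lab n l1 (f k)) (lab (a + r) l2 (contraction a r 0 (u k) (z k))) t" if "t \<in> space NM" for k t
   by (rule L(8)[OF kTameD(1)[OF f, of k] kTameD(1)[OF t, of k] that])
 qed
 then show ?thesis
  by (subst kNull_iff[OF inj_on_id]) (intro measurable_gcon cp p kTameD(1)[OF f] kTameD(1)[OF t])
qed

section \<open>Tameness from integrability of the marginals\<close>

lemma LallI_pow2:
 assumes m: "!!k. \<omega> k \<in> borel_measurable halfline"
  and bd: "!!r. \<exists>B<\<infinity>. \<forall>k. (\<integral>\<^sup>+ x. (\<omega> k x) ^ (2 ^ r) \<partial>halfline) \<le> B"
 shows "Lall \<omega>"
proof (rule LallI[OF m])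
 fix p :: nat assume p: "1 \<le> p"
 note [measurable] = m
 obtain B1 where B1: "B1 < \<infinity>" "!!k. (\<integral>\<^sup>+ x. (\<omega> k x) ^ (2 ^ 0) \<partial>halfline) \<le> B1" using bd by blast
 obtain B2 where B2: "B2 < \<infinity>" "!!k. (\<integral>\<^sup>+ x. (\<omega> k x) ^ (2 ^ p) \<partial>halfline) \<le> B2" using bd by blast
 have pw: "x ^ p \<le> x + x ^ (2 ^ p)" for x :: ennreal
 proof (cases "x \<le> 1")
  case True
  then have "x ^ p \<le> x ^ 1" using p by (intro power_decreasing) auto
  then show ?thesis by (simp add: add_increasing2)
 next
  case False
  then have "x ^ p \<le> x ^ (2 ^ p)" by (intro power_increasing) (auto simp: less_imp_le[OF less_exp])
  then show ?thesis by (simp add: add_increasing)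
 qed
 have "(\<integral>\<^sup>+ x. (\<omega> k x) ^ p \<partial>halfline) \<le> B1 + B2" for k
 proof -
  have "(\<integral>\<^sup>+ x. (\<omega> k x) ^ p \<partial>halfline) \<le> (\<integral>\<^sup>+ x. \<omega> k x + (\<omega> k x) ^ (2 ^ p) \<partial>halfline)"
   by (intro nn_integral_mono pw)
  also have "\<dots> = (\<integral>\<^sup>+ x. \<omega> k x \<partial>halfline) + (\<integral>\<^sup>+ x. (\<omega> k x) ^ (2 ^ p) \<partial>halfline)"
   by (rule nn_integral_add) measurable
  also have "\<dots> \<le> B1 + B2" using B1(2)[of k] B2(2)[of k] by (intro add_mono) auto
  finally show ?thesis .
 qed
 moreover have "B1 + B2 < \<infinity>" using B1 B2 by simp
 ultimately show "\<exists>B<\<infinity>. \<forall>k. (\<integral>\<^sup>+ x. (\<omega> k x) ^ p \<partial>halfline) \<le> B" by blast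
qed

text \<open>Jensen's inequality for powers of two, by iterating Cauchy-Schwarz.\<close>

lemma lm_weighted_power:
 assumes [measurable]: "h \<in> borel_measurable NM" "w \<in> borel_measurable NM" and t: "t \<in> space NM"
 shows "(lm C (%t. (h t)\<^sup>2 * w t) t) ^ (2 ^ r) \<le> (lm C (%t. (h t)\<^sup>2) t) ^ (2 ^ r - 1) * lm C (%t. (h t)\<^sup>2 * (w t) ^ (2 ^ r)) t"
proof (induction r)
 case (Suc r)
 let ?P = "2 ^ r :: nat"
 let ?a = "lm C (%t. (h t)\<^sup>2) t"
 have "(lm C (%t. (h t)\<^sup>2 * w t) t) ^ (2 ^ Suc r) = ((lm C (%t. (h t)\<^sup>2 * w t) t) ^ ?P)\<^sup>2"
  by (simp add: power_mult[symmetric] mult.commute)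
 also have "\<dots> \<le> (?a ^ (?P - 1) * lm C (%t. (h t)\<^sup>2 * (w t) ^ ?P) t)\<^sup>2"
  by (rule power_mono[OF Suc]) simp
 also have "\<dots> = ?a ^ (2 * (?P - 1)) * (lm C (%t. h t * (h t * (w t) ^ ?P)) t)\<^sup>2"
 proof -
  have "(%t. h t * (h t * (w t) ^ ?P)) = (%t. (h t)\<^sup>2 * (w t) ^ ?P)" by (simp add: power2_eq_square mult.assoc)
  then show ?thesis by (simp add: power_mult_distrib power_mult[symmetric] mult.commute[of 2])
 qed
 also have "\<dots> \<le> ?a ^ (2 * (?P - 1)) * (?a * lm C (%t. (h t * (w t) ^ ?P)\<^sup>2) t)"
  by (intro mult_left_mono lm_Cauchy_Schwarz[OF _ _ t]) measurable
 also have "\<dots> = ?a ^ (2 ^ Suc r - 1) * lm C (%t. (h t)\<^sup>2 * (w t) ^ (2 ^ Suc r)) t"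
 proof -
  have "2 ^ Suc r - 1 = Suc (2 * (?P - 1))" using one_le_power[of "2::nat" r] unfolding power_Suc by linarith
  then show ?thesis by (simp add: power_mult_distrib power_mult[symmetric] mult_ac)
 qed
 finally show ?case .
qed simp

lemma prod_le_sum_powers:
 fixes v :: "'a => ennreal"
 assumes "finite J" "J \<noteq> {}"
 shows "(\<Prod>i\<in>J. v i) \<le> (\<Sum>i\<in>J. v i ^ card J)"
proof -
 obtain m where m: "m \<in> J" "!!i. i \<in> J ==> v i \<le> v m"
 proof -
  have "Max (v ` J) \<in> v ` J" using assms by (intro Max_in) auto
  then obtain m where "m \<in> J" "Max (v ` J) = v m" by auto
  moreover have "v i \<le> Max (v ` J)" if "i \<in> J" for i using assms that by simp
  ultimately show ?thesis by (intro that[of m]) auto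
 qed
 have "finite K ==> (!!i. i \<in> K ==> v i \<le> v m) ==> (\<Prod>i\<in>K. v i) \<le> v m ^ card K" for K
  by (induction K rule: finite_induct) (auto intro!: mult_mono)
 then have "(\<Prod>i\<in>J. v i) \<le> v m ^ card J" using assms m by blast
 also have "\<dots> \<le> (\<Sum>i\<in>J. v i ^ card J)" using assms m by (intro member_le_sum) auto
 finally show ?thesis .
qed

lemma Lall_sum: "finite K ==> (!!j. j \<in> K ==> Lall (\<omega> j)) ==> Lall (%k x. \<Sum>j\<in>K. \<omega> j k x)"
proof (induction K rule: finite_induct)
 case empty
 show ?case using Lall_zero by simp
next
 case (insert j K)
 have "Lall (%k x. \<omega> j k x + (\<Sum>j\<in>K. \<omega> j k x))"
  by (rule Lall_add[OF insert.prems[OF insertI1] insert.IH]) (rule insert.prems, simp)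
 then show ?case using insert.hyps by simp
qed

lemma Lall_power: assumes "Lall \<omega>" "1 \<le> M" shows "Lall (%k x. \<omega> k x ^ M)"
proof (rule LallI)
 note [measurable] = Lall_meas[OF assms(1)]
 show "(%x. \<omega> k x ^ M) \<in> borel_measurable halfline" for k by measurable
 fix p :: nat assume "1 \<le> p"
 then have "1 \<le> M * p" using assms(2) by simp
 from Lall_bound[OF assms(1) this]
 show "\<exists>B<\<infinity>. \<forall>k. (\<integral>\<^sup>+ x. (\<omega> k x ^ M) ^ p \<partial>halfline) \<le> B" by (simp add: power_mult)
qed

lemma measurable_insert_coordinate: "(%x. ((%_. 0)(j := x)) :: nat => real) \<in> halfline \<rightarrow>\<^sub>M NM"
proof (rule measurable_PiM_single')
 fix i :: nat
 show "(%x. ((%_. 0)(j := x)) i) \<in> halfline \<rightarrow>\<^sub>M halfline" by (cases "i = j") (auto simp: space_restrict_space)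
qed (auto simp: space_PiM PiE_def Pi_iff space_restrict_space)

text \<open>By Jensen's inequality a power of the weighted marginal is bounded by a weighted integral of \<open>h\<^sup>2\<close>; the product weight is at most a sum of powers of weights in one variable, and each such integral is one of an unweighted marginal.\<close>

lemma Tame_of_marginals:
 assumes fin: "finite J" and m: "!!k. h k \<in> borel_measurable NM" and d: "!!k. dep J (h k)"
  and bd: "\<exists>B<\<infinity>. \<forall>k. nsq J (h k) \<le> B" and marg: "!!j. j \<in> J ==> Lall (%k. umarg J j (h k))"
 shows "Tame True J h"
 unfolding Tame_def
proof (intro conjI allI impI ballI fin m d bd)
 fix \<omega> j assume \<omega>: "Lall \<omega>" and j: "j \<in> J"
 note [measurable] = m
 note [measurable] = measurable_insert_coordinate
 define \<mu> where "\<mu> k x = (\<Sum>i\<in>J. umarg J i (h k) x) + \<omega> k x" for k x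
 have L\<mu>: "Lall \<mu>" unfolding \<mu>_def[abs_def] by (intro Lall_add Lall_sum fin marg \<omega>)
 note m\<mu> = Lall_meas[OF L\<mu>]
 have mw [measurable]: "wt (\<mu> k) K \<in> borel_measurable NM" for k K by (rule measurable_wt[OF m\<mu>])
 have mw' [measurable]: "wt (\<omega> k) K \<in> borel_measurable NM" for k K by (rule measurable_wt[OF Lall_meas[OF \<omega>]])
 have um: "umarg J j (h k) x \<le> \<mu> k x" for k x
 proof -
  have "umarg J j (h k) x \<le> (\<Sum>i\<in>J. umarg J i (h k) x)" using fin j by (intro member_le_sum) auto
  then show ?thesis unfolding \<mu>_def by (simp add: add_increasing2)
 qed
 show "Lall (marg J j h \<omega>)"
 proof (rule LallI_pow2)
  show "marg J j h \<omega> k \<in> borel_measurable halfline" for k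
   by (rule measurable_marg[where \<omega> = \<omega>, OF fin m Lall_meas[OF \<omega>]])
  fix r
  define P where "P = (2::nat) ^ r"
  define M where "M = P * card J"
  have "card J \<ge> 1" using j fin by (metis One_nat_def Suc_leI card_gt_0_iff empty_iff)
  then have M1: "1 \<le> M" by (simp add: M_def P_def)
  have "Lall (%k x. \<mu> k x ^ M)" by (rule Lall_power[OF L\<mu> M1])
  then have LM: "Lall (%k x. \<Sum>i\<in>J. 2 ^ M * (umarg J i (h k) x + umarg J i (h k) x * \<mu> k x ^ M))"
   by (intro Lall_sum fin Lall_cmult Lall_add Lall_mult marg) (auto simp: power_less_top_ennreal)
  obtain B where B: "B < \<infinity>" "!!k. (\<integral>\<^sup>+ x. (\<Sum>i\<in>J. 2 ^ M * (umarg J i (h k) x + umarg J i (h k) x * \<mu> k x ^ M)) ^ 1 \<partial>halfline) \<le> B"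
   using Lall_bound[OF LM order_refl] by blast
  have mu [measurable]: "umarg J i (h k) \<in> borel_measurable halfline" if "i \<in> J" for i k
   by (rule Lall_meas[OF marg[OF that]])
  have "(\<integral>\<^sup>+ x. (marg J j h \<omega> k x) ^ P \<partial>halfline) \<le> B" for k
  proof -
   note [measurable] = m\<mu>[of k]
   have "(marg J j h \<omega> k x) ^ P \<le> lm (J - {j}) (%t. (h k t)\<^sup>2 * (wt (\<mu> k) J t) ^ P) ((%_. 0)(j := x))" if x: "0 \<le> x" for x
   proof -
    define t where "t = (%_. 0::real)(j := x)"
    have t: "t \<in> space NM" using x by (auto simp: t_def space_NM)
    have tj: "t j = x" by (simp add: t_def)
    have "(marg J j h \<omega> k x) ^ P \<le> (lm (J - {j}) (%t. (h k t)\<^sup>2) t) ^ (P - 1) *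
      lm (J - {j}) (%t. (h k t)\<^sup>2 * (wt (\<omega> k) (J - {j}) t) ^ P) t"
     unfolding marg_def t_def[symmetric] P_def by (rule lm_weighted_power[OF m mw' t])
    also have "\<dots> \<le> (1 + \<mu> k x) ^ P * lm (J - {j}) (%t. (h k t)\<^sup>2 * (wt (\<mu> k) (J - {j}) t) ^ P) t"
    proof (rule weight_mono)
     have "(lm (J - {j}) (%t. (h k t)\<^sup>2) t) ^ (P - 1) \<le> (1 + \<mu> k x) ^ (P - 1)"
      using um[of k x] unfolding umarg_def t_def[symmetric] by (intro power_mono) (auto intro: add_increasing)
     also have "\<dots> \<le> (1 + \<mu> k x) ^ P" by (intro power_increasing) auto
     finally show "(lm (J - {j}) (%t. (h k t)\<^sup>2) t) ^ (P - 1) \<le> (1 + \<mu> k x) ^ P" .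
     show "lm (J - {j}) (%t. (h k t)\<^sup>2 * (wt (\<omega> k) (J - {j}) t) ^ P) t \<le>
      lm (J - {j}) (%t. (h k t)\<^sup>2 * (wt (\<mu> k) (J - {j}) t) ^ P) t"
      by (rule lm_mono[OF _ t]) (intro mult_left_mono power_mono wt_mono, auto simp: \<mu>_def add_increasing)
    qed
    also have "\<dots> = lm (J - {j}) (%t. (1 + \<mu> k (t j)) ^ P * ((h k t)\<^sup>2 * (wt (\<mu> k) (J - {j}) t) ^ P)) t"
     unfolding tj[symmetric]
     by (rule lm_cmult[symmetric, where J = "{j}"]) (use t in \<open>auto simp: dep_def\<close>)
    also have "\<dots> = lm (J - {j}) (%t. (h k t)\<^sup>2 * (wt (\<mu> k) J t) ^ P) t"
    proof (rule lm_cong[OF _ t])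
     fix t
     have "wt (\<mu> k) J t = (1 + \<mu> k (t j)) * wt (\<mu> k) (J - {j}) t"
      unfolding wt_def by (rule prod.remove[OF fin j])
     then show "(1 + \<mu> k (t j)) ^ P * ((h k t)\<^sup>2 * (wt (\<mu> k) (J - {j}) t) ^ P) = (h k t)\<^sup>2 * (wt (\<mu> k) J t) ^ P"
      by (simp add: power_mult_distrib mult_ac)
    qed
    finally show ?thesis by (simp only: t_def)
   qed
   then have "(\<integral>\<^sup>+ x. (marg J j h \<omega> k x) ^ P \<partial>halfline) \<le>
     (\<integral>\<^sup>+ x. lm (J - {j}) (%t. (h k t)\<^sup>2 * (wt (\<mu> k) J t) ^ P) ((%_. 0)(j := x)) \<partial>halfline)"
    by (intro nn_integral_mono) (auto simp: space_restrict_space)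
   also have "\<dots> = lm J (%t. (h k t)\<^sup>2 * (wt (\<mu> k) J t) ^ P) (%_. 0)"
    by (rule lm_eq_marginal_integral[symmetric, OF fin j]) auto
   also have "\<dots> \<le> lm J (%t. \<Sum>i\<in>J. (h k t)\<^sup>2 * (1 + \<mu> k (t i)) ^ M) (%_. 0)"
   proof (rule lm_mono)
    fix t
    have "(wt (\<mu> k) J t) ^ P = (\<Prod>i\<in>J. (1 + \<mu> k (t i)) ^ P)" by (simp add: wt_def prod_power_distrib)
    also have "\<dots> \<le> (\<Sum>i\<in>J. ((1 + \<mu> k (t i)) ^ P) ^ card J)" by (rule prod_le_sum_powers) (use fin j in auto)
    finally have "(h k t)\<^sup>2 * (wt (\<mu> k) J t) ^ P \<le> (h k t)\<^sup>2 * (\<Sum>i\<in>J. ((1 + \<mu> k (t i)) ^ P) ^ card J)"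
     by (rule mult_left_mono) simp
    also have "\<dots> = (\<Sum>i\<in>J. (h k t)\<^sup>2 * (1 + \<mu> k (t i)) ^ M)"
     by (simp add: sum_distrib_left power_mult[symmetric] M_def)
    finally show "(h k t)\<^sup>2 * (wt (\<mu> k) J t) ^ P \<le> (\<Sum>i\<in>J. (h k t)\<^sup>2 * (1 + \<mu> k (t i)) ^ M)" .
   qed simp
   also have "\<dots> = (\<Sum>i\<in>J. lm J (%t. (h k t)\<^sup>2 * (1 + \<mu> k (t i)) ^ M) (%_. 0))"
    unfolding lm_def by (rule nn_integral_sum, rule measurable_ov_section[OF _ zero_space_NM]) measurable
   also have "\<dots> \<le> (\<Sum>i\<in>J. \<integral>\<^sup>+ x. 2 ^ M * (umarg J i (h k) x + umarg J i (h k) x * \<mu> k x ^ M) \<partial>halfline)"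
   proof (rule sum_mono)
    fix i assume i: "i \<in> J"
    have "lm J (%t. (h k t)\<^sup>2 * (1 + \<mu> k (t i)) ^ M) (%_. 0) =
      (\<integral>\<^sup>+ x. lm (J - {i}) (%t. (h k t)\<^sup>2 * (1 + \<mu> k (t i)) ^ M) ((%_. 0)(i := x)) \<partial>halfline)"
     by (rule lm_eq_marginal_integral[OF fin i]) auto
    also have "\<dots> \<le> (\<integral>\<^sup>+ x. 2 ^ M * (umarg J i (h k) x + umarg J i (h k) x * \<mu> k x ^ M) \<partial>halfline)"
    proof (rule nn_integral_mono)
     fix x assume "x \<in> space halfline"
     then have x: "0 \<le> x" by (simp add: space_restrict_space)
     define t where "t = (%_. 0::real)(i := x)"
     have t: "t \<in> space NM" using x by (auto simp: t_def space_NM)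
     have ti: "t i = x" by (simp add: t_def)
     have "lm (J - {i}) (%t. (h k t)\<^sup>2 * (1 + \<mu> k (t i)) ^ M) t = lm (J - {i}) (%t. (1 + \<mu> k (t i)) ^ M * (h k t)\<^sup>2) t"
      by (simp add: mult.commute)
     also have "\<dots> = (1 + \<mu> k (t i)) ^ M * lm (J - {i}) (%t. (h k t)\<^sup>2) t"
      by (rule lm_cmult[where J = "{i}"]) (use t in \<open>auto simp: dep_def\<close>)
     also have "\<dots> \<le> 2 ^ M * (1 ^ M + \<mu> k (t i) ^ M) * lm (J - {i}) (%t. (h k t)\<^sup>2) t"
      by (rule mult_right_mono[OF ennreal_power_add_le]) simp
     also have "\<dots> = 2 ^ M * (umarg J i (h k) x + umarg J i (h k) x * \<mu> k x ^ M)"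
      unfolding umarg_def t_def[symmetric] ti by (simp add: algebra_simps)
     finally show "lm (J - {i}) (%t. (h k t)\<^sup>2 * (1 + \<mu> k (t i)) ^ M) ((%_. 0)(i := x)) \<le>
       2 ^ M * (umarg J i (h k) x + umarg J i (h k) x * \<mu> k x ^ M)" by (simp only: t_def)
    qed
    finally show "lm J (%t. (h k t)\<^sup>2 * (1 + \<mu> k (t i)) ^ M) (%_. 0) \<le> \<dots>" .
   qed
   also have "\<dots> = (\<integral>\<^sup>+ x. (\<Sum>i\<in>J. 2 ^ M * (umarg J i (h k) x + umarg J i (h k) x * \<mu> k x ^ M)) \<partial>halfline)"
    by (rule nn_integral_sum[symmetric]) measurable
   also have "\<dots> \<le> B" using B(2)[of k] by simp
   finally show ?thesis .
  qed
  then show "\<exists>B<\<infinity>. \<forall>k. (\<integral>\<^sup>+ x. (marg J j h \<omega> k x) ^ (2 ^ r) \<partial>halfline) \<le> B" using B(1) unfolding P_def by blast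
 qed
qed

text \<open>In the Wigner case, and for constants, boundedness in \<open>L\<^sup>2\<close> is all that is needed.\<close>

lemma kTame_plain:
 assumes m: "!!k. u k \<in> borel_measurable (Rp q)" and bd: "\<exists>B<\<infinity>. \<forall>k. n2 q (u k) \<le> B" and b: "\<not> b \<or> q = 0"
 shows "kTame b q u"
 unfolding kTame_def
proof (intro conjI allI impI m)
 fix l :: "nat => nat" assume l: "inj_on l {..<q}"
 have nb: "nsq (l ` {..<q}) (nabs (%k. lab q l (u k)) k) = n2 q (u k)" for k
  using cnsq_lab[OF l m] by (simp add: cnsq_nabs[symmetric])
 show "cTame b (l ` {..<q}) (%k. lab q l (u k))"
  unfolding cTame_def Tame_def
 proof (intro conjI allI impI ballI)
  show "lab q l (u k) \<in> borel_measurable NM" for k by (rule measurable_lab[OF m])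
  then show "nabs (%k. lab q l (u k)) k \<in> borel_measurable NM" for k unfolding nabs_def[abs_def] by measurable
  show "dep (l ` {..<q}) (lab q l (u k))" for k by (rule dep_lab)
  then show "dep (l ` {..<q}) (nabs (%k. lab q l (u k)) k)" for k unfolding nabs_def[abs_def] by (rule dep_op1)
  show "\<exists>B<\<infinity>. \<forall>k. nsq (l ` {..<q}) (nabs (%k. lab q l (u k)) k) \<le> B" unfolding nb by (rule bd)
 qed (use b in auto)
qed

text \<open>The marginal density of \<open>\<bar>y\<bar>\<^sup>2\<close> in the first coordinate.\<close>

definition first_marginal :: "nat => kernel => real => ennreal" where
 "first_marginal q y x = (\<integral>\<^sup>+ s. (ennreal (cmod (y (\<lambda>i\<in>{..<q}. if i = 0 then x else s (q - 1 - i)))))\<^sup>2 \<partial>Rp (q - 1))"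

lemma umarg_lab_first:
 fixes l :: "nat => nat"
 assumes f: "f \<in> borel_measurable (Rp n)" and l: "inj_on l {..<n}" and n: "1 \<le> n" and x: "0 \<le> x"
 shows "umarg (l ` {..<n}) (l 0) (%t. ennreal (cmod (lab n l f t))) x = first_marginal n f x"
proof -
 define d where "d i = l (n - 1 - i)" for i
 have di: "inj_on d {..<n - 1}"
 proof (rule inj_onI)
  fix i j assume ij: "i \<in> {..<n - 1}" "j \<in> {..<n - 1}" "d i = d j"
  then have "n - 1 - i = n - 1 - j" using inj_onD[OF l, of "n - 1 - i" "n - 1 - j"] by (simp add: d_def)
  then show "i = j" using ij by auto
 qed
 have rI: "(%i. n - 1 - i) ` {..<n - 1} = {..<n} - {0}"
 proof (intro set_eqI iffI)
  fix i assume "i \<in> {..<n} - {0}"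
  then have "i = n - 1 - (n - 1 - i)" "n - 1 - i \<in> {..<n - 1}" by auto
  then show "i \<in> (%i. n - 1 - i) ` {..<n - 1}" by blast
 qed auto
 have dI: "d ` {..<n - 1} = l ` {..<n} - {l 0}"
 proof -
  have "d ` {..<n - 1} = l ` (%i. n - 1 - i) ` {..<n - 1}" unfolding image_image d_def ..
  also have "\<dots> = l ` {..<n} - l ` {0}"
   unfolding rI by (rule image_diff_sub[OF l, symmetric]) (use n in auto)
  finally show ?thesis by simp
 qed
 define t where "t = (%_. 0::real)(l 0 := x)"
 have t: "t \<in> space NM" using x by (auto simp: t_def space_NM)
 have m: "(%t. (ennreal (cmod (lab n l f t)))\<^sup>2) \<in> borel_measurable NM"
  using measurable_lab[OF f, of l] by measurable
 have "umarg (l ` {..<n}) (l 0) (%t. ennreal (cmod (lab n l f t))) x =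
   lm (d ` {..<n - 1}) (%t. (ennreal (cmod (lab n l f t)))\<^sup>2) t"
  unfolding umarg_def dI t_def ..
 also have "\<dots> = (\<integral>\<^sup>+ s. (ennreal (cmod (lab n l f (relab (n - 1) d t s))))\<^sup>2 \<partial>Rp (n - 1))"
  by (rule lm_relabel[OF di m t])
 also have "\<dots> = first_marginal n f x"
  unfolding first_marginal_def lab_def
 proof (intro nn_integral_cong arg_cong[where f = "%z. (ennreal (cmod (f z)))\<^sup>2"] restrict_ext)
  fix s i assume i: "i \<in> {..<n}"
  show "relab (n - 1) d t s (l i) = (if i = 0 then x else s (n - 1 - i))"
  proof (cases "i = 0")
   case True
   have "l 0 \<notin> d ` {..<n - 1}" unfolding dI by simp
   then show ?thesis using True relab_out[of "l 0" d "n - 1" t s] by (simp add: t_def)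
  next
   case False
   then have "l i = d (n - 1 - i)" "n - 1 - i < n - 1" using i by (auto simp: d_def)
   then show ?thesis using False relab_in[OF di, of "n - 1 - i" t s] by simp
  qed
 qed
 finally show ?thesis .
qed

text \<open>By symmetry all marginals agree almost everywhere with the first one.\<close>

lemma kTame_symmetric:
 assumes n: "1 \<le> n" and m: "!!k. f k \<in> borel_measurable (Rp n)" and sym: "!!k. symmetric_kernel n (f k)"
  and bd: "\<exists>B<\<infinity>. \<forall>k. n2 n (f k) \<le> B" and mg: "Lall (%k. first_marginal n (f k))"
 shows "kTame True n f"
 unfolding kTame_def
proof (intro conjI allI impI m)
 fix l :: "nat => nat" assume l: "inj_on l {..<n}"
 let ?J = "l ` {..<n}"
 have nb: "nsq ?J (nabs (%k. lab n l (f k)) k) = n2 n (f k)" for k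
  using cnsq_lab[OF l m] by (simp add: cnsq_nabs[symmetric])
 have ml: "lab n l' (f k) \<in> borel_measurable NM" for l' k by (rule measurable_lab[OF m])
 have T: "Tame True ?J (nabs (%k. lab n l (f k)))"
 proof (rule Tame_of_marginals)
  show mn: "nabs (%k. lab n l (f k)) k \<in> borel_measurable NM" for k using ml unfolding nabs_def[abs_def] by measurable
  show "dep ?J (nabs (%k. lab n l (f k)) k)" for k unfolding nabs_def[abs_def] by (rule dep_op1[OF dep_lab])
  show "\<exists>B<\<infinity>. \<forall>k. nsq ?J (nabs (%k. lab n l (f k)) k) \<le> B" unfolding nb by (rule bd)
  fix j assume "j \<in> ?J"
  then obtain i0 where i0: "i0 < n" "j = l i0" by auto
  define l' where "l' = l \<circ> Transposition.transpose 0 i0"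
  have tr: "Transposition.transpose 0 i0 permutes {..<n}" using i0 n by (intro permutes_swap_id) auto
  have l'i: "inj_on l' {..<n}" unfolding l'_def
   by (rule comp_inj_on) (use l permutes_inj_on[OF tr] permutes_image[OF tr] in auto)
  have l'I: "?J = l' ` {..<n}" unfolding l'_def image_comp[symmetric] permutes_image[OF tr] ..
  have l'0: "l' 0 = j" by (simp add: l'_def i0)
  have um: "AE x in halfline. umarg ?J j (nabs (%k. lab n l (f k)) k) x = first_marginal n (f k) x" for k
  proof -
   define D where "D t = (ennreal (cmod (lab n l (f k) t - lab n l' (f k) t)))\<^sup>2" for t
   have mD: "D \<in> borel_measurable NM" unfolding D_def[abs_def] using ml[of l k] ml[of l' k] by measurable
   have jJ: "j \<in> ?J" using i0 by auto
   have "lm ?J D (%_. 0) = 0"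
    using cnsq_lab_relabel[OF m[of k] sym[of k] l l'i l'I] by (simp add: cnsq_def nsq_def D_def[abs_def])
   then have "(\<integral>\<^sup>+ x. lm (?J - {j}) D ((%_. 0)(j := x)) \<partial>halfline) = 0"
    using lm_eq_marginal_integral[OF _ jJ mD zero_space_NM] by simp
   moreover have "(%x. lm (?J - {j}) D ((%_. 0)(j := x))) \<in> borel_measurable halfline"
    by (rule measurable_compose[OF measurable_insert_coordinate measurable_lm[OF _ mD]]) simp
   ultimately have "AE x in halfline. lm (?J - {j}) D ((%_. 0)(j := x)) = 0"
    by (simp add: nn_integral_0_iff_AE)
   then show ?thesis
    using AE_space
   proof eventually_elim
    case (elim x)
    then have x: "0 \<le> x" by (simp add: space_restrict_space)
    define t where "t = (%_. 0::real)(j := x)"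
    have t: "t \<in> space NM" using x by (auto simp: t_def space_NM)
    have "AE s in PM (?J - {j}). D (ov (?J - {j}) t s) = 0"
     using elim(1) lm_zero_iff[OF mD t] unfolding t_def by blast
    then have "AE s in PM (?J - {j}). (nabs (%k. lab n l (f k)) k (ov (?J - {j}) t s))\<^sup>2 =
      (nabs (%k. lab n l' (f k)) k (ov (?J - {j}) t s))\<^sup>2"
     by (rule AE_mp) (rule AE_I2, simp add: D_def nabs_def)
    then have "lm (?J - {j}) (%t. (nabs (%k. lab n l (f k)) k t)\<^sup>2) t =
      lm (?J - {j}) (%t. (nabs (%k. lab n l' (f k)) k t)\<^sup>2) t"
     unfolding lm_def by (rule nn_integral_cong_AE)
    then have "umarg ?J j (nabs (%k. lab n l (f k)) k) x = umarg ?J j (%t. ennreal (cmod (lab n l' (f k) t))) x"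
     unfolding umarg_def t_def nabs_def .
    also have "\<dots> = first_marginal n (f k) x"
     using umarg_lab_first[OF m[of k] l'i n x] unfolding l'I l'0 .
    finally show ?case .
   qed
  qed
  show "Lall (%k. umarg ?J j (nabs (%k. lab n l (f k)) k))"
  proof (rule LallI)
   show "umarg ?J j (nabs (%k. lab n l (f k)) k) \<in> borel_measurable halfline" for k
    unfolding umarg_def[abs_def]
    by (rule measurable_compose[OF measurable_insert_coordinate measurable_lm]) (use mn[of k] in \<open>simp, measurable\<close>)
   fix p :: nat assume "1 \<le> p"
   from Lall_bound[OF mg this] obtain B where B: "B < \<infinity>" "!!k. (\<integral>\<^sup>+ x. (first_marginal n (f k) x) ^ p \<partial>halfline) \<le> B" by blast
   have "(\<integral>\<^sup>+ x. (umarg ?J j (nabs (%k. lab n l (f k)) k) x) ^ p \<partial>halfline) =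
     (\<integral>\<^sup>+ x. (first_marginal n (f k) x) ^ p \<partial>halfline)" for k
   proof (rule nn_integral_cong_AE)
    show "AE x in halfline. (umarg ?J j (nabs (%k. lab n l (f k)) k) x) ^ p = (first_marginal n (f k) x) ^ p"
     using um[of k] by eventually_elim simp
   qed
   then show "\<exists>B<\<infinity>. \<forall>k. (\<integral>\<^sup>+ x. (umarg ?J j (nabs (%k. lab n l (f k)) k) x) ^ p \<partial>halfline) \<le> B"
    using B by auto
  qed
 qed simp
 then show "cTame True ?J (%k. lab n l (f k))"
  unfolding cTame_def using ml dep_lab by blast
qed

section \<open>Norms of contractions\<close>

lemma integral_PM_empty: "(\<integral>s. (c :: complex) \<partial>PM {}) = c"
 by (simp add: PiM_empty lebesgue_integral_count_space_finite)

lemma cm_empty: "cm {} \<phi> t = \<phi> t"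
 unfolding cm_def ov_def by (simp only: empty_iff if_False integral_PM_empty)

lemma n2_gcon:
 assumes p: "of_bool c \<le> p" "p \<le> n" "p \<le> m" and L: "glue_labels c n m p id D l1 l2" and D: "D \<inter> id ` {..<gord c n m p} = {}"
  and f: "f \<in> borel_measurable (Rp n)" and g: "g \<in> borel_measurable (Rp m)"
 shows "n2 (gord c n m p) (gcon c n m p f g) = cnsq (l1 ` {..<n} \<union> l2 ` {..<m} - D) (cg D (lab n l1 f) (lab m l2 g))"
proof -
 let ?N = "gord c n m p"
 have "n2 ?N (gcon c n m p f g) = cnsq (id ` {..<?N}) (lab ?N id (gcon c n m p f g))"
  by (rule cnsq_lab[OF inj_on_id measurable_gcon[OF p f g], symmetric])
 also have "\<dots> = cnsq (id ` {..<?N}) (cg D (lab n l1 f) (lab m l2 g))"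
  by (rule cnsq_cong) (rule glue_labelsD(8)[OF L f g])
 finally show ?thesis unfolding glue_labels_sets(10)[OF L p(2,3) inj_on_id D imp_refl refl refl refl] .
qed

lemma kNull_gcon:
 assumes f: "kTame b n f" and g: "kTame b m g" and p: "of_bool c \<le> p" "p \<le> n" "p \<le> m" and cb: "c --> b" and null: "kNull m g"
 shows "kNull (gord c n m p) (%k. gcon c n m p (f k) (g k))"
proof -
 obtain D l1 l2 where "finite D" and D: "D \<inter> id ` {..<gord c n m p} = {}" and "D \<inter> {} = {}" and L: "glue_labels c n m p id D l1 l2"
  by (rule fresh_glue_labels[OF p inj_on_id finite.emptyI])
 note l = glue_labelsD(1,2)[OF L]
 have gl: "gluable b (l2 ` {..<m}) (l1 ` {..<n}) D"
  using glue_labels_sets(9)[OF L p(2,3) inj_on_id D cb refl refl refl] by (simp only: gluable_sym)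
 have "cnull (l2 ` {..<m}) (%k. lab m l2 (g k))" using kNull_iff[OF l(2) kTameD(1)[OF g]] null by simp
 from cnull_cg[OF kTameD(2)[OF g l(2)] kTameD(2)[OF f l(1)] gl this]
 have "(%k. cnsq (l1 ` {..<n} \<union> l2 ` {..<m} - D) (cg D (lab n l1 (f k)) (lab m l2 (g k)))) \<longlonglongrightarrow> 0"
  unfolding cnull_def by (simp add: Un_commute cg_sym[of D "lab m l2 _"])
 then show ?thesis unfolding kNull_def by (simp only: n2_gcon[OF p L D kTameD(1)[OF f] kTameD(1)[OF g]])
qed

lemma n2_contraction_le:
 assumes p: "p \<le> n" "p \<le> m" and f: "f \<in> borel_measurable (Rp n)" and g: "g \<in> borel_measurable (Rp m)"
 shows "n2 (n + m - 2 * p) (contraction n m p f g) \<le> n2 n f * n2 m g"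
proof -
 have p0: "of_bool False \<le> p" by simp
 obtain D l1 l2 where "finite D" and D: "D \<inter> id ` {..<gord False n m p} = {}" and "D \<inter> {} = {}" and L: "glue_labels False n m p id D l1 l2"
  by (rule fresh_glue_labels[OF p0 p inj_on_id finite.emptyI])
 note eq = n2_gcon[OF p0 p L D f g]
 have C: "D = l1 ` {..<n} \<inter> l2 ` {..<m}"
  using glue_labels_sets(11)[OF L p inj_on_id D imp_refl refl refl refl] by simp
 note mf = measurable_lab[OF f, of l1] and mg = measurable_lab[OF g, of l2]
 have "n2 (gord False n m p) (gcon False n m p f g) \<le>
  nsq (l1 ` {..<n} \<union> l2 ` {..<m} - D) (glue D (%t. ennreal (cmod (lab n l1 f t))) (%t. ennreal (cmod (lab m l2 g t))))"
  unfolding eq cnsq_def nsq_def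
  by (rule lm_mono[OF _ zero_space_NM]) (intro power_mono cg_le_glue mf mg, auto)
 also have "\<dots> \<le> nsq (l1 ` {..<n}) (%t. ennreal (cmod (lab n l1 f t))) * nsq (l2 ` {..<m}) (%t. ennreal (cmod (lab m l2 g t)))"
  by (rule nsq_glue_plain[OF _ _ _ _ _ _ C]) (use mf mg in \<open>auto intro: dep_op1[OF dep_lab]\<close>)
 finally show ?thesis
  by (simp add: gcon_def cnsq_def[symmetric] cnsq_lab[OF glue_labelsD(1)[OF L] f] cnsq_lab[OF glue_labelsD(2)[OF L] g])
qed

lemma n2_tensor:
 assumes f: "f \<in> borel_measurable (Rp n)" and g: "g \<in> borel_measurable (Rp m)"
 shows "n2 (n + m) (contraction n m 0 f g) = n2 n f * n2 m g"
proof -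
 have p0: "of_bool False \<le> (0::nat)" by simp
 obtain D l1 l2 where "finite D" and D: "D \<inter> id ` {..<gord False n m 0} = {}" and "D \<inter> {} = {}" and L: "glue_labels False n m 0 id D l1 l2"
  by (rule fresh_glue_labels[OF p0 le0 le0 inj_on_id finite.emptyI])
 note eq = n2_gcon[OF p0 le0 le0 L D f g] and l = glue_labelsD(1,2)[OF L]
 have D0: "D = {}" using glue_labelsD(7)[OF L] by simp
 have di: "l1 ` {..<n} \<inter> l2 ` {..<m} = {}"
  using glue_labels_sets(11)[OF L le0 le0 inj_on_id D imp_refl refl refl refl] D0 by simp
 have mf [measurable]: "lab n l1 f \<in> borel_measurable NM" and mg [measurable]: "lab m l2 g \<in> borel_measurable NM"
  by (rule measurable_lab[OF f] measurable_lab[OF g])+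
 have "n2 (n + m) (contraction n m 0 f g) =
   lm (l1 ` {..<n} \<union> l2 ` {..<m}) (%t. (ennreal (cmod (lab n l1 f t)))\<^sup>2 * (ennreal (cmod (lab m l2 g t)))\<^sup>2) (%_. 0)"
  using eq unfolding D0 cnsq_def nsq_def cg_def
  by (simp add: gcon_def cm_empty norm_mult ennreal_mult power_mult_distrib)
 also have "\<dots> = lm (l1 ` {..<n}) (%t. (ennreal (cmod (lab n l1 f t)))\<^sup>2) (%_. 0) *
   lm (l2 ` {..<m}) (%t. (ennreal (cmod (lab m l2 g t)))\<^sup>2) (%_. 0)"
  by (rule lm_mult_indep[where U = "l1 ` {..<n}" and V = "l2 ` {..<m}"])
   (use di in \<open>auto intro!: dep_op1[OF dep_lab, where f = "%z. (ennreal (cmod z))\<^sup>2"]\<close>)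
 also have "\<dots> = n2 n f * n2 m g"
  using cnsq_lab[OF l(1) f] cnsq_lab[OF l(2) g] by (simp add: cnsq_def nsq_def)
 finally show ?thesis .
qed

section \<open>Tensor products\<close>

lemma tensor_apply: "contraction q r 0 u z t = u (\<lambda>i\<in>{..<q}. t i) * z (\<lambda>i\<in>{..<r}. t (q + i))"
proof -
 have "contraction q r 0 u z t = (\<integral>s. u (\<lambda>i\<in>{..<q}. t i) * z (\<lambda>i\<in>{..<r}. t (q + i)) \<partial>PM {})"
  unfolding contraction_def Rp_PM lessThan_0
  by (intro Bochner_Integration.integral_cong refl arg_cong2[where f = "(*)"] arg_cong[where f = u] arg_cong[where f = z])
   (auto simp: restrict_def)
 also have "\<dots> = u (\<lambda>i\<in>{..<q}. t i) * z (\<lambda>i\<in>{..<r}. t (q + i))" by (rule integral_PM_empty)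
 finally show ?thesis .
qed

text \<open>As \<open>p \<le> q\<close>, the contraction does not reach the second tensor factor.\<close>

lemma contraction_tensor:
 assumes p: "p \<le> n" "p \<le> q"
 shows "contraction n (q + r) p f (contraction q r 0 u z) = contraction (n + q - 2 * p) r 0 (contraction n q p f u) z"
proof
 fix t :: "nat => real"
 have 1: "(\<lambda>i\<in>{..<q}. (\<lambda>i\<in>{..<q + r}. if i < p then s (p - 1 - i) else t (n - p + (i - p))) i) =
   (\<lambda>i\<in>{..<q}. if i < p then s (p - 1 - i) else (\<lambda>i\<in>{..<n + q - 2 * p}. t i) (n - p + (i - p)))" for s :: "nat => real"
  using p by (auto simp: fun_eq_iff)
 have 2: "(\<lambda>i\<in>{..<r}. (\<lambda>i\<in>{..<q + r}. if i < p then s (p - 1 - i) else t (n - p + (i - p))) (q + i)) =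
   (\<lambda>i\<in>{..<r}. t (n + q - 2 * p + i))" for s :: "nat => real"
  using p by (auto simp: fun_eq_iff intro!: arg_cong[where f = t])
 have 3: "(\<lambda>i\<in>{..<n}. if i < n - p then t i else s (i - (n - p))) =
   (\<lambda>i\<in>{..<n}. if i < n - p then (\<lambda>i\<in>{..<n + q - 2 * p}. t i) i else s (i - (n - p)))" for s :: "nat => real"
  using p by (auto simp: fun_eq_iff)
 show "contraction n (q + r) p f (contraction q r 0 u z) t = contraction (n + q - 2 * p) r 0 (contraction n q p f u) z t"
  unfolding tensor_apply contraction_def[of n] 1 2 3
  by (simp only: mult.assoc[symmetric] integral_mult_left_zero)
qed

lemma star_contraction_tensor:
 assumes p: "1 \<le> p" "p \<le> n" "p \<le> q"
 shows "star_contraction n (q + r) p f (contraction q r 0 u z) = contraction (n + q - 2 * p + 1) r 0 (star_contraction n q p f u) z"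
proof
 fix t :: "nat => real"
 have 1: "(\<lambda>i\<in>{..<q}. (\<lambda>i\<in>{..<q + r}. if i < p - 1 then s i else t (n - p + (i - (p - 1)))) i) =
   (\<lambda>i\<in>{..<q}. if i < p - 1 then s i else (\<lambda>i\<in>{..<n + q - 2 * p + 1}. t i) (n - p + (i - (p - 1))))" for s :: "nat => real"
  using p by (auto simp: fun_eq_iff)
 have 2: "(\<lambda>i\<in>{..<r}. (\<lambda>i\<in>{..<q + r}. if i < p - 1 then s i else t (n - p + (i - (p - 1)))) (q + i)) =
   (\<lambda>i\<in>{..<r}. t (n + q - 2 * p + 1 + i))" for s :: "nat => real"
  using p by (auto simp: fun_eq_iff intro!: arg_cong[where f = t])
 have 3: "(\<lambda>i\<in>{..<n}. if i \<le> n - p then t i else s (n - 1 - i)) =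
   (\<lambda>i\<in>{..<n}. if i \<le> n - p then (\<lambda>i\<in>{..<n + q - 2 * p + 1}. t i) i else s (n - 1 - i))" for s :: "nat => real"
  using p by (auto simp: fun_eq_iff)
 show "star_contraction n (q + r) p f (contraction q r 0 u z) t = contraction (n + q - 2 * p + 1) r 0 (star_contraction n q p f u) z t"
  unfolding tensor_apply star_contraction_def 1 2 3
  by (simp only: mult.assoc[symmetric] integral_mult_left_zero)
qed

lemma gcon_tensor:
 "of_bool c \<le> p ==> p \<le> n ==> p \<le> q ==>
 gcon c n (q + r) p f (contraction q r 0 u z) = contraction (gord c n q p) r 0 (gcon c n q p f u) z"
 by (cases c) (simp_all add: gcon_def contraction_tensor star_contraction_tensor)

section \<open>Linear spans of sequences of vectors\<close>

text \<open>Pairs of sequences in the span of given pairs: a linear relation, so that a fact about generators extends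
 to their combinations without choosing representations.\<close>

inductive spanned :: "((nat => 'a::complex_hilbert_space) => (nat => 'b::complex_hilbert_space) => bool) =>
  (nat => 'a) => (nat => 'b) => bool" for R where
 zero: "spanned R (%_. 0) (%_. 0)"
| add: "R x y ==> spanned R \<xi> \<theta> ==> spanned R (%k. c *\<^sub>C x k + \<xi> k) (%k. c *\<^sub>C y k + \<theta> k)"

lemma spanned_plus: "spanned R \<xi> \<theta> ==> spanned R \<xi>' \<theta>' ==> spanned R (%k. \<xi> k + \<xi>' k) (%k. \<theta> k + \<theta>' k)"
proof (induction rule: spanned.induct)
 case (add x y \<xi> \<theta> c)
 from spanned.add[of R x y, OF add.hyps(1) add.IH[OF add.prems], of c] show ?case by (simp add: add.assoc)
qed simp

lemma spanned_scale: "spanned R \<xi> \<theta> ==> spanned R (%k. c *\<^sub>C \<xi> k) (%k. c *\<^sub>C \<theta> k)"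
proof (induction rule: spanned.induct)
 case zero
 show ?case using spanned.zero[of R] by simp
next
 case (add x y \<xi> \<theta> d)
 from spanned.add[of R x y, OF add.hyps(1) add.IH, of "c * d"] show ?case by (simp add: scaleC_add_right scaleC_scaleC)
qed

lemma spanned_gen: "R x y ==> spanned R x y"
 using spanned.add[of R x y "%_. 0" "%_. 0" 1] spanned.zero[of R] by simp

lemma spanned_sum:
 assumes "finite K" "!!i. i \<in> K ==> spanned R (x i) (y i)"
 shows "spanned R (%k. \<Sum>i\<in>K. x i k) (%k. \<Sum>i\<in>K. y i k)"
 using assms
proof (induction K rule: finite_induct)
 case empty
 show ?case using spanned.zero[of R] by simp
next
 case (insert i K)
 from spanned_plus[OF insert.prems[OF insertI1] insert.IH[OF insert.prems[OF insertI2]]] insert.hyps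
 show ?case by simp
qed

lemma spanned_mono:
 assumes "spanned R \<xi> \<theta>" "!!x y. R x y ==> spanned R' x y" shows "spanned R' \<xi> \<theta>"
 using assms(1)
proof (induction rule: spanned.induct)
 case (add x y \<xi> \<theta> c)
 show ?case by (rule spanned_plus[OF spanned_scale[OF assms(2)[OF add.hyps(1)]] add.IH])
qed (rule spanned.zero)

context nc_L2_completion
begin

lemma spanned_times:
 assumes "!!x y. R x y ==> \<exists>x' y'. spanned R' x' y' \<and> (\<forall>k. nc_times A \<phi> \<iota> (\<alpha> k) (x k) (x' k)) \<and> (\<forall>k. nc_times A \<phi> \<iota> (\<beta> k) (y k) (y' k))"
  and "spanned R \<xi> \<theta>"
 shows "\<exists>\<xi>' \<theta>'. spanned R' \<xi>' \<theta>' \<and> (\<forall>k. nc_times A \<phi> \<iota> (\<alpha> k) (\<xi> k) (\<xi>' k)) \<and> (\<forall>k. nc_times A \<phi> \<iota> (\<beta> k) (\<theta> k) (\<theta>' k))"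
 using assms(2)
proof (induction rule: spanned.induct)
 case zero
 show ?case by (intro exI[of _ "%_. 0"] conjI allI nc_times_zero_right spanned.zero)
next
 case (add x y \<xi> \<theta> c)
 obtain \<xi>' \<theta>' where 1: "spanned R' \<xi>' \<theta>'" "!!k. nc_times A \<phi> \<iota> (\<alpha> k) (\<xi> k) (\<xi>' k)" "!!k. nc_times A \<phi> \<iota> (\<beta> k) (\<theta> k) (\<theta>' k)"
  using add.IH by blast
 obtain x' y' where 2: "spanned R' x' y'" "!!k. nc_times A \<phi> \<iota> (\<alpha> k) (x k) (x' k)" "!!k. nc_times A \<phi> \<iota> (\<beta> k) (y k) (y' k)"
  using assms(1)[OF add.hyps(1)] by blast
 show ?case
  by (intro exI[of _ "%k. c *\<^sub>C x' k + \<xi>' k"] exI[of _ "%k. c *\<^sub>C y' k + \<theta>' k"] conjI allI spanned_plus spanned_scale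
    nc_times_add_right nc_times_scale_right 1 2)
qed

lemma nc_times_sum_left:
 "finite K ==> (!!i. i \<in> K ==> nc_times A \<phi> \<iota> (u i) \<xi> (v i)) ==> nc_times A \<phi> \<iota> (\<Sum>i\<in>K. u i) \<xi> (\<Sum>i\<in>K. v i)"
proof (induction K rule: finite_induct)
 case (insert i K)
 from nc_times_add_left[OF insert.prems[OF insertI1] insert.IH[OF insert.prems[OF insertI2]]] insert.hyps
 show ?case by simp
qed (simp add: nc_times_zero_left)

lemma nc_times_sum_right:
 "finite K ==> (!!i. i \<in> K ==> nc_times A \<phi> \<iota> \<xi> (u i) (v i)) ==> nc_times A \<phi> \<iota> \<xi> (\<Sum>i\<in>K. u i) (\<Sum>i\<in>K. v i)"
proof (induction K rule: finite_induct)
 case (insert i K)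
 from nc_times_add_right[OF insert.prems[OF insertI1] insert.IH[OF insert.prems[OF insertI2]]] insert.hyps
 show ?case by simp
qed (simp add: nc_times_zero_right)

lemma nc_times_diff_left:
 "nc_times A \<phi> \<iota> \<xi> \<eta> \<zeta> ==> nc_times A \<phi> \<iota> \<xi>' \<eta> \<zeta>' ==> nc_times A \<phi> \<iota> (\<xi> - \<xi>') \<eta> (\<zeta> - \<zeta>')"
 using nc_times_add_left[OF _ nc_times_scale_left[of \<xi>' \<eta> \<zeta>' "-1"], of \<xi> \<zeta>] by (simp add: scaleC_minus1)

end

section \<open>Algebras of multiple integrals\<close>

text \<open>The flag \<open>b\<close> tells the free Poisson case, with star contractions, from the Wigner case.\<close>

locale chaos = nc_L2_completion A \<phi> \<iota>
 for A :: "'h::complex_hilbert_space op set" and \<phi> :: "'h op => complex"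
  and \<iota> :: "'h op => 'l::complex_hilbert_space" +
 fixes I :: "nat => kernel => 'l" and D :: "nat => kernel set" and b :: bool
 assumes D_L2: "D q \<subseteq> L2_kernels q"
  and D_const: "(%_. c) \<in> D 0"
  and D_zero: "(%_. 0) \<in> D q"
  and D_lin: "h \<in> D q ==> w \<in> D q ==> (%t. c * h t + d * w t) \<in> D q"
  and D_contraction: "h \<in> D q ==> w \<in> D r ==> p \<le> min q r ==> contraction q r p h w \<in> D (q + r - 2 * p)"
  and D_star: "b ==> h \<in> D q ==> w \<in> D r ==> 1 \<le> p ==> p \<le> min q r ==> star_contraction q r p h w \<in> D (q + r - 2 * p + 1)"
  and I_lin: "h \<in> L2_kernels q ==> w \<in> L2_kernels q ==> I q (%t. c * h t + d * w t) = c *\<^sub>C I q h + d *\<^sub>C I q w"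
  and I_const: "I 0 (%_. c) = c *\<^sub>C \<iota> id"
  and I_iso: "h \<in> L2_kernels q ==> w \<in> L2_kernels q ==> cinner (I q h) (I q w) = (\<integral>t. h t * cnj (w t) \<partial>Rp q)"
  and I_orth: "q \<noteq> r ==> h \<in> L2_kernels q ==> w \<in> L2_kernels r ==> cinner (I q h) (I r w) = 0"
  and I_adj: "h \<in> L2_kernels q ==> J (I q h) = I q (kernel_adjoint q h)"
  and I_times: "h \<in> D q ==> w \<in> D r ==> nc_times A \<phi> \<iota> (I q h) (I r w)
   ((\<Sum>p\<le>min q r. I (q + r - 2 * p) (contraction q r p h w)) +
    (if b then \<Sum>p=1..min q r. I (q + r - 2 * p + 1) (star_contraction q r p h w) else 0))"
begin

lemma L2D:
 assumes "h \<in> L2_kernels q"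
 shows "h \<in> borel_measurable (Rp q)" "ennreal ((norm (I q h))\<^sup>2) = n2 q h"
proof -
 show m: "h \<in> borel_measurable (Rp q)" using assms by (simp add: L2_kernels_def)
 have i: "integrable (Rp q) (%t. (cmod (h t))\<^sup>2)" using assms by (simp add: L2_kernels_def)
 have "complex_of_real ((norm (I q h))\<^sup>2) = (\<integral>t. h t * cnj (h t) \<partial>Rp q)"
  using I_iso[OF assms assms] by (simp add: cinner_self)
 also have "\<dots> = (\<integral>t. complex_of_real ((cmod (h t))\<^sup>2) \<partial>Rp q)" by (simp add: complex_norm_square[symmetric])
 also have "\<dots> = complex_of_real (\<integral>t. (cmod (h t))\<^sup>2 \<partial>Rp q)" by (rule integral_complex_of_real)
 finally have "(norm (I q h))\<^sup>2 = (\<integral>t. (cmod (h t))\<^sup>2 \<partial>Rp q)" by (simp only: of_real_eq_iff)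
 moreover have "n2 q h = ennreal (\<integral>t. (cmod (h t))\<^sup>2 \<partial>Rp q)"
  unfolding n2_def by (simp add: ennreal_power nn_integral_eq_integral[OF i])
 ultimately show "ennreal ((norm (I q h))\<^sup>2) = n2 q h" by simp
qed

lemma L2I:
 assumes "h \<in> borel_measurable (Rp q)" "n2 q h < \<infinity>" shows "h \<in> L2_kernels q"
 using assms unfolding L2_kernels_def n2_def
 by (auto intro!: integrableI_bounded simp: ennreal_power)

lemma D_meas: "h \<in> D q ==> h \<in> borel_measurable (Rp q)"
 using D_L2 L2D(1) by blast

lemma L2_const: "(%_. c) \<in> L2_kernels 0"
 using D_const D_L2 by blast

lemma cinner_I_Omega: "h \<in> L2_kernels q ==> q \<noteq> 0 ==> cinner (I q h) (\<iota> id) = 0"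
 using I_orth[OF _ _ L2_const[of 1], of q h] I_const[of 1] by simp

lemma I_0: assumes "h \<in> L2_kernels 0" shows "I 0 h = h (%_. undefined) *\<^sub>C \<iota> id"
proof -
 let ?d = "%t. 1 * h t + (- 1) * h (%_. undefined)"
 have Id: "I 0 ?d = 1 *\<^sub>C I 0 h + (- 1) *\<^sub>C (h (%_. undefined) *\<^sub>C \<iota> id)"
  using I_lin[OF assms L2_const[of "h (%_. undefined)"], of 1 "-1"] by (simp add: I_const)
 have m: "?d \<in> borel_measurable (Rp 0)" using L2D(1)[OF assms] by measurable
 have "n2 0 ?d = 0"
  unfolding n2_def Rp_PM lessThan_0 by (simp add: PiM_empty nn_integral_count_space_finite)
 then have "I 0 ?d = 0" using L2D(2)[OF L2I[OF m]] by simp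
 then show ?thesis unfolding Id by (simp add: scaleC_minus1)
qed

lemma I_scale: "h \<in> L2_kernels q ==> I q (%t. c * h t) = c *\<^sub>C I q h"
 using I_lin[of h q h c 0] by simp

lemma I_zero: "I q (%_. 0) = 0"
 using I_scale[of "%_. 0" q 0] D_zero D_L2 by auto

definition vec :: "nat => (nat => kernel) => nat => 'l" where
 "vec q u k = I q (u k)"

definition tens :: "nat => nat => (nat => kernel) => (nat => kernel) => nat => kernel" where
 "tens q r u z k = contraction q r 0 (u k) (z k)"

definition Kernels :: "nat => (nat => kernel) => bool" where
 "Kernels q u \<longleftrightarrow> (\<forall>k. u k \<in> D q) \<and> kTame b q u"

definition Ready :: "nat => (nat => kernel) => nat => (nat => kernel) => bool" where
 "Ready n f q z \<longleftrightarrow> Kernels q z \<and> NF b True n f q z"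

definition Safe :: "nat => (nat => kernel) => nat => (nat => kernel) => bool" where
 "Safe n f q u \<longleftrightarrow> Kernels q u \<and> NF b False n f q u"

definition Negligible :: "nat => (nat => kernel) => bool" where
 "Negligible q u \<longleftrightarrow> Kernels q u \<and> kNull q u"

lemma KernelsD: "Kernels q u ==> u k \<in> D q" "Kernels q u ==> kTame b q u" "Kernels q u ==> u k \<in> L2_kernels q"
 unfolding Kernels_def using D_L2 by blast+

lemma D_gcon: "(c --> b) ==> h \<in> D q ==> w \<in> D r ==> of_bool c \<le> p ==> p \<le> min q r ==> gcon c q r p h w \<in> D (gord c q r p)"
 using D_contraction[of h q w r p] D_star[of h q w r p] by (cases c) (simp_all add: gcon_def)

lemma Kernels_gcon:
 "(c --> b) ==> Kernels q u ==> Kernels r w ==> of_bool c \<le> p ==> p \<le> min q r ==>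
 Kernels (gord c q r p) (%k. gcon c q r p (u k) (w k))"
 using D_gcon kTame_gcon[of b q u r w c p] unfolding Kernels_def by simp

lemma Kernels_tens: "Kernels q u ==> Kernels r z ==> Kernels (q + r) (tens q r u z)"
 using Kernels_gcon[of False q u r z 0] unfolding tens_def[abs_def] by (simp add: gcon_def)

definition prod_terms :: "nat => nat => kernel => kernel => 'l" where
 "prod_terms q r h w = (\<Sum>p\<le>min q r. I (q + r - 2 * p) (contraction q r p h w)) +
    (if b then \<Sum>p=1..min q r. I (q + r - 2 * p + 1) (star_contraction q r p h w) else 0)"

lemma prod_terms_gcon:
 "prod_terms q r h w = (\<Sum>c\<in>{c. c --> b}. \<Sum>p\<in>{of_bool c..min q r}. I (gord c q r p) (gcon c q r p h w))"
proof -
 have 0: "(\<Sum>p\<in>{of_bool False..min q r}. I (gord False q r p) (gcon False q r p h w)) =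
   (\<Sum>p\<le>min q r. I (q + r - 2 * p) (contraction q r p h w))"
  by (simp only: gcon_def of_bool_eq if_False add_0_right atMost_atLeast0)
 have 1: "(\<Sum>p\<in>{of_bool True..min q r}. I (gord True q r p) (gcon True q r p h w)) =
   (\<Sum>p=1..min q r. I (q + r - 2 * p + 1) (star_contraction q r p h w))"
  by (simp only: gcon_def of_bool_eq if_True)
 have sums: "(\<Sum>c\<in>{False, True}. x c) = x False + x True" "(\<Sum>c\<in>{False}. x c) = x False" for x :: "bool => 'l"
  by simp_all
 show ?thesis
 proof (cases b)
  case True
  then have "{c. c --> b} = {False, True}" by auto
  then show ?thesis unfolding prod_terms_def using True by (simp only: sums 0 1 if_True)
 next
  case False
  then have "{c. c --> b} = {False}" by auto
  then show ?thesis unfolding prod_terms_def using False by (simp only: sums 0 if_False add_0_right)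
 qed
qed

lemma nc_times_vec:
 "Kernels q u ==> Kernels r w ==> nc_times A \<phi> \<iota> (vec q u k) (vec r w k) (prod_terms q r (u k) (w k))"
 unfolding vec_def prod_terms_def by (intro I_times KernelsD)

text \<open>Products with the multiple integral of \<open>f\<close> keep a sequence negligible.\<close>

definition neg_pair :: "(nat => 'l) => (nat => 'l) => bool" where
 "neg_pair x y \<longleftrightarrow> x = (%_. 0) \<and> (\<exists>q u. Negligible q u \<and> y = vec q u)"

lemma neg_pair_gen: "Negligible q u ==> neg_pair (%_. 0) (%k. I q (u k))"
 unfolding neg_pair_def vec_def[abs_def] by blast

lemma Negligible_times:
 assumes f: "Kernels n f" and u: "Negligible q u"
 shows "spanned neg_pair (%_. 0) (%k. prod_terms n q (f k) (u k))"
proof -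
 have uK: "Kernels q u" and null: "kNull q u" using u by (simp_all add: Negligible_def)
 have "spanned neg_pair (%_. 0) (%k. I (gord c n q p) (gcon c n q p (f k) (u k)))"
  if "c --> b" "of_bool c \<le> p" "p \<le> min n q" for c p
 proof (intro spanned_gen neg_pair_gen)
  show "Negligible (gord c n q p) (%k. gcon c n q p (f k) (u k))"
   unfolding Negligible_def using Kernels_gcon[OF that(1) f uK that(2,3)]
    kNull_gcon[OF KernelsD(2)[OF f] KernelsD(2)[OF uK] that(2) _ _ that(1) null] that by simp
 qed
 then have "spanned neg_pair (%k. \<Sum>c\<in>{c. c --> b}. \<Sum>p\<in>{of_bool c..min n q}. 0) (%k. prod_terms n q (f k) (u k))"
  unfolding prod_terms_gcon by (intro spanned_sum) auto
 then show ?thesis by simp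
qed

text \<open>In the product of \<open>f\<close> with \<open>u \<otimes> z\<close>, the contractions that stay inside \<open>u\<close> are \<open>(f u) \<otimes> z\<close>, and those
 that reach into \<open>z\<close> are negligible. So multiplying \<open>u\<close> and \<open>u \<otimes> z\<close> by \<open>f\<close> gives again a pair of this form.\<close>

definition tensor_pair :: "nat => (nat => kernel) => nat => (nat => kernel) => (nat => 'l) => (nat => 'l) => bool" where
 "tensor_pair m g r z x y \<longleftrightarrow> neg_pair x y \<or> (\<exists>q u. Safe m g q u \<and> x = vec q u \<and> y = vec (q + r) (tens q r u z))"

lemma tensor_pair_gen: "Safe m g q u ==> spanned (tensor_pair m g r z) (vec q u) (vec (q + r) (tens q r u z))"
 by (rule spanned_gen) (auto simp: tensor_pair_def)

lemma tensor_times: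
 assumes f: "Safe m g n f" and g: "Kernels m g" and u: "Safe m g q u" and z: "Ready n f r z"
 shows "spanned (tensor_pair m g r z) (%k. prod_terms n q (f k) (u k)) (%k. prod_terms n (q + r) (f k) (tens q r u z k))"
proof -
 have fK: "Kernels n f" and fN: "NF b False m g n f" using f by (simp_all add: Safe_def)
 have uK: "Kernels q u" and uN: "NF b False m g q u" using u by (simp_all add: Safe_def)
 have zK: "Kernels r z" and zN: "NF b True n f r z" using z by (simp_all add: Ready_def)
 have tK: "Kernels (q + r) (tens q r u z)" by (rule Kernels_tens[OF uK zK])
 note T = KernelsD(2)[OF fK] KernelsD(2)[OF g] KernelsD(2)[OF uK] KernelsD(2)[OF zK]
 let ?R = "tensor_pair m g r z"
 have 1: "spanned ?R (%k. if p \<le> q then I (gord c n q p) (gcon c n q p (f k) (u k)) else 0)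
   (%k. I (gord c n (q + r) p) (gcon c n (q + r) p (f k) (tens q r u z k)))"
  if cb: "c --> b" and p: "of_bool c \<le> p" "p \<le> min n (q + r)" for c p
 proof (cases "p \<le> q")
  case True
  then have pnq: "p \<le> min n q" "p \<le> n" using p by auto
  have "Safe m g (gord c n q p) (%k. gcon c n q p (f k) (u k))"
   unfolding Safe_def
   using Kernels_gcon[OF cb fK uK p(1) pnq(1)] NF_gcon[OF T(2,1,3) p(1) pnq(2) True cb fN uN] by simp
  from tensor_pair_gen[OF this, of r z]
  have "spanned ?R (%k. I (gord c n q p) (gcon c n q p (f k) (u k)))
   (%k. I (gord c n q p + r) (contraction (gord c n q p) r 0 (gcon c n q p (f k) (u k)) (z k)))"
   unfolding vec_def[abs_def] tens_def .
  moreover have "gord c n (q + r) p = gord c n q p + r" using True pnq by simp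
  ultimately show ?thesis using True by (simp only: tens_def gcon_tensor[OF p(1) pnq(2) True] if_True)
 next
  case False
  have "Negligible (gord c n (q + r) p) (%k. gcon c n (q + r) p (f k) (tens q r u z k))"
   unfolding Negligible_def
   using Kernels_gcon[OF cb fK tK p] kNull_beyond_tensor[OF T(1,3,4) zN _ _ _ cb, of p] False p
   by (simp add: tens_def)
  then show ?thesis using False by (intro spanned_gen) (simp add: tensor_pair_def neg_pair_gen)
 qed
 have e: "(\<Sum>p\<in>{of_bool c..min n q}. I (gord c n q p) (gcon c n q p (f k) (u k))) =
   (\<Sum>p\<in>{of_bool c..min n (q + r)}. if p \<le> q then I (gord c n q p) (gcon c n q p (f k) (u k)) else 0)" for c k
  by (rule sum.mono_neutral_cong_left) auto
 show ?thesis unfolding prod_terms_gcon e by (intro spanned_sum 1) auto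
qed

lemma vec_tens_0:
 assumes u: "Kernels 0 u" and z: "Kernels r z"
 shows "vec (0 + r) (tens 0 r u z) k = u k (%_. undefined) *\<^sub>C vec r z k"
proof -
 let ?c = "u k (%_. undefined)"
 have t: "tens 0 r u z k = (%t. ?c * z k (\<lambda>i\<in>{..<r}. t i))"
  unfolding tens_def by (rule ext) (simp add: tensor_apply restrict_def)
 have zL: "z k \<in> L2_kernels r" by (rule KernelsD(3)[OF z])
 have tL: "tens 0 r u z k \<in> L2_kernels r" using KernelsD(3)[OF Kernels_tens[OF u z], of k] by simp
 have czL: "(%t. ?c * z k t) \<in> L2_kernels r"
 proof (rule subsetD[OF D_L2])
  show "(%t. ?c * z k t) \<in> D r" using D_lin[OF KernelsD(1)[OF z] KernelsD(1)[OF z], of ?c k 0 k] by simp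
 qed
 let ?d = "%t. 1 * tens 0 r u z k t + (- 1) * (?c * z k t)"
 have m: "?d \<in> borel_measurable (Rp r)" using L2D(1)[OF tL] L2D(1)[OF czL] by measurable
 have "n2 r ?d = (\<integral>\<^sup>+ s. 0 \<partial>Rp r)"
  unfolding n2_def
 proof (rule nn_integral_cong)
  fix s assume "s \<in> space (Rp r)"
  then have "(\<lambda>i\<in>{..<r}. s i) = s" by (auto simp: Rp_PM space_PiM PiE_iff intro!: extensional_restrict)
  then show "(ennreal (cmod (?d s)))\<^sup>2 = 0" by (simp add: t)
 qed
 then have n0: "n2 r ?d = 0" by simp
 then have "I r ?d = 0" using L2D(2)[OF L2I[OF m]] by simp
 moreover have "I r ?d = 1 *\<^sub>C I r (tens 0 r u z k) + (- 1) *\<^sub>C I r (%t. ?c * z k t)" by (rule I_lin[OF tL czL])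
 ultimately have "I r (tens 0 r u z k) = I r (%t. ?c * z k t)" by (simp add: scaleC_minus1)
 also have "\<dots> = ?c *\<^sub>C I r (z k)" by (rule I_scale[OF zL])
 finally show ?thesis unfolding vec_def by simp
qed

text \<open>Splitting off the component of order 0 of the first member of a pair.\<close>

definition tensor_pair1 :: "nat => (nat => kernel) => nat => (nat => kernel) => (nat => 'l) => (nat => 'l) => bool" where
 "tensor_pair1 m g r z x y \<longleftrightarrow> neg_pair x y \<or>
  (\<exists>q u. 1 \<le> q \<and> Safe m g q u \<and> x = vec q u \<and> y = vec (q + r) (tens q r u z))"

lemma tensor_center:
 assumes "spanned (tensor_pair m g r z) \<xi> \<theta>" and z: "Kernels r z"
 shows "spanned (tensor_pair1 m g r z) (%k. \<xi> k - cinner (\<xi> k) (\<iota> id) *\<^sub>C \<iota> id) (%k. \<theta> k - cinner (\<xi> k) (\<iota> id) *\<^sub>C vec r z k)"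
 using assms(1)
proof (induction rule: spanned.induct)
 case zero
 show ?case using spanned.zero by simp
next
 case (add x y \<xi> \<theta> c)
 have "spanned (tensor_pair1 m g r z) (%k. x k - cinner (x k) (\<iota> id) *\<^sub>C \<iota> id) (%k. y k - cinner (x k) (\<iota> id) *\<^sub>C vec r z k)"
 proof (cases "neg_pair x y")
  case True
  then have "x = (%_. 0)" by (simp add: neg_pair_def)
  then show ?thesis using True by (intro spanned_gen) (simp add: tensor_pair1_def)
 next
  case False
  then obtain q u where u: "Safe m g q u" "x = vec q u" "y = vec (q + r) (tens q r u z)"
   using add.hyps(1) unfolding tensor_pair_def by blast
  have uK: "Kernels q u" using u(1) by (simp add: Safe_def)
  show ?thesis
  proof (cases "q = 0")
   case True
   have x: "x k = u k (%_. undefined) *\<^sub>C \<iota> id" for k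
    unfolding u(2) vec_def True by (rule I_0) (use KernelsD(3)[OF uK, of k] True in simp)
   have one: "cinner (\<iota> id) (\<iota> id) = 1"
    using phi_iota[OF A_id] phi_unital by simp
   have y: "y k = u k (%_. undefined) *\<^sub>C vec r z k" for k
    unfolding u(3) using vec_tens_0[OF _ z, of u k] uK True by simp
   show ?thesis using spanned.zero by (simp add: x y cinner_scaleC_left one)
  next
   case False
   then have "cinner (x k) (\<iota> id) = 0" for k
    unfolding u(2) vec_def using cinner_I_Omega[OF KernelsD(3)[OF uK]] by simp
   moreover have "tensor_pair1 m g r z x y" unfolding tensor_pair1_def using False u by (metis One_nat_def Suc_leI neq0_conv)
   ultimately show ?thesis by (simp add: spanned_gen)
  qed
 qed
 from spanned_plus[OF spanned_scale[OF this, of c] add.IH]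
 show ?case
  by (simp only: cinner_add_left cinner_scaleC_left scaleC_diff_right scaleC_scaleC scaleC_add_left add_diff_add)
qed

end

context chaos
begin

lemma Kernels_one: "Kernels 0 (%_ _. 1)"
 unfolding Kernels_def
proof (intro conjI allI D_const kTame_plain)
 show "\<exists>B<\<infinity>. \<forall>k::nat. n2 0 (%_. 1) \<le> B"
  by (rule exI[of _ 1]) (simp add: n2_def Rp_PM PiM_empty nn_integral_count_space_finite)
qed auto

lemma NF_order_0: "NF b init n f 0 u"
 unfolding NF_def by auto

lemma Safe_one: "Safe n f 0 (%_ _. 1)"
 unfolding Safe_def using Kernels_one NF_order_0 by blast

lemma Ready_one: "Ready n f 0 (%_ _. 1)"
 unfolding Ready_def using Kernels_one NF_order_0 by blast

lemma vec_one: "vec 0 (%_ _. 1) k = \<iota> id"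
 unfolding vec_def using I_const[of 1] by simp

text \<open>Combinations of integrals of order at least \<open>s0\<close> of kernels that \<open>f\<close> cannot be contracted with from the left, up to null sequences.\<close>

definition chain_gen :: "nat => nat => (nat => kernel) => (nat => 'l) => (nat => 'l) => bool" where
 "chain_gen s0 n f x y \<longleftrightarrow> neg_pair x y \<or> (x = (%_. 0) \<and> (\<exists>s w. s0 \<le> s \<and> Ready n f s w \<and> y = vec s w))"

lemma chain_of_tensor_pair1:
 assumes "spanned (tensor_pair1 m g r z) \<xi> \<theta>" and z: "Kernels r z" and g: "Kernels m g"
 shows "spanned (chain_gen 1 m g) (%_. 0) \<theta>"
 using assms(1)
proof (induction rule: spanned.induct)
 case (add x y \<xi> \<theta> c)
 have "chain_gen 1 m g (%_. 0) y"
 proof (cases "neg_pair x y")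
  case True
  then show ?thesis by (simp add: chain_gen_def neg_pair_def)
 next
  case False
  then obtain q u where u: "1 \<le> q" "Safe m g q u" "y = vec (q + r) (tens q r u z)"
   using add.hyps(1) unfolding tensor_pair1_def by blast
  have uK: "Kernels q u" "NF b False m g q u" using u(2) by (simp_all add: Safe_def)
  have "NF b True m g (q + r) (tens q r u z)"
   unfolding tens_def[abs_def]
   by (rule NF_tensor_initial[OF KernelsD(2)[OF g] KernelsD(2)[OF uK(1)] KernelsD(2)[OF z] u(1) uK(2)])
  then have "Ready m g (q + r) (tens q r u z)" unfolding Ready_def using Kernels_tens[OF uK(1) z] by blast
  then show ?thesis unfolding chain_gen_def using u(1,3) by (metis trans_le_add1)
 qed
 from spanned.add[of "chain_gen 1 m g", OF this add.IH, of c] show ?case by simp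
qed (rule spanned.zero)

text \<open>The isometry turns null kernels into null vectors.\<close>

lemma Negligible_tendsto: assumes "Negligible q u" shows "vec q u \<longlonglongrightarrow> 0"
proof -
 have K: "Kernels q u" and "kNull q u" using assms by (simp_all add: Negligible_def)
 then have "(%k. ennreal ((norm (vec q u k))\<^sup>2)) \<longlonglongrightarrow> ennreal 0"
  unfolding kNull_def vec_def by (simp add: L2D(2)[OF KernelsD(3)[OF K]])
 then have "(%k. (norm (vec q u k))\<^sup>2) \<longlonglongrightarrow> 0" by (subst (asm) tendsto_ennreal_iff) auto
 then have "(%k. sqrt ((norm (vec q u k))\<^sup>2)) \<longlonglongrightarrow> sqrt 0" by (rule tendsto_real_sqrt)
 then show ?thesis by (simp add: tendsto_norm_zero_iff)
qed

lemma chain_trace: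
 assumes "spanned (chain_gen 1 n f) \<xi> \<theta>" shows "(%k. nc_trace \<iota> (\<theta> k)) \<longlonglongrightarrow> 0"
 using assms
proof (induction rule: spanned.induct)
 case zero
 show ?case by (simp add: nc_trace_def)
next
 case (add x y \<xi> \<theta> c)
 have "(%k. nc_trace \<iota> (y k)) \<longlonglongrightarrow> 0"
 proof (cases "neg_pair x y")
  case True
  then obtain q u where u: "Negligible q u" "y = vec q u" unfolding neg_pair_def by blast
  from tendsto_cinner[OF Negligible_tendsto[OF u(1)] tendsto_const[of "\<iota> id"]]
  show ?thesis by (simp add: nc_trace_def u(2))
 next
  case False
  then obtain s w where w: "1 \<le> s" "Ready n f s w" "y = vec s w" using add.hyps(1) unfolding chain_gen_def by blast
  have "nc_trace \<iota> (y k) = 0" for k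
   unfolding nc_trace_def w(3) vec_def
   by (rule cinner_I_Omega) (use w KernelsD(3)[of s w k] in \<open>auto simp: Ready_def\<close>)
  then show ?thesis by simp
 qed
 from tendsto_add[OF tendsto_mult[OF tendsto_const[of c] this] add.IH]
 show ?case by (simp add: nc_trace_def cinner_add_left cinner_scaleC_left)
qed

end

section \<open>Alternating products in the limit\<close>

locale chaos_pair = chaos A \<phi> \<iota> I D b
 for A :: "'h::complex_hilbert_space op set" and \<phi> :: "'h op => complex"
  and \<iota> :: "'h op => 'l::complex_hilbert_space" and I D b +
 fixes N :: "nat => nat" and K :: "nat => nat => kernel" and W :: "nat => nat list => 'l"
  and X :: "nat => 'l" and Winf :: "nat list => 'l"
 assumes words: "nc_words A \<phi> \<iota> (%i. I (N i) (K i k)) {..<2} (W k)"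
  and words_inf: "nc_words A \<phi> \<iota> X {..<2} Winf"
  and moments: "set u \<subseteq> {..<2} ==> (%k. nc_trace \<iota> (W k u)) \<longlonglongrightarrow> nc_trace \<iota> (Winf u)"
  and safe: "i < 2 ==> Safe (N (1 - i)) (K (1 - i)) (N i) (K i)"
begin

lemma Kernels_K: "i < 2 ==> Kernels (N i) (K i)"
 using safe by (simp add: Safe_def)

lemma other: assumes "i < (2::nat)" shows "1 - i < 2" "1 - (1 - i) = i"
 using assms by auto

lemma replicate_sub: "i < 2 ==> set (replicate j i) \<subseteq> {..<2}"
 by auto

lemma W_Suc: "i < 2 ==> nc_times A \<phi> \<iota> (vec (N i) (K i) k) (W k (replicate j i)) (W k (replicate (Suc j) i))"
 using nc_words.W_Cons[OF words _ replicate_sub, of i i k j] by (simp add: vec_def)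

lemma power_step:
 assumes i: "i < 2" and 1: "nc_times A \<phi> \<iota> (W k (replicate j i)) c d"
  and 2: "nc_times A \<phi> \<iota> (vec (N i) (K i) k) d e"
 shows "nc_times A \<phi> \<iota> (W k (replicate (Suc j) i)) c e"
 using nc_times_assoc[OF W_Suc[OF i] 1] 2 by blast

lemma tensor_power:
 assumes i: "i < 2" and z: "Ready (N i) (K i) r z"
 shows "\<exists>\<theta>. spanned (tensor_pair (N (1 - i)) (K (1 - i)) r z) (%k. W k (replicate j i)) \<theta> \<and>
  (\<forall>k. nc_times A \<phi> \<iota> (W k (replicate j i)) (vec r z k) (\<theta> k))"
proof (induction j)
 case 0
 have zK: "Kernels r z" using z by (simp add: Ready_def)
 have W0: "W k [] = \<iota> id" for k by (rule nc_words.W_Nil[OF words])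
 have "spanned (tensor_pair (N (1 - i)) (K (1 - i)) r z) (vec 0 (%_ _. 1)) (vec (0 + r) (tens 0 r (%_ _. 1) z))"
  by (rule tensor_pair_gen[OF Safe_one])
 moreover have "vec 0 (%_ _. 1) = (%k. W k (replicate 0 i))" by (simp add: fun_eq_iff vec_one W0)
 moreover have "vec (0 + r) (tens 0 r (%_ _. 1) z) = vec r z"
  using vec_tens_0[OF Kernels_one zK] by (simp add: fun_eq_iff)
 ultimately have "spanned (tensor_pair (N (1 - i)) (K (1 - i)) r z) (%k. W k (replicate 0 i)) (vec r z)" by simp
 then show ?case using nc_times_id_left by (intro exI[of _ "vec r z"]) (simp add: W0)
next
 case (Suc j)
 let ?m = "N (1 - i)" and ?g = "K (1 - i)"
 obtain \<theta> where th: "spanned (tensor_pair ?m ?g r z) (%k. W k (replicate j i)) \<theta>"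
  "!!k. nc_times A \<phi> \<iota> (W k (replicate j i)) (vec r z k) (\<theta> k)" using Suc.IH by blast
 have zK: "Kernels r z" using z by (simp add: Ready_def)
 have gen: "\<exists>x' y'. spanned (tensor_pair ?m ?g r z) x' y' \<and> (\<forall>k. nc_times A \<phi> \<iota> (vec (N i) (K i) k) (x k) (x' k)) \<and>
   (\<forall>k. nc_times A \<phi> \<iota> (vec (N i) (K i) k) (y k) (y' k))" if "tensor_pair ?m ?g r z x y" for x y
 proof (cases "neg_pair x y")
  case True
  then obtain q u where u: "Negligible q u" "x = (%_. 0)" "y = vec q u" unfolding neg_pair_def by blast
  have "spanned (tensor_pair ?m ?g r z) (%_. 0) (%k. prod_terms (N i) q (K i k) (u k))"
   by (rule spanned_mono[OF Negligible_times[OF Kernels_K[OF i] u(1)]]) (rule spanned_gen, simp add: tensor_pair_def)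
  moreover have "nc_times A \<phi> \<iota> (vec (N i) (K i) k) (y k) (prod_terms (N i) q (K i k) (u k))" for k
   unfolding u(3) by (rule nc_times_vec[OF Kernels_K[OF i]]) (use u(1) in \<open>simp add: Negligible_def\<close>)
  ultimately show ?thesis using nc_times_zero_right u(2) by blast
 next
  case False
  then obtain q u where u: "Safe ?m ?g q u" "x = vec q u" "y = vec (q + r) (tens q r u z)"
   using \<open>tensor_pair ?m ?g r z x y\<close> unfolding tensor_pair_def by blast
  have uK: "Kernels q u" using u(1) by (simp add: Safe_def)
  show ?thesis
   using tensor_times[OF safe[OF i] Kernels_K[OF other(1)[OF i]] u(1) z]
    nc_times_vec[OF Kernels_K[OF i] uK] nc_times_vec[OF Kernels_K[OF i] Kernels_tens[OF uK zK]]
   unfolding u(2,3) by blast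
 qed
 from spanned_times[OF gen th(1)] obtain \<xi>' \<theta>' where *: "spanned (tensor_pair ?m ?g r z) \<xi>' \<theta>'"
  "!!k. nc_times A \<phi> \<iota> (vec (N i) (K i) k) (W k (replicate j i)) (\<xi>' k)"
  "!!k. nc_times A \<phi> \<iota> (vec (N i) (K i) k) (\<theta> k) (\<theta>' k)" by blast
 have "\<xi>' = (%k. W k (replicate (Suc j) i))"
  by (rule ext) (rule nc_times_unique[OF *(2) W_Suc[OF i]])
 then show ?case using *(1) power_step[OF i th(2) *(3)] by blast
qed

lemma neg_power:
 assumes i: "i < 2" and u: "Negligible q u"
 shows "\<exists>\<theta>. spanned neg_pair (%_. 0) \<theta> \<and> (\<forall>k. nc_times A \<phi> \<iota> (W k (replicate j i)) (vec q u k) (\<theta> k))"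
proof (induction j)
 case 0
 have W0: "W k [] = \<iota> id" for k by (rule nc_words.W_Nil[OF words])
 have "spanned neg_pair (%_. 0) (vec q u)" using u by (intro spanned_gen) (auto simp: neg_pair_def)
 then show ?case using nc_times_id_left by (intro exI[of _ "vec q u"]) (simp add: W0)
next
 case (Suc j)
 obtain \<theta> where th: "spanned neg_pair (%_. 0) \<theta>"
  "!!k. nc_times A \<phi> \<iota> (W k (replicate j i)) (vec q u k) (\<theta> k)" using Suc.IH by blast
 have gen: "\<exists>x' y'. spanned neg_pair x' y' \<and> (\<forall>k. nc_times A \<phi> \<iota> 0 (x k) (x' k)) \<and>
   (\<forall>k. nc_times A \<phi> \<iota> (vec (N i) (K i) k) (y k) (y' k))" if xy: "neg_pair x y" for x y
 proof -
  obtain q u where u: "Negligible q u" "x = (%_. 0)" "y = vec q u" using xy unfolding neg_pair_def by blast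
  have "nc_times A \<phi> \<iota> (vec (N i) (K i) k) (y k) (prod_terms (N i) q (K i k) (u k))" for k
   unfolding u(3) by (rule nc_times_vec[OF Kernels_K[OF i]]) (use u(1) in \<open>simp add: Negligible_def\<close>)
  then show ?thesis using Negligible_times[OF Kernels_K[OF i] u(1)] nc_times_zero_left by blast
 qed
 from spanned_times[OF gen th(1)] obtain \<xi>' \<theta>' where *: "spanned neg_pair \<xi>' \<theta>'"
  "!!k. nc_times A \<phi> \<iota> 0 0 (\<xi>' k)" "!!k. nc_times A \<phi> \<iota> (vec (N i) (K i) k) (\<theta> k) (\<theta>' k)" by blast
 have "\<xi>' = (%_. 0)" by (rule ext) (rule nc_times_unique[OF *(2) nc_times_zero_left])
 then show ?case using *(1) power_step[OF i th(2) *(3)] by blast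
qed

definition pol :: "nat => nat => complex poly => 'l" where
 "pol k i P = (\<Sum>j\<le>degree P. coeff P j *\<^sub>C W k (replicate j i))"

definition pol_inf :: "nat => complex poly => 'l" where
 "pol_inf i P = (\<Sum>j\<le>degree P. coeff P j *\<^sub>C Winf (replicate j i))"

text \<open>The trace that is subtracted is a convergent, hence bounded, sequence of scalars, so it keeps a null kernel tame and null.\<close>

lemma center_neg:
 assumes i: "i < 2" and u: "Negligible q u"
 shows "\<exists>\<theta>. spanned (chain_gen 1 m g) (%_. 0) \<theta> \<and> (\<forall>k. nc_times A \<phi> \<iota> (nc_center \<iota> (pol k i P)) (vec q u k) (\<theta> k))"
proof -
 obtain \<theta> where th: "!!j. spanned neg_pair (%_. 0) (\<theta> j)"
  "!!j k. nc_times A \<phi> \<iota> (W k (replicate j i)) (vec q u k) (\<theta> j k)" using neg_power[OF i u] by metis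
 define \<omega> where "\<omega> k = nc_trace \<iota> (pol k i P)" for k
 have uK: "Kernels q u" using u by (simp add: Negligible_def)
 have "(%k. nc_trace \<iota> (pol k i P)) \<longlonglongrightarrow> nc_trace \<iota> (pol_inf i P)"
  unfolding pol_def pol_inf_def nc_trace_def cinner_sum_left cinner_scaleC_left
  by (intro tendsto_sum tendsto_mult tendsto_const moments[unfolded nc_trace_def] replicate_sub i)
 then have "Bseq \<omega>" unfolding \<omega>_def by (intro convergent_imp_Bseq convergentI)
 then obtain B where B: "0 < B" "!!k. cmod (\<omega> k) \<le> B" unfolding Bseq_def by blast
 define u' where "u' k t = \<omega> k * u k t" for k t
 have n2u': "n2 q (u' k) = ennreal ((cmod (\<omega> k))\<^sup>2) * n2 q (u k)" for k
  unfolding n2_def u'_def using D_meas[OF KernelsD(1)[OF uK, of k]]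
  by (simp add: norm_mult ennreal_mult power_mult_distrib nn_integral_cmult ennreal_power)
 have D': "u' k \<in> D q" for k
  unfolding u'_def using D_lin[OF KernelsD(1)[OF uK] KernelsD(1)[OF uK], of "\<omega> k" k 0 k] by simp
 have I': "I q (u' k) = \<omega> k *\<^sub>C vec q u k" for k
  unfolding u'_def vec_def by (rule I_scale[OF KernelsD(3)[OF uK]])
 have "kTame b q u'"
  unfolding kTame_def
 proof (intro conjI allI impI D_meas[OF D'])
  fix l :: "nat => nat" assume l: "inj_on l {..<q}"
  note T = kTameD(2)[OF KernelsD(2)[OF uK] l]
  have lab': "lab q l (u' k) t = \<omega> k * lab q l (u k) t" for k t by (simp add: lab_def u'_def)
  have "cTame b (l ` {..<q}) (%k t. of_real B * lab q l (u k) t)"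
  proof -
   have g: "gluable b {} (l ` {..<q}) {}" by (simp add: gluable_def)
   have T0: "cTame b {} (%_ _. of_real B)"
    unfolding cTame_def Tame_def nabs_def[abs_def] using B(1)
    by (auto simp: dep_def nsq_def ennreal_power intro!: exI[of _ "ennreal (B\<^sup>2)"])
   have "cm {} h = h" for h by (rule ext) (rule cm_empty)
   with cTame_cg[OF T0 T g] show ?thesis by (simp add: cg_def[abs_def])
  qed
  note TB = this
  show "cTame b (l ` {..<q}) (%k. lab q l (u' k))"
   unfolding cTame_def
  proof (intro conjI allI)
   show m: "lab q l (u' k) \<in> borel_measurable NM" for k by (rule measurable_lab[OF D_meas[OF D']])
   show d: "dep (l ` {..<q}) (lab q l (u' k))" for k by (rule dep_lab)
   show "Tame b (l ` {..<q}) (nabs (%k. lab q l (u' k)))"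
   proof (rule Tame_mono[OF cTameD(3)[OF TB]])
    show "nabs (%k. lab q l (u' k)) k \<in> borel_measurable NM" for k using m[of k] unfolding nabs_def[abs_def] by measurable
    show "dep (l ` {..<q}) (nabs (%k. lab q l (u' k)) k)" for k unfolding nabs_def[abs_def] by (rule dep_op1[OF d])
    show "nabs (%k. lab q l (u' k)) k t \<le> nabs (%k t. of_real B * lab q l (u k) t) k t" for k t
     unfolding nabs_def lab' using B by (intro ennreal_leI) (auto simp: norm_mult intro!: mult_right_mono)
   qed
  qed
 qed
 moreover have "kNull q u'"
  unfolding kNull_def
 proof (rule tendsto_sandwich[OF _ _ tendsto_const])
  have "(%k. ennreal (B\<^sup>2) * n2 q (u k)) \<longlonglongrightarrow> ennreal (B\<^sup>2) * 0"
   using u by (intro ennreal_tendsto_cmult) (auto simp: Negligible_def kNull_def)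
  then show "(%k. ennreal (B\<^sup>2) * n2 q (u k)) \<longlonglongrightarrow> 0" by simp
  show "\<forall>\<^sub>F k in sequentially. n2 q (u' k) \<le> ennreal (B\<^sup>2) * n2 q (u k)"
   unfolding n2u' using B by (intro always_eventually allI mult_right_mono ennreal_leI power_mono) auto
 qed simp
 ultimately have N': "Negligible q u'" unfolding Negligible_def Kernels_def using D' by blast
 have "spanned neg_pair (%_. 0) (%k. (\<Sum>j\<le>degree P. coeff P j *\<^sub>C \<theta> j k) + (- 1) *\<^sub>C vec q u' k)"
 proof -
  have "spanned neg_pair (%k. (\<Sum>j\<le>degree P. coeff P j *\<^sub>C 0) + (- 1) *\<^sub>C 0) (%k. (\<Sum>j\<le>degree P. coeff P j *\<^sub>C \<theta> j k) + (- 1) *\<^sub>C vec q u' k)"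
   by (intro spanned_plus spanned_sum spanned_scale th spanned_gen) (use N' in \<open>auto simp: neg_pair_def\<close>)
  then show ?thesis by simp
 qed
 moreover have "nc_times A \<phi> \<iota> (nc_center \<iota> (pol k i P)) (vec q u k) ((\<Sum>j\<le>degree P. coeff P j *\<^sub>C \<theta> j k) + (- 1) *\<^sub>C vec q u' k)" for k
 proof -
  have "nc_times A \<phi> \<iota> (pol k i P - \<omega> k *\<^sub>C \<iota> id) (vec q u k) ((\<Sum>j\<le>degree P. coeff P j *\<^sub>C \<theta> j k) - \<omega> k *\<^sub>C vec q u k)"
   unfolding pol_def
   by (intro nc_times_diff_left nc_times_sum_left nc_times_scale_left th nc_times_id_left) simp
  then show ?thesis unfolding nc_center_def \<omega>_def[symmetric] by (simp add: vec_def I' scaleC_minus1)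
 qed
 ultimately show ?thesis
  by (intro exI conjI allI) (rule spanned_mono, assumption, rule spanned_gen, simp add: chain_gen_def)
qed

text \<open>Subtracting the trace removes exactly the part of order zero of the polynomial, so the tensor factor that is put in front has positive order and shields \<open>z\<close>.\<close>

lemma center_ready:
 assumes i: "i < 2" and z: "Ready (N i) (K i) r z"
 shows "\<exists>\<theta>. spanned (chain_gen 1 (N (1 - i)) (K (1 - i))) (%_. 0) \<theta> \<and>
  (\<forall>k. nc_times A \<phi> \<iota> (nc_center \<iota> (pol k i P)) (vec r z k) (\<theta> k))"
proof -
 let ?R = "tensor_pair (N (1 - i)) (K (1 - i)) r z"
 have zK: "Kernels r z" using z by (simp add: Ready_def)
 obtain \<theta> where th: "!!j. spanned ?R (%k. W k (replicate j i)) (\<theta> j)"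
  "!!j k. nc_times A \<phi> \<iota> (W k (replicate j i)) (vec r z k) (\<theta> j k)" using tensor_power[OF i z] by metis
 have "spanned ?R (%k. pol k i P) (%k. \<Sum>j\<le>degree P. coeff P j *\<^sub>C \<theta> j k)"
  unfolding pol_def by (intro spanned_sum spanned_scale th) simp
 from chain_of_tensor_pair1[OF tensor_center[OF this zK] zK Kernels_K[OF other(1)[OF i]]]
 have "spanned (chain_gen 1 (N (1 - i)) (K (1 - i))) (%_. 0)
   (%k. (\<Sum>j\<le>degree P. coeff P j *\<^sub>C \<theta> j k) - nc_trace \<iota> (pol k i P) *\<^sub>C vec r z k)"
  unfolding nc_trace_def .
 moreover have "nc_times A \<phi> \<iota> (nc_center \<iota> (pol k i P)) (vec r z k)
   ((\<Sum>j\<le>degree P. coeff P j *\<^sub>C \<theta> j k) - nc_trace \<iota> (pol k i P) *\<^sub>C vec r z k)" for k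
  unfolding nc_center_def by (subst (1) pol_def)
   (intro nc_times_diff_left nc_times_sum_left nc_times_scale_left th nc_times_id_left, simp)
 ultimately show ?thesis by blast
qed

lemma chain_step:
 assumes i: "i < 2" and "spanned (chain_gen 0 (N i) (K i)) (%_. 0) \<xi>"
 shows "\<exists>\<theta>. spanned (chain_gen 1 (N (1 - i)) (K (1 - i))) (%_. 0) \<theta> \<and>
  (\<forall>k. nc_times A \<phi> \<iota> (nc_center \<iota> (pol k i P)) (\<xi> k) (\<theta> k))"
proof -
 have gen: "\<exists>x' y'. spanned (chain_gen 1 (N (1 - i)) (K (1 - i))) x' y' \<and> (\<forall>k. nc_times A \<phi> \<iota> 0 (x k) (x' k)) \<and>
   (\<forall>k. nc_times A \<phi> \<iota> (nc_center \<iota> (pol k i P)) (y k) (y' k))" if "chain_gen 0 (N i) (K i) x y" for x y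
 proof (cases "neg_pair x y")
  case True
  then obtain q u where u: "Negligible q u" "x = (%_. 0)" "y = vec q u" unfolding neg_pair_def by blast
  from center_neg[OF i u(1), of "N (1 - i)" "K (1 - i)" P] show ?thesis unfolding u(3) using nc_times_zero_left by blast
 next
  case False
  then obtain s w where w: "Ready (N i) (K i) s w" "y = vec s w"
   using \<open>chain_gen 0 (N i) (K i) x y\<close> unfolding chain_gen_def by blast
  from center_ready[OF i w(1), of P] show ?thesis unfolding w(2) using nc_times_zero_left by blast
 qed
 from spanned_times[OF gen assms(2)] obtain \<xi>' \<theta>' where *: "spanned (chain_gen 1 (N (1 - i)) (K (1 - i))) \<xi>' \<theta>'"
  "!!k. nc_times A \<phi> \<iota> 0 0 (\<xi>' k)" "!!k. nc_times A \<phi> \<iota> (nc_center \<iota> (pol k i P)) (\<xi> k) (\<theta>' k)" by blast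
 have "\<xi>' = (%_. 0)" by (rule ext) (rule nc_times_unique[OF *(2) nc_times_zero_left])
 then show ?thesis using * by blast
qed

text \<open>Combinations of words with convergent coefficients, paired with their limits: all moments converge along them.\<close>

definition conv_gen :: "(nat => 'l) => (nat => 'l) => bool" where
 "conv_gen x y \<longleftrightarrow> (\<exists>w a a'. set w \<subseteq> {..<2} \<and> a \<longlonglongrightarrow> a' \<and> x = (%k. a k *\<^sub>C W k w) \<and> y = (%_. a' *\<^sub>C Winf w))"

lemma conv_genI: "set w \<subseteq> {..<2} ==> a \<longlonglongrightarrow> a' ==> spanned conv_gen (%k. a k *\<^sub>C W k w) (%_. a' *\<^sub>C Winf w)"
 by (rule spanned_gen) (auto simp: conv_gen_def)

lemma conv_step:
 assumes i: "i < 2" and "spanned conv_gen \<xi> \<theta>"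
 shows "\<exists>\<xi>' \<theta>'. spanned conv_gen \<xi>' \<theta>' \<and> (\<forall>k. nc_times A \<phi> \<iota> (nc_center \<iota> (pol k i P)) (\<xi> k) (\<xi>' k)) \<and>
  (\<forall>k. nc_times A \<phi> \<iota> (nc_center \<iota> (pol_inf i P)) (\<theta> k) (\<theta>' k))"
proof (rule spanned_times[OF _ assms(2)])
 fix x y assume "conv_gen x y"
 then obtain w a a' where w: "set w \<subseteq> {..<2}" and a: "a \<longlonglongrightarrow> a'" and xy: "x = (%k. a k *\<^sub>C W k w)" "y = (%_. a' *\<^sub>C Winf w)"
  unfolding conv_gen_def by blast
 have tr: "(%k. nc_trace \<iota> (pol k i P)) \<longlonglongrightarrow> nc_trace \<iota> (pol_inf i P)"
  unfolding pol_def pol_inf_def nc_trace_def cinner_sum_left cinner_scaleC_left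
  by (intro tendsto_sum tendsto_mult tendsto_const moments[unfolded nc_trace_def] replicate_sub i)
 have wi: "set (replicate j i @ w) \<subseteq> {..<2}" for j using w i by auto
 let ?x = "%k. (\<Sum>j\<le>degree P. coeff P j *\<^sub>C (a k *\<^sub>C W k (replicate j i @ w))) + (- 1) *\<^sub>C ((nc_trace \<iota> (pol k i P) * a k) *\<^sub>C W k w)"
 let ?y = "%k::nat. (\<Sum>j\<le>degree P. coeff P j *\<^sub>C (a' *\<^sub>C Winf (replicate j i @ w))) + (- 1) *\<^sub>C ((nc_trace \<iota> (pol_inf i P) * a') *\<^sub>C Winf w)"
 have "spanned conv_gen ?x ?y"
  by (intro spanned_plus spanned_sum spanned_scale conv_genI a tr tendsto_mult w wi) simp
 moreover have "nc_times A \<phi> \<iota> (nc_center \<iota> (pol k i P)) (x k) (?x k)" for k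
 proof -
  have "nc_times A \<phi> \<iota> (pol k i P - nc_trace \<iota> (pol k i P) *\<^sub>C \<iota> id) (a k *\<^sub>C W k w)
   ((\<Sum>j\<le>degree P. coeff P j *\<^sub>C (a k *\<^sub>C W k (replicate j i @ w))) - nc_trace \<iota> (pol k i P) *\<^sub>C (a k *\<^sub>C W k w))"
   by (subst (1) pol_def)
    (intro nc_times_diff_left nc_times_sum_left nc_times_scale_left nc_times_scale_right nc_times_id_left
     nc_words.W_append[OF words] replicate_sub i w, simp)
  then show ?thesis unfolding nc_center_def xy scaleC_minus1 by (simp only: scaleC_scaleC add_uminus_conv_diff)
 qed
 moreover have "nc_times A \<phi> \<iota> (nc_center \<iota> (pol_inf i P)) (y k) (?y k)" for k
 proof -
  have "nc_times A \<phi> \<iota> (pol_inf i P - nc_trace \<iota> (pol_inf i P) *\<^sub>C \<iota> id) (a' *\<^sub>C Winf w)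
   ((\<Sum>j\<le>degree P. coeff P j *\<^sub>C (a' *\<^sub>C Winf (replicate j i @ w))) - nc_trace \<iota> (pol_inf i P) *\<^sub>C (a' *\<^sub>C Winf w))"
   by (subst (1) pol_inf_def)
    (intro nc_times_diff_left nc_times_sum_left nc_times_scale_left nc_times_scale_right nc_times_id_left
     nc_words.W_append[OF words_inf] replicate_sub i w, simp)
  then show ?thesis unfolding nc_center_def xy scaleC_minus1 by (simp only: scaleC_scaleC add_uminus_conv_diff)
 qed
 ultimately show "\<exists>x' y'. spanned conv_gen x' y' \<and> (\<forall>k. nc_times A \<phi> \<iota> (nc_center \<iota> (pol k i P)) (x k) (x' k)) \<and>
   (\<forall>k. nc_times A \<phi> \<iota> (nc_center \<iota> (pol_inf i P)) (y k) (y' k))" by blast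
qed

lemma conv_trace:
 assumes "spanned conv_gen \<xi> \<theta>" shows "(%k. nc_trace \<iota> (\<xi> k) - nc_trace \<iota> (\<theta> k)) \<longlonglongrightarrow> 0"
 using assms
proof (induction rule: spanned.induct)
 case (add x y \<xi> \<theta> c)
 obtain w a a' where w: "set w \<subseteq> {..<2}" and a: "a \<longlonglongrightarrow> a'" and xy: "x = (%k. a k *\<^sub>C W k w)" "y = (%_. a' *\<^sub>C Winf w)"
  using add.hyps(1) unfolding conv_gen_def by blast
 have "(%k. nc_trace \<iota> (x k) - nc_trace \<iota> (y k)) \<longlonglongrightarrow> a' * nc_trace \<iota> (Winf w) - a' * nc_trace \<iota> (Winf w)"
  unfolding xy nc_trace_def cinner_scaleC_left
  by (intro tendsto_intros a moments[OF w, unfolded nc_trace_def])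
 from tendsto_add[OF tendsto_mult[OF tendsto_const[of c] this] add.IH]
 show ?case by (simp add: nc_trace_def cinner_add_left cinner_scaleC_left algebra_simps)
qed (simp add: nc_trace_def)

text \<open>The same product is described in two ways: as a combination of words, whose traces converge to the trace of the limit, and as a sum of integrals of positive order, whose traces vanish asymptotically.\<close>

lemma alternating_word:
 assumes "\<forall>(i, P)\<in>set w. i < 2" "distinct_adj (map fst w)"
 shows "\<exists>\<xi> \<zeta>. nc_word A \<phi> \<iota> (map (%(i, P). nc_center \<iota> (pol_inf i P)) w) \<zeta> \<and> spanned conv_gen \<xi> (%_. \<zeta>) \<and>
  (if w = [] then \<xi> = (%_. \<iota> id)
  else spanned (chain_gen 1 (N (1 - fst (hd w))) (K (1 - fst (hd w)))) (%_. 0) \<xi>)"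
 using assms
proof (induction w)
 case Nil
 have W0: "W k [] = \<iota> id" for k by (rule nc_words.W_Nil[OF words])
 have Winf0: "Winf [] = \<iota> id" by (rule nc_words.W_Nil[OF words_inf])
 have "spanned conv_gen (%k. 1 *\<^sub>C W k []) (%_. 1 *\<^sub>C Winf [])" by (rule conv_genI) auto
 then show ?case using nc_word.Nil by (intro exI[of _ "%_. \<iota> id"] exI[of _ "\<iota> id"]) (simp add: W0 Winf0)
next
 case (Cons ip v)
 obtain i P where ip: "ip = (i, P)" by (cases ip)
 have i: "i < 2" using Cons.prems(1) ip by auto
 have "distinct_adj (map fst v)" using Cons.prems(2) by (cases v) auto
 then obtain \<xi> \<zeta> where IH: "nc_word A \<phi> \<iota> (map (%(i, P). nc_center \<iota> (pol_inf i P)) v) \<zeta>" "spanned conv_gen \<xi> (%_. \<zeta>)"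
  "if v = [] then \<xi> = (%_. \<iota> id) else spanned (chain_gen 1 (N (1 - fst (hd v))) (K (1 - fst (hd v)))) (%_. 0) \<xi>"
  using Cons.IH Cons.prems(1) by auto
 have "spanned (chain_gen 0 (N i) (K i)) (%_. 0) \<xi>"
 proof (cases "v = []")
  case True
  then have "\<xi> = vec 0 (%_ _. 1)" using IH(3) by (simp add: fun_eq_iff vec_one)
  then show ?thesis using Ready_one by (intro spanned_gen) (auto simp: chain_gen_def)
 next
  case False
  then obtain j Q v' where v: "v = (j, Q) # v'" by (cases v) auto
  have "i \<noteq> j" "j < 2" using Cons.prems ip v by auto
  then have "1 - j = i" using i by arith
  then have "spanned (chain_gen 1 (N i) (K i)) (%_. 0) \<xi>" using IH(3) v by simp
  then show ?thesis by (rule spanned_mono) (rule spanned_gen, auto simp: chain_gen_def)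
 qed
 from chain_step[OF i this, of P] obtain \<theta> where th: "spanned (chain_gen 1 (N (1 - i)) (K (1 - i))) (%_. 0) \<theta>"
  "!!k. nc_times A \<phi> \<iota> (nc_center \<iota> (pol k i P)) (\<xi> k) (\<theta> k)" by blast
 from conv_step[OF i IH(2), of P] obtain \<xi>' \<theta>' where *: "spanned conv_gen \<xi>' \<theta>'"
  "!!k. nc_times A \<phi> \<iota> (nc_center \<iota> (pol k i P)) (\<xi> k) (\<xi>' k)"
  "!!k. nc_times A \<phi> \<iota> (nc_center \<iota> (pol_inf i P)) \<zeta> (\<theta>' k)" by blast
 have "\<theta> = \<xi>'" by (rule ext) (rule nc_times_unique[OF th(2) *(2)])
 moreover have "\<theta>' = (%_. \<theta>' 0)" by (rule ext) (rule nc_times_unique[OF *(3) *(3)])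
 moreover have "nc_word A \<phi> \<iota> (map (%(i, P). nc_center \<iota> (pol_inf i P)) (ip # v)) (\<theta>' 0)"
  using nc_word.Cons[OF IH(1) *(3)[of 0]] by (simp add: ip)
 ultimately show ?case using * th(1) ip by (intro exI[of _ \<xi>'] exI[of _ "\<theta>' 0"]) simp
qed

lemma nc_poly_pol_inf: "i < 2 ==> nc_poly A \<phi> \<iota> P (X i) = pol_inf i P"
proof -
 assume i: "i < 2"
 have "(THE \<zeta>. nc_word A \<phi> \<iota> (replicate j (X i)) \<zeta>) = Winf (replicate j i)" for j
  using nc_words.word[OF words_inf replicate_sub[OF i, of j]] nc_word_unique by (intro the_equality) auto
 then show ?thesis unfolding nc_poly_def pol_inf_def by simp
qed

theorem free_limit: "nc_free A \<phi> \<iota> [X 0, X 1]"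
 unfolding nc_free_def
proof (intro allI impI, elim conjE)
 fix w :: "(nat \<times> complex poly) list"
 assume w: "w \<noteq> []" "\<forall>(i, P)\<in>set w. i < length [X 0, X 1]" "distinct_adj (map fst w)"
 have w2: "\<forall>(i, P)\<in>set w. i < 2" using w(2) by (simp add: numeral_2_eq_2)
 obtain \<xi> \<zeta> where *: "nc_word A \<phi> \<iota> (map (%(i, P). nc_center \<iota> (pol_inf i P)) w) \<zeta>" "spanned conv_gen \<xi> (%_. \<zeta>)"
  "spanned (chain_gen 1 (N (1 - fst (hd w))) (K (1 - fst (hd w)))) (%_. 0) \<xi>"
  using alternating_word[OF w2 w(3)] w(1) by auto
 from tendsto_diff[OF chain_trace[OF *(3)] conv_trace[OF *(2)]]
 have "(%k::nat. nc_trace \<iota> \<zeta>) \<longlonglongrightarrow> 0" by simp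
 then have z0: "nc_trace \<iota> \<zeta> = 0" by (simp add: LIMSEQ_const_iff)
 have eq: "map (%(i, P). nc_center \<iota> (nc_poly A \<phi> \<iota> P ([X 0, X 1] ! i))) w = map (%(i, P). nc_center \<iota> (pol_inf i P)) w"
 proof (rule map_cong[OF refl])
  fix x assume "x \<in> set w"
  obtain i P where x: "x = (i, P)" by (cases x)
  then have i: "i < 2" using w2 \<open>x \<in> set w\<close> by auto
  then have "[X 0, X 1] ! i = X i" by (auto simp: less_2_cases_iff)
  then show "(case x of (i, P) => nc_center \<iota> (nc_poly A \<phi> \<iota> P ([X 0, X 1] ! i))) = (case x of (i, P) => nc_center \<iota> (pol_inf i P))"
   using nc_poly_pol_inf[OF i] x by simp
 qed
 show "nc_moment A \<phi> \<iota> (map (%(i, P). nc_center \<iota> (nc_poly A \<phi> \<iota> P ([X 0, X 1] ! i))) w) 0"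
  unfolding nc_moment_def eq using *(1) z0 by blast
qed

end

lemma norm_sum_orthogonal:
 fixes x :: "'i => 'a::complex_hilbert_space"
 assumes "finite K" "!!i j. i \<in> K ==> j \<in> K ==> i \<noteq> j ==> cinner (x i) (x j) = 0"
 shows "(norm (\<Sum>i\<in>K. x i))\<^sup>2 = (\<Sum>i\<in>K. (norm (x i))\<^sup>2)"
 using assms
proof (induction K rule: finite_induct)
 case (insert i K)
 have "cinner (x i) (\<Sum>j\<in>K. x j) = 0"
  unfolding cinner_sum_right by (rule sum.neutral) (use insert in auto)
 moreover have "(norm (\<Sum>j\<in>K. x j))\<^sup>2 = (\<Sum>j\<in>K. (norm (x j))\<^sup>2)" by (rule insert.IH) (use insert.prems in auto)
 ultimately show ?case using insert.hyps by (simp add: norm_add_sq)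
qed simp

lemma kNullI:
 assumes "!!k. n2 q (u k) = ennreal (e k)" "e \<longlonglongrightarrow> 0" shows "kNull q u"
 unfolding kNull_def assms(1) using tendsto_ennrealI[OF assms(2)] by simp

locale chaos_seq = chaos A \<phi> \<iota> I D b
 for A :: "'h::complex_hilbert_space op set" and \<phi> :: "'h op => complex"
  and \<iota> :: "'h op => 'l::complex_hilbert_space" and I D b +
 fixes N :: "nat => nat" and K :: "nat => nat => kernel" and W :: "nat => nat list => 'l"
  and X :: "nat => 'l" and Winf :: "nat list => 'l"
 assumes words: "nc_words A \<phi> \<iota> (%i. I (N i) (K i k)) {..<2} (W k)"
  and words_inf: "nc_words A \<phi> \<iota> X {..<2} Winf"
  and moments: "set u \<subseteq> {..<2} ==> (%k. nc_trace \<iota> (W k u)) \<longlonglongrightarrow> nc_trace \<iota> (Winf u)"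
  and K_D: "i < 2 ==> K i k \<in> D (N i)"
  and K_sym: "i < 2 ==> symmetric_kernel (N i) (K i k)"
  and N_pos: "i < 2 ==> 1 \<le> N i"
  and D_adj: "b ==> h \<in> D q ==> kernel_adjoint q h \<in> D q"
begin

lemma D_L2': "h \<in> D q ==> h \<in> L2_kernels q"
 using D_L2 by blast

lemma cinner_Wk: "set u \<subseteq> {..<2} ==> set v \<subseteq> {..<2} ==> cinner (W k u) (W k v) = nc_trace \<iota> (W k (u @ rev v))"
 using nc_words.cinner_W[OF words] unfolding nc_words.tau_def[OF words] .

lemma cinner_Winf: "set u \<subseteq> {..<2} ==> set v \<subseteq> {..<2} ==> cinner (Winf u) (Winf v) = nc_trace \<iota> (Winf (u @ rev v))"
 using nc_words.cinner_W[OF words_inf] unfolding nc_words.tau_def[OF words_inf] .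

lemma norm_Wk: "set u \<subseteq> {..<2} ==> complex_of_real ((norm (W k u))\<^sup>2) = nc_trace \<iota> (W k (u @ rev u))"
 unfolding cinner_self[symmetric] by (rule cinner_Wk)

lemma norm_Wk_bounded:
 assumes "set u \<subseteq> {..<2}" shows "\<exists>B. \<forall>k. (norm (W k u))\<^sup>2 \<le> B"
proof -
 have "(%k. complex_of_real ((norm (W k u))\<^sup>2)) \<longlonglongrightarrow> nc_trace \<iota> (Winf (u @ rev u))"
  unfolding norm_Wk[OF assms] by (rule moments) (use assms in auto)
 then have "Bseq (%k. complex_of_real ((norm (W k u))\<^sup>2))" by (intro convergent_imp_Bseq convergentI)
 then obtain B where "!!k. cmod (complex_of_real ((norm (W k u))\<^sup>2)) \<le> B" unfolding Bseq_def by blast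
 then have "!!k. (norm (W k u))\<^sup>2 \<le> B" by (simp only: norm_of_real abs_power2)
 then show ?thesis by blast
qed

lemma n2_K: "i < 2 ==> n2 (N i) (K i k) = ennreal ((norm (W k [i]))\<^sup>2)"
 using L2D(2)[OF D_L2'[OF K_D]] nc_words.W_single[OF words] by simp

lemma n2_K_bounded: assumes "i < 2" shows "\<exists>B<\<infinity>. \<forall>k. n2 (N i) (K i k) \<le> B"
proof -
 obtain B where "!!k. (norm (W k [i]))\<^sup>2 \<le> B" using norm_Wk_bounded[of "[i]"] assms by auto
 then show ?thesis unfolding n2_K[OF assms] by (intro exI[of _ "ennreal B"]) (auto intro: ennreal_leI)
qed

section \<open>Freeness forces the contractions to vanish\<close>

text \<open>All terms of the product formula have different orders, since those of contractions and of star contractions differ in parity.\<close>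

lemma norm_prod_terms:
 assumes f: "f \<in> D n" and g: "g \<in> D m"
 shows "(norm (prod_terms n m f g))\<^sup>2 = (\<Sum>p\<le>min n m. (norm (I (n + m - 2 * p) (contraction n m p f g)))\<^sup>2) +
  (if b then \<Sum>p=1..min n m. (norm (I (n + m - 2 * p + 1) (star_contraction n m p f g)))\<^sup>2 else 0)"
proof -
 let ?c = "%p. I (n + m - 2 * p) (contraction n m p f g)"
 let ?s = "%p. I (n + m - 2 * p + 1) (star_contraction n m p f g)"
 have cL: "contraction n m p f g \<in> L2_kernels (n + m - 2 * p)" if "p \<le> min n m" for p
  using D_L2'[OF D_contraction[OF f g that]] .
 have sL: "star_contraction n m p f g \<in> L2_kernels (n + m - 2 * p + 1)" if "b" "1 \<le> p" "p \<le> min n m" for p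
  using D_L2'[OF D_star[OF that(1) f g that(2,3)]] .
 have 1: "(norm (\<Sum>p\<le>min n m. ?c p))\<^sup>2 = (\<Sum>p\<le>min n m. (norm (?c p))\<^sup>2)"
  by (rule norm_sum_orthogonal) (auto intro!: I_orth cL)
 show ?thesis
 proof (cases b)
  case True
  have 2: "(norm (\<Sum>p=1..min n m. ?s p))\<^sup>2 = (\<Sum>p=1..min n m. (norm (?s p))\<^sup>2)"
   by (rule norm_sum_orthogonal) (auto intro!: I_orth sL[unfolded One_nat_def add_Suc_right add_0_right] True)
  have "cinner (?c p) (?s p') = 0" if p: "p \<le> min n m" "1 \<le> p'" "p' \<le> min n m" for p p'
  proof (rule I_orth[OF _ cL sL])
   have "even (n + m - 2 * p + 2 * p + (n + m - 2 * p' + 2 * p'))" using p by simp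
   then show "n + m - 2 * p \<noteq> n + m - 2 * p' + 1" by presburger
  qed (use p True in auto)
  then have "cinner (\<Sum>p\<le>min n m. ?c p) (\<Sum>p=1..min n m. ?s p) = 0"
   unfolding cinner_sum_left cinner_sum_right by (intro sum.neutral ballI) auto
  then show ?thesis unfolding prod_terms_def using True 1 2 by (simp add: norm_add_sq)
 next
  case False
  then show ?thesis unfolding prod_terms_def using 1 by simp
 qed
qed

text \<open>Freeness, applied to the centered squares.\<close>

lemma free_trace:
 assumes "nc_free A \<phi> \<iota> [X 0, X 1]"
 shows "nc_trace \<iota> (Winf [0,0,1,1]) = nc_trace \<iota> (Winf [0,0]) * nc_trace \<iota> (Winf [1,1])"
proof -
 let ?P = "monom 1 2 :: complex poly"
 define t where "t i = nc_trace \<iota> (Winf [i,i])" for i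
 have poly: "nc_poly A \<phi> \<iota> ?P (X i) = Winf [i,i]" if i: "i < 2" for i
 proof -
  have "(THE \<zeta>. nc_word A \<phi> \<iota> (replicate j (X i)) \<zeta>) = Winf (replicate j i)" for j
  proof (rule the_equality)
   have "set (replicate j i) \<subseteq> {..<2}" using i by auto
   from nc_words.word[OF words_inf this] show w: "nc_word A \<phi> \<iota> (replicate j (X i)) (Winf (replicate j i))" by simp
   show "\<zeta> = Winf (replicate j i)" if "nc_word A \<phi> \<iota> (replicate j (X i)) \<zeta>" for \<zeta>
    by (rule nc_word_unique[OF that w])
  qed
  then show ?thesis
   unfolding nc_poly_def by (simp add: degree_monom_eq numeral_2_eq_2 lessThan_Suc_atMost[symmetric] coeff_monom)
 qed
 define \<eta> where "\<eta> i = nc_center \<iota> (Winf [i,i])" for i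
 have "nc_moment A \<phi> \<iota> (map (%(i, P). nc_center \<iota> (nc_poly A \<phi> \<iota> P ([X 0, X 1] ! i))) [(0, ?P), (1, ?P)]) 0"
  by (rule assms[unfolded nc_free_def, rule_format]) auto
 then have "nc_moment A \<phi> \<iota> [\<eta> 0, \<eta> 1] 0"
  using poly[of 0] poly[of 1] by (simp add: \<eta>_def)
 then obtain \<zeta> where z: "nc_word A \<phi> \<iota> [\<eta> 0, \<eta> 1] \<zeta>" "nc_trace \<iota> \<zeta> = 0" unfolding nc_moment_def by blast
 from z(1) obtain \<xi> where x: "nc_word A \<phi> \<iota> [\<eta> 1] \<xi>" "nc_times A \<phi> \<iota> (\<eta> 0) \<xi> \<zeta>"
  by (cases rule: nc_word.cases) auto
 from x(1) obtain \<xi>0 where "nc_word A \<phi> \<iota> [] \<xi>0" "nc_times A \<phi> \<iota> (\<eta> 1) \<xi>0 \<xi>"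
  by (cases rule: nc_word.cases) auto
 then have "nc_times A \<phi> \<iota> (\<eta> 1) (\<iota> id) \<xi>" using nc_word_unique[OF _ nc_word.Nil] by metis
 then have xi: "\<xi> = \<eta> 1" using nc_times_unique[OF _ nc_times_id_right] by blast
 have W0: "Winf [] = \<iota> id" by (rule nc_words.W_Nil[OF words_inf])
 have one: "cinner (\<iota> id) (\<iota> id) = 1" using phi_iota[OF A_id] phi_unital by simp
 have JW: "J (Winf [1,1]) = Winf [1,1]" using nc_words.J_W[OF words_inf, of "[1,1]"] by simp
 have e0: "cinner (\<eta> 0) (\<iota> id) = 0"
  unfolding \<eta>_def nc_center_def by (simp add: cinner_diff_left cinner_scaleC_left one nc_trace_def)
 have "0 = cinner \<zeta> (\<iota> id)" using z(2) by (simp add: nc_trace_def)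
 also have "\<dots> = cinner (\<eta> 0) (J (\<eta> 1))" using nc_timesD[OF x(2) A_id] by (simp add: xi)
 also have "J (\<eta> 1) = Winf [1,1] + (- cnj (t 1)) *\<^sub>C \<iota> id"
 proof -
  have "\<eta> 1 = Winf [1,1] + (- t 1) *\<^sub>C \<iota> id"
   unfolding \<eta>_def nc_center_def t_def[symmetric] using scaleC_diff_left[of 0 "t 1" "\<iota> id"] by simp
  then show ?thesis by (simp only: J_add J_scale J_id JW) simp
 qed
 also have "cinner (\<eta> 0) (Winf [1,1] + (- cnj (t 1)) *\<^sub>C \<iota> id) = cinner (\<eta> 0) (Winf [1,1])"
  by (simp add: cinner_add_right cinner_scaleC_right e0)
 also have "\<dots> = cinner (Winf [0,0]) (Winf [1,1]) - t 0 * cinner (Winf []) (Winf [1,1])"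
  unfolding \<eta>_def nc_center_def W0 t_def[symmetric] by (simp add: cinner_diff_left cinner_scaleC_left)
 also have "\<dots> = nc_trace \<iota> (Winf [0,0,1,1]) - t 0 * t 1"
  using cinner_Winf[of "[0,0]" "[1,1]"] cinner_Winf[of "[]" "[1,1]"] by (simp add: t_def)
 finally show ?thesis by (simp add: t_def)
qed

text \<open>\<open>\<parallel>F\<^sub>k G\<^sub>k\<parallel>\<^sup>2 - \<parallel>F\<^sub>k\<parallel>\<^sup>2 \<parallel>G\<^sub>k\<parallel>\<^sup>2\<close> tends to zero by freeness, and it is the sum of the squared norms of all nontrivial contractions.\<close>

lemma free_null:
 assumes free: "nc_free A \<phi> \<iota> [X 0, X 1]" and p: "1 \<le> p" "p \<le> min (N 0) (N 1)"
 shows "kNull (N 0 + N 1 - 2 * p) (%k. contraction (N 0) (N 1) p (K 0 k) (K 1 k))"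
  and "b ==> kNull (N 0 + N 1 - 2 * p + 1) (%k. star_contraction (N 0) (N 1) p (K 0 k) (K 1 k))"
proof -
 let ?n = "N 0" and ?m = "N 1"
 let ?c = "%p k. (norm (I (?n + ?m - 2 * p) (contraction ?n ?m p (K 0 k) (K 1 k))))\<^sup>2"
 let ?s = "%p k. (norm (I (?n + ?m - 2 * p + 1) (star_contraction ?n ?m p (K 0 k) (K 1 k))))\<^sup>2"
 have KD: "K 0 k \<in> D ?n" "K 1 k \<in> D ?m" for k by (simp_all add: K_D)
 have W01: "W k [0,1] = prod_terms ?n ?m (K 0 k) (K 1 k)" for k
 proof -
  have "nc_times A \<phi> \<iota> (I ?n (K 0 k)) (W k [1]) (W k [0,1])" by (rule nc_words.W_Cons[OF words]) auto
  then have "nc_times A \<phi> \<iota> (I ?n (K 0 k)) (I ?m (K 1 k)) (W k [0,1])" using nc_words.W_single[OF words, of 1 k] by simp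
  from nc_times_unique[OF this I_times[OF KD]] show ?thesis by (simp add: prod_terms_def)
 qed
 define e where "e k = (norm (W k [0,1]))\<^sup>2 - (norm (W k [0]))\<^sup>2 * (norm (W k [1]))\<^sup>2" for k
 have c0: "?c 0 k = (norm (W k [0]))\<^sup>2 * (norm (W k [1]))\<^sup>2" for k
 proof -
  have "ennreal (?c 0 k) = n2 (?n + ?m) (contraction ?n ?m 0 (K 0 k) (K 1 k))"
   using L2D(2)[OF D_L2'[OF D_contraction[OF KD, of 0 k k]]] by simp
  also have "\<dots> = ennreal ((norm (W k [0]))\<^sup>2) * ennreal ((norm (W k [1]))\<^sup>2)"
   using n2_tensor[OF D_meas[OF KD(1)] D_meas[OF KD(2)]] n2_K[of 0 k] n2_K[of 1 k] by simp
  also have "\<dots> = ennreal ((norm (W k [0]))\<^sup>2 * (norm (W k [1]))\<^sup>2)" by (simp add: ennreal_mult)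
  finally show ?thesis by (subst (asm) ennreal_inj) auto
 qed
 have ek: "e k = (\<Sum>p=1..min ?n ?m. ?c p k) + (if b then \<Sum>p=1..min ?n ?m. ?s p k else 0)" for k
 proof -
  have "{..min ?n ?m} = insert 0 {1..min ?n ?m}" by auto
  then have "(\<Sum>p\<le>min ?n ?m. ?c p k) = ?c 0 k + (\<Sum>p=1..min ?n ?m. ?c p k)" by simp
  then show ?thesis unfolding e_def W01 norm_prod_terms[OF KD] c0[symmetric, of k] by simp
 qed
 have "(%k. complex_of_real (e k)) \<longlonglongrightarrow>
   nc_trace \<iota> (Winf [0,1,1,0]) - nc_trace \<iota> (Winf [0,0]) * nc_trace \<iota> (Winf [1,1])"
 proof -
  have eq: "complex_of_real (e k) = nc_trace \<iota> (W k [0,1,1,0]) - nc_trace \<iota> (W k [0,0]) * nc_trace \<iota> (W k [1,1])" for k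
   unfolding e_def of_real_diff of_real_mult using norm_Wk[of "[0,1]" k] norm_Wk[of "[0]" k] norm_Wk[of "[1]" k] by simp
  show ?thesis unfolding eq by (intro tendsto_intros moments) auto
 qed
 moreover have "nc_trace \<iota> (Winf [0,1,1,0]) = nc_trace \<iota> (Winf [0,0,1,1])"
  using nc_words.tau_cyclic[OF words_inf, of "[0,1,1]" "[0]"] unfolding nc_words.tau_def[OF words_inf] by simp
 ultimately have "(%k. complex_of_real (e k)) \<longlonglongrightarrow> complex_of_real 0" using free_trace[OF free] by simp
 then have e0: "e \<longlonglongrightarrow> 0" by (simp only: tendsto_of_real_iff)
 have c_le: "?c p k \<le> e k" for k
 proof -
  have "?c p k \<le> (\<Sum>p=1..min ?n ?m. ?c p k)" by (rule member_le_sum) (use p in auto)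
  then show ?thesis unfolding ek by (auto intro!: add_increasing2 sum_nonneg)
 qed
 show "kNull (?n + ?m - 2 * p) (%k. contraction ?n ?m p (K 0 k) (K 1 k))"
 proof (rule kNullI)
  show "n2 (?n + ?m - 2 * p) (contraction ?n ?m p (K 0 k) (K 1 k)) = ennreal (?c p k)" for k
   by (rule L2D(2)[OF D_L2'[OF D_contraction[OF KD p(2)]], symmetric])
  show "?c p \<longlonglongrightarrow> 0"
   by (rule tendsto_sandwich[OF _ _ tendsto_const e0]) (use c_le in auto)
 qed
 assume b: b
 have s_le: "?s p k \<le> e k" for k
 proof -
  have "?s p k \<le> (\<Sum>p=1..min ?n ?m. ?s p k)" by (rule member_le_sum) (use p in auto)
  then show ?thesis unfolding ek using b by (auto intro!: add_increasing sum_nonneg)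
 qed
 show "kNull (?n + ?m - 2 * p + 1) (%k. star_contraction ?n ?m p (K 0 k) (K 1 k))"
 proof (rule kNullI)
  show "n2 (?n + ?m - 2 * p + 1) (star_contraction ?n ?m p (K 0 k) (K 1 k)) = ennreal (?s p k)" for k
   by (rule L2D(2)[OF D_L2'[OF D_star[OF b KD p]], symmetric])
  show "?s p \<longlonglongrightarrow> 0"
   by (rule tendsto_sandwich[OF _ _ tendsto_const e0]) (use s_le in auto)
 qed
qed

end

section \<open>The first marginal\<close>

lemma measurable_cnj: "h \<in> borel_measurable M ==> (%s. cnj (h s)) \<in> borel_measurable M"
 by (rule measurable_compose[OF _ borel_measurable_continuous_onI[OF continuous_on_cnj[OF continuous_on_id]]])

lemma measurable_first_marginal:
 assumes h: "h \<in> borel_measurable (Rp q)" and q: "1 \<le> q"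
 shows "first_marginal q h \<in> borel_measurable halfline"
proof -
 have m: "(%t. (ennreal (cmod (lab q id h t)))\<^sup>2) \<in> borel_measurable NM"
  using measurable_lab[OF h, of id] by measurable
 have "(%x. umarg (id ` {..<q}) (id 0) (%t. ennreal (cmod (lab q id h t))) x) \<in> borel_measurable halfline"
  unfolding umarg_def by (rule measurable_compose[OF measurable_insert_coordinate measurable_lm[OF _ m]]) simp
 then show ?thesis
  by (rule measurable_cong[THEN iffD1, rotated]) (rule umarg_lab_first[OF h inj_on_id q], simp add: space_restrict_space)
qed

lemma integral_first_marginal:
 assumes h: "h \<in> borel_measurable (Rp q)" and q: "1 \<le> q"
 shows "(\<integral>\<^sup>+ x. first_marginal q h x \<partial>halfline) = n2 q h"
proof -
 have m: "(%t. (ennreal (cmod (lab q id h t)))\<^sup>2) \<in> borel_measurable NM"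
  using measurable_lab[OF h, of id] by measurable
 have "n2 q h = lm (id ` {..<q}) (%t. (ennreal (cmod (lab q id h t)))\<^sup>2) (%_. 0)"
  using cnsq_lab[OF inj_on_id h] by (simp add: cnsq_def nsq_def)
 also have "\<dots> = (\<integral>\<^sup>+ x. umarg (id ` {..<q}) (id 0) (%t. ennreal (cmod (lab q id h t))) x \<partial>halfline)"
  unfolding umarg_def by (rule lm_eq_marginal_integral[OF _ _ m zero_space_NM]) (use q in auto)
 also have "\<dots> = (\<integral>\<^sup>+ x. first_marginal q h x \<partial>halfline)"
  by (rule nn_integral_cong, rule umarg_lab_first[OF h inj_on_id q]) (simp add: space_restrict_space)
 finally show ?thesis by simp
qed

lemma first_marginal_Suc:
 assumes h: "h \<in> borel_measurable (Rp (Suc q))" and x: "0 \<le> x"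
 shows "first_marginal (Suc q) h x = (\<integral>\<^sup>+ s. (ennreal (cmod (h (\<lambda>i\<in>{..<Suc q}. if i = 0 then x else s (i - 1)))))\<^sup>2 \<partial>Rp q)"
proof -
 define t where "t = (%_::nat. 0::real)(0 := x)"
 have t: "t \<in> space NM" using x by (auto simp: t_def space_NM)
 have m: "(%t. (ennreal (cmod (lab (Suc q) id h t)))\<^sup>2) \<in> borel_measurable NM"
  using measurable_lab[OF h, of id] by measurable
 have Si: "inj_on Suc {..<q}" by simp
 have dI: "id ` {..<Suc q} - {id 0} = Suc ` {..<q}" by (auto simp: image_iff less_Suc_eq_0_disj)
 have "first_marginal (Suc q) h x = umarg (id ` {..<Suc q}) (id 0) (%t. ennreal (cmod (lab (Suc q) id h t))) x"
  by (rule umarg_lab_first[OF h inj_on_id _ x, symmetric]) simp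
 also have "\<dots> = lm (Suc ` {..<q}) (%t. (ennreal (cmod (lab (Suc q) id h t)))\<^sup>2) t"
  unfolding umarg_def dI t_def by simp
 also have "\<dots> = (\<integral>\<^sup>+ s. (ennreal (cmod (lab (Suc q) id h (relab q Suc t s))))\<^sup>2 \<partial>Rp q)"
  by (rule lm_relabel[OF Si m t])
 also have "\<dots> = (\<integral>\<^sup>+ s. (ennreal (cmod (h (\<lambda>i\<in>{..<Suc q}. if i = 0 then x else s (i - 1)))))\<^sup>2 \<partial>Rp q)"
  unfolding lab_def
 proof (intro nn_integral_cong arg_cong[where f = "%z. (ennreal (cmod (h z)))\<^sup>2"] restrict_ext)
  fix s i assume i: "i \<in> {..<Suc q}"
  show "relab q Suc t s (id i) = (if i = 0 then x else s (i - 1))"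
  proof (cases i)
   case 0
   then show ?thesis using relab_out[of 0 Suc q t s] by (simp add: t_def)
  next
   case (Suc j)
   then show ?thesis using relab_in[OF Si, of j t s] i by simp
  qed
 qed
 finally show ?thesis .
qed

lemma measurable_section_first:
 assumes h: "h \<in> borel_measurable (Rp n)" and x: "0 \<le> x" and j: "!!i. i < n ==> i \<noteq> 0 ==> j i < q"
 shows "(%s. h (\<lambda>i\<in>{..<n}. if i = 0 then x else s (j i))) \<in> borel_measurable (Rp q)"
proof (rule measurable_compose[OF _ h])
 show "(%s. \<lambda>i\<in>{..<n}. if i = 0 then x else s (j i)) \<in> Rp q \<rightarrow>\<^sub>M Rp n"
  unfolding Rp_PM
 proof (rule measurable_restrict)
  fix i assume i: "i \<in> {..<n}"
  show "(%s. if i = 0 then x else s (j i)) \<in> PM {..<q} \<rightarrow>\<^sub>M halfline"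
  proof (cases "i = 0")
   case True
   then show ?thesis using x by (simp add: space_restrict_space)
  next
   case False
   then show ?thesis using j[of i] i by simp
  qed
 qed
qed

text \<open>The marginal density of \<open>\<bar>h\<bar>\<^sup>2\<close> as a star contraction: all arguments but the shared one are integrated out.\<close>

lemma star_contraction_self:
 assumes h: "h \<in> borel_measurable (Rp q)" and q: "1 \<le> q" and x: "0 \<le> x" and t: "t 0 = x"
  and fin: "first_marginal q h x < \<infinity>"
 shows "star_contraction q q q h (kernel_adjoint q h) t = complex_of_real (enn2real (first_marginal q h x))"
proof -
 let ?h = "%s. h (\<lambda>i\<in>{..<q}. if i = 0 then x else s (q - 1 - i))"
 have m: "?h \<in> borel_measurable (Rp (q - 1))" by (rule measurable_section_first[OF h x]) auto
 have 1: "(\<lambda>i\<in>{..<q}. if i \<le> q - q then t i else s (q - 1 - i)) = (\<lambda>i\<in>{..<q}. if i = 0 then x else s (q - 1 - i))" for s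
  using t by (auto simp: fun_eq_iff)
 have 2: "(\<lambda>i\<in>{..<q}. (\<lambda>i\<in>{..<q}. if i < q - 1 then s i else t (q - q + (i - (q - 1)))) (q - 1 - i)) =
   (\<lambda>i\<in>{..<q}. if i = 0 then x else s (q - 1 - i))" for s
  using t q by (auto simp: fun_eq_iff)
 have "star_contraction q q q h (kernel_adjoint q h) t = (\<integral>s. ?h s * cnj (?h s) \<partial>Rp (q - 1))"
  unfolding star_contraction_def kernel_adjoint_def 1 2 ..
 also have "\<dots> = (\<integral>s. complex_of_real ((cmod (?h s))\<^sup>2) \<partial>Rp (q - 1))" by (simp only: complex_norm_square)
 also have "\<dots> = complex_of_real (\<integral>s. (cmod (?h s))\<^sup>2 \<partial>Rp (q - 1))" by (rule integral_complex_of_real)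
 also have "(\<integral>s. (cmod (?h s))\<^sup>2 \<partial>Rp (q - 1)) = enn2real (\<integral>\<^sup>+ s. ennreal ((cmod (?h s))\<^sup>2) \<partial>Rp (q - 1))"
  by (rule integral_eq_nn_integral) (use m in auto)
 also have "(\<integral>\<^sup>+ s. ennreal ((cmod (?h s))\<^sup>2) \<partial>Rp (q - 1)) = first_marginal q h x"
  unfolding first_marginal_def by (simp add: ennreal_power)
 finally show ?thesis .
qed

lemma cmod_integral_mult_le:
 assumes [measurable]: "u \<in> borel_measurable M" "v \<in> borel_measurable M"
 shows "(ennreal (cmod (\<integral>s. u s * v s \<partial>M)))\<^sup>2 \<le> (\<integral>\<^sup>+ s. (ennreal (cmod (u s)))\<^sup>2 \<partial>M) * (\<integral>\<^sup>+ s. (ennreal (cmod (v s)))\<^sup>2 \<partial>M)"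
proof -
 have "ennreal (cmod (\<integral>s. u s * v s \<partial>M)) \<le> (\<integral>\<^sup>+ s. ennreal (cmod (u s)) * ennreal (cmod (v s)) \<partial>M)"
 proof (cases "integrable M (%s. u s * v s)")
  case True
  from integral_norm_bound_ennreal[OF this] show ?thesis by (simp add: norm_mult ennreal_mult)
 qed (simp add: not_integrable_integral_eq)
 then have "(ennreal (cmod (\<integral>s. u s * v s \<partial>M)))\<^sup>2 \<le> (\<integral>\<^sup>+ s. ennreal (cmod (u s)) * ennreal (cmod (v s)) \<partial>M)\<^sup>2"
  by (rule power_mono) simp
 also have "\<dots> \<le> (\<integral>\<^sup>+ s. (ennreal (cmod (u s)))\<^sup>2 \<partial>M) * (\<integral>\<^sup>+ s. (ennreal (cmod (v s)))\<^sup>2 \<partial>M)"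
  by (rule Cauchy_Schwarz_nn_integral) measurable
 finally show ?thesis .
qed

lemma contraction_adjoint_up:
 assumes h: "h \<in> borel_measurable (Rp (Suc q))" and w: "w \<in> borel_measurable (Rp q)" and x: "0 \<le> x" and t: "t 0 = x"
 shows "(ennreal (cmod (contraction (Suc q) q q h (kernel_adjoint q w) t)))\<^sup>2 \<le> first_marginal (Suc q) h x * n2 q w"
proof -
 let ?h = "%s. h (\<lambda>i\<in>{..<Suc q}. if i = 0 then x else s (i - 1))"
 have m: "?h \<in> borel_measurable (Rp q)" by (rule measurable_section_first[OF h x]) auto
 have 1: "(\<lambda>i\<in>{..<Suc q}. if i < Suc q - q then t i else s (i - (Suc q - q))) = (\<lambda>i\<in>{..<Suc q}. if i = 0 then x else s (i - 1))" for s
  using t by (auto simp: fun_eq_iff)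
 have 2: "(\<lambda>i\<in>{..<q}. (\<lambda>i\<in>{..<q}. if i < q then s (q - 1 - i) else t (Suc q - q + (i - q))) (q - 1 - i)) = (\<lambda>i\<in>{..<q}. s i)" for s
  by (auto simp: fun_eq_iff)
 have "contraction (Suc q) q q h (kernel_adjoint q w) t = (\<integral>s. ?h s * cnj (w s) \<partial>Rp q)"
  unfolding contraction_def kernel_adjoint_def 1 2
 proof (rule Bochner_Integration.integral_cong[OF refl])
  fix s assume "s \<in> space (Rp q)"
  then have "(\<lambda>i\<in>{..<q}. s i) = s" by (auto simp: Rp_PM space_PiM PiE_iff intro!: extensional_restrict)
  then show "?h s * cnj (w (\<lambda>i\<in>{..<q}. s i)) = ?h s * cnj (w s)" by simp
 qed
 then have "(ennreal (cmod (contraction (Suc q) q q h (kernel_adjoint q w) t)))\<^sup>2 \<le>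
   (\<integral>\<^sup>+ s. (ennreal (cmod (?h s)))\<^sup>2 \<partial>Rp q) * (\<integral>\<^sup>+ s. (ennreal (cmod (cnj (w s))))\<^sup>2 \<partial>Rp q)"
  using cmod_integral_mult_le[OF m measurable_cnj[OF w]] by simp
 then show ?thesis unfolding first_marginal_Suc[OF h x] n2_def by simp
qed

lemma contraction_adjoint_down:
 assumes h: "h \<in> borel_measurable (Rp (Suc q))" and w: "w \<in> borel_measurable (Rp q)" and x: "0 \<le> x" and t: "t 0 = x"
 shows "(ennreal (cmod (contraction q (Suc q) q w (kernel_adjoint (Suc q) h) t)))\<^sup>2 \<le> first_marginal (Suc q) h x * n2 q w"
proof -
 let ?h = "%s. h (\<lambda>i\<in>{..<Suc q}. if i = 0 then x else s (i - 1))"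
 have m: "?h \<in> borel_measurable (Rp q)" by (rule measurable_section_first[OF h x]) auto
 have 1: "(\<lambda>i\<in>{..<Suc q}. (\<lambda>i\<in>{..<Suc q}. if i < q then s (q - 1 - i) else t (q - q + (i - q))) (Suc q - 1 - i)) =
   (\<lambda>i\<in>{..<Suc q}. if i = 0 then x else s (i - 1))" for s
 proof (rule restrict_ext)
  fix i assume i: "i \<in> {..<Suc q}"
  show "(\<lambda>i\<in>{..<Suc q}. if i < q then s (q - 1 - i) else t (q - q + (i - q))) (Suc q - 1 - i) = (if i = 0 then x else s (i - 1))"
  proof (cases i)
   case (Suc j)
   then have "q - 1 - (q - i) = j" "q - i < q" using i by auto
   then show ?thesis using Suc by simp
  qed (use t in simp)
 qed
 have 2: "(\<lambda>i\<in>{..<q}. if i < q - q then t i else s (i - (q - q))) = (\<lambda>i\<in>{..<q}. s i)" for s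
  by (auto simp: fun_eq_iff)
 have "contraction q (Suc q) q w (kernel_adjoint (Suc q) h) t = (\<integral>s. w s * cnj (?h s) \<partial>Rp q)"
  unfolding contraction_def kernel_adjoint_def 1 2
 proof (rule Bochner_Integration.integral_cong[OF refl])
  fix s assume "s \<in> space (Rp q)"
  then have "(\<lambda>i\<in>{..<q}. s i) = s" by (auto simp: Rp_PM space_PiM PiE_iff intro!: extensional_restrict)
  then show "w (\<lambda>i\<in>{..<q}. s i) * cnj (?h s) = w s * cnj (?h s)" by simp
 qed
 then have "(ennreal (cmod (contraction q (Suc q) q w (kernel_adjoint (Suc q) h) t)))\<^sup>2 \<le>
   (\<integral>\<^sup>+ s. (ennreal (cmod (w s)))\<^sup>2 \<partial>Rp q) * (\<integral>\<^sup>+ s. (ennreal (cmod (cnj (?h s))))\<^sup>2 \<partial>Rp q)"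
  using cmod_integral_mult_le[OF w measurable_cnj[OF m]] by simp
 then show ?thesis unfolding first_marginal_Suc[OF h x] n2_def by (simp add: mult.commute)
qed

section \<open>Squares of sums of multiple integrals\<close>

text \<open>The kernel \<open>h\<close> of order \<open>s\<close>, sorted under the order \<open>r\<close>.\<close>

definition slot :: "nat => nat => kernel => kernel" where
 "slot s r h t = (if s = r then h t else 0)"

definition order_term :: "nat => nat => kernel => kernel => nat => kernel" where
 "order_term q r h w s t = (\<Sum>p\<le>min q r. slot (q + r - 2 * p) s (contraction q r p h w) t) +
  (\<Sum>p=1..min q r. slot (q + r - 2 * p + 1) s (star_contraction q r p h w) t)"

text \<open>The component of order \<open>s\<close> of \<open>Y Y\<^sup>*\<close>, where \<open>Y\<close> has the components \<open>y\<close> up to order \<open>Q\<close>.\<close>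

definition square_kernel :: "nat => (nat => kernel) => nat => kernel" where
 "square_kernel Q y s t = (\<Sum>q\<le>Q. \<Sum>r\<le>Q. order_term q r (y q) (kernel_adjoint r (y r)) s t)"

lemma order_term_diag: "order_term q q h w 1 t = (if 1 \<le> q then star_contraction q q q h w t else 0)"
proof -
 have "(\<Sum>p\<le>q. slot (q + q - 2 * p) 1 (contraction q q p h w) t) = 0"
  by (rule sum.neutral) (auto simp: slot_def, presburger)
 moreover have "(\<Sum>p=1..q. slot (q + q - 2 * p + 1) 1 (star_contraction q q p h w) t) =
   (\<Sum>p=1..q. if p = q then star_contraction q q p h w t else 0)"
  by (rule sum.cong) (auto simp: slot_def)
 ultimately show ?thesis by (simp add: order_term_def)
qed

lemma order_term_up: "order_term (Suc q) q h w 1 t = contraction (Suc q) q q h w t"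
proof -
 have "(\<Sum>p\<le>q. slot (Suc q + q - 2 * p) 1 (contraction (Suc q) q p h w) t) =
   (\<Sum>p\<le>q. if p = q then contraction (Suc q) q p h w t else 0)"
  by (rule sum.cong) (auto simp: slot_def)
 moreover have "(\<Sum>p=1..q. slot (Suc q + q - 2 * p + 1) 1 (star_contraction (Suc q) q p h w) t) = 0"
  by (rule sum.neutral) (auto simp: slot_def)
 ultimately show ?thesis by (simp add: order_term_def)
qed

lemma order_term_down: "order_term q (Suc q) h w 1 t = contraction q (Suc q) q h w t"
proof -
 have "(\<Sum>p\<le>q. slot (q + Suc q - 2 * p) 1 (contraction q (Suc q) p h w) t) =
   (\<Sum>p\<le>q. if p = q then contraction q (Suc q) p h w t else 0)"
  by (rule sum.cong) (auto simp: slot_def)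
 moreover have "(\<Sum>p=1..q. slot (q + Suc q - 2 * p + 1) 1 (star_contraction q (Suc q) p h w) t) = 0"
  by (rule sum.neutral) (auto simp: slot_def)
 ultimately show ?thesis by (simp add: order_term_def)
qed

lemma order_term_far: assumes "q \<noteq> r" "q \<noteq> Suc r" "r \<noteq> Suc q" shows "order_term q r h w 1 t = 0"
proof -
 have "(\<Sum>p\<le>min q r. slot (q + r - 2 * p) 1 (contraction q r p h w) t) = 0"
  by (rule sum.neutral) (use assms in \<open>auto simp: slot_def\<close>)
 moreover have "(\<Sum>p=1..min q r. slot (q + r - 2 * p + 1) 1 (star_contraction q r p h w) t) = 0"
  by (rule sum.neutral) (use assms in \<open>auto simp: slot_def\<close>)
 ultimately show ?thesis by (simp add: order_term_def)
qed

definition marginal_sum :: "nat => (nat => kernel) => real => ennreal" where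
 "marginal_sum Q y x = (\<Sum>q=1..Q. first_marginal q (y q) x)"

text \<open>The component of order 1 of \<open>Y\<^sup>2\<close> is the sum of the marginal densities of the components of \<open>Y\<close>, which
 is positive, up to contractions of components of neighbouring orders. So the marginals of \<open>Y\<close>
 are controlled by those of \<open>Y\<^sup>2\<close>.\<close>

lemma marginal_sum_square:
 assumes m: "!!q. y q \<in> borel_measurable (Rp q)" and B: "0 \<le> B" "!!q. q \<le> Q ==> n2 q (y q) \<le> ennreal B"
  and x: "0 \<le> x" and fin: "marginal_sum Q y x < \<infinity>"
 shows "(marginal_sum Q y x)\<^sup>2 \<le> 2 * first_marginal 1 (square_kernel Q y 1) x +
  ennreal (2 * real (Q + 1) ^ 4 * B) * marginal_sum Q y x"
proof -
 define t where "t = (\<lambda>i\<in>{..<1::nat}. x)"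
 have t: "t 0 = x" by (simp add: t_def)
 define z where "z q r = order_term q r (y q) (kernel_adjoint r (y r)) 1 t" for q r
 define \<sigma> where "\<sigma> = enn2real (marginal_sum Q y x)"
 have S: "marginal_sum Q y x = ennreal \<sigma>" using fin unfolding \<sigma>_def by simp
 have s0: "0 \<le> \<sigma>" by (simp add: \<sigma>_def)
 have le: "first_marginal q (y q) x \<le> ennreal \<sigma>" if "1 \<le> q" "q \<le> Q" for q
  unfolding S[symmetric] marginal_sum_def using that by (intro member_le_sum) auto
 have fm: "first_marginal q (y q) x < \<infinity>" if "1 \<le> q" "q \<le> Q" for q
  using le[OF that] by (rule le_less_trans) simp
 have diag: "(\<Sum>q\<le>Q. z q q) = complex_of_real \<sigma>"
 proof -
  have "(\<Sum>q\<le>Q. z q q) = (\<Sum>q\<le>Q. if 1 \<le> q then complex_of_real (enn2real (first_marginal q (y q) x)) else 0)"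
  proof (rule sum.cong[OF refl])
   fix q assume "q \<in> {..Q}"
   then show "z q q = (if 1 \<le> q then complex_of_real (enn2real (first_marginal q (y q) x)) else 0)"
    unfolding z_def order_term_diag using star_contraction_self[of "y q" q x t] m x t fm by simp
  qed
  also have "\<dots> = (\<Sum>q=1..Q. complex_of_real (enn2real (first_marginal q (y q) x)))"
   by (rule sum.mono_neutral_cong_right) auto
  also have "\<dots> = complex_of_real (\<Sum>q=1..Q. enn2real (first_marginal q (y q) x))" by simp
  also have "(\<Sum>q=1..Q. enn2real (first_marginal q (y q) x)) = \<sigma>"
   unfolding \<sigma>_def marginal_sum_def using enn2real_sum[of "{1..Q}" "%q. first_marginal q (y q) x"] fm by (simp add: comp_def)
  finally show ?thesis .
 qed
 have sqrtI: "cmod c \<le> sqrt (B * \<sigma>)" if "(ennreal (cmod c))\<^sup>2 \<le> first_marginal q (y q) x * n2 r (y r)" "1 \<le> q" "q \<le> Q" "r \<le> Q" for c q r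
 proof -
  have "(ennreal (cmod c))\<^sup>2 \<le> ennreal \<sigma> * ennreal B"
   using that(1) by (rule order_trans) (intro mult_mono le B that, auto)
  then have "ennreal ((cmod c)\<^sup>2) \<le> ennreal (\<sigma> * B)" using s0 B(1) by (simp add: ennreal_power ennreal_mult)
  then have "(cmod c)\<^sup>2 \<le> B * \<sigma>" using s0 B(1) by (subst (asm) ennreal_le_iff) (auto simp: mult.commute)
  then show ?thesis by (rule real_le_rsqrt)
 qed
 have off: "cmod (z q r) \<le> sqrt (B * \<sigma>)" if "q \<le> Q" "r \<le> Q" "q \<noteq> r" for q r
 proof -
  consider "q = Suc r" | "r = Suc q" | "q \<noteq> Suc r" "r \<noteq> Suc q" by blast
  then show ?thesis
  proof cases
   case 1
   show ?thesis unfolding 1 z_def order_term_up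
    by (rule sqrtI[OF contraction_adjoint_up[of "y (Suc r)" r "y r" x t, OF m m x t]]) (use that 1 in auto)
  next
   case 2
   show ?thesis unfolding 2 z_def order_term_down
    by (rule sqrtI[OF contraction_adjoint_down[of "y (Suc q)" q "y q" x t, OF m m x t]]) (use that 2 in auto)
  next
   case 3
   then show ?thesis unfolding z_def using order_term_far[OF that(3) 3] B(1) s0 by simp
  qed
 qed
 define Y where "Y = square_kernel Q y 1 t"
 define c where "c = (\<Sum>q\<le>Q. \<Sum>r\<le>Q. if q = r then 0 else z q r)"
 have Yc: "Y = complex_of_real \<sigma> + c"
 proof -
  have "Y = (\<Sum>q\<le>Q. \<Sum>r\<le>Q. (if q = r then z q q else 0) + (if q = r then 0 else z q r))"
   unfolding Y_def square_kernel_def z_def by (intro sum.cong refl) auto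
  also have "\<dots> = (\<Sum>q\<le>Q. z q q) + c" by (simp add: sum.distrib c_def)
  finally show ?thesis by (simp add: diag)
 qed
 have "cmod c \<le> (\<Sum>q\<le>Q. \<Sum>r\<le>Q. sqrt (B * \<sigma>))"
  unfolding c_def by (intro order_trans[OF norm_sum] sum_mono) (use off B(1) s0 in auto)
 also have "\<dots> = real (Q + 1) ^ 2 * sqrt (B * \<sigma>)" by (simp add: power2_eq_square algebra_simps)
 finally have cb: "cmod c \<le> real (Q + 1) ^ 2 * sqrt (B * \<sigma>)" .
 have "(cmod c)\<^sup>2 \<le> (real (Q + 1) ^ 2 * sqrt (B * \<sigma>))\<^sup>2" by (rule power_mono[OF cb]) simp
 also have "\<dots> = real (Q + 1) ^ 4 * (B * \<sigma>)"
  using B(1) s0 by (simp add: power_mult_distrib power_mult[symmetric])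
 finally have c2: "(cmod c)\<^sup>2 \<le> real (Q + 1) ^ 4 * (B * \<sigma>)" .
 have "\<sigma> = cmod (Y - c)" using s0 by (simp add: Yc)
 also have "\<dots> \<le> cmod Y + cmod c" by (rule norm_triangle_ineq4)
 finally have "\<sigma>\<^sup>2 \<le> (cmod Y + cmod c)\<^sup>2" using s0 by (rule power_mono)
 also have "\<dots> \<le> 2 * (cmod Y)\<^sup>2 + 2 * (cmod c)\<^sup>2"
  using zero_le_power2[of "cmod Y - cmod c"] by (simp add: power2_sum power2_diff)
 also have "\<dots> \<le> 2 * (cmod Y)\<^sup>2 + 2 * real (Q + 1) ^ 4 * B * \<sigma>" using c2 by simp
 finally have "ennreal (\<sigma>\<^sup>2) \<le> ennreal (2 * (cmod Y)\<^sup>2 + 2 * real (Q + 1) ^ 4 * B * \<sigma>)" by (rule ennreal_leI)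
 also have "\<dots> = 2 * (ennreal (cmod Y))\<^sup>2 + ennreal (2 * real (Q + 1) ^ 4 * B) * ennreal \<sigma>"
  using B(1) s0 by (simp add: ennreal_plus ennreal_mult ennreal_power)
 also have "(ennreal (cmod Y))\<^sup>2 = first_marginal 1 (square_kernel Q y 1) x"
 proof -
  have "first_marginal 1 (square_kernel Q y 1) x = (\<integral>\<^sup>+ s. (ennreal (cmod Y))\<^sup>2 \<partial>Rp 0)"
  proof -
   have r: "(\<lambda>i\<in>{..<1}. if i = 0 then x else s (1 - 1 - i)) = (\<lambda>i\<in>{..<1::nat}. x)" for s :: "nat => real"
    by (auto simp: fun_eq_iff)
   show ?thesis unfolding first_marginal_def Y_def t_def r by simp
  qed
  then show ?thesis by (simp add: Rp_PM PiM_empty nn_integral_count_space_finite)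
 qed
 finally show ?thesis unfolding S using s0 by (simp add: ennreal_power)
qed

context chaos
begin

lemma D_slot: "h \<in> D s ==> slot s r h \<in> D r"
 unfolding slot_def[abs_def] using D_zero by (cases "s = r") auto

lemma I_slot: "I r (slot s r h) = (if s = r then I s h else 0)"
 unfolding slot_def[abs_def] using I_zero by (cases "s = r") auto

lemma D_I_add: assumes "h \<in> D q" "w \<in> D q"
 shows "(%t. h t + w t) \<in> D q" "I q (%t. h t + w t) = I q h + I q w"
proof -
 show "(%t. h t + w t) \<in> D q" using D_lin[OF assms, of 1 1] by simp
 show "I q (%t. h t + w t) = I q h + I q w"
  using I_lin[OF subsetD[OF D_L2 assms(1)] subsetD[OF D_L2 assms(2)], of 1 1] by simp
qed

lemma D_I_sum:
 assumes "finite L" "!!i. i \<in> L ==> h i \<in> D q"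
 shows "(%t. \<Sum>i\<in>L. h i t) \<in> D q \<and> I q (%t. \<Sum>i\<in>L. h i t) = (\<Sum>i\<in>L. I q (h i))"
 using assms
proof (induction L rule: finite_induct)
 case empty
 show ?case using D_zero I_zero by simp
next
 case (insert i L)
 have IH: "(%t. \<Sum>i\<in>L. h i t) \<in> D q" "I q (%t. \<Sum>i\<in>L. h i t) = (\<Sum>i\<in>L. I q (h i))"
  using insert.IH insert.prems by auto
 show ?case using D_I_add[OF insert.prems[OF insertI1] IH(1)] insert.hyps IH(2) by simp
qed

lemma order_term_I:
 assumes b: b and h: "h \<in> D q" and w: "w \<in> D r"
 shows "order_term q r h w s \<in> D s"
  and "I s (order_term q r h w s) = (\<Sum>p\<le>min q r. if q + r - 2 * p = s then I (q + r - 2 * p) (contraction q r p h w) else 0) +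
   (\<Sum>p=1..min q r. if q + r - 2 * p + 1 = s then I (q + r - 2 * p + 1) (star_contraction q r p h w) else 0)"
proof -
 have 1: "slot (q + r - 2 * p) s (contraction q r p h w) \<in> D s" if "p \<in> {..min q r}" for p
  by (rule D_slot[OF D_contraction[OF h w]]) (use that in simp)
 have 2: "slot (q + r - 2 * p + 1) s (star_contraction q r p h w) \<in> D s" if "p \<in> {1..min q r}" for p
  by (rule D_slot[OF D_star[OF b h w]]) (use that in simp_all)
 note S1 = D_I_sum[of "{..min q r}" "%p. slot (q + r - 2 * p) s (contraction q r p h w)" s, OF _ 1]
 note S2 = D_I_sum[of "{1..min q r}" "%p. slot (q + r - 2 * p + 1) s (star_contraction q r p h w)" s, OF _ 2]
 note A = D_I_add[OF conjunct1[OF S1] conjunct1[OF S2]]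
 show "order_term q r h w s \<in> D s" unfolding order_term_def[abs_def] by (rule A(1)) auto
 have "I s (order_term q r h w s) = (\<Sum>p\<le>min q r. I s (slot (q + r - 2 * p) s (contraction q r p h w))) +
   (\<Sum>p=1..min q r. I s (slot (q + r - 2 * p + 1) s (star_contraction q r p h w)))"
  unfolding order_term_def[abs_def] using A(2) S1 S2 by simp
 then show "I s (order_term q r h w s) = (\<Sum>p\<le>min q r. if q + r - 2 * p = s then I (q + r - 2 * p) (contraction q r p h w) else 0) +
   (\<Sum>p=1..min q r. if q + r - 2 * p + 1 = s then I (q + r - 2 * p + 1) (star_contraction q r p h w) else 0)"
  unfolding I_slot .
qed

lemma sum_order_term:
 assumes b: b and h: "h \<in> D q" and w: "w \<in> D r" and Q: "q \<le> Q" "r \<le> Q"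
 shows "(\<Sum>s\<le>2 * Q. I s (order_term q r h w s)) = prod_terms q r h w"
proof -
 have 1: "(\<Sum>s\<le>2 * Q. \<Sum>p\<le>min q r. if q + r - 2 * p = s then I (q + r - 2 * p) (contraction q r p h w) else 0) =
   (\<Sum>p\<le>min q r. I (q + r - 2 * p) (contraction q r p h w))"
  by (subst sum.swap, rule sum.cong) (use Q in auto)
 have 2: "(\<Sum>s\<le>2 * Q. \<Sum>p=1..min q r. if q + r - 2 * p + 1 = s then I (q + r - 2 * p + 1) (star_contraction q r p h w) else 0) =
   (\<Sum>p=1..min q r. I (q + r - 2 * p + 1) (star_contraction q r p h w))"
  by (subst sum.swap, rule sum.cong) (use Q in auto)
 show ?thesis unfolding order_term_I(2)[OF b h w] sum.distrib 1 2 prod_terms_def using b by simp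
qed

lemma J_sum: "finite L ==> J (\<Sum>i\<in>L. x i) = (\<Sum>i\<in>L. J (x i))"
 by (induction L rule: finite_induct) (auto simp: J_add)

text \<open>As \<open>\<xi>\<close> is self-adjoint, its square is the product with its adjoint, whose components are the adjoint kernels.\<close>

lemma square_expansion:
 assumes b: b and y: "!!q. y q \<in> D q" and adj: "!!q. kernel_adjoint q (y q) \<in> D q"
  and \<xi>: "\<xi> = (\<Sum>q\<le>Q. I q (y q))" and J: "J \<xi> = \<xi>"
 shows "square_kernel Q y s \<in> D s" "nc_times A \<phi> \<iota> \<xi> \<xi> (\<Sum>s\<le>2 * Q. I s (square_kernel Q y s))"
proof -
 have in1: "(%t. \<Sum>r\<le>Q. order_term q r (y q) (kernel_adjoint r (y r)) s t) \<in> D s \<and>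
   I s (%t. \<Sum>r\<le>Q. order_term q r (y q) (kernel_adjoint r (y r)) s t) =
   (\<Sum>r\<le>Q. I s (order_term q r (y q) (kernel_adjoint r (y r)) s))" for q s
  by (rule D_I_sum[where h = "%r. order_term q r (y q) (kernel_adjoint r (y r)) s"])
   (auto intro: order_term_I(1)[OF b y adj])
 have in2: "square_kernel Q y s \<in> D s \<and>
   I s (square_kernel Q y s) = (\<Sum>q\<le>Q. I s (%t. \<Sum>r\<le>Q. order_term q r (y q) (kernel_adjoint r (y r)) s t))" for s
  unfolding square_kernel_def[abs_def]
  by (rule D_I_sum[where h = "%q t. \<Sum>r\<le>Q. order_term q r (y q) (kernel_adjoint r (y r)) s t"]) (use in1 in auto)
 show "square_kernel Q y s \<in> D s" using in2 by blast
 have J': "\<xi> = (\<Sum>r\<le>Q. I r (kernel_adjoint r (y r)))"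
  by (subst J[symmetric], subst \<xi>) (simp add: J_sum I_adj[OF subsetD[OF D_L2 y]])
 have "nc_times A \<phi> \<iota> (\<Sum>q\<le>Q. I q (y q)) (\<Sum>r\<le>Q. I r (kernel_adjoint r (y r)))
   (\<Sum>q\<le>Q. \<Sum>r\<le>Q. prod_terms q r (y q) (kernel_adjoint r (y r)))"
  unfolding prod_terms_def by (intro nc_times_sum_left nc_times_sum_right I_times y adj) auto
 moreover have "(\<Sum>q\<le>Q. \<Sum>r\<le>Q. prod_terms q r (y q) (kernel_adjoint r (y r))) = (\<Sum>s\<le>2 * Q. I s (square_kernel Q y s))"
 proof -
  have "(\<Sum>s\<le>2 * Q. I s (square_kernel Q y s)) =
    (\<Sum>s\<le>2 * Q. \<Sum>q\<le>Q. \<Sum>r\<le>Q. I s (order_term q r (y q) (kernel_adjoint r (y r)) s))"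
   using in1 in2 by simp
  also have "\<dots> = (\<Sum>q\<le>Q. \<Sum>s\<le>2 * Q. \<Sum>r\<le>Q. I s (order_term q r (y q) (kernel_adjoint r (y r)) s))" by (rule sum.swap)
  also have "\<dots> = (\<Sum>q\<le>Q. \<Sum>r\<le>Q. \<Sum>s\<le>2 * Q. I s (order_term q r (y q) (kernel_adjoint r (y r)) s))"
   by (rule sum.cong[OF refl]) (rule sum.swap)
  also have "\<dots> = (\<Sum>q\<le>Q. \<Sum>r\<le>Q. prod_terms q r (y q) (kernel_adjoint r (y r)))"
   by (intro sum.cong refl sum_order_term[OF b y adj]) auto
  finally show ?thesis by simp
 qed
 ultimately show "nc_times A \<phi> \<iota> \<xi> \<xi> (\<Sum>s\<le>2 * Q. I s (square_kernel Q y s))"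
  using \<xi> J' by simp
qed

end

section \<open>Marginals are bounded in all powers\<close>

lemma nn_integral_combination:
 assumes [measurable]: "u \<in> borel_measurable M" "v \<in> borel_measurable M"
 shows "(\<integral>\<^sup>+ x. c * (d * u x + e * v x) \<partial>M) = c * (d * (\<integral>\<^sup>+ x. u x \<partial>M) + e * (\<integral>\<^sup>+ x. v x \<partial>M))"
 by (simp add: nn_integral_cmult nn_integral_add)

context chaos_seq
begin

text \<open>The components of the \<open>2^a\<close>-th power of the multiple integral of \<open>K i k\<close>.\<close>

primrec components :: "nat => nat => nat => nat => kernel" where
 "components i k 0 = (%q. if q = N i then K i k else (%_. 0))"
| "components i k (Suc a) = square_kernel (2 ^ a * N i) (components i k a)"

lemma components:
 assumes b: b and i: "i < 2"
 shows "(\<forall>q. components i k a q \<in> D q) \<and> W k (replicate (2 ^ a) i) = (\<Sum>q\<le>2 ^ a * N i. I q (components i k a q))"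
proof (induction a)
 case 0
 have "W k [i] = I (N i) (K i k)" by (rule nc_words.W_single[OF words]) (use i in simp)
 moreover have "(\<Sum>q\<le>N i. I q (components i k 0 q)) = (\<Sum>q\<le>N i. if q = N i then I q (K i k) else 0)"
  by (rule sum.cong) (auto simp: I_zero)
 moreover have "replicate (2 ^ 0) i = [i]" by simp
 ultimately show ?case using K_D[OF i] D_zero by simp
next
 case (Suc a)
 let ?w = "replicate (2 ^ a) i"
 have sub: "set ?w \<subseteq> {..<2}" using i by auto
 have y: "!!q. components i k a q \<in> D q" and rep: "W k ?w = (\<Sum>q\<le>2 ^ a * N i. I q (components i k a q))"
  using Suc.IH by auto
 have J: "J (W k ?w) = W k ?w" using nc_words.J_W[OF words sub] by simp
 note sq = square_expansion[OF b y D_adj[OF b y] rep J]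
 have "nc_times A \<phi> \<iota> (W k ?w) (W k ?w) (W k (?w @ ?w))" by (rule nc_words.W_append[OF words sub sub])
 moreover have "?w @ ?w = replicate (2 ^ Suc a) i" by (simp add: replicate_add[symmetric] mult_2)
 ultimately have "W k (replicate (2 ^ Suc a) i) = (\<Sum>s\<le>2 * (2 ^ a * N i). I s (square_kernel (2 ^ a * N i) (components i k a) s))"
  using nc_times_unique[OF _ sq(2)] by simp
 then show ?case using sq(1) by (simp add: mult.assoc)
qed

lemma components_bounded:
 assumes b: b and i: "i < 2"
 shows "\<exists>B\<ge>0. \<forall>k q. q \<le> 2 ^ a * N i --> n2 q (components i k a q) \<le> ennreal B"
proof -
 let ?w = "replicate (2 ^ a) i"
 have sub: "set ?w \<subseteq> {..<2}" using i by auto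
 obtain B where B: "!!k. (norm (W k ?w))\<^sup>2 \<le> B" using norm_Wk_bounded[OF sub] by blast
 have "n2 q (components i k a q) \<le> ennreal B" if q: "q \<le> 2 ^ a * N i" for k q
 proof -
  note y = conjunct1[OF components[OF b i, of k a], rule_format]
  have "(norm (I q (components i k a q)))\<^sup>2 \<le> (\<Sum>q\<le>2 ^ a * N i. (norm (I q (components i k a q)))\<^sup>2)"
   using q by (intro member_le_sum) auto
  also have "\<dots> = (norm (W k ?w))\<^sup>2"
   unfolding conjunct2[OF components[OF b i]]
   by (rule norm_sum_orthogonal[symmetric]) (auto intro!: I_orth D_L2' y)
  also have "\<dots> \<le> B" by (rule B)
  finally show ?thesis unfolding L2D(2)[OF D_L2'[OF y], symmetric] by (rule ennreal_leI)
 qed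
 moreover have "0 \<le> B" using B[of 0] by (rule order_trans[rotated]) simp
 ultimately show ?thesis by blast
qed

lemma measurable_marginal_sum:
 assumes b: b and i: "i < 2"
 shows "marginal_sum Q (components i k a) \<in> borel_measurable halfline"
proof -
 have "first_marginal q (components i k a q) \<in> borel_measurable halfline" if "q \<in> {1..Q}" for q
  by (rule measurable_first_marginal[OF D_meas]) (use components[OF b i] that in auto)
 then show ?thesis unfolding marginal_sum_def[abs_def] by (rule borel_measurable_sum)
qed

lemma marginal_sum_integrable:
 assumes b: b and i: "i < 2"
 shows "\<exists>B<\<infinity>. \<forall>k. (\<integral>\<^sup>+ x. marginal_sum (2 ^ a * N i) (components i k a) x \<partial>halfline) \<le> B"
proof -
 obtain B where B: "0 \<le> B" "!!k q. q \<le> 2 ^ a * N i ==> n2 q (components i k a q) \<le> ennreal B"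
  using components_bounded[OF b i, of a] by blast
 have "(\<integral>\<^sup>+ x. marginal_sum (2 ^ a * N i) (components i k a) x \<partial>halfline) \<le> (\<Sum>q=1..2 ^ a * N i. ennreal B)" for k
 proof -
  note D' = D_meas[OF conjunct1[OF components[OF b i, of k a], rule_format]]
  have "(\<integral>\<^sup>+ x. marginal_sum (2 ^ a * N i) (components i k a) x \<partial>halfline) =
    (\<Sum>q=1..2 ^ a * N i. \<integral>\<^sup>+ x. first_marginal q (components i k a q) x \<partial>halfline)"
   unfolding marginal_sum_def
   by (rule nn_integral_sum) (auto intro: measurable_first_marginal[OF D'])
  also have "\<dots> = (\<Sum>q=1..2 ^ a * N i. n2 q (components i k a q))"
   by (rule sum.cong[OF refl]) (simp add: integral_first_marginal[OF D'])
  also have "\<dots> \<le> (\<Sum>q=1..2 ^ a * N i. ennreal B)" by (rule sum_mono) (simp add: B)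
  finally show ?thesis .
 qed
 moreover have "(\<Sum>q=1..2 ^ a * N i. ennreal B) = ennreal (\<Sum>q=1..2 ^ a * N i. B)" by (rule sum_ennreal) (rule B)
 then have "(\<Sum>q=1..2 ^ a * N i. ennreal B) < \<infinity>" by (simp only: infinity_ennreal_def ennreal_less_top)
 ultimately show ?thesis by blast
qed

text \<open>Squaring the power \<open>2^a\<close> to \<open>2^(a + 1)\<close> doubles the available integrability of the marginals, so induction on \<open>r\<close> for all \<open>a\<close> at once works.\<close>

lemma marginal_sum_bounded:
 assumes b: b and i: "i < 2"
 shows "\<exists>B<\<infinity>. \<forall>k. (\<integral>\<^sup>+ x. (marginal_sum (2 ^ a * N i) (components i k a) x) ^ (2 ^ r) \<partial>halfline) \<le> B"
proof (induction r arbitrary: a)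
 case 0
 show ?case using marginal_sum_integrable[OF b i, of a] by (simp only: power_0 power_one_right)
next
 case (Suc r)
 let ?Q = "2 ^ a * N i"
 obtain B where B: "0 \<le> B" "!!k q. q \<le> ?Q ==> n2 q (components i k a q) \<le> ennreal B"
  using components_bounded[OF b i, of a] by blast
 obtain B1 where B1: "B1 < \<infinity>" "!!k. (\<integral>\<^sup>+ x. marginal_sum ?Q (components i k a) x \<partial>halfline) \<le> B1"
  using marginal_sum_integrable[OF b i, of a] by blast
 obtain C1 where C1: "C1 < \<infinity>" "!!k. (\<integral>\<^sup>+ x. (marginal_sum ?Q (components i k a) x) ^ (2 ^ r) \<partial>halfline) \<le> C1"
  using Suc.IH[of a] by blast
 obtain C2 where C2: "C2 < \<infinity>" "!!k. (\<integral>\<^sup>+ x. (marginal_sum (2 ^ Suc a * N i) (components i k (Suc a)) x) ^ (2 ^ r) \<partial>halfline) \<le> C2"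
  using Suc.IH[of "Suc a"] by blast
 define M where "M = ennreal (2 * real (?Q + 1) ^ 4 * B)"
 let ?P = "2 ^ r :: nat"
 have "(\<integral>\<^sup>+ x. (marginal_sum ?Q (components i k a) x) ^ (2 ^ Suc r) \<partial>halfline) \<le> 2 ^ ?P * (2 ^ ?P * C2 + M ^ ?P * C1)" for k
 proof -
  let ?S = "marginal_sum ?Q (components i k a)" and ?T = "marginal_sum (2 ^ Suc a * N i) (components i k (Suc a))"
  note [measurable] = measurable_marginal_sum[OF b i, of ?Q k a] measurable_marginal_sum[OF b i, of "2 ^ Suc a * N i" k "Suc a"]
  have "(\<integral>\<^sup>+ x. ?S x \<partial>halfline) \<le> B1" by (rule B1(2))
  then have "(\<integral>\<^sup>+ x. ?S x \<partial>halfline) \<noteq> \<infinity>" using B1(1) by (metis leD)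
  then have "AE x in halfline. ?S x \<noteq> \<infinity>" by (intro nn_integral_PInf_AE) auto
  then have "AE x in halfline. ?S x ^ (2 ^ Suc r) \<le> 2 ^ ?P * (2 ^ ?P * ?T x ^ ?P + M ^ ?P * ?S x ^ ?P)"
   using AE_space
  proof eventually_elim
   case (elim x)
   then have x: "0 \<le> x" by (simp add: space_restrict_space)
   have y: "components i k a q \<in> borel_measurable (Rp q)" for q by (rule D_meas) (use components[OF b i] in blast)
   have "(?S x)\<^sup>2 \<le> 2 * first_marginal 1 (square_kernel ?Q (components i k a) 1) x + M * ?S x"
    unfolding M_def by (rule marginal_sum_square[OF y B(1) B(2) x]) (use elim(1) in \<open>auto simp: less_top\<close>)
   also have "first_marginal 1 (square_kernel ?Q (components i k a) 1) x \<le> ?T x"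
   proof -
    have "1 \<in> {1..2 ^ Suc a * N i}" using N_pos[OF i] by simp
    then have "first_marginal 1 (components i k (Suc a) 1) x \<le> ?T x"
     unfolding marginal_sum_def by (intro member_le_sum) auto
    then show ?thesis by simp
   qed
   finally have "(?S x)\<^sup>2 \<le> 2 * ?T x + M * ?S x" by (simp add: mult_left_mono add_right_mono)
   then have "((?S x)\<^sup>2) ^ ?P \<le> (2 * ?T x + M * ?S x) ^ ?P" by (rule power_mono) simp
   also have "\<dots> \<le> 2 ^ ?P * ((2 * ?T x) ^ ?P + (M * ?S x) ^ ?P)" by (rule ennreal_power_add_le)
   finally show ?case by (simp add: power_mult[symmetric] power_mult_distrib)
  qed
  then have "(\<integral>\<^sup>+ x. ?S x ^ (2 ^ Suc r) \<partial>halfline) \<le> (\<integral>\<^sup>+ x. 2 ^ ?P * (2 ^ ?P * ?T x ^ ?P + M ^ ?P * ?S x ^ ?P) \<partial>halfline)"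
   by (rule nn_integral_mono_AE)
  also have "\<dots> = 2 ^ ?P * (2 ^ ?P * (\<integral>\<^sup>+ x. ?T x ^ ?P \<partial>halfline) + M ^ ?P * (\<integral>\<^sup>+ x. ?S x ^ ?P \<partial>halfline))"
   by (rule nn_integral_combination) measurable
  also have "\<dots> \<le> 2 ^ ?P * (2 ^ ?P * C2 + M ^ ?P * C1)"
   by (intro mult_left_mono add_mono C1 C2) auto
  finally show ?thesis .
 qed
 moreover have "2 ^ ?P * (2 ^ ?P * C2 + M ^ ?P * C1) < \<infinity>"
  using C1(1) C2(1) by (simp add: M_def ennreal_mult_less_top power_less_top_ennreal)
 ultimately show ?case by blast
qed

lemma Lall_first_marginal:
 assumes b: b and i: "i < 2" shows "Lall (%k. first_marginal (N i) (K i k))"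
proof (rule LallI_pow2)
 show "first_marginal (N i) (K i k) \<in> borel_measurable halfline" for k
  by (rule measurable_first_marginal[OF D_meas[OF K_D[OF i]] N_pos[OF i]])
 fix r
 obtain B where B: "B < \<infinity>" "!!k. (\<integral>\<^sup>+ x. (marginal_sum (2 ^ 0 * N i) (components i k 0) x) ^ (2 ^ r) \<partial>halfline) \<le> B"
  using marginal_sum_bounded[OF b i, of 0 r] by blast
 have "first_marginal (N i) (K i k) x \<le> marginal_sum (2 ^ 0 * N i) (components i k 0) x" for k x
 proof -
  have "first_marginal (N i) (components i k 0 (N i)) x \<le> marginal_sum (2 ^ 0 * N i) (components i k 0) x"
   unfolding marginal_sum_def using N_pos[OF i] by (intro member_le_sum) auto
  then show ?thesis by simp
 qed
 then have "(\<integral>\<^sup>+ x. (first_marginal (N i) (K i k) x) ^ (2 ^ r) \<partial>halfline) \<le> B" for k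
  by (intro order_trans[OF nn_integral_mono B(2)[of k]] power_mono) auto
 then show "\<exists>B<\<infinity>. \<forall>k. (\<integral>\<^sup>+ x. (first_marginal (N i) (K i k) x) ^ (2 ^ r) \<partial>halfline) \<le> B" using B(1) by blast
qed

lemma Kernels_sequence: assumes i: "i < 2" shows "Kernels (N i) (K i)"
proof -
 note m = D_meas[OF K_D[OF i]]
 have "kTame b (N i) (K i)"
 proof (cases b)
  case True
  then show ?thesis
   using kTame_symmetric[OF N_pos[OF i] m K_sym[OF i] n2_K_bounded[OF i] Lall_first_marginal[OF True i]] by simp
 next
  case False
  then show ?thesis by (intro kTame_plain[OF m n2_K_bounded[OF i]]) simp
 qed
 then show ?thesis unfolding Kernels_def using K_D[OF i] by blast
qed

end

section \<open>Square-integrable kernels\<close>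

lemma L2_kernels_iff: "h \<in> L2_kernels q \<longleftrightarrow> h \<in> borel_measurable (Rp q) \<and> n2 q h < \<infinity>"
proof (cases "h \<in> borel_measurable (Rp q)")
 case True
 then have "integrable (Rp q) (%t. (cmod (h t))\<^sup>2) \<longleftrightarrow> n2 q h < \<infinity>"
  unfolding n2_def by (simp add: integrable_iff_bounded ennreal_power)
 then show ?thesis using True by (simp add: L2_kernels_def)
qed (simp add: L2_kernels_def)

lemma L2_kernels_lin:
 assumes h: "h \<in> L2_kernels q" and w: "w \<in> L2_kernels q"
 shows "(%t. c * h t + d * w t) \<in> L2_kernels q"
proof -
 have m: "h \<in> borel_measurable (Rp q)" "w \<in> borel_measurable (Rp q)" using h w by (auto simp: L2_kernels_def)
 have i: "integrable (Rp q) (%t. 2 * (cmod c)\<^sup>2 * (cmod (h t))\<^sup>2 + 2 * (cmod d)\<^sup>2 * (cmod (w t))\<^sup>2)"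
  using h w by (intro Bochner_Integration.integrable_add integrable_mult_right) (auto simp: L2_kernels_def)
 have "integrable (Rp q) (%t. (cmod (c * h t + d * w t))\<^sup>2)"
 proof (rule Bochner_Integration.integrable_bound[OF i])
  show "(%t. (cmod (c * h t + d * w t))\<^sup>2) \<in> borel_measurable (Rp q)" using m by measurable
  have "(cmod (c * h t + d * w t))\<^sup>2 \<le> 2 * (cmod c)\<^sup>2 * (cmod (h t))\<^sup>2 + 2 * (cmod d)\<^sup>2 * (cmod (w t))\<^sup>2" for t
  proof -
   have "(cmod (c * h t + d * w t))\<^sup>2 \<le> (cmod (c * h t) + cmod (d * w t))\<^sup>2"
    by (rule power_mono[OF norm_triangle_ineq]) simp
   also have "\<dots> \<le> 2 * (cmod (c * h t))\<^sup>2 + 2 * (cmod (d * w t))\<^sup>2"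
    using zero_le_power2[of "cmod (c * h t) - cmod (d * w t)"] by (simp add: power2_sum power2_diff)
   finally show ?thesis by (simp add: norm_mult power_mult_distrib)
  qed
  then show "AE t in Rp q. norm ((cmod (c * h t + d * w t))\<^sup>2) \<le> norm (2 * (cmod c)\<^sup>2 * (cmod (h t))\<^sup>2 + 2 * (cmod d)\<^sup>2 * (cmod (w t))\<^sup>2)"
   by (intro AE_I2) (simp add: abs_of_nonneg)
 qed
 then show ?thesis using m by (simp add: L2_kernels_def)
qed

lemma L2_null_sequence_iff: "L2_null_sequence q h \<longleftrightarrow> (\<forall>k. h k \<in> L2_kernels q) \<and> kNull q h"
proof (cases "\<forall>k. h k \<in> L2_kernels q")
 case True
 have e: "n2 q (h k) = ennreal (\<integral>t. (cmod (h k t))\<^sup>2 \<partial>Rp q)" for k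
  unfolding n2_def using True by (simp add: ennreal_power nn_integral_eq_integral L2_kernels_def)
 have "kNull q h \<longleftrightarrow> (%k. \<integral>t. (cmod (h k t))\<^sup>2 \<partial>Rp q) \<longlonglongrightarrow> 0"
 proof -
  have "kNull q h \<longleftrightarrow> (%k. ennreal (\<integral>t. (cmod (h k t))\<^sup>2 \<partial>Rp q)) \<longlonglongrightarrow> ennreal 0"
   unfolding kNull_def e by simp
  also have "\<dots> \<longleftrightarrow> (%k. \<integral>t. (cmod (h k t))\<^sup>2 \<partial>Rp q) \<longlonglongrightarrow> 0" by (rule tendsto_ennreal_iff) auto
  finally show ?thesis .
 qed
 also have "\<dots> \<longleftrightarrow> (%k. sqrt (\<integral>t. (cmod (h k t))\<^sup>2 \<partial>Rp q)) \<longlonglongrightarrow> 0"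
 proof
  assume "(%k. sqrt (\<integral>t. (cmod (h k t))\<^sup>2 \<partial>Rp q)) \<longlonglongrightarrow> 0"
  then have "(%k. (sqrt (\<integral>t. (cmod (h k t))\<^sup>2 \<partial>Rp q))\<^sup>2) \<longlonglongrightarrow> 0\<^sup>2" by (rule tendsto_power)
  then show "(%k. \<integral>t. (cmod (h k t))\<^sup>2 \<partial>Rp q) \<longlonglongrightarrow> 0" by simp
 next
  assume "(%k. \<integral>t. (cmod (h k t))\<^sup>2 \<partial>Rp q) \<longlonglongrightarrow> 0"
  then have "(%k. sqrt (\<integral>t. (cmod (h k t))\<^sup>2 \<partial>Rp q)) \<longlonglongrightarrow> sqrt 0" by (rule tendsto_real_sqrt)
  then show "(%k. sqrt (\<integral>t. (cmod (h k t))\<^sup>2 \<partial>Rp q)) \<longlonglongrightarrow> 0" by simp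
 qed
 finally show ?thesis using True by (simp add: L2_null_sequence_def)
next
 case False
 then show ?thesis unfolding L2_null_sequence_def by blast
qed

section \<open>The criterion\<close>

context chaos
begin

text \<open>For a symmetric kernel, reversing the arguments and conjugating changes nothing almost everywhere.\<close>

lemma I_symmetric:
 assumes h: "h \<in> L2_kernels q" and sym: "symmetric_kernel q h"
 shows "J (I q h) = I q h"
proof -
 define \<sigma> where "\<sigma> i = (if i < q then q - 1 - i else i)" for i
 have "bij_betw \<sigma> {..<q} {..<q}"
  by (rule bij_betwI[where g = \<sigma>]) (auto simp: \<sigma>_def)
 then have \<sigma>: "\<sigma> permutes {..<q}" by (intro bij_imp_permutes) (auto simp: \<sigma>_def)
 have adj: "kernel_adjoint q h t = cnj (h (\<lambda>i\<in>{..<q}. t (\<sigma> i)))" for t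
  unfolding kernel_adjoint_def \<sigma>_def by (intro arg_cong[where f = "%s. cnj (h s)"]) (auto simp: fun_eq_iff)
 have hm: "h \<in> borel_measurable (Rp q)" by (rule L2D(1)[OF h])
 have m: "kernel_adjoint q h \<in> borel_measurable (Rp q)"
  unfolding adj[abs_def] by (rule measurable_cnj[OF measurable_permuted_kernel[OF hm \<sigma>]])
 have "AE t in Rp q. h t = h (\<lambda>i\<in>{..<q}. t (\<sigma> i))" "AE t in Rp q. h t \<in> \<real>"
  using sym \<sigma> unfolding symmetric_kernel_def by blast+
 then have ae: "AE t in Rp q. kernel_adjoint q h t = h t"
  by eventually_elim (metis adj Reals_cnj_iff)
 have "n2 q (kernel_adjoint q h) = n2 q h"
  unfolding n2_def by (rule nn_integral_cong_AE) (use ae in eventually_elim, simp)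
 then have aL: "kernel_adjoint q h \<in> L2_kernels q" using h m by (simp add: L2_kernels_iff)
 let ?d = "%t. 1 * kernel_adjoint q h t + (- 1) * h t"
 have "n2 q ?d = (\<integral>\<^sup>+ t. 0 \<partial>Rp q)"
  unfolding n2_def by (rule nn_integral_cong_AE) (use ae in eventually_elim, simp)
 then have "I q ?d = 0" using L2D(2)[OF L2_kernels_lin[OF aL h, of 1 "-1"]] by simp
 moreover have "I q ?d = 1 *\<^sub>C I q (kernel_adjoint q h) + (- 1) *\<^sub>C I q h" by (rule I_lin[OF aL h])
 ultimately have "I q (kernel_adjoint q h) = I q h" by (simp add: scaleC_minus1)
 then show ?thesis by (simp add: I_adj[OF h])
qed

end

context chaos_seq
begin

theorem free_iff:
 "nc_free A \<phi> \<iota> [X 0, X 1] \<longleftrightarrow> (\<forall>p\<in>{1..min (N 0) (N 1)}.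
  kNull (N 0 + N 1 - 2 * p) (%k. contraction (N 0) (N 1) p (K 0 k) (K 1 k)) \<and>
  (b --> kNull (N 0 + N 1 - 2 * p + 1) (%k. star_contraction (N 0) (N 1) p (K 0 k) (K 1 k))))"
proof
 assume "nc_free A \<phi> \<iota> [X 0, X 1]"
 from free_null[OF this] show "\<forall>p\<in>{1..min (N 0) (N 1)}.
  kNull (N 0 + N 1 - 2 * p) (%k. contraction (N 0) (N 1) p (K 0 k) (K 1 k)) \<and>
  (b --> kNull (N 0 + N 1 - 2 * p + 1) (%k. star_contraction (N 0) (N 1) p (K 0 k) (K 1 k)))"
  by (meson atLeastAtMost_iff)
next
 assume null: "\<forall>p\<in>{1..min (N 0) (N 1)}.
  kNull (N 0 + N 1 - 2 * p) (%k. contraction (N 0) (N 1) p (K 0 k) (K 1 k)) \<and>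
  (b --> kNull (N 0 + N 1 - 2 * p + 1) (%k. star_contraction (N 0) (N 1) p (K 0 k) (K 1 k)))"
 have m: "K i k \<in> borel_measurable (Rp (N i))" if "i < 2" for i k by (rule D_meas[OF K_D[OF that]])
 have nl: "kNull (gord c (N 0) (N 1) p) (%k. gcon c (N 0) (N 1) p (K 0 k) (K 1 k))"
  if "c --> b" "1 \<le> p" "p \<le> N 0" "p \<le> N 1" for c p
  using null that by (cases c) (simp_all add: gcon_def)
 have NF: "NF b False (N 0) (K 0) (N 1) (K 1)" "NF b False (N 1) (K 1) (N 0) (K 0)"
  by (rule NF_of_contractions[OF m K_sym m K_sym nl]; simp)+
 then have "Safe (N (1 - i)) (K (1 - i)) (N i) (K i)" if "i < 2" for i
  unfolding Safe_def using Kernels_sequence[OF that] that by (auto simp: less_2_cases_iff)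
 then have "chaos_pair A \<phi> \<iota> I D b N K W X Winf"
  using chaos_axioms words words_inf moments by (intro chaos_pair.intro chaos_pair_axioms.intro)
 then show "nc_free A \<phi> \<iota> [X 0, X 1]" by (rule chaos_pair.free_limit)
qed

end

text \<open>The words in the limit and along the sequence exist by convergence in law, and their traces are the moments.\<close>

lemma (in chaos) free_criterion:
 assumes nm: "n \<ge> 1" "m \<ge> 1"
  and f: "!!k. f k \<in> D n" "!!k. symmetric_kernel n (f k)"
  and g: "!!k. g k \<in> D m" "!!k. symmetric_kernel m (g k)"
  and sa: "nc_selfadjoint A \<iota> F" "nc_selfadjoint A \<iota> G"
  and conv: "joint_law_convergence A \<phi> \<iota> (%k. [I n (f k), I m (g k)]) [F, G]"
  and adj: "!!h q. b ==> h \<in> D q ==> kernel_adjoint q h \<in> D q"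
 shows "nc_free A \<phi> \<iota> [F, G] \<longleftrightarrow> (\<forall>p\<in>{1..min n m}.
  L2_null_sequence (n + m - 2 * p) (%k. contraction n m p (f k) (g k)) \<and>
  (b --> L2_null_sequence (n + m - 2 * p + 1) (%k. star_contraction n m p (f k) (g k))))"
proof -
 define N where "N i = (if i = 0 then n else m)" for i :: nat
 define K where "K i = (if i = 0 then f else g)" for i :: nat
 define X where "X i = (if i = 0 then F else G)" for i :: nat
 define W where "W k u = (SOME \<zeta>. nc_word A \<phi> \<iota> (map (%i. I (N i) (K i k)) u) \<zeta>)" for k u
 define Winf where "Winf u = (SOME \<zeta>. nc_word A \<phi> \<iota> (map X u) \<zeta>)" for u
 have mp: "map ((!) [I n (f k), I m (g k)]) u = map (%i. I (N i) (K i k)) u" "map ((!) [F, G]) u = map X u"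
  if "set u \<subseteq> {..<2}" for k u
  using that by (auto simp: N_def K_def X_def less_2_cases_iff subset_iff)
 have ex: "(\<exists>c cinf. (\<forall>k. nc_moment A \<phi> \<iota> (map (%i. I (N i) (K i k)) u) (c k)) \<and> nc_moment A \<phi> \<iota> (map X u) cinf \<and> c \<longlonglongrightarrow> cinf)"
  if u: "set u \<subseteq> {..<2}" for u
 proof (cases "u = []")
  case True
  have "nc_moment A \<phi> \<iota> [] (nc_trace \<iota> (\<iota> id))" unfolding nc_moment_def using nc_word.Nil by blast
  then show ?thesis using True by (intro exI[of _ "%_. nc_trace \<iota> (\<iota> id)"] exI[of _ "nc_trace \<iota> (\<iota> id)"]) simp
 next
  case False
  have "set u \<subseteq> {..<length [F, G]}" using u by (simp add: numeral_2_eq_2)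
  with conv False have "\<exists>c cinf. (\<forall>k. nc_moment A \<phi> \<iota> (map ((!) [I n (f k), I m (g k)]) u) (c k)) \<and>
    nc_moment A \<phi> \<iota> (map ((!) [F, G]) u) cinf \<and> c \<longlonglongrightarrow> cinf"
   unfolding joint_law_convergence_def by blast
  then show ?thesis by (simp only: mp[OF u])
 qed
 have Wk: "nc_word A \<phi> \<iota> (map (%i. I (N i) (K i k)) u) (W k u)" if "set u \<subseteq> {..<2}" for k u
 proof -
  have "\<exists>\<zeta>. nc_word A \<phi> \<iota> (map (%i. I (N i) (K i k)) u) \<zeta>" using ex[OF that] unfolding nc_moment_def by meson
  then show ?thesis unfolding W_def by (rule someI_ex)
 qed
 have Wi: "nc_word A \<phi> \<iota> (map X u) (Winf u)" if "set u \<subseteq> {..<2}" for u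
 proof -
  have "\<exists>\<zeta>. nc_word A \<phi> \<iota> (map X u) \<zeta>" using ex[OF that] unfolding nc_moment_def by meson
  then show ?thesis unfolding Winf_def by (rule someI_ex)
 qed
 have KD: "K i k \<in> D (N i)" for i k using f(1) g(1) by (simp add: K_def N_def)
 have Ksym: "symmetric_kernel (N i) (K i k)" for i k using f(2) g(2) by (simp add: K_def N_def)
 have seq: "chaos_seq A \<phi> \<iota> I D b N K W X Winf"
 proof (intro chaos_seq.intro chaos_seq_axioms.intro chaos_axioms)
  show "nc_words A \<phi> \<iota> (%i. I (N i) (K i k)) {..<2} (W k)" for k
  proof (intro nc_words.intro nc_words_axioms.intro nc_L2_completion_axioms Wk)
   show "J (I (N i) (K i k)) = I (N i) (K i k)" for i
    by (rule I_symmetric[OF subsetD[OF D_L2 KD] Ksym])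
  qed
  show "nc_words A \<phi> \<iota> X {..<2} Winf"
  proof (intro nc_words.intro nc_words_axioms.intro nc_L2_completion_axioms Wi)
   show "J (X i) = X i" for i
    using sa unfolding nc_adjoint_iff X_def by (cases "i = 0") simp_all
  qed
  show "(%k. nc_trace \<iota> (W k u)) \<longlonglongrightarrow> nc_trace \<iota> (Winf u)" if u: "set u \<subseteq> {..<2}" for u
  proof -
   obtain c cinf where c: "!!k. nc_moment A \<phi> \<iota> (map (%i. I (N i) (K i k)) u) (c k)" "nc_moment A \<phi> \<iota> (map X u) cinf" "c \<longlonglongrightarrow> cinf"
    using ex[OF u] by blast
   have "c k = nc_trace \<iota> (W k u)" for k
    using c(1)[of k] nc_word_unique[OF _ Wk[OF u, of k]] unfolding nc_moment_def by metis
   then have "c = (%k. nc_trace \<iota> (W k u))" by (rule ext)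
   moreover have "cinf = nc_trace \<iota> (Winf u)"
    using c(2) nc_word_unique[OF _ Wi[OF u]] unfolding nc_moment_def by metis
   ultimately show ?thesis using c(3) by simp
  qed
  show "1 \<le> N i" for i using nm by (simp add: N_def)
 qed (use KD Ksym adj in auto)
 have cL: "contraction n m p (f k) (g k) \<in> L2_kernels (n + m - 2 * p)" if "p \<in> {1..min n m}" for p k
  by (rule subsetD[OF D_L2 D_contraction[OF f(1) g(1)]]) (use that in simp)
 have sL: "star_contraction n m p (f k) (g k) \<in> L2_kernels (n + m - 2 * p + 1)" if b "p \<in> {1..min n m}" for p k
  by (rule subsetD[OF D_L2 D_star[OF that(1) f(1) g(1)]]) (use that in simp_all)
 have "nc_free A \<phi> \<iota> [F, G] \<longleftrightarrow> (\<forall>p\<in>{1..min n m}. kNull (n + m - 2 * p) (%k. contraction n m p (f k) (g k)) \<and>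
  (b --> kNull (n + m - 2 * p + 1) (%k. star_contraction n m p (f k) (g k))))"
  using chaos_seq.free_iff[OF seq] by (simp add: N_def K_def X_def)
 also have "\<dots> \<longleftrightarrow> (\<forall>p\<in>{1..min n m}.
  L2_null_sequence (n + m - 2 * p) (%k. contraction n m p (f k) (g k)) \<and>
  (b --> L2_null_sequence (n + m - 2 * p + 1) (%k. star_contraction n m p (f k) (g k))))"
 proof (rule ball_cong[OF refl])
  fix p assume p: "p \<in> {1..min n m}"
  show "(kNull (n + m - 2 * p) (%k. contraction n m p (f k) (g k)) \<and>
   (b --> kNull (n + m - 2 * p + 1) (%k. star_contraction n m p (f k) (g k)))) \<longleftrightarrow>
  (L2_null_sequence (n + m - 2 * p) (%k. contraction n m p (f k) (g k)) \<and>
   (b --> L2_null_sequence (n + m - 2 * p + 1) (%k. star_contraction n m p (f k) (g k))))"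
   unfolding L2_null_sequence_iff using cL[OF p] sL[OF _ p] by blast
 qed
 finally show ?thesis .
qed

lemma (in nc_L2_completion) I_adjoint:
 assumes "multiple_integrals A \<iota> M I" and h: "h \<in> L2_kernels q"
 shows "J (I q h) = I q (kernel_adjoint q h)"
proof -
 have "\<forall>n. \<forall>f\<in>L2_kernels n. nc_adjoint A \<iota> (I n f) (I n (kernel_adjoint n f))"
  using assms(1) unfolding multiple_integrals_def by (elim conjE) assumption
 with h have "nc_adjoint A \<iota> (I q h) (I q (kernel_adjoint q h))" by simp
 then show ?thesis by (simp only: nc_adjoint_iff)
qed

lemma zero_L2_kernel: "(%_. 0) \<in> L2_kernels q"
 by (simp add: L2_kernels_def)

lemma const_L2_kernel: "(%_. c) \<in> L2_kernels 0"
 by (simp add: L2_kernels_iff n2_def Rp_PM PiM_empty nn_integral_count_space_finite power_less_top_ennreal)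

lemma contraction_L2:
 assumes "h \<in> L2_kernels q" "w \<in> L2_kernels r" "p \<le> min q r"
 shows "contraction q r p h w \<in> L2_kernels (q + r - 2 * p)"
proof -
 have m: "h \<in> borel_measurable (Rp q)" "w \<in> borel_measurable (Rp r)" and fin: "n2 q h < \<infinity>" "n2 r w < \<infinity>"
  using assms(1,2) by (auto simp: L2_kernels_iff)
 have p: "p \<le> q" "p \<le> r" using assms(3) by auto
 have "n2 (q + r - 2 * p) (contraction q r p h w) < \<infinity>"
  by (rule le_less_trans[OF n2_contraction_le[OF p m]]) (use fin in \<open>simp add: ennreal_mult_less_top\<close>)
 then show ?thesis using measurable_gcon[of False, OF _ p m] by (simp add: L2_kernels_iff gcon_def)
qed

lemma chaos_Wigner:
 assumes nc: "nc_L2_completion A \<phi> \<iota>" and mi: "multiple_integrals A \<iota> M I" and wp: "wigner_product_formula A \<phi> \<iota> I"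
 shows "chaos A \<phi> \<iota> I L2_kernels False"
proof (intro chaos.intro chaos_axioms.intro nc)
 show "nc_L2_completion.J A \<iota> (I q h) = I q (kernel_adjoint q h)" if "h \<in> L2_kernels q" for q h
  by (rule nc_L2_completion.I_adjoint[OF nc mi that])
 show "nc_times A \<phi> \<iota> (I q h) (I r w) ((\<Sum>p\<le>min q r. I (q + r - 2 * p) (contraction q r p h w)) +
    (if False then \<Sum>p = 1..min q r. I (q + r - 2 * p + 1) (star_contraction q r p h w) else 0))"
  if "h \<in> L2_kernels q" "w \<in> L2_kernels r" for q r h w
  using wp that unfolding wigner_product_formula_def by simp
qed (use mi in \<open>auto simp: multiple_integrals_def intro: zero_L2_kernel const_L2_kernel L2_kernels_lin contraction_L2\<close>)

text \<open>Adding the zero kernel of every order keeps the class of kernels stable.\<close>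

lemma chaos_Poisson:
 assumes nc: "nc_L2_completion A \<phi> \<iota>" and mi: "multiple_integrals A \<iota> M I" and pa: "poisson_integral_algebra A \<phi> \<iota> I D"
 shows "chaos A \<phi> \<iota> I (%q. insert (%_. 0) (D q)) True"
  and "h \<in> insert (%_. 0) (D q) ==> kernel_adjoint q h \<in> insert (%_. 0) (D q)"
proof -
 have D_L2: "D q \<subseteq> L2_kernels q" and D_const: "(%_. c) \<in> D 0" and D_adj: "h \<in> D q ==> kernel_adjoint q h \<in> D q"
  and D_lin: "h \<in> D q ==> w \<in> D q ==> (%t. c * h t + d * w t) \<in> D q" for q c d h w
  using pa unfolding poisson_integral_algebra_def by blast+
 have D_con: "h \<in> D q ==> w \<in> D r ==> p \<le> min q r ==> contraction q r p h w \<in> D (q + r - 2 * p)" for p q r h w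
  using pa unfolding poisson_integral_algebra_def by (simp only: atLeastAtMost_iff le0 simp_thms, blast?)
 have D_star: "h \<in> D q ==> w \<in> D r ==> 1 \<le> p ==> p \<le> min q r ==> star_contraction q r p h w \<in> D (q + r - 2 * p + 1)" for p q r h w
  using pa unfolding poisson_integral_algebra_def by (simp only: atLeastAtMost_iff le0 simp_thms, blast?)
 have prod: "h \<in> D q ==> w \<in> D r ==> nc_times A \<phi> \<iota> (I q h) (I r w)
     ((\<Sum>p\<le>min q r. I (q + r - 2 * p) (contraction q r p h w)) +
     (\<Sum>p=1..min q r. I (q + r - 2 * p + 1) (star_contraction q r p h w)))" for q r h w
  using pa unfolding poisson_integral_algebra_def by blast
 have I_lin: "h \<in> L2_kernels q ==> w \<in> L2_kernels q ==> I q (%t. c * h t + d * w t) = c *\<^sub>C I q h + d *\<^sub>C I q w" for q c d h w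
  using conjunct1[OF mi[unfolded multiple_integrals_def]] by simp
 have I0: "I q (%_. 0) = 0" for q
  using I_lin[OF zero_L2_kernel zero_L2_kernel, of q 0 0] by simp
 have cz: "contraction q r p (%_. 0) w = (%_. 0)" "contraction q r p h (%_. 0) = (%_. 0)"
  "star_contraction q r p (%_. 0) w = (%_. 0)" "star_contraction q r p h (%_. 0) = (%_. 0)" for q r p h w
  by (simp_all add: contraction_def star_contraction_def)
 show adj: "kernel_adjoint q h \<in> insert (%_. 0) (D q)" if "h \<in> insert (%_. 0) (D q)" for q h
  using that D_adj by (auto simp: kernel_adjoint_def)
 show "chaos A \<phi> \<iota> I (%q. insert (%_. 0) (D q)) True"
 proof (intro chaos.intro chaos_axioms.intro nc)
  show "insert (%_. 0) (D q) \<subseteq> L2_kernels q" for q using D_L2 zero_L2_kernel by blast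
  show "(%t. c * h t + d * w t) \<in> insert (%_. 0) (D q)"
   if "h \<in> insert (%_. 0) (D q)" "w \<in> insert (%_. 0) (D q)" for h w q c d
   using that D_lin[of h q w c d] D_lin[of h q h c 0] D_lin[of w q w d 0] by auto
  show "contraction q r p h w \<in> insert (%_. 0) (D (q + r - 2 * p))"
   if "h \<in> insert (%_. 0) (D q)" "w \<in> insert (%_. 0) (D r)" "p \<le> min q r" for h w q r p
   using that D_con[of h q w r p] cz by auto
  show "star_contraction q r p h w \<in> insert (%_. 0) (D (q + r - 2 * p + 1))"
   if "h \<in> insert (%_. 0) (D q)" "w \<in> insert (%_. 0) (D r)" "1 \<le> p" "p \<le> min q r" for h w q r p
   using that D_star[of h q w r p] cz by auto
  show "nc_L2_completion.J A \<iota> (I q h) = I q (kernel_adjoint q h)" if "h \<in> L2_kernels q" for q h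
   by (rule nc_L2_completion.I_adjoint[OF nc mi that])
  show "nc_times A \<phi> \<iota> (I q h) (I r w) ((\<Sum>p\<le>min q r. I (q + r - 2 * p) (contraction q r p h w)) +
    (if True then \<Sum>p = 1..min q r. I (q + r - 2 * p + 1) (star_contraction q r p h w) else 0))"
   if "h \<in> insert (%_. 0) (D q)" "w \<in> insert (%_. 0) (D r)" for q r h w
   using that prod[of h q w r] nc_L2_completion.nc_times_zero_left[OF nc, of "I r w"]
    nc_L2_completion.nc_times_zero_right[OF nc, of "I q h"] by (auto simp: cz I0)
 qed (use mi D_const in \<open>auto simp: multiple_integrals_def\<close>)
qed

theorem theorem4p3:
  fixes A :: "'h::complex_hilbert_space op set"
    and \<phi> :: "'h op \<Rightarrow> complex"
    and \<iota> :: "'h op \<Rightarrow> 'l::complex_hilbert_space"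
    and M :: "real \<Rightarrow> 'h op"
    and I :: "nat \<Rightarrow> kernel \<Rightarrow> 'l"
    and D :: "nat \<Rightarrow> kernel set"
    and n m :: nat
    and f g :: "nat \<Rightarrow> kernel"
    and F G :: 'l
  assumes "nc_L2_completion A \<phi> \<iota>"
    and "multiple_integrals A \<iota> M I"
    and "n \<ge> 1" and "m \<ge> 1"
    and "\<And>k. f k \<in> L2_kernels n" and "\<And>k. symmetric_kernel n (f k)"
    and "\<And>k. g k \<in> L2_kernels m" and "\<And>k. symmetric_kernel m (g k)"
    and "nc_selfadjoint A \<iota> F" and "nc_selfadjoint A \<iota> G"
    and "joint_law_convergence A \<phi> \<iota> (\<lambda>k. [I n (f k), I m (g k)]) [F, G]"
  shows
    "(free_brownian_motion A \<phi> M \<and> wigner_product_formula A \<phi> \<iota> I \<longrightarrow>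
       (nc_free A \<phi> \<iota> [F, G] \<longleftrightarrow>
        (\<forall>p\<in>{1..min n m}.
           L2_null_sequence (n + m - 2 * p) (\<lambda>k. contraction n m p (f k) (g k))))) \<and>
     (compensated_free_poisson A \<phi> M \<and> poisson_integral_algebra A \<phi> \<iota> I D \<and>
      (\<forall>k. f k \<in> D n \<and> g k \<in> D m) \<longrightarrow>
       (nc_free A \<phi> \<iota> [F, G] \<longleftrightarrow>
        (\<forall>p\<in>{1..min n m}.
           L2_null_sequence (n + m - 2 * p) (\<lambda>k. contraction n m p (f k) (g k)) \<and>
           L2_null_sequence (n + m - 2 * p + 1) (\<lambda>k. star_contraction n m p (f k) (g k)))))"
proof (intro conjI impI; elim conjE)
  assume "wigner_product_formula A \<phi> \<iota> I"
  note chaos = chaos_Wigner[OF assms(1,2) this]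
  show "nc_free A \<phi> \<iota> [F, G] \<longleftrightarrow>
      (\<forall>p\<in>{1..min n m}. L2_null_sequence (n + m - 2 * p) (\<lambda>k. contraction n m p (f k) (g k)))"
    using chaos.free_criterion[OF chaos assms(3-11)] by simp
next
  assume pa: "poisson_integral_algebra A \<phi> \<iota> I D" and fg: "\<forall>k. f k \<in> D n \<and> g k \<in> D m"
  note P = chaos_Poisson[OF assms(1,2) pa]
  have f: "f k \<in> insert (\<lambda>_. 0) (D n)" and g: "g k \<in> insert (\<lambda>_. 0) (D m)" for k using fg by auto
  show "nc_free A \<phi> \<iota> [F, G] \<longleftrightarrow>
      (\<forall>p\<in>{1..min n m}.
         L2_null_sequence (n + m - 2 * p) (\<lambda>k. contraction n m p (f k) (g k)) \<and>
         L2_null_sequence (n + m - 2 * p + 1) (\<lambda>k. star_contraction n m p (f k) (g k)))"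
    using chaos.free_criterion[OF P(1) assms(3,4) f assms(6) g assms(8-11) P(2)] by simp
qed

end
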